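(* Let $\delta>0$. Let $\{\boldsymbol{\Phi}_k\}_{k\in\mathbb{N}}$ be a sequence of approximation sets in $\mathcal{B}$ that is a stable approximation for $\mathcal{B}$, with every $\phi_{k,p}\in\mathcal{B}\cap C^0(\overline{B_1})$, and let sampling points $\{\mathbf{x}_s\}_{s=1}^S\subset\partial B_1$ together with positive weight vectors $\mathbf{w}_S=(w_s)_s\in\mathbb{R}^S$ be given such that $$\lim_{S\to\infty}\sum_{s=1}^S w_s v(\mathbf{x}_s)=\int_{\partial B_1}v\,\mathrm{d}\sigma\qquad\forall v\in C^0(\partial B_1).$$ Assume that $\kappa^2$ is not a Dirichlet eigenvalue (of $-\Delta$) in $B_1$. Then for every $u\in\mathcal{B}\cap C^0(\overline{B_1})$ there exist $k\in\mathbb{N}$, $S_0\in\mathbb{N}$ and $\epsilon_0\in(0,1]$ such that for all $S\geq S_0$ and $\epsilon\in(0,\epsilon_0]$ $$\|u-\mathcal{T}_{\boldsymbol{\Phi}_k}\boldsymbol{\xi}_{S,\epsilon}\|_{L^2(B_1)}\leq\delta\|u\|_{\mathcal{B}},$$ where $\boldsymbol{\xi}_{S,\epsilon}\in\mathbb{C}^{|\boldsymbol{\Phi}_k|}$ is the regularized SVD solution defined in the context. Moreover, the regularization parameter $\epsilon$ can be taken as large as $$\epsilon_0=\frac{\delta}{2C_{\mathrm{err}}C_{\mathrm{stb}}\,\sigma_{\max}|\boldsymbol{\Phi}_k|^{\lambda}\|\mathbf{w}_S\|_\infty^{1/2}},$$ where $C_{\mathrm{err}}>0$ is a constant independent of $u$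 and of the approximation sets, and $\lambda$, $C_{\mathrm{stb}}$ are the stability exponent and stability constant of the sequence.
   Context: $\kappa>0$ is fixed and $B_1$ is the open unit ball of $\mathbb{R}^3$. On $H^1(B_1)$ put $(u,v)_{\mathcal{B}}:=(u,v)_{L^2(B_1)}+\kappa^{-2}(\nabla u,\nabla v)_{L^2(B_1)}$, $\|u\|_{\mathcal{B}}^2=(u,u)_{\mathcal{B}}$. $\mathcal{B}$ is the closure in $\|\cdot\|_{\mathcal{B}}$ of the span of the functions $\mathbf{x}\mapsto j_\ell(\kappa|\mathbf{x}|)Y_\ell^m(\mathbf{x}/|\mathbf{x}|)$, $0\le|m|\le\ell$ ($j_\ell$ spherical Bessel functions of the first kind, $Y_\ell^m$ the $L^2(\mathbb{S}^2)$-orthonormal spherical harmonics); equivalently, it is the space of $H^1(B_1)$ solutions of $\Delta u+\kappa^2u=0$. A sequence of approximation sets is $\{\boldsymbol{\Phi}_k\}_{k\in\mathbb{N}}$ with $\boldsymbol{\Phi}_k=\{\phi_{k,p}\}_p\subset\mathcal{B}$ finite (not necessarily nested). $\mathcal{T}_{\boldsymbol{\Phi}_k}:\mathbb{C}^{|\boldsymbol{\Phi}_k|}\to\mathcal{B}$, $\boldsymbol{\mu}\mapsto\sum_p\mu_p\phi_{k,p}$. The sequence is a stable approximation for $\mathcal{B}$ if for every $\eta>0$ there exist $\lambda\ge0$ (stability exponent) and $C_{\mathrm{stb}}\ge0$ (stability constant) such that for all $u\in\mathcal{B}$ there exist $k\in\mathbb{N}$, $\boldsymbol{\mu}\in\mathbb{C}^{|\boldsymbol{\Phi}_k|}$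 with $\|u-\mathcal{T}_{\boldsymbol{\Phi}_k}\boldsymbol{\mu}\|_{\mathcal{B}}\le\eta\|u\|_{\mathcal{B}}$ and $\|\boldsymbol{\mu}\|_{\ell^2}\le C_{\mathrm{stb}}|\boldsymbol{\Phi}_k|^\lambda\|u\|_{\mathcal{B}}$. Regularized solution: for given $k$, $S\ge|\boldsymbol{\Phi}_k|$, let $A_{s,p}:=w_s^{1/2}\phi_{k,p}(\mathbf{x}_s)$ and $b_s:=w_s^{1/2}u(\mathbf{x}_s)$, $1\le s\le S$, $1\le p\le|\boldsymbol{\Phi}_k|$. Let $A=U\Sigma V^*$ be the singular value decomposition with largest singular value $\sigma_{\max}$. For $\epsilon\in(0,1]$, let $\Sigma_\epsilon$ be $\Sigma$ with all singular values $<\epsilon\sigma_{\max}$ replaced by $0$, $\Sigma_\epsilon^\dagger$ its pseudo-inverse, and $\boldsymbol{\xi}_{S,\epsilon}:=V\Sigma_\epsilon^\dagger U^*\mathbf{b}$.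
   Formalization: C_err may depend on the S-point quadrature rule, with C_err(S)·‖w_S‖_∞^{1/2} bounded in S; a C_err independent of S is impossible because ‖w_S‖_∞ tends to 0 while σ_max stays bounded. The displayed ε_0 is capped at 1. *)

theory Defs
  imports
    "HOL-Analysis.Analysis"
    "HOL-Computational_Algebra.Polynomial"
    "Jordan_Normal_Form.Schur_Decomposition"
begin

text \<open>Vectors and matrices of variable size come from the matrix library; there \<open>$\<close> is kept for
  components of elements of \<open>real^3\<close> and \<open>complex^3\<close>.\<close>

no_notation Matrix.vec_index (infixl "$" 100)

type_synonym pt = "real^3"

abbreviation B1 :: "pt set" where "B1 \<equiv> ball 0 1"

section \<open>The Sobolev space on the unit ball\<close>

text \<open>Elements of \<open>L\<^sup>2(B1)\<close> and \<open>H\<^sup>1(B1)\<close> are represented by functions on the whole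
  space; only their values on the ball matter, up to null sets.\<close>

definition L2_space :: "(pt \<Rightarrow> 'a::{banach, second_countable_topology}) set" where
  "L2_space = {f. f \<in> borel_measurable (lebesgue_on B1) \<and>
                  integrable (lebesgue_on B1) (\<lambda>x. (norm (f x))\<^sup>2)}"

definition L2_norm :: "(pt \<Rightarrow> 'a::{banach, second_countable_topology}) \<Rightarrow> real" where
  "L2_norm f = sqrt (integral\<^sup>L (lebesgue_on B1) (\<lambda>x. (norm (f x))\<^sup>2))"

text \<open>\<open>test_function \<phi> D\<close>: \<open>\<phi>\<close> is \<open>C\<^sup>1\<close> with compact support in the open ball and \<open>D\<close> is its
  gradient. Using \<open>C\<^sup>1\<close> (instead of smooth) test functions is Brezis' definition of weak
  derivatives and of \<open>H\<^sup>1\<^sub>0\<close>.\<close>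

definition test_function :: "(pt \<Rightarrow> complex) \<Rightarrow> (pt \<Rightarrow> complex^3) \<Rightarrow> bool" where
  "test_function \<phi> D \<longleftrightarrow>
     (\<forall>x. (\<phi> has_derivative (\<lambda>h. \<Sum>i\<in>UNIV. of_real (h $ i) * D x $ i)) (at x)) \<and>
     continuous_on UNIV D \<and>
     (\<exists>K. compact K \<and> K \<subseteq> B1 \<and> (\<forall>x. x \<notin> K \<longrightarrow> \<phi> x = 0))"

definition has_weak_gradient :: "(pt \<Rightarrow> complex) \<Rightarrow> (pt \<Rightarrow> complex^3) \<Rightarrow> bool" where
  "has_weak_gradient u g \<longleftrightarrow> u \<in> L2_space \<and> g \<in> L2_space \<and>
     (\<forall>\<phi> D. test_function \<phi> D \<longrightarrow> (\<forall>i.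
        integral\<^sup>L (lebesgue_on B1) (\<lambda>x. u x * D x $ i) =
        - integral\<^sup>L (lebesgue_on B1) (\<lambda>x. g x $ i * \<phi> x)))"

definition H1_space :: "(pt \<Rightarrow> complex) set" where
  "H1_space = {u. \<exists>g. has_weak_gradient u g}"

definition weak_gradient :: "(pt \<Rightarrow> complex) \<Rightarrow> pt \<Rightarrow> complex^3" where
  "weak_gradient u = (SOME g. has_weak_gradient u g)"

definition B_norm :: "real \<Rightarrow> (pt \<Rightarrow> complex) \<Rightarrow> real" where
  "B_norm \<kappa> u = sqrt ((L2_norm u)\<^sup>2 + (L2_norm (weak_gradient u))\<^sup>2 / \<kappa>\<^sup>2)"

text \<open>Dirichlet eigenvalue of \<open>-\<Delta>\<close> in the ball, weak form: a nonzero \<open>w \<in> H\<^sup>1\<^sub>0(B1)\<close> (the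
  \<open>H\<^sup>1\<close> closure of the test functions) with \<open>-\<Delta> w = \<Lambda> w\<close>.\<close>

definition dirichlet_eigenvalue :: "real \<Rightarrow> bool" where
  "dirichlet_eigenvalue \<Lambda> \<longleftrightarrow>
     (\<exists>w g. has_weak_gradient w g \<and> L2_norm w \<noteq> 0 \<and>
        (\<forall>e>0. \<exists>\<phi> D. test_function \<phi> D \<and>
            L2_norm (\<lambda>x. w x - \<phi> x) < e \<and> L2_norm (\<lambda>x. g x - D x) < e) \<and>
        (\<forall>\<phi> D. test_function \<phi> D \<longrightarrow>
            integral\<^sup>L (lebesgue_on B1) (\<lambda>x. \<Sum>i\<in>UNIV. g x $ i * D x $ i) =
            of_real \<Lambda> * integral\<^sup>L (lebesgue_on B1) (\<lambda>x. w x * \<phi> x)))"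

section \<open>Spherical waves and the space of Helmholtz solutions\<close>

text \<open>Power series of \<open>j\<^sub>l(r) = sqrt (\<pi> / (2 r)) J\<^bsub>l+1/2\<^esub>(r)\<close>, which is also correct at \<open>r = 0\<close>.\<close>

definition spherical_bessel :: "nat \<Rightarrow> real \<Rightarrow> real" where
  "spherical_bessel l r =
     (\<Sum>k. (-1) ^ k * 2 ^ l * fact (l + k) / (fact k * fact (2 * l + 2 * k + 1)) * r ^ (l + 2 * k))"

text \<open>\<open>Y\<^sub>l\<^sup>m\<close> for \<open>m \<ge> 0\<close> in Cartesian coordinates on the unit sphere: with
  \<open>x = (sin \<theta> cos \<phi>, sin \<theta> sin \<phi>, cos \<theta>)\<close> one has \<open>(x\<^sub>1 + \<i> x\<^sub>2)\<^sup>m = sin\<^sup>m \<theta> e\<^sup>i\<^sup>m\<^sup>\<phi>\<close>, so this is the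
  normalization constant times \<open>e\<^sup>i\<^sup>m\<^sup>\<phi> P\<^sub>l\<^sup>m(cos \<theta>)\<close>, where \<open>P\<^sub>l\<^sup>m\<close> is the Ferrers function
  given by Rodrigues' formula
  \<open>(-1)\<^sup>m / (2\<^sup>l l!) (1 - z\<^sup>2)\<^bsup>m/2\<^esup> (d/dz)\<^bsup>l+m\<^esup> (z\<^sup>2 - 1)\<^sup>l\<close>.\<close>

definition spherical_harmonic_nonneg :: "nat \<Rightarrow> nat \<Rightarrow> pt \<Rightarrow> complex" where
  "spherical_harmonic_nonneg l m x =
     of_real (sqrt ((2 * real l + 1) / (4 * pi) * (fact (l - m) / fact (l + m)))
              * (-1) ^ m / (2 ^ l * fact l)
              * poly ((pderiv ^^ (l + m)) ([:-1, 0, 1:] ^ l)) (x $ 3))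
     * Complex (x $ 1) (x $ 2) ^ m"

definition spherical_harmonic :: "nat \<Rightarrow> int \<Rightarrow> pt \<Rightarrow> complex" where
  "spherical_harmonic l m x =
     (if m \<ge> 0 then spherical_harmonic_nonneg l (nat m) x
      else (-1) ^ nat (- m) * cnj (spherical_harmonic_nonneg l (nat (- m)) x))"

definition spherical_wave :: "real \<Rightarrow> nat \<Rightarrow> int \<Rightarrow> pt \<Rightarrow> complex" where
  "spherical_wave \<kappa> l m x =
     of_real (spherical_bessel l (\<kappa> * norm x)) * spherical_harmonic l m (x /\<^sub>R norm x)"

definition spherical_wave_span :: "real \<Rightarrow> (pt \<Rightarrow> complex) set" where
  "spherical_wave_span \<kappa> =
     {v. \<exists>L c. v = (\<lambda>x. \<Sum>l\<le>L. \<Sum>m\<in>{- int l..int l}. c l m * spherical_wave \<kappa> l m x)}"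

definition B_space :: "real \<Rightarrow> (pt \<Rightarrow> complex) set" where
  "B_space \<kappa> =
     {u \<in> H1_space. \<forall>e>0. \<exists>v\<in>spherical_wave_span \<kappa>. B_norm \<kappa> (\<lambda>x. u x - v x) < e}"

section \<open>Approximation sets and stability\<close>

text \<open>An approximation set is a finite family, given as a list; \<open>length\<close> is its cardinality.\<close>

definition synthesis :: "(pt \<Rightarrow> complex) list \<Rightarrow> complex Matrix.vec \<Rightarrow> pt \<Rightarrow> complex" where
  "synthesis \<phi>s \<mu> x = (\<Sum>p<length \<phi>s. vec_index \<mu> p * (\<phi>s ! p) x)"

definition vec_l2_norm :: "complex Matrix.vec \<Rightarrow> real" where
  "vec_l2_norm \<mu> = sqrt (\<Sum>p<dim_vec \<mu>. (cmod (vec_index \<mu> p))\<^sup>2)"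

definition approximation_sets :: "real \<Rightarrow> (nat \<Rightarrow> (pt \<Rightarrow> complex) list) \<Rightarrow> bool" where
  "approximation_sets \<kappa> \<Phi> \<longleftrightarrow> (\<forall>k. set (\<Phi> k) \<subseteq> B_space \<kappa>)"

text \<open>\<open>lam\<close> and \<open>C\<close> are a stability exponent and a stability constant of the sequence \<open>\<Phi>\<close>
  for the tolerance \<open>\<eta>\<close>.\<close>

definition stability_constants ::
    "real \<Rightarrow> (nat \<Rightarrow> (pt \<Rightarrow> complex) list) \<Rightarrow> real \<Rightarrow> real \<Rightarrow> real \<Rightarrow> bool" where
  "stability_constants \<kappa> \<Phi> \<eta> lam C \<longleftrightarrow> lam \<ge> 0 \<and> C \<ge> 0 \<and>
     (\<forall>u\<in>B_space \<kappa>. \<exists>k. \<exists>\<mu>\<in>carrier_vec (length (\<Phi> k)).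
        B_norm \<kappa> (\<lambda>x. u x - synthesis (\<Phi> k) \<mu> x) \<le> \<eta> * B_norm \<kappa> u \<and>
        vec_l2_norm \<mu> \<le> C * real (length (\<Phi> k)) powr lam * B_norm \<kappa> u)"

definition stable_approximation :: "real \<Rightarrow> (nat \<Rightarrow> (pt \<Rightarrow> complex) list) \<Rightarrow> bool" where
  "stable_approximation \<kappa> \<Phi> \<longleftrightarrow> approximation_sets \<kappa> \<Phi> \<and>
     (\<forall>\<eta>>0. \<exists>lam C. stability_constants \<kappa> \<Phi> \<eta> lam C)"

section \<open>Boundary sampling\<close>

definition sphere_integral :: "(pt \<Rightarrow> complex) \<Rightarrow> complex" where
  "sphere_integral v =
     integral (cbox (0, 0) (pi, 2 * pi))
       (\<lambda>(\<theta>, \<phi>). of_real (sin \<theta>) * v (vector [sin \<theta> * cos \<phi>, sin \<theta> * sin \<phi>, cos \<theta>]))"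

text \<open>For each \<open>S\<close> the nodes are \<open>x S 0, \<dots>, x S (S - 1)\<close> with weights
  \<open>w S 0, \<dots>, w S (S - 1)\<close>.\<close>

definition convergent_quadrature :: "(nat \<Rightarrow> nat \<Rightarrow> pt) \<Rightarrow> (nat \<Rightarrow> nat \<Rightarrow> real) \<Rightarrow> bool" where
  "convergent_quadrature x w \<longleftrightarrow>
     (\<forall>S. \<forall>s<S. x S s \<in> sphere 0 1 \<and> w S s > 0) \<and>
     (\<forall>v. continuous_on (sphere 0 1) v \<longrightarrow>
        (\<lambda>S. \<Sum>s<S. of_real (w S s) * v (x S s)) \<longlonglongrightarrow> sphere_integral v)"

definition weight_max :: "(nat \<Rightarrow> nat \<Rightarrow> real) \<Rightarrow> nat \<Rightarrow> real" where
  "weight_max w S = Max (insert 0 ((\<lambda>s. \<bar>w S s\<bar>) ` {..<S}))"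

definition sampling_matrix ::
    "(nat \<Rightarrow> nat \<Rightarrow> pt) \<Rightarrow> (nat \<Rightarrow> nat \<Rightarrow> real) \<Rightarrow> nat \<Rightarrow> (pt \<Rightarrow> complex) list \<Rightarrow> complex mat" where
  "sampling_matrix x w S \<phi>s =
     mat S (length \<phi>s) (\<lambda>(s, p). of_real (sqrt (w S s)) * (\<phi>s ! p) (x S s))"

definition sampling_rhs ::
    "(nat \<Rightarrow> nat \<Rightarrow> pt) \<Rightarrow> (nat \<Rightarrow> nat \<Rightarrow> real) \<Rightarrow> nat \<Rightarrow> (pt \<Rightarrow> complex) \<Rightarrow> complex Matrix.vec" where
  "sampling_rhs x w S u = Matrix.vec S (\<lambda>s. of_real (sqrt (w S s)) * u (x S s))"

section \<open>Singular value decomposition and regularized solution\<close>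

definition rect_diag :: "nat \<Rightarrow> nat \<Rightarrow> (nat \<Rightarrow> real) \<Rightarrow> complex mat" where
  "rect_diag m n d = mat m n (\<lambda>(i, j). if i = j then of_real (d i) else 0)"

definition unitary_mat :: "nat \<Rightarrow> complex mat \<Rightarrow> bool" where
  "unitary_mat n U \<longleftrightarrow> U \<in> carrier_mat n n \<and>
     U * mat_adjoint U = 1\<^sub>m n \<and> mat_adjoint U * U = 1\<^sub>m n"

text \<open>The singular values \<open>d i\<close> need not be sorted.\<close>

definition is_svd :: "complex mat \<Rightarrow> complex mat \<Rightarrow> (nat \<Rightarrow> real) \<Rightarrow> complex mat \<Rightarrow> bool" where
  "is_svd A U d V \<longleftrightarrow> unitary_mat (dim_row A) U \<and> unitary_mat (dim_col A) V \<and>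
     (\<forall>i<min (dim_row A) (dim_col A). d i \<ge> 0) \<and>
     A = U * rect_diag (dim_row A) (dim_col A) d * mat_adjoint V"

definition sigma_max :: "complex mat \<Rightarrow> (nat \<Rightarrow> real) \<Rightarrow> real" where
  "sigma_max A d = Max (insert 0 (d ` {..<min (dim_row A) (dim_col A)}))"

text \<open>\<open>V \<Sigma>\<^sub>\<epsilon>\<^sup>\<dagger> U\<^sup>* b\<close>. The pseudo-inverse of a rectangular diagonal matrix inverts the nonzero
  diagonal entries of the transpose; recall \<open>inverse 0 = 0\<close>.\<close>

definition regularized_solution ::
    "complex mat \<Rightarrow> complex mat \<Rightarrow> (nat \<Rightarrow> real) \<Rightarrow> complex mat \<Rightarrow> real \<Rightarrow> complex Matrix.vec
      \<Rightarrow> complex Matrix.vec" where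
  "regularized_solution A U d V \<epsilon> b =
     (let d\<epsilon> = (\<lambda>i. if d i < \<epsilon> * sigma_max A d then 0 else d i)
      in (V * rect_diag (dim_col A) (dim_row A) (\<lambda>i. inverse (d\<epsilon> i)) * mat_adjoint U) *\<^sub>v b)"

text \<open>The admissible size \<open>\<delta> / (2 Cerr Cstb \<sigma> N\<^sup>l\<^sup>a\<^sup>m W\<^bsup>1/2\<^esup>)\<close> of the regularization parameter, capped
  at \<open>1\<close>; a vanishing denominator is read as no restriction other than \<open>\<epsilon> \<le> 1\<close>.
  Here \<open>W\<close> is the largest weight of the \<open>S\<close>-point rule. Since the surface measure has no atoms,
  \<open>W\<close> tends to \<open>0\<close> for every convergent quadrature while \<open>\<sigma>\<close> already contains the weights and
  stays bounded; hence \<open>Cerr\<close> has to be a constant of the \<open>S\<close>-point rule (independent of \<open>u\<close> and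
  of the approximation sets), with \<open>Cerr W\<^bsup>1/2\<^esup>\<close> bounded uniformly in \<open>S\<close>.\<close>

definition epsilon_bound ::
    "real \<Rightarrow> real \<Rightarrow> real \<Rightarrow> real \<Rightarrow> nat \<Rightarrow> real \<Rightarrow> real \<Rightarrow> real" where
  "epsilon_bound \<delta> Cerr Cstb \<sigma> N lam W =
     (let q = 2 * Cerr * Cstb * \<sigma> * real N powr lam * sqrt W
      in if q = 0 then 1 else min 1 (\<delta> / q))"

end

theory Submission
  imports Defs
begin

text \<open>Since \<open>\<kappa>\<^sup>2\<close> is not a Dirichlet eigenvalue, no \<open>j\<^sub>l(\<kappa>)\<close> vanishes: otherwise
  \<open>j\<^sub>l(\<kappa>|x|) Y\<^sub>l\<^sup>l(x/|x|)\<close> would be an eigenfunction. As \<open>j\<^sub>l(\<kappa> r) / j\<^sub>l(\<kappa>)\<close> is then bounded uniformly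
  in \<open>l\<close> and \<open>r \<le> 1\<close>, the \<open>L\<^sup>2\<close> norm of a wave over the ball is bounded by its \<open>L\<^sup>2\<close> norm over the
  sphere. On the finite-dimensional space spanned by \<open>u\<close> and one approximation set the latter is comparable,
  for a large number of nodes, to the discrete norm of the samples, which is the norm minimized by the
  regularized solution up to a term \<open>\<epsilon> \<sigma>\<^bsub>max\<^esub> \<parallel>\<mu>\<parallel>\<close> for every competitor \<open>\<mu>\<close>. Taking as \<open>\<mu>\<close> the coefficients
  provided by stability, the discrete residual is bounded through the trace inequality by the \<open>H\<^sup>1\<close> error of
  the stable approximation, and the remaining term is small because \<open>\<parallel>\<mu>\<parallel>\<close> is controlled.\<close>

section \<open>Square integrable functions\<close>

text \<open>Membership in \<open>B_space\<close> only provides approximation by finite sums of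
  waves; an expansion or the smoothness of the limit is not at hand. The passage from ball to sphere
  is therefore made by duality: tested against a finite sum, a function enters only through its
  moments over concentric spheres, and these are radial limits of multiples of
  \<open>spherical_bessel l (\<kappa> * r)\<close>, hence multiples themselves. The trace inequality
  is likewise proved for continuous functions with a weak gradient, by test fields that concentrate
  at the boundary. Quadrature need not converge uniformly in the integrand, so \<open>S0\<close>
  depends on \<open>u\<close> and on the selected set. The constants \<open>D\<close> (ball by
  sphere) and \<open>T\<close> (trace) do not, which allows the tolerance \<delta> / (8 D T) to be
  fixed before \<open>u\<close>: a factor 4 comes from passing from the sphere to the samples and
  back, and a factor 2 from giving half of \<delta> to each of the two error terms. An \<epsilon>
  valid for all \<open>S\<close> at once needs a bound on the largest singular value that is
  independent of \<open>S\<close>.\<close>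

definition square_integrable :: "'a measure \<Rightarrow> ('a \<Rightarrow> 'b::{banach,second_countable_topology}) \<Rightarrow> bool" where
  "square_integrable M f \<longleftrightarrow> f \<in> borel_measurable M \<and> integrable M (\<lambda>x. (norm (f x))\<^sup>2)"

text \<open>A general measure allows the same estimates over the ball, the sphere and the radial
  interval. The Bochner integral of a non-integrable function is 0, so this number is a norm only
  together with \<open>square_integrable\<close>.\<close>

definition l2norm :: "'a measure \<Rightarrow> ('a \<Rightarrow> 'b::{banach,second_countable_topology}) \<Rightarrow> real" where
  "l2norm M f = sqrt (integral\<^sup>L M (\<lambda>x. (norm (f x))\<^sup>2))"

lemma square_integrable_measurable: "square_integrable M f \<Longrightarrow> f \<in> borel_measurable M"
  by (simp add: square_integrable_def)

lemma l2norm_nonneg [simp]: "0 \<le> l2norm M f"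
  by (simp add: l2norm_def)

lemma l2norm_power2: "(l2norm M f)\<^sup>2 = integral\<^sup>L M (\<lambda>x. (norm (f x))\<^sup>2)"
  by (simp add: l2norm_def)

lemma integrable_norm_mult:
  assumes "square_integrable M f" "square_integrable M g"
  shows "integrable M (\<lambda>x. norm (f x) * norm (g x))"
proof (rule Bochner_Integration.integrable_bound)
  show "integrable M (\<lambda>x. (norm (f x))\<^sup>2 + (norm (g x))\<^sup>2)"
    using assms by (auto simp: square_integrable_def)
  show "(\<lambda>x. norm (f x) * norm (g x)) \<in> borel_measurable M"
    using assms by (auto simp: square_integrable_def)
  have "a * b \<le> a\<^sup>2 + b\<^sup>2" for a b :: real
    using sum_squares_bound[of a b] zero_le_power2[of a] zero_le_power2[of b] by linarith
  then show "AE x in M. norm (norm (f x) * norm (g x)) \<le> norm ((norm (f x))\<^sup>2 + (norm (g x))\<^sup>2)"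
    by auto
qed

text \<open>Integrate the inequality 2 (s |f|) (t |g|) \<le> (s |f|)^2 + (t |g|)^2 and take for
  \<open>s\<close> the norm of \<open>g\<close> and for \<open>t\<close> the norm of
  \<open>f\<close>. If one of the norms vanishes, this choice gives nothing, and a free factor is
  made large instead.\<close>

lemma l2norm_cauchy_schwarz:
  assumes "square_integrable M f" "square_integrable M g"
  shows "integral\<^sup>L M (\<lambda>x. norm (f x) * norm (g x)) \<le> l2norm M f * l2norm M g"
proof -
  let ?a = "l2norm M f" and ?b = "l2norm M g"
  let ?I = "integral\<^sup>L M (\<lambda>x. norm (f x) * norm (g x))"
  have I0: "?I \<ge> 0" by simp
  have *: "2 * s * t * ?I \<le> s\<^sup>2 * ?a\<^sup>2 + t\<^sup>2 * ?b\<^sup>2" for s t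
  proof -
    have "integral\<^sup>L M (\<lambda>x. 2 * s * t * (norm (f x) * norm (g x))) \<le>
        integral\<^sup>L M (\<lambda>x. s\<^sup>2 * (norm (f x))\<^sup>2 + t\<^sup>2 * (norm (g x))\<^sup>2)"
    proof (rule integral_mono)
      show "integrable M (\<lambda>x. 2 * s * t * (norm (f x) * norm (g x)))"
        using integrable_norm_mult[OF assms] by simp
      show "integrable M (\<lambda>x. s\<^sup>2 * (norm (f x))\<^sup>2 + t\<^sup>2 * (norm (g x))\<^sup>2)"
        using assms by (auto simp: square_integrable_def)
      show "2 * s * t * (norm (f x) * norm (g x)) \<le> s\<^sup>2 * (norm (f x))\<^sup>2 + t\<^sup>2 * (norm (g x))\<^sup>2" for x
        using sum_squares_bound[of "s * norm (f x)" "t * norm (g x)"]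
        by (simp add: power_mult_distrib mult_ac)
    qed
    also have "\<dots> = s\<^sup>2 * ?a\<^sup>2 + t\<^sup>2 * ?b\<^sup>2"
      using assms by (simp add: l2norm_power2 square_integrable_def)
    finally show ?thesis by simp
  qed
  show ?thesis
  proof (cases "?a = 0 \<or> ?b = 0")
    case True
    have "?I \<le> 0"
    proof (rule field_le_epsilon)
      fix e :: real assume e: "e > 0"
      \<comment> \<open>\<open>K\<close> exceeds the square of the other norm, so the factor
        \<open>K/e\<close> on the function of norm zero yields
        \<open>?I \<le> e / 2\<close>.\<close>
      define K where "K = ?a\<^sup>2 + ?b\<^sup>2 + 1"
      have K: "K > 0" unfolding K_def by (simp add: add_nonneg_pos)
      show "?I \<le> 0 + e"
      proof (cases "?a = 0")
        case True
        have "2 * (K/e) * 1 * ?I \<le> K" using *[of "K/e" 1] True by (simp add: K_def)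
        hence "?I \<le> e / 2" using K e by (simp add: field_simps)
        thus ?thesis using e by simp
      next
        case False
        hence b: "?b = 0" using \<open>?a = 0 \<or> ?b = 0\<close> by simp
        have "2 * 1 * (K/e) * ?I \<le> K" using *[of 1 "K/e"] b by (simp add: K_def)
        hence "?I \<le> e / 2" using K e by (simp add: field_simps)
        thus ?thesis using e by simp
      qed
    qed
    thus ?thesis by (meson order_trans l2norm_nonneg mult_nonneg_nonneg)
  next
    case False
    hence ab: "?a > 0" "?b > 0" by (auto simp: less_le)
    have "2 * ?b * ?a * ?I \<le> 2 * ?b * ?a * (?a * ?b)"
      using *[of ?b ?a] by (simp add: power2_eq_square mult_ac)
    thus ?thesis using ab by simp
  qed
qed

lemma integrable_mult_square_integrable:
  fixes f g :: "'a \<Rightarrow> complex"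
  assumes "square_integrable M f" "square_integrable M g"
  shows "integrable M (\<lambda>x. f x * g x)"
  by (rule Bochner_Integration.integrable_bound[OF integrable_norm_mult[OF assms]])
     (use assms in \<open>auto simp: square_integrable_def norm_mult\<close>)

lemma norm_integral_mult_le:
  fixes f g :: "'a \<Rightarrow> complex"
  assumes "square_integrable M f" "square_integrable M g"
  shows "norm (integral\<^sup>L M (\<lambda>x. f x * g x)) \<le> l2norm M f * l2norm M g"
proof -
  have "norm (integral\<^sup>L M (\<lambda>x. f x * g x)) \<le> integral\<^sup>L M (\<lambda>x. norm (f x) * norm (g x))"
    using integral_norm_bound[of M "\<lambda>x. f x * g x"] by (simp add: norm_mult)
  thus ?thesis using l2norm_cauchy_schwarz[OF assms] by linarith
qed

lemma square_integrable_add: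
  assumes "square_integrable M f" "square_integrable M g"
  shows "square_integrable M (\<lambda>x. f x + g x)"
  unfolding square_integrable_def
proof
  show m: "(\<lambda>x. f x + g x) \<in> borel_measurable M"
    using assms by (auto simp: square_integrable_def)
  show "integrable M (\<lambda>x. (norm (f x + g x))\<^sup>2)"
  proof (rule Bochner_Integration.integrable_bound)
    show "integrable M (\<lambda>x. (norm (f x))\<^sup>2 + 2 * (norm (f x) * norm (g x)) + (norm (g x))\<^sup>2)"
      using assms integrable_norm_mult[OF assms] by (auto simp: square_integrable_def)
    show "(\<lambda>x. (norm (f x + g x))\<^sup>2) \<in> borel_measurable M" using m by measurable
    show "AE x in M. norm ((norm (f x + g x))\<^sup>2) \<le>
        norm ((norm (f x))\<^sup>2 + 2 * (norm (f x) * norm (g x)) + (norm (g x))\<^sup>2)"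
    proof (intro AE_I2)
      fix x
      have "(norm (f x + g x))\<^sup>2 \<le> (norm (f x) + norm (g x))\<^sup>2"
        by (intro power_mono norm_triangle_ineq) auto
      also have "\<dots> = (norm (f x))\<^sup>2 + 2 * (norm (f x) * norm (g x)) + (norm (g x))\<^sup>2"
        by (simp add: power2_sum)
      finally show "norm ((norm (f x + g x))\<^sup>2) \<le>
        norm ((norm (f x))\<^sup>2 + 2 * (norm (f x) * norm (g x)) + (norm (g x))\<^sup>2)" by simp
    qed
  qed
qed

lemma l2norm_triangle:
  assumes "square_integrable M f" "square_integrable M g"
  shows "l2norm M (\<lambda>x. f x + g x) \<le> l2norm M f + l2norm M g"
proof (rule power2_le_imp_le)
  have "(l2norm M (\<lambda>x. f x + g x))\<^sup>2 = integral\<^sup>L M (\<lambda>x. (norm (f x + g x))\<^sup>2)"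
    by (rule l2norm_power2)
  also have "\<dots> \<le> integral\<^sup>L M (\<lambda>x. (norm (f x))\<^sup>2 + 2 * (norm (f x) * norm (g x)) + (norm (g x))\<^sup>2)"
  proof (rule integral_mono)
    show "integrable M (\<lambda>x. (norm (f x + g x))\<^sup>2)"
      using square_integrable_add[OF assms] by (simp add: square_integrable_def)
    show "integrable M (\<lambda>x. (norm (f x))\<^sup>2 + 2 * (norm (f x) * norm (g x)) + (norm (g x))\<^sup>2)"
      using assms integrable_norm_mult[OF assms] by (auto simp: square_integrable_def)
    fix x
    have "(norm (f x + g x))\<^sup>2 \<le> (norm (f x) + norm (g x))\<^sup>2"
      by (intro power_mono norm_triangle_ineq) auto
    thus "(norm (f x + g x))\<^sup>2 \<le> (norm (f x))\<^sup>2 + 2 * (norm (f x) * norm (g x)) + (norm (g x))\<^sup>2"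
      by (simp add: power2_sum)
  qed
  also have "\<dots> = (l2norm M f)\<^sup>2 + 2 * integral\<^sup>L M (\<lambda>x. norm (f x) * norm (g x)) + (l2norm M g)\<^sup>2"
    using assms integrable_norm_mult[OF assms] by (simp add: l2norm_power2 square_integrable_def)
  also have "\<dots> \<le> (l2norm M f)\<^sup>2 + 2 * (l2norm M f * l2norm M g) + (l2norm M g)\<^sup>2"
    using l2norm_cauchy_schwarz[OF assms] by simp
  also have "\<dots> = (l2norm M f + l2norm M g)\<^sup>2" by (simp add: power2_sum)
  finally show "(l2norm M (\<lambda>x. f x + g x))\<^sup>2 \<le> (l2norm M f + l2norm M g)\<^sup>2" .
qed simp

lemma square_integrable_bounded_mult:
  fixes f h :: "'a \<Rightarrow> 'b::{banach,second_countable_topology,real_normed_algebra}"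
  assumes "square_integrable M f" "h \<in> borel_measurable M" "\<And>x. x \<in> space M \<Longrightarrow> norm (h x) \<le> K"
  shows "square_integrable M (\<lambda>x. h x * f x)" "l2norm M (\<lambda>x. h x * f x) \<le> \<bar>K\<bar> * l2norm M f"
proof -
  have m: "(\<lambda>x. h x * f x) \<in> borel_measurable M"
    using assms by (auto simp: square_integrable_def)
  have b: "(norm (h x * f x))\<^sup>2 \<le> K\<^sup>2 * (norm (f x))\<^sup>2" if "x \<in> space M" for x
  proof -
    have "norm (h x * f x) \<le> \<bar>K\<bar> * norm (f x)"
      using assms(3)[OF that] norm_mult_ineq[of "h x" "f x"]
      by (meson abs_ge_self mult_right_mono norm_ge_zero order_trans)
    hence "(norm (h x * f x))\<^sup>2 \<le> (\<bar>K\<bar> * norm (f x))\<^sup>2" by (intro power_mono) auto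
    thus ?thesis by (simp add: power_mult_distrib)
  qed
  have i: "integrable M (\<lambda>x. K\<^sup>2 * (norm (f x))\<^sup>2)" using assms by (auto simp: square_integrable_def)
  have "integrable M (\<lambda>x. (norm (h x * f x))\<^sup>2)"
  proof (rule Bochner_Integration.integrable_bound[OF i])
    show "(\<lambda>x. (norm (h x * f x))\<^sup>2) \<in> borel_measurable M" using m by measurable
    show "AE x in M. norm ((norm (h x * f x))\<^sup>2) \<le> norm (K\<^sup>2 * (norm (f x))\<^sup>2)"
      using b by (intro AE_I2) auto
  qed
  with m show si: "square_integrable M (\<lambda>x. h x * f x)" by (simp add: square_integrable_def)
  show "l2norm M (\<lambda>x. h x * f x) \<le> \<bar>K\<bar> * l2norm M f"
  proof (rule power2_le_imp_le)
    have "(l2norm M (\<lambda>x. h x * f x))\<^sup>2 \<le> integral\<^sup>L M (\<lambda>x. K\<^sup>2 * (norm (f x))\<^sup>2)"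
      unfolding l2norm_power2 using si i b
      by (intro integral_mono) (auto simp: square_integrable_def)
    also have "\<dots> = (\<bar>K\<bar> * l2norm M f)\<^sup>2" by (simp add: power_mult_distrib l2norm_power2)
    finally show "(l2norm M (\<lambda>x. h x * f x))\<^sup>2 \<le> (\<bar>K\<bar> * l2norm M f)\<^sup>2" .
  qed simp
qed

lemma square_integrable_cmult:
  fixes f :: "'a \<Rightarrow> complex"
  assumes "square_integrable M f"
  shows "square_integrable M (\<lambda>x. c * f x)"
  using square_integrable_bounded_mult(1)[OF assms, of "\<lambda>_. c" "norm c"] by simp

lemma l2norm_cmult:
  fixes f :: "'a \<Rightarrow> complex"
  shows "l2norm M (\<lambda>x. c * f x) = norm c * l2norm M f"
  by (simp add: l2norm_def norm_mult power_mult_distrib real_sqrt_mult)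

lemma square_integrable_diff:
  fixes f :: "'a \<Rightarrow> 'b::{banach,second_countable_topology}"
  assumes "square_integrable M f" "square_integrable M g"
  shows "square_integrable M (\<lambda>x. f x - g x)"
proof -
  have "square_integrable M (\<lambda>x. - g x)" using assms(2) by (simp add: square_integrable_def)
  from square_integrable_add[OF assms(1) this] show ?thesis by simp
qed

lemma square_integrable_sum:
  fixes f :: "'i \<Rightarrow> 'a \<Rightarrow> 'b::{banach,second_countable_topology}"
  assumes "\<And>i. i \<in> I \<Longrightarrow> square_integrable M (f i)"
  shows "square_integrable M (\<lambda>x. \<Sum>i\<in>I. f i x)"
  using assms
proof (induction I rule: infinite_finite_induct)
  case (insert i I)
  have "square_integrable M (\<lambda>x. f i x + (\<Sum>i\<in>I. f i x))"
    by (intro square_integrable_add insert) auto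
  thus ?case using insert by simp
qed (auto simp: square_integrable_def)

lemma square_integrable_cnj:
  "square_integrable M f \<Longrightarrow> square_integrable M (\<lambda>x. cnj (f x))"
  by (auto simp: square_integrable_def intro!: borel_measurable_continuous_on[OF continuous_on_cnj[OF continuous_on_id]])

lemma l2norm_cnj [simp]: "l2norm M (\<lambda>x. cnj (f x)) = l2norm M f"
  by (simp add: l2norm_def)

lemma square_integrable_bounded:
  fixes f :: "'a \<Rightarrow> 'b::{banach,second_countable_topology}"
  assumes "finite_measure M" "f \<in> borel_measurable M" "\<And>x. x \<in> space M \<Longrightarrow> norm (f x) \<le> K"
  shows "square_integrable M f"
proof -
  have "integrable M (\<lambda>x. (norm (f x))\<^sup>2)"
  proof (rule finite_measure.integrable_const_bound[OF assms(1), where B="K\<^sup>2"])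
    show "AE x in M. norm ((norm (f x))\<^sup>2) \<le> K\<^sup>2"
      using assms(3) by (intro AE_I2) (auto intro!: power_mono)
    show "(\<lambda>x. (norm (f x))\<^sup>2) \<in> borel_measurable M" using assms(2) by measurable
  qed
  with assms(2) show ?thesis by (simp add: square_integrable_def)
qed

lemma L2_space_eq: "L2_space = {f. square_integrable (lebesgue_on B1) f}"
  by (simp add: L2_space_def square_integrable_def)

lemma L2_norm_eq: "L2_norm = l2norm (lebesgue_on B1)"
  by (simp add: L2_norm_def l2norm_def fun_eq_iff)

section \<open>Polar coordinates\<close>

text \<open>The parametrization inside \<open>sphere_integral\<close>: first component the polar
  angle, second the azimuth.\<close>

definition sphere_point :: "real \<times> real \<Rightarrow> pt" where
  "sphere_point q = vector [sin (fst q) * cos (snd q), sin (fst q) * sin (snd q), cos (fst q)]"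

lemma sphere_point_nth [simp]:
  "sphere_point q $ 1 = sin (fst q) * cos (snd q)" "sphere_point q $ 2 = sin (fst q) * sin (snd q)"
  "sphere_point q $ 3 = cos (fst q)"
  by (simp_all add: sphere_point_def)

lemma norm_pt: "norm (x::pt) = sqrt ((x $ 1)\<^sup>2 + (x $ 2)\<^sup>2 + (x $ 3)\<^sup>2)"
  by (simp add: norm_eq_sqrt_inner inner_vec_def sum_3 power2_eq_square)

lemma norm_sph [simp]: "norm (sphere_point q) = 1"
proof -
  have "(sin (fst q) * cos (snd q))\<^sup>2 + (sin (fst q) * sin (snd q))\<^sup>2 + (cos (fst q))\<^sup>2 = 1"
  proof -
    have "(s * d)\<^sup>2 + (s * t)\<^sup>2 + c\<^sup>2 = s\<^sup>2 * (t\<^sup>2 + d\<^sup>2) + c\<^sup>2" for s c t d :: real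
      by (simp add: power_mult_distrib algebra_simps)
    thus ?thesis by simp
  qed
  thus ?thesis by (simp add: norm_pt)
qed

lemma continuous_vector3:
  assumes "continuous_on A f" "continuous_on A g" "continuous_on A h"
  shows "continuous_on A (\<lambda>x. vector [f x, g x, h x] :: pt)"
proof -
  have "continuous_on A (\<lambda>x. (\<chi> i. if i = 1 then f x else if i = 2 then g x else h x) :: pt)"
  proof (rule continuous_on_vec_lambda)
    show "continuous_on A (\<lambda>x. if i = 1 then f x else if i = 2 then g x else h x)" for i :: 3
      by (cases "i = 1"; cases "i = 2") (simp_all add: assms)
  qed
  moreover have "vector [f x, g x, h x] = ((\<chi> i. if i = 1 then f x else if i = 2 then g x else h x) :: pt)" for x
    by (simp add: Finite_Cartesian_Product.vec_eq_iff forall_3)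
  ultimately show ?thesis by simp
qed

lemma continuous_on_sph [continuous_intros]: "continuous_on A sphere_point"
  unfolding sphere_point_def by (intro continuous_vector3 continuous_intros)

lemma Basis_pt: "(Basis :: pt set) = {axis 1 1, axis 2 1, axis 3 1}"
  unfolding Basis_vec_def by (auto simp: UNIV_3)

lemma prod_Basis_pt: "(\<Prod>b\<in>(Basis::pt set). f b) = f (axis 1 1) * (f (axis 2 1) * f (axis 3 1))"
  unfolding Basis_pt by (simp add: axis_eq_axis)

text \<open>Tonelli's theorem speaks about products of measures, so the space is identified with
  nested pairs of reals: radius first, then the pair of angles.\<close>

definition vec3 :: "real \<times> real \<times> real \<Rightarrow> pt" where
  "vec3 p = vector [fst p, fst (snd p), snd (snd p)]"

lemma vec3_nth [simp]: "vec3 p $ 1 = fst p" "vec3 p $ 2 = fst (snd p)" "vec3 p $ 3 = snd (snd p)"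
  by (simp_all add: vec3_def)

lemma borel_measurable_vec3 [measurable]: "vec3 \<in> borel_measurable borel"
  unfolding vec3_def by (intro borel_measurable_continuous_onI continuous_vector3 continuous_intros)

lemma mem_box_pt: "x \<in> box l u \<longleftrightarrow> l$1 < x$1 \<and> x$1 < u$1 \<and> l$2 < x$2 \<and> x$2 < u$2 \<and> l$3 < x$3 \<and> x$3 < (u::pt)$3"
  by (auto simp: mem_box_cart forall_3)

text \<open>Lebesgue measure is determined by its values on boxes, and the preimage of a box under
  \<open>vec3\<close> is a product of three intervals.\<close>

lemma lborel_pt_eq: "(lborel :: pt measure) = distr lborel borel vec3"
proof (rule lborel_eqI)
  fix l u :: pt assume le: "\<And>b. b \<in> Basis \<Longrightarrow> l \<bullet> b \<le> u \<bullet> b"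
  have le': "l $ i \<le> u $ i" for i
    using le[of "axis i 1"] by (simp add: inner_axis axis_in_Basis_iff)
  have "vec3 -` box l u = {l$1<..<u$1} \<times> {l$2<..<u$2} \<times> {l$3<..<u$3}"
    by (auto simp: mem_box_pt)
  hence "emeasure (distr lborel borel vec3) (box l u) =
      emeasure (lborel \<Otimes>\<^sub>M lborel) ({l$1<..<u$1} \<times> {l$2<..<u$2} \<times> {l$3<..<u$3})"
    by (simp add: emeasure_distr lborel_prod)
  also have "\<dots> = emeasure lborel {l$1<..<u$1} * emeasure (lborel \<Otimes>\<^sub>M lborel) ({l$2<..<u$2} \<times> {l$3<..<u$3})"
    by (subst lborel.emeasure_pair_measure_Times) (auto simp: lborel_prod borel_Times)
  also have "\<dots> = ennreal (u$1 - l$1) * (ennreal (u$2 - l$2) * ennreal (u$3 - l$3))"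
    using le' by (simp add: lborel.emeasure_pair_measure_Times )
  also have "\<dots> = ennreal (\<Prod>b\<in>Basis. (u - l) \<bullet> b)"
    using le' by (simp add: prod_Basis_pt inner_axis ennreal_mult)
  finally show "emeasure (distr lborel borel vec3) (box l u) = ennreal (\<Prod>b\<in>Basis. (u - l) \<bullet> b)" .
qed simp

section \<open>Change of variables to spherical coordinates\<close>

definition polar :: "pt \<Rightarrow> pt" where
  "polar y = y $ 1 *\<^sub>R sphere_point (y $ 2, y $ 3)"

definition polar' :: "pt \<Rightarrow> pt \<Rightarrow> pt" where
  "polar' y h = vector
    [h$1 * sin (y$2) * cos (y$3) + y$1 * cos (y$2) * cos (y$3) * h$2 - y$1 * sin (y$2) * sin (y$3) * h$3,
     h$1 * sin (y$2) * sin (y$3) + y$1 * cos (y$2) * sin (y$3) * h$2 + y$1 * sin (y$2) * cos (y$3) * h$3,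
     h$1 * cos (y$2) - y$1 * sin (y$2) * h$2]"

lemma has_derivative_nth [derivative_intros]:
  "((\<lambda>x::real^'n. x $ i) has_derivative (\<lambda>h. h $ i)) F"
  by (rule bounded_linear_imp_has_derivative[OF bounded_linear_vec_nth])

lemma has_derivative_polar: "(polar has_derivative polar' y) (at y within S)"
proof -
  have 1: "((\<lambda>x::pt. x$1 * (sin (x$2) * cos (x$3))) has_derivative (\<lambda>h. polar' y h $ 1)) (at y within S)"
    by (rule has_derivative_eq_rhs, (rule derivative_intros)+) (simp add: polar'_def algebra_simps)
  have 2: "((\<lambda>x::pt. x$1 * (sin (x$2) * sin (x$3))) has_derivative (\<lambda>h. polar' y h $ 2)) (at y within S)"
    by (rule has_derivative_eq_rhs, (rule derivative_intros)+) (simp add: polar'_def algebra_simps)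
  have 3: "((\<lambda>x::pt. x$1 * cos (x$2)) has_derivative (\<lambda>h. polar' y h $ 3)) (at y within S)"
    by (rule has_derivative_eq_rhs, (rule derivative_intros)+) (simp add: polar'_def algebra_simps)
  show ?thesis
    by (subst has_derivative_componentwise_within) (use 1 2 3 in \<open>simp add: Basis_pt inner_axis polar_def\<close>)
qed

lemma det_polar': "Determinants.det (matrix (polar' y)) = (y $ 1)\<^sup>2 * sin (y $ 2)"
proof -
  \<comment> \<open>The two Pythagorean factors are kept so that the identity is polynomial in the
    five letters; the zeros stem from the third coordinate, which does not depend on the
    azimuth.\<close>
  have *: "r * s * t * 0 + (r\<^sup>2 * s) * (s\<^sup>2 + c\<^sup>2) * (t\<^sup>2 + d\<^sup>2) =
     s * d * (r * c * t) * 0 - s * d * (r * s * d) * (- (r * s)) - r * c * d * (s * t) * 0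
      + r * c * d * (r * s * d) * c + (- (r * s * t)) * (s * t) * (- (r * s)) - (- (r * s * t)) * (r * c * t) * c"
    for r s c t d :: real
    by (simp add: algebra_simps power2_eq_square)
  show ?thesis
    using *[of "y$1" "sin (y$2)" "sin (y$3)" "cos (y$2)" "cos (y$3)"]
    unfolding det_3 by (simp add: matrix_def polar'_def axis_def mult_ac)
qed

text \<open>The norm recovers the radius, the third coordinate the polar angle since cosine is
  injective on [0, pi], and sine and cosine together the azimuth modulo 2 pi, which the open range
  makes unique.\<close>

lemma inj_on_polar: "inj_on polar {y. 0 < y$1 \<and> y$2 \<in> {0<..<pi} \<and> y$3 \<in> {0<..<2*pi}}"
proof (rule inj_onI)
  fix y z :: pt
  assume "y \<in> {y. 0 < y$1 \<and> y$2 \<in> {0<..<pi} \<and> y$3 \<in> {0<..<2*pi}}"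
    and "z \<in> {y. 0 < y$1 \<and> y$2 \<in> {0<..<pi} \<and> y$3 \<in> {0<..<2*pi}}" and eq: "polar y = polar z"
  hence y: "0 < y$1" "0 < y$2" "y$2 < pi" "0 < y$3" "y$3 < 2*pi"
    and z: "0 < z$1" "0 < z$2" "z$2 < pi" "0 < z$3" "z$3 < 2*pi" by simp_all
  have "norm (polar y) = norm (polar z)" using eq by simp
  hence r: "y$1 = z$1" using y(1) z(1) by (simp add: polar_def)
  have s: "sphere_point (y$2, y$3) = sphere_point (z$2, z$3)" using eq r z(1) by (simp add: polar_def)
  have "sphere_point (y$2, y$3) $ 3 = sphere_point (z$2, z$3) $ 3" using s by simp
  hence t: "y$2 = z$2" using y(2,3) z(2,3) cos_inj_pi[of "y$2" "z$2"] by simp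
  have sp: "sin (y$2) > 0" using y by (simp add: sin_gt_zero)
  have "sphere_point (y$2, y$3) $ 1 = sphere_point (z$2, z$3) $ 1" "sphere_point (y$2, y$3) $ 2 = sphere_point (z$2, z$3) $ 2" using s by simp_all
  hence "sin (y$3) = sin (z$3) \<and> cos (y$3) = cos (z$3)" using t sp by simp
  then obtain n where n: "y$3 = z$3 + 2 * pi * real_of_int n" using sin_cos_eq_iff by metis
  have "\<bar>2 * pi * real_of_int n\<bar> < 2 * pi" using n y(4,5) z(4,5) by linarith
  hence "\<bar>real_of_int n\<bar> < 1" by (simp add: abs_mult)
  hence "n = 0" by linarith
  hence p: "y$3 = z$3" using n by simp
  show "y = z" using r t p by (simp add: Finite_Cartesian_Product.vec_eq_iff forall_3)
qed

text \<open>Open parameter ranges miss the axis and the half-plane of azimuth 0. Both lie in the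
  hyperplane excluded by the hypothesis, which is a null set.\<close>

lemma polar_surj:
  fixes x :: pt
  assumes "x $ 2 \<noteq> 0"
  obtains y where "0 < y$1" "0 < y$2" "y$2 < pi" "0 < y$3" "y$3 < 2*pi" "polar y = x" "y $ 1 = norm x"
proof -
  define r where "r = norm x"
  define \<rho> where "\<rho> = sqrt ((x$1)\<^sup>2 + (x$2)\<^sup>2)"
  have rho2: "\<rho>\<^sup>2 = (x$1)\<^sup>2 + (x$2)\<^sup>2" by (simp add: \<rho>_def)
  have "(x$1)\<^sup>2 + (x$2)\<^sup>2 > 0" using assms by (simp add: add_nonneg_pos)
  hence rho: "\<rho> > 0" by (simp add: \<rho>_def)
  have r2: "r\<^sup>2 = \<rho>\<^sup>2 + (x$3)\<^sup>2" by (simp add: r_def norm_pt rho2)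
  have r: "r > 0" using assms by (auto simp: r_def)
  have "(x$1 / \<rho>)\<^sup>2 + (x$2 / \<rho>)\<^sup>2 = 1" using rho by (simp add: power_divide add_divide_distrib[symmetric] rho2[symmetric])
  then obtain p where p: "0 \<le> p" "p < 2*pi" "x$1 / \<rho> = cos p" "x$2 / \<rho> = sin p"
    using sincos_total_2pi by metis
  have p0: "p \<noteq> 0" using p(4) assms rho by auto
  define t where "t = arccos (x$3 / r)"
  have "(x$3)\<^sup>2 < r\<^sup>2" using r2 rho by simp
  hence "\<bar>x$3\<bar> < r" using r by (metis abs_of_pos power2_less_imp_less abs_ge_zero power2_abs less_imp_le)
  hence b: "-1 < x$3 / r" "x$3 / r < 1" using r by (auto simp: field_simps)
  have t: "0 < t" "t < pi" using arccos_lt_bounded[OF b] by (auto simp: t_def)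
  have ct: "cos t = x$3 / r" using b by (simp add: t_def)
  have "(sin t)\<^sup>2 = (\<rho> / r)\<^sup>2" 
  proof -
    have "(sin t)\<^sup>2 = 1 - (x$3 / r)\<^sup>2" by (simp add: sin_squared_eq ct)
    also have "\<dots> = (\<rho> / r)\<^sup>2" 
    proof -
      have "\<rho>\<^sup>2 = r\<^sup>2 - (x$3)\<^sup>2" using r2 by simp
      thus ?thesis using r by (simp add: power_divide diff_divide_distrib)
    qed
    finally show ?thesis .
  qed
  hence st: "sin t = \<rho> / r" using t rho r by (simp add: sin_gt_zero power2_eq_iff_nonneg less_imp_le)
  let ?y = "vector [r, t, p] :: pt"
  have "polar ?y = x"
    using ct st r rho p(3,4) by (simp add: polar_def Finite_Cartesian_Product.vec_eq_iff forall_3 field_simps)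
  thus ?thesis using that[of ?y] r t p p0 by (simp add: r_def)
qed

definition polar_box :: "pt set" where
  "polar_box = {y. 0 < y$1 \<and> y$1 < 1 \<and> 0 < y$2 \<and> y$2 < pi \<and> 0 < y$3 \<and> y$3 < 2*pi}"

lemma polar_box_eq: "polar_box = box 0 (vector [1, pi, 2*pi])"
  by (auto simp: polar_box_def mem_box_pt)

lemma borel_measurable_polar [measurable]: "polar \<in> borel_measurable borel"
proof (rule borel_measurable_continuous_onI)
  show "continuous_on UNIV polar"
    by (meson continuous_at_imp_continuous_on has_derivative_continuous has_derivative_polar)
qed

text \<open>The measure of an injective differentiable image is the integral of the Jacobian
  determinant; the part of \<open>A\<close> outside the image lies in the null hyperplane left out
  by \<open>polar_surj\<close>.\<close>

lemma emeasure_ball_polar: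
  assumes A: "A \<in> sets borel" "A \<subseteq> B1"
  shows "emeasure lborel A = (\<integral>\<^sup>+ y. ennreal ((y$1)\<^sup>2 * sin (y$2)) * indicator (polar_box \<inter> polar -` A) y \<partial>lborel)"
proof -
  let ?S = "polar_box \<inter> polar -` A"
  let ?h = "\<lambda>y::pt. (y$1)\<^sup>2 * sin (y$2)"
  have S: "?S \<in> sets borel"
    using measurable_sets_borel[OF borel_measurable_polar A(1)] by (auto simp: polar_box_eq)
  have pos: "0 \<le> ?h y" if "y \<in> polar_box" for y
    using that by (auto simp: polar_box_def intro!: mult_nonneg_nonneg sin_ge_zero)
  have hb: "\<bar>?h y\<bar> \<le> 1" if "y \<in> polar_box" for y
  proof -
    have "(y$1)\<^sup>2 \<le> 1" using that by (auto simp: polar_box_def power_le_one)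
    thus ?thesis using abs_sin_le_one[of "y$2"] by (simp add: abs_mult mult_le_one)
  qed
  have cont: "continuous_on UNIV ?h" by (intro continuous_intros)
  have hm: "?h \<in> borel_measurable borel" by (rule borel_measurable_continuous_onI[OF cont])
  have int: "integrable lborel (\<lambda>y. indicator ?S y *\<^sub>R ?h y)"
  proof (rule Bochner_Integration.integrable_bound)
    show "integrable lborel (indicator polar_box :: pt \<Rightarrow> real)"
      by (auto simp: polar_box_eq emeasure_lborel_box_eq)
    show "(\<lambda>y. indicator ?S y *\<^sub>R ?h y) \<in> borel_measurable lborel"
      using S hm by simp
    show "AE y in lborel. norm (indicator ?S y *\<^sub>R ?h y) \<le> norm (indicator polar_box y :: real)"
      using hb by (intro AE_I2) (auto simp: indicator_def)
  qed
  define m where "m = integral\<^sup>L lborel (\<lambda>y. indicator ?S y *\<^sub>R ?h y)"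
  have "(?h has_integral m) ?S"
  proof -
    have "((\<lambda>y. if y \<in> ?S then ?h y else 0) has_integral m) UNIV"
    proof -
      have "(\<lambda>y. indicator ?S y *\<^sub>R ?h y) = (\<lambda>y. if y \<in> ?S then ?h y else 0)"
        by (simp add: fun_eq_iff indicator_def)
      thus ?thesis using has_integral_integral_lborel[OF int] unfolding m_def by simp
    qed
    thus ?thesis by (simp only: has_integral_restrict_UNIV)
  qed
  hence "((\<lambda>y. \<bar>Determinants.det (matrix (polar' y))\<bar>) has_integral m) ?S"
    by (rule has_integral_eq[rotated]) (use pos in \<open>auto simp: det_polar'\<close>)
  moreover have "inj_on polar ?S"
    by (rule inj_on_subset[OF inj_on_polar]) (auto simp: polar_box_def)
  ultimately have m: "polar ` ?S \<in> lmeasurable" "measure lebesgue (polar ` ?S) = m"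
    using has_measure_differentiable_image[of ?S polar polar' m] S has_derivative_polar by auto
  have sub: "polar ` ?S \<subseteq> A" by auto
  have "A - polar ` ?S \<subseteq> {x. x $ 2 = 0}"
  proof
    fix x assume x: "x \<in> A - polar ` ?S"
    show "x \<in> {x. x $ 2 = 0}"
    proof (rule ccontr)
      assume "x \<notin> {x. x $ 2 = 0}"
      hence "x $ 2 \<noteq> 0" by simp
      then obtain y where y: "0 < y$1" "0 < y$2" "y$2 < pi" "0 < y$3" "y$3 < 2*pi" "polar y = x" "y $ 1 = norm x"
        using polar_surj by metis
      have "norm x < 1" using x A(2) by auto
      hence "y \<in> ?S" using y x by (auto simp: polar_box_def)
      thus False using x y(6) by auto
    qed
  qed
  moreover have "negligible {x::pt. x $ 2 = 0}" by (rule negligible_standard_hyperplane_cart)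
  ultimately have neg: "negligible (A - polar ` ?S)" using negligible_subset by blast
  have "emeasure lborel A = emeasure lebesgue A" using A(1) by simp
  also have "\<dots> = emeasure lebesgue (polar ` ?S)"
  proof (rule emeasure_eq_AE)
    have "AE x in lebesgue. x \<notin> A - polar ` ?S"
      by (rule AE_not_in) (simp add: negligible_iff_null_sets[symmetric] neg)
    thus "AE x in lebesgue. x \<in> A \<longleftrightarrow> x \<in> polar ` ?S"
      by eventually_elim (use sub in blast)
    show "A \<in> sets lebesgue" using A(1) by simp
    show "polar ` ?S \<in> sets lebesgue" by (rule fmeasurableD[OF m(1)])
  qed
  also have "\<dots> = ennreal m" using emeasure_eq_measure2[OF m(1)] m(2) by simp
  also have "\<dots> = (\<integral>\<^sup>+ y. ennreal (indicator ?S y *\<^sub>R ?h y) \<partial>lborel)"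
    unfolding m_def by (rule nn_integral_eq_integral[OF int, symmetric]) (use pos in \<open>auto simp: indicator_def\<close>)
  also have "\<dots> = (\<integral>\<^sup>+ y. ennreal (?h y) * indicator ?S y \<partial>lborel)"
    by (intro nn_integral_cong) (auto simp: indicator_def)
  finally show ?thesis .
qed

section \<open>Surface and radial measures\<close>

definition sphere_measure :: "pt measure" where
  "sphere_measure = distr (density lborel (\<lambda>q. ennreal (sin (fst q)) * indicator (box (0,0) (pi, 2*pi)) q))
     (restrict_space borel (sphere 0 1)) sphere_point"

text \<open>The Jacobian r^2 sin \<theta> is split between the two factors:
  \<open>sphere_measure\<close> carries the sine and \<open>radius_measure\<close> the r^2, so that
  Lebesgue measure on the ball becomes their product. Both live on restricted spaces, hence
  pointwise conditions are only ever required on the unit sphere and for 0 < r < 1.\<close>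

definition radius_measure :: "real measure" where
  "radius_measure = density (restrict_space lborel {0<..<1}) (\<lambda>r. ennreal (r\<^sup>2))"

lemma space_surf [simp]: "space sphere_measure = sphere 0 1"
  by (simp add: sphere_measure_def space_restrict_space)

lemma sets_surf [measurable_cong]: "sets sphere_measure = sets (restrict_space borel (sphere 0 1))"
  by (simp add: sphere_measure_def)

lemma space_rad [simp]: "space radius_measure = {0<..<1}"
  by (simp add: radius_measure_def space_restrict_space)

lemma sets_rad [measurable_cong]: "sets radius_measure = sets (restrict_space borel {0<..<1})"
  by (simp add: radius_measure_def sets_restrict_space)

lemma measurable_sph: "sphere_point \<in> measurable borel (restrict_space borel (sphere 0 1))"
  by (intro measurable_restrict_space2 borel_measurable_continuous_onI continuous_on_sph) auto

lemma mem_box2: "q \<in> box (a, b) (c, d) \<longleftrightarrow> a < fst q \<and> fst q < c \<and> b < snd q \<and> snd q < (d::real)"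
  for a b c d :: real
  by (cases q) (auto simp: mem_box Basis_prod_def)

lemma borel_measurable_sin_fst [measurable]: "(\<lambda>q::real\<times>real. sin (fst q)) \<in> borel_measurable borel"
  by (intro borel_measurable_continuous_onI continuous_intros)

lemma emeasure_nn_integral_space: "emeasure M (space M) = (\<integral>\<^sup>+ x. 1 \<partial>M)"
  by simp

lemma nn_integral_surf:
  assumes "f \<in> borel_measurable (restrict_space borel (sphere 0 1))"
  shows "(\<integral>\<^sup>+ \<omega>. f \<omega> \<partial>sphere_measure) =
    (\<integral>\<^sup>+ q. ennreal (sin (fst q)) * indicator (box (0,0) (pi, 2*pi)) q * f (sphere_point q) \<partial>lborel)"
proof -
  have m: "(\<lambda>q. f (sphere_point q)) \<in> borel_measurable borel"
    by (rule measurable_compose[OF measurable_sph assms])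
  show ?thesis
    unfolding sphere_measure_def using assms m measurable_sph
    by (subst nn_integral_distr) (auto simp: nn_integral_density)
qed

lemma integral_surf:
  fixes f :: "pt \<Rightarrow> 'a::{banach,second_countable_topology}"
  assumes "f \<in> borel_measurable (restrict_space borel (sphere 0 1))"
  shows "integral\<^sup>L sphere_measure f =
    integral\<^sup>L lborel (\<lambda>q. (sin (fst q) * indicator (box (0,0) (pi, 2*pi)) q) *\<^sub>R f (sphere_point q))"
proof -
  have m: "(\<lambda>q. f (sphere_point q)) \<in> borel_measurable borel"
    by (rule measurable_compose[OF measurable_sph assms])
  have "(\<lambda>q. ennreal (sin (fst q)) * indicator (box (0,0) (pi, 2*pi)) q) =
      (\<lambda>q. ennreal (sin (fst q) * indicator (box (0,0) (pi, 2*pi)) q))"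
    by (auto simp: fun_eq_iff indicator_def)
  moreover have "0 \<le> sin (fst q) * indicator (box (0,0) (pi, 2*pi)) q" for q :: "real \<times> real"
    by (auto simp: indicator_def mem_box2 sin_ge_zero)
  ultimately show ?thesis
    unfolding sphere_measure_def using assms m measurable_sph
    by (subst integral_distr) (auto simp: integral_density)
qed

lemma finite_measure_surf: "finite_measure sphere_measure"
proof
  have "emeasure sphere_measure (space sphere_measure) = (\<integral>\<^sup>+ \<omega>. 1 \<partial>sphere_measure)" by (rule emeasure_nn_integral_space)
  also have "\<dots> = (\<integral>\<^sup>+ q. ennreal (sin (fst q)) * indicator (box (0,0) (pi, 2*pi)) q * 1 \<partial>lborel)"
    by (rule nn_integral_surf) simp
  also have "\<dots> \<le> (\<integral>\<^sup>+ q. indicator (box (0,0) (pi, 2*pi :: real)) q \<partial>lborel)"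
    by (intro nn_integral_mono) (auto simp: indicator_def)
  also have "\<dots> < \<infinity>"
    by (simp add: emeasure_lborel_box_eq ennreal_mult_less_top prod_ennreal less_top[symmetric])
  finally show "emeasure sphere_measure (space sphere_measure) \<noteq> \<infinity>" by simp
qed

lemma borel_measurable_ennreal_power2:
  "(\<lambda>r::real. ennreal (r\<^sup>2)) \<in> borel_measurable (restrict_space lborel A)"
  by (intro measurable_restrict_space1) simp

lemma finite_measure_rad: "finite_measure radius_measure"
proof
  have "emeasure radius_measure (space radius_measure) = (\<integral>\<^sup>+ r. ennreal (r\<^sup>2) * indicator {0<..<1} r \<partial>lborel)"
    unfolding emeasure_nn_integral_space unfolding radius_measure_def
    by (subst nn_integral_density) (simp_all add: nn_integral_restrict_space borel_measurable_ennreal_power2 del: nn_integral_const)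
  also have "\<dots> \<le> (\<integral>\<^sup>+ r. indicator {0<..<1::real} r \<partial>lborel)"
    by (intro nn_integral_mono) (auto simp: indicator_def power_le_one)
  also have "\<dots> < \<infinity>" by simp
  finally show "emeasure radius_measure (space radius_measure) \<noteq> \<infinity>" by simp
qed

lemma measurable_scaleR_rad_surf:
  "(\<lambda>p. fst p *\<^sub>R snd p) \<in> measurable (radius_measure \<Otimes>\<^sub>M sphere_measure) (restrict_space borel B1)"
proof (rule measurable_restrict_space2)
  have "(\<lambda>r. r) \<in> borel_measurable radius_measure" "(\<lambda>w. w) \<in> borel_measurable sphere_measure"
    by (simp_all add: measurable_cong_sets[OF sets_rad refl] measurable_cong_sets[OF sets_surf refl] measurable_restrict_space1)
  thus "(\<lambda>p. fst p *\<^sub>R snd p) \<in> borel_measurable (radius_measure \<Otimes>\<^sub>M sphere_measure)" by measurable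
qed (auto simp: space_pair_measure)

text \<open>An equality of measures, so that integrability and integrals transfer alike. On a Borel
  set the left side is an iterated integral over radius and angles; recombined into one integral
  over the space it is the formula of \<open>emeasure_ball_polar\<close>.\<close>

lemma polar_coordinates:
  "distr (radius_measure \<Otimes>\<^sub>M sphere_measure) (restrict_space borel B1) (\<lambda>p. fst p *\<^sub>R snd p) = restrict_space lborel B1"
proof (rule measure_eqI)
  interpret sphere_measure: finite_measure sphere_measure by (rule finite_measure_surf)
  interpret radius_measure: finite_measure radius_measure by (rule finite_measure_rad)
  show "sets (distr (radius_measure \<Otimes>\<^sub>M sphere_measure) (restrict_space borel B1) (\<lambda>p. fst p *\<^sub>R snd p)) = sets (restrict_space lborel B1)"
    by (simp add: sets_restrict_space)
  fix A assume "A \<in> sets (distr (radius_measure \<Otimes>\<^sub>M sphere_measure) (restrict_space borel B1) (\<lambda>p. fst p *\<^sub>R snd p))"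
  hence A': "A \<in> sets (restrict_space borel B1)" by simp
  hence A: "A \<in> sets borel" "A \<subseteq> B1" by (auto simp: sets_restrict_space_iff)
  have rs: "(\<lambda>q. indicator A (r *\<^sub>R sphere_point q) :: ennreal) \<in> borel_measurable borel" for r
  proof (rule measurable_compose[OF _ borel_measurable_indicator[OF A(1)]])
    show "(\<lambda>q. r *\<^sub>R sphere_point q) \<in> borel_measurable borel"
      by (intro borel_measurable_continuous_onI continuous_intros)
  qed
  have "(\<lambda>y::pt. (y$1)\<^sup>2 * sin (y$2)) \<in> borel_measurable borel"
    by (intro borel_measurable_continuous_onI continuous_intros)
  moreover have "polar_box \<inter> polar -` A \<in> sets borel"
    using measurable_sets_borel[OF borel_measurable_polar A(1)] by (auto simp: polar_box_eq)
  ultimately have hm: "(\<lambda>y::pt. ennreal ((y$1)\<^sup>2 * sin (y$2)) * indicator (polar_box \<inter> polar -` A) y) \<in> borel_measurable borel"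
    by measurable
  let ?g = "\<lambda>p. indicator A (fst p *\<^sub>R snd p) :: ennreal"
  have gm: "?g \<in> borel_measurable (radius_measure \<Otimes>\<^sub>M sphere_measure)"
    using measurable_compose[OF measurable_scaleR_rad_surf borel_measurable_indicator[OF A']] .
  have "emeasure (distr (radius_measure \<Otimes>\<^sub>M sphere_measure) (restrict_space borel B1) (\<lambda>p. fst p *\<^sub>R snd p)) A
      = (\<integral>\<^sup>+ x. indicator A x \<partial>distr (radius_measure \<Otimes>\<^sub>M sphere_measure) (restrict_space borel B1) (\<lambda>p. fst p *\<^sub>R snd p))"
    using A' by simp
  also have "\<dots> = (\<integral>\<^sup>+ p. ?g p \<partial>(radius_measure \<Otimes>\<^sub>M sphere_measure))"
    using A' measurable_scaleR_rad_surf by (subst nn_integral_distr) auto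
  also have "\<dots> = (\<integral>\<^sup>+ r. (\<integral>\<^sup>+ \<omega>. ?g (r, \<omega>) \<partial>sphere_measure) \<partial>radius_measure)"
    by (rule sphere_measure.nn_integral_fst[symmetric, OF gm])
  also have "\<dots> = (\<integral>\<^sup>+ r. ennreal (r\<^sup>2) * indicator {0<..<1} r * (\<integral>\<^sup>+ \<omega>. ?g (r, \<omega>) \<partial>sphere_measure) \<partial>lborel)"
  proof -
    have "(\<lambda>r. \<integral>\<^sup>+ \<omega>. ?g (r, \<omega>) \<partial>sphere_measure) \<in> borel_measurable radius_measure"
      by (rule sphere_measure.borel_measurable_nn_integral_fst[OF gm])
    hence "(\<lambda>r. \<integral>\<^sup>+ \<omega>. ?g (r, \<omega>) \<partial>sphere_measure) \<in> borel_measurable (restrict_space lborel {0<..<1})"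
      by (simp add: radius_measure_def)
    thus ?thesis unfolding radius_measure_def
      by (subst nn_integral_density)
         (simp_all add: nn_integral_restrict_space borel_measurable_ennreal_power2 mult_ac)
  qed
  also have "\<dots> = (\<integral>\<^sup>+ r. ennreal (r\<^sup>2) * indicator {0<..<1} r * 
      (\<integral>\<^sup>+ q. ennreal (sin (fst q)) * indicator (box (0,0) (pi, 2*pi)) q * indicator A (r *\<^sub>R sphere_point q) \<partial>lborel) \<partial>lborel)"
  proof (rule nn_integral_cong)
    fix r :: real
    have m: "(\<lambda>\<omega>. ?g (r, \<omega>)) \<in> borel_measurable (restrict_space borel (sphere 0 1))"
      unfolding fst_conv snd_conv
    proof (rule measurable_compose[OF _ borel_measurable_indicator[OF A(1)]])
      show "(\<lambda>\<omega>::pt. r *\<^sub>R \<omega>) \<in> restrict_space borel (sphere 0 1) \<rightarrow>\<^sub>M borel"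
        by (intro measurable_restrict_space1 borel_measurable_scaleR borel_measurable_const) simp
    qed
    show "ennreal (r\<^sup>2) * indicator {0<..<1} r * (\<integral>\<^sup>+ \<omega>. ?g (r, \<omega>) \<partial>sphere_measure) =
      ennreal (r\<^sup>2) * indicator {0<..<1} r * 
      (\<integral>\<^sup>+ q. ennreal (sin (fst q)) * indicator (box (0,0) (pi, 2*pi)) q * indicator A (r *\<^sub>R sphere_point q) \<partial>lborel)"
      by (subst nn_integral_surf[OF m]) simp
  qed
  also have "\<dots> = (\<integral>\<^sup>+ r. (\<integral>\<^sup>+ q. ennreal (r\<^sup>2) * indicator {0<..<1} r * 
      (ennreal (sin (fst q)) * indicator (box (0,0) (pi, 2*pi)) q * indicator A (r *\<^sub>R sphere_point q)) \<partial>lborel) \<partial>lborel)"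
  proof (rule nn_integral_cong)
    fix r :: real
    have "(\<lambda>q. ennreal (sin (fst q)) * indicator (box (0,0) (pi, 2*pi)) q * indicator A (r *\<^sub>R sphere_point q)) \<in> borel_measurable lborel"
      using rs[of r] by simp
    from nn_integral_cmult[OF this]
    show "ennreal (r\<^sup>2) * indicator {0<..<1} r * 
      (\<integral>\<^sup>+ q. ennreal (sin (fst q)) * indicator (box (0,0) (pi, 2*pi)) q * indicator A (r *\<^sub>R sphere_point q) \<partial>lborel) = 
      (\<integral>\<^sup>+ q. ennreal (r\<^sup>2) * indicator {0<..<1} r * 
      (ennreal (sin (fst q)) * indicator (box (0,0) (pi, 2*pi)) q * indicator A (r *\<^sub>R sphere_point q)) \<partial>lborel)"
      by (rule sym)
  qed
  also have "\<dots> = (\<integral>\<^sup>+ p. ennreal (((vec3 p) $ 1)\<^sup>2 * sin ((vec3 p) $ 2)) * indicator (polar_box \<inter> polar -` A) (vec3 p) \<partial>lborel)"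
  proof -
    let ?H = "\<lambda>y::pt. ennreal ((y$1)\<^sup>2 * sin (y$2)) * indicator (polar_box \<inter> polar -` A) y"
    have "(\<lambda>p. ?H (vec3 p)) \<in> borel_measurable (lborel \<Otimes>\<^sub>M lborel)"
      using measurable_compose[OF borel_measurable_vec3 hm] by (simp add: lborel_prod)
    from lborel.nn_integral_fst[OF this]
    have "(\<integral>\<^sup>+ p. ?H (vec3 p) \<partial>lborel) = (\<integral>\<^sup>+ r. (\<integral>\<^sup>+ q. ?H (vec3 (r, q)) \<partial>lborel) \<partial>lborel)"
      by (simp only: lborel_prod)
    also have "\<dots> = (\<integral>\<^sup>+ r. (\<integral>\<^sup>+ q. ennreal (r\<^sup>2) * indicator {0<..<1} r * 
      (ennreal (sin (fst q)) * indicator (box (0,0) (pi, 2*pi)) q * indicator A (r *\<^sub>R sphere_point q)) \<partial>lborel) \<partial>lborel)"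
    proof (intro nn_integral_cong)
      fix r :: real and q :: "real \<times> real"
      show "?H (vec3 (r, q)) = ennreal (r\<^sup>2) * indicator {0<..<1} r * 
        (ennreal (sin (fst q)) * indicator (box (0,0) (pi, 2*pi)) q * indicator A (r *\<^sub>R sphere_point q))"
      \<comment> \<open>Outside the parameter box both sides vanish; inside, the sine is nonnegative
        and \<open>ennreal\<close> may be split over the product.\<close>
      proof (cases "r \<in> {0<..<1} \<and> q \<in> box (0,0) (pi, 2*pi)")
        case True
        hence "sin (fst q) \<ge> 0" by (simp add: mem_box2 sin_ge_zero)
        moreover have "vec3 (r, q) \<in> polar_box" using True by (simp add: polar_box_def mem_box2)
        ultimately show ?thesis using True by (simp add: indicator_def polar_def ennreal_mult)
      next
        case False
        hence "vec3 (r, q) \<notin> polar_box" by (auto simp: polar_box_def mem_box2)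
        thus ?thesis using False by (auto simp: indicator_def)
      qed
    qed
    finally show ?thesis ..
  qed
  also have "\<dots> = (\<integral>\<^sup>+ y. ennreal ((y$1)\<^sup>2 * sin (y$2)) * indicator (polar_box \<inter> polar -` A) y \<partial>lborel)"
  proof -
    have "(\<integral>\<^sup>+ y. ennreal ((y$1)\<^sup>2 * sin (y$2)) * indicator (polar_box \<inter> polar -` A) y \<partial>distr lborel borel vec3)
      = (\<integral>\<^sup>+ p. ennreal (((vec3 p) $ 1)\<^sup>2 * sin ((vec3 p) $ 2)) * indicator (polar_box \<inter> polar -` A) (vec3 p) \<partial>lborel)"
      by (rule nn_integral_distr) (use hm in simp_all)
    thus ?thesis by (simp only: lborel_pt_eq[symmetric])
  qed
  also have "\<dots> = emeasure lborel A" by (rule emeasure_ball_polar[OF A, symmetric])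
  also have "\<dots> = emeasure (restrict_space lborel B1) A"
    using A by (simp add: emeasure_restrict_space)
  finally show "emeasure (distr (radius_measure \<Otimes>\<^sub>M sphere_measure) (restrict_space borel B1) (\<lambda>p. fst p *\<^sub>R snd p)) A
      = emeasure (restrict_space lborel B1) A" .
qed

lemma compact_norm_bound:
  fixes v :: "'a::topological_space \<Rightarrow> 'b::real_normed_vector"
  assumes "compact A" "continuous_on A v"
  obtains K where "\<And>x. x \<in> A \<Longrightarrow> norm (v x) \<le> K"
proof -
  have "bounded (v ` A)" using assms by (intro compact_imp_bounded compact_continuous_image)
  thus ?thesis using that by (auto simp: bounded_iff)
qed

lemma borel_measurable_surf:
  "continuous_on (sphere 0 1) v \<Longrightarrow> v \<in> borel_measurable sphere_measure"
  by (subst measurable_cong_sets[OF sets_surf refl]) (rule borel_measurable_continuous_on_restrict)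

lemma square_integrable_surf:
  fixes v :: "pt \<Rightarrow> 'b::{banach,second_countable_topology}"
  assumes "continuous_on (sphere 0 1) v"
  shows "square_integrable sphere_measure v"
proof -
  obtain K where "\<And>x. x \<in> sphere 0 1 \<Longrightarrow> norm (v x) \<le> K"
    using compact_norm_bound[OF compact_sphere assms] by blast
  thus ?thesis
    by (intro square_integrable_bounded[OF finite_measure_surf borel_measurable_surf[OF assms]]) simp
qed

lemma integrable_surf:
  fixes v :: "pt \<Rightarrow> 'b::{banach,second_countable_topology}"
  assumes "continuous_on (sphere 0 1) v"
  shows "integrable sphere_measure v"
proof -
  obtain K where "\<And>x. x \<in> sphere 0 1 \<Longrightarrow> norm (v x) \<le> K"
    using compact_norm_bound[OF compact_sphere assms] by blast
  thus ?thesis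
    by (intro finite_measure.integrable_const_bound[OF finite_measure_surf, of _ K] AE_I2
        borel_measurable_surf assms) auto
qed

text \<open>Borel measurability is demanded because \<open>polar_coordinates\<close> is an identity
  of Borel measures; the completion in \<open>lebesgue_on\<close> is stripped off first. Fubini then
  separates radius and direction.\<close>

lemma integral_ball_polar:
  fixes f :: "pt \<Rightarrow> 'b::{banach,second_countable_topology}"
  assumes m: "f \<in> borel_measurable (restrict_space borel B1)" and i: "integrable (lebesgue_on B1) f"
  shows "integrable (radius_measure \<Otimes>\<^sub>M sphere_measure) (\<lambda>p. f (fst p *\<^sub>R snd p))"
    and "integral\<^sup>L (lebesgue_on B1) f = (LINT r|radius_measure. (LINT \<omega>|sphere_measure. f (r *\<^sub>R \<omega>)))"
proof -
  interpret sphere_measure: finite_measure sphere_measure by (rule finite_measure_surf)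
  interpret radius_measure: finite_measure radius_measure by (rule finite_measure_rad)
  interpret pair_sigma_finite radius_measure sphere_measure ..
  have m': "(\<lambda>x. indicator B1 x *\<^sub>R f x) \<in> borel_measurable lborel"
    using m by (simp add: borel_measurable_restrict_space_iff)
  have "integrable lborel (\<lambda>x. indicator B1 x *\<^sub>R f x)"
    using i m' by (simp add: integrable_restrict_space integrable_completion)
  hence i': "integrable (restrict_space lborel B1) f" by (simp add: integrable_restrict_space)
  have I: "integral\<^sup>L (lebesgue_on B1) f = integral\<^sup>L (restrict_space lborel B1) f"
    using m' by (simp add: integral_restrict_space integral_completion)
  show int: "integrable (radius_measure \<Otimes>\<^sub>M sphere_measure) (\<lambda>p. f (fst p *\<^sub>R snd p))"
    using i' unfolding polar_coordinates[symmetric]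
    by (subst (asm) integrable_distr_eq[OF measurable_scaleR_rad_surf m])
  have "integral\<^sup>L (restrict_space lborel B1) f = integral\<^sup>L (radius_measure \<Otimes>\<^sub>M sphere_measure) (\<lambda>p. f (fst p *\<^sub>R snd p))"
    unfolding polar_coordinates[symmetric] by (rule integral_distr[OF measurable_scaleR_rad_surf m])
  also have "\<dots> = (LINT r|radius_measure. (LINT \<omega>|sphere_measure. f (r *\<^sub>R \<omega>)))"
    using integral_fst'[OF int] by simp
  finally show "integral\<^sup>L (lebesgue_on B1) f = (LINT r|radius_measure. (LINT \<omega>|sphere_measure. f (r *\<^sub>R \<omega>)))"
    by (simp add: I)
qed

lemma continuous_on_compose_sph:
  "continuous_on (sphere 0 1) v \<Longrightarrow> continuous_on A (\<lambda>q. v (sphere_point q))"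
  by (rule continuous_on_compose2[OF _ continuous_on_sph]) auto

text \<open>Connects \<open>sphere_measure\<close> with the gauge integral by which
  \<open>sphere_integral\<close> is defined; passing from the open to the closed rectangle changes
  nothing.\<close>

lemma integral_surf_eq_HK:
  fixes v :: "pt \<Rightarrow> 'b::euclidean_space"
  assumes "continuous_on (sphere 0 1) v"
  shows "integral\<^sup>L sphere_measure v = integral (cbox (0,0) (pi, 2*pi)) (\<lambda>q. sin (fst q) *\<^sub>R v (sphere_point q))"
proof -
  let ?f = "\<lambda>q. sin (fst q) *\<^sub>R v (sphere_point q)"
  have c: "continuous_on A ?f" for A by (intro continuous_intros continuous_on_compose_sph assms)
  have "set_integrable lborel (cbox (0,0) (pi, 2*pi)) ?f"
    unfolding set_integrable_def by (rule borel_integrable_compact[OF compact_cbox c])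
  hence s: "set_integrable lborel (box (0,0) (pi, 2*pi)) ?f"
    by (rule set_integrable_subset) (auto simp: box_subset_cbox)
  have "integral\<^sup>L sphere_measure v = set_lebesgue_integral lborel (box (0,0) (pi, 2*pi)) ?f"
    by (subst integral_surf)
       (auto simp: assms borel_measurable_continuous_on_restrict set_lebesgue_integral_def mult.commute)
  also have "\<dots> = integral (box (0,0) (pi, 2*pi)) ?f" by (rule set_borel_integral_eq_integral(2)[OF s])
  also have "\<dots> = integral (cbox (0,0) (pi, 2*pi)) ?f" by (rule integral_open_interval)
  finally show ?thesis .
qed

lemma sphere_integral_eq:
  fixes v :: "pt \<Rightarrow> complex"
  assumes "continuous_on (sphere 0 1) v"
  shows "sphere_integral v = integral\<^sup>L sphere_measure v"
  unfolding integral_surf_eq_HK[OF assms] sphere_integral_def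
  by (rule arg_cong[where f="integral _"]) (auto simp: fun_eq_iff sphere_point_def scaleR_conv_of_real)

text \<open>In contrast to the open box used for the measure, the closed rectangle reaches every
  point, the poles with an arbitrary azimuth (0 is taken).\<close>

lemma sph_surj:
  assumes "norm (x::pt) = 1"
  obtains q where "q \<in> cbox (0,0) (pi, 2*pi)" "sphere_point q = x"
proof -
  define t where "t = arccos (x$3)"
  have n: "(x$1)\<^sup>2 + (x$2)\<^sup>2 + (x$3)\<^sup>2 = 1" using assms by (simp add: norm_pt)
  hence "(x$3)\<^sup>2 \<le> 1" using zero_le_power2[of "x$1"] zero_le_power2[of "x$2"] by linarith
  hence b: "-1 \<le> x$3" "x$3 \<le> 1" using abs_le_square_iff[of "x$3" 1] by auto
  have t: "0 \<le> t" "t \<le> pi" "cos t = x$3" using b by (auto simp: t_def arccos_lbound arccos_ubound)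
  have s: "(sin t)\<^sup>2 = (x$1)\<^sup>2 + (x$2)\<^sup>2" using n by (simp add: sin_squared_eq t(3))
  obtain p where p: "0 \<le> p" "p \<le> 2*pi" "sin t * cos p = x$1" "sin t * sin p = x$2"
  proof (cases "sin t = 0")
    case True
    hence "x$1 = 0" "x$2 = 0" using s by (simp_all add: sum_power2_eq_zero_iff)
    thus ?thesis using True that[of 0] by simp
  next
    case False
    have "(x$1 / sin t)\<^sup>2 + (x$2 / sin t)\<^sup>2 = 1"
      using False by (simp add: power_divide add_divide_distrib[symmetric] s[symmetric])
    then obtain p where "0 \<le> p" "p < 2*pi" "x$1 / sin t = cos p" "x$2 / sin t = sin p"
      using sincos_total_2pi by metis
    thus ?thesis using False that[of p] by (simp add: field_simps)
  qed
  have "sphere_point (t, p) = x"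
    using t p by (simp add: Finite_Cartesian_Product.vec_eq_iff forall_3)
  moreover have "(t, p) \<in> cbox (0,0) (pi, 2*pi)" using t p by (simp add: cbox_Pair_eq)
  ultimately show ?thesis using that by blast
qed

text \<open>A continuous nonnegative integrand with integral zero vanishes. The factor sin \<theta>
  is zero at the poles, so the conclusion holds first in the open rectangle and then on its closure
  by continuity.\<close>

lemma l2norm_surf_eq_0:
  fixes v :: "pt \<Rightarrow> complex"
  assumes c: "continuous_on (sphere 0 1) v" and z: "l2norm sphere_measure v = 0" and x: "norm x = 1"
  shows "v x = 0"
proof -
  let ?C = "cbox (0::real, 0::real) (pi, 2*pi)"
  let ?g = "\<lambda>q. sin (fst q) *\<^sub>R (norm (v (sphere_point q)))\<^sup>2"
  have cn: "continuous_on (sphere 0 1) (\<lambda>x. (norm (v x))\<^sup>2)" by (intro continuous_intros c)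
  have cg: "continuous_on A ?g" for A
    by (intro continuous_intros continuous_on_compose_sph c)
  have "integral ?C ?g = (l2norm sphere_measure v)\<^sup>2"
    unfolding l2norm_power2 by (rule integral_surf_eq_HK[OF cn, symmetric])
  hence "(?g has_integral 0) ?C"
    using z integrable_integral[OF integrable_continuous[OF cg, of "(0,0)" "(pi, 2*pi)"]] by simp
  hence g0: "?g q = 0" if "q \<in> ?C" for q
  proof (rule has_integral_0_cbox_imp_0[OF cg, rotated])
    show "box (0::real, 0::real) (pi, 2*pi) \<noteq> {}" by (simp add: box_ne_empty Basis_prod_def)
    show "0 \<le> ?g q" if "q \<in> box (0::real, 0::real) (pi, 2*pi)" for q
      using that by (auto simp: mem_box2 sin_ge_zero)
  qed (use that in auto)
  have v0: "v (sphere_point q) = 0" if "q \<in> box (0::real, 0::real) (pi, 2*pi)" for q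
  proof -
    have "q \<in> ?C" using that box_subset_cbox by blast
    moreover have "sin (fst q) > 0" using that by (auto simp: mem_box2 sin_gt_zero)
    ultimately show ?thesis using g0[of q] by simp
  qed
  obtain q where q: "q \<in> ?C" "sphere_point q = x" using sph_surj[OF x] by metis
  have "closure (box (0::real, 0::real) (pi, 2*pi)) = ?C"
    by (rule closure_box) (simp add: box_ne_empty Basis_prod_def)
  hence "v (sphere_point q) = 0"
    using continuous_constant_on_closure[of "box (0::real, 0::real) (pi, 2*pi)" "\<lambda>q. v (sphere_point q)" 0 q]
      continuous_on_compose_sph[OF c] v0 q(1) by simp
  thus ?thesis using q by simp
qed

lemma quadrature_tendsto:
  fixes v :: "pt \<Rightarrow> complex"
  assumes "convergent_quadrature x w" "continuous_on (sphere 0 1) v"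
  shows "(\<lambda>S. \<Sum>s<S. of_real (w S s) * v (x S s)) \<longlonglongrightarrow> integral\<^sup>L sphere_measure v"
  using assms sphere_integral_eq[OF assms(2)] by (auto simp: convergent_quadrature_def)

section \<open>Moments over concentric spheres and continuous functions on the ball\<close>

lemma continuous_on_slice:
  assumes "continuous_on (cball 0 1) v" "0 \<le> r" "r \<le> 1"
  shows "continuous_on (sphere 0 1) (\<lambda>\<omega>::pt. v (r *\<^sub>R \<omega>))"
  by (rule continuous_on_compose2[OF assms(1)]) (use assms in \<open>auto intro!: continuous_intros\<close>)

text \<open>Dominated convergence, the bound being the maximum of \<open>v\<close> on the closed
  ball times the modulus of \<open>h\<close>.\<close>

lemma continuous_on_moment:
  fixes v h :: "pt \<Rightarrow> complex"
  assumes v: "continuous_on (cball 0 1) v" and h: "continuous_on (sphere 0 1) h"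
  shows "continuous_on {0..1} (\<lambda>r. LINT \<omega>|sphere_measure. v (r *\<^sub>R \<omega>) * h \<omega>)"
proof (rule continuous_on_sequentiallyI)
  fix u :: "nat \<Rightarrow> real" and a
  assume u: "\<forall>n. u n \<in> {0..1}" and a: "a \<in> {0..1}" and ua: "u \<longlonglongrightarrow> a"
  obtain K where K: "\<And>x. x \<in> cball 0 1 \<Longrightarrow> norm (v x) \<le> K"
    using compact_norm_bound[OF compact_cball v] by blast
  have K0: "K \<ge> 0" using K[of 0] norm_ge_zero[of "v 0"] by (simp add: order_trans[OF norm_ge_zero])
  show "(\<lambda>n. LINT \<omega>|sphere_measure. v (u n *\<^sub>R \<omega>) * h \<omega>) \<longlonglongrightarrow> (LINT \<omega>|sphere_measure. v (a *\<^sub>R \<omega>) * h \<omega>)"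
  proof (rule integral_dominated_convergence[where w="\<lambda>\<omega>. K * norm (h \<omega>)"])
    show "(\<lambda>\<omega>. v (a *\<^sub>R \<omega>) * h \<omega>) \<in> borel_measurable sphere_measure"
      using a by (intro borel_measurable_surf continuous_on_mult continuous_on_slice v h) auto
    show "(\<lambda>\<omega>. v (u n *\<^sub>R \<omega>) * h \<omega>) \<in> borel_measurable sphere_measure" for n
      using u by (intro borel_measurable_surf continuous_on_mult continuous_on_slice v h) auto
    show "integrable sphere_measure (\<lambda>\<omega>. K * norm (h \<omega>))"
      by (intro integrable_surf continuous_intros h)
    show "AE \<omega> in sphere_measure. (\<lambda>n. v (u n *\<^sub>R \<omega>) * h \<omega>) \<longlonglongrightarrow> v (a *\<^sub>R \<omega>) * h \<omega>"
    proof (intro AE_I2 tendsto_intros)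
      fix \<omega> assume "\<omega> \<in> space sphere_measure"
      hence o: "norm \<omega> = 1" by simp
      have 1: "(\<lambda>n. u n *\<^sub>R \<omega>) \<longlonglongrightarrow> a *\<^sub>R \<omega>" by (intro tendsto_intros ua)
      show "(\<lambda>n. v (u n *\<^sub>R \<omega>)) \<longlonglongrightarrow> v (a *\<^sub>R \<omega>)"
        by (rule continuous_on_tendsto_compose[OF v 1]) (use a u o in auto)
    qed
    show "AE \<omega> in sphere_measure. norm (v (u n *\<^sub>R \<omega>) * h \<omega>) \<le> K * norm (h \<omega>)" for n
    proof (intro AE_I2)
      fix \<omega> assume "\<omega> \<in> space sphere_measure"
      hence o: "norm \<omega> = 1" by simp
      have "norm (u n *\<^sub>R \<omega>) \<le> 1" using u o by simp
      thus "norm (v (u n *\<^sub>R \<omega>) * h \<omega>) \<le> K * norm (h \<omega>)"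
        using K by (simp add: norm_mult mult_right_mono)
    qed
  qed
qed

lemma borel_measurable_ball:
  "continuous_on (cball 0 1) v \<Longrightarrow> v \<in> borel_measurable (restrict_space borel B1)"
  by (rule borel_measurable_continuous_on_restrict) (auto elim: continuous_on_subset)

lemma borel_measurable_lebesgue_ball:
  fixes f :: "pt \<Rightarrow> 'b::{banach,second_countable_topology}"
  assumes "f \<in> borel_measurable (restrict_space borel B1)"
  shows "f \<in> borel_measurable (lebesgue_on B1)"
proof -
  have "(\<lambda>x. indicator B1 x *\<^sub>R f x) \<in> borel_measurable borel"
    using assms by (simp add: borel_measurable_restrict_space_iff)
  hence "(\<lambda>x. indicator B1 x *\<^sub>R f x) \<in> borel_measurable lebesgue"
    by (simp add: measurable_completion)
  thus ?thesis by (simp add: borel_measurable_restrict_space_iff)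
qed

lemma finite_measure_ball: "finite_measure (lebesgue_on B1)"
  by (rule finite_measure_lebesgue_on) simp

lemma square_integrable_ball:
  fixes f :: "pt \<Rightarrow> 'b::{banach,second_countable_topology}"
  assumes "f \<in> borel_measurable (restrict_space borel B1)" "\<And>x. norm x < 1 \<Longrightarrow> norm (f x) \<le> K"
  shows "square_integrable (lebesgue_on B1) f"
  by (rule square_integrable_bounded[OF finite_measure_ball borel_measurable_lebesgue_ball[OF assms(1)]])
     (use assms(2) in \<open>simp add: space_restrict_space\<close>)

lemma square_integrable_ball_continuous:
  fixes v :: "pt \<Rightarrow> 'b::{banach,second_countable_topology}"
  assumes v: "continuous_on (cball 0 1) v"
  shows "square_integrable (lebesgue_on B1) v"
proof -
  obtain K where K: "\<And>x. x \<in> cball 0 1 \<Longrightarrow> norm (v x) \<le> K"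
    using compact_norm_bound[OF compact_cball v] by blast
  thus ?thesis by (intro square_integrable_ball[OF borel_measurable_ball[OF v], of K]) auto
qed

section \<open>Orthogonality of spherical harmonics\<close>

text \<open>Each differentiation costs one order of vanishing; this controls the boundary terms in
  the integration by parts for Legendre polynomials.\<close>

lemma power_dvd_pderiv:
  fixes p q :: "'a::{comm_semiring_1,semiring_no_zero_divisors} poly"
  assumes "p ^ Suc k dvd q"
  shows "p ^ k dvd pderiv q"
proof -
  obtain s where "q = p ^ Suc k * s" using assms by (auto elim: dvdE)
  hence "pderiv q = p ^ Suc k * pderiv s + s * (Polynomial.smult (of_nat (Suc k)) (p ^ k) * pderiv p)"
    by (simp only: pderiv_mult pderiv_power_Suc)
  moreover have "p ^ k dvd p ^ Suc k * pderiv s + s * (Polynomial.smult (of_nat (Suc k)) (p ^ k) * pderiv p)"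
    by (intro dvd_add dvd_mult dvd_mult2 dvd_smult) simp_all
  ultimately show ?thesis by simp
qed

lemma power_dvd_pderiv_funpow:
  fixes p q :: "real poly"
  shows "p ^ (k + i) dvd q \<Longrightarrow> p ^ k dvd (pderiv ^^ i) q"
proof (induction i arbitrary: k)
  case (Suc i)
  have "p ^ Suc k dvd (pderiv ^^ i) q" using Suc.prems by (intro Suc.IH) simp
  thus ?case using power_dvd_pderiv by simp
qed simp

lemma pderiv_funpow_eq_0:
  fixes p :: "real poly"
  shows "degree p < n \<Longrightarrow> (pderiv ^^ n) p = 0"
proof (induction n arbitrary: p)
  case (Suc n)
  have "(pderiv ^^ n) (pderiv p) = 0"
  proof (cases "degree p = 0")
    case True
    hence "pderiv p = 0" by (simp add: pderiv_eq_0_iff)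
    moreover have "(pderiv ^^ n) 0 = (0 :: real poly)" by (induction n) simp_all
    ultimately show ?thesis by simp
  next
    case False
    thus ?thesis using Suc.prems by (intro Suc.IH) (simp add: degree_pderiv)
  qed
  thus ?case by (simp add: funpow_swap1)
qed simp

lemma degree_pderiv_funpow: "degree ((pderiv ^^ n) (p :: real poly)) = degree p - n"
  by (induction n) (simp_all add: degree_pderiv)

text \<open>Repeated integration by parts; \<open>T\<close> collects the boundary terms.\<close>

lemma antiderivative_mult_pderiv_funpow:
  fixes A B :: "real poly"
  assumes "(pderiv ^^ n) A = 0"
    and "\<And>i z. i < n \<Longrightarrow> z \<in> Z \<Longrightarrow> poly ((pderiv ^^ i) A) z * poly ((pderiv ^^ (n - 1 - i)) B) z = 0"
  shows "\<exists>T. pderiv T = A * (pderiv ^^ n) B \<and> (\<forall>z\<in>Z. poly T z = 0)"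
  using assms
proof (induction n arbitrary: A)
  case 0
  thus ?case by (intro exI[of _ 0]) simp
next
  case (Suc n)
  have 1: "(pderiv ^^ n) (pderiv A) = 0" using Suc.prems(1) by (simp add: funpow_swap1)
  have 2: "poly ((pderiv ^^ i) (pderiv A)) z * poly ((pderiv ^^ (n - 1 - i)) B) z = 0" if "i < n" "z \<in> Z" for i z
    using Suc.prems(2)[of "Suc i" z] that by (simp add: funpow_swap1)
  obtain T where T: "pderiv T = pderiv A * (pderiv ^^ n) B" "\<forall>z\<in>Z. poly T z = 0"
    using Suc.IH[OF 1 2] by blast
  have "poly (A * (pderiv ^^ n) B - T) z = 0" if "z \<in> Z" for z
    using Suc.prems(2)[of 0 z] T(2) that by simp
  moreover have "pderiv (A * (pderiv ^^ n) B - T) = A * (pderiv ^^ Suc n) B"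
    by (simp add: pderiv_diff pderiv_mult T(1))
  ultimately show ?case by blast
qed

text \<open>By Rodrigues' formula this is the m-th derivative of the Legendre polynomial of degree
  \<open>l\<close>, without the factor 1 / (2^l l!).\<close>

definition legendre_deriv :: "nat \<Rightarrow> nat \<Rightarrow> real poly" where
  "legendre_deriv l m = (pderiv ^^ (l + m)) ([:-1, 0, 1:] ^ l)"

text \<open>Orthogonality with the weight (z^2 - 1)^m, stated through an antiderivative with equal
  end values. All l' + m derivatives are moved off (z^2 - 1)^l' onto a polynomial of degree at most
  l + m, which they annihilate since l < l'.\<close>

lemma legendre_orthogonal:
  assumes "l < l'" "m \<le> l"
  shows "\<exists>T. pderiv T = [:-1, 0, 1:] ^ m * legendre_deriv l m * legendre_deriv l' m \<and> poly T 1 = 0 \<and> poly T (-1) = 0"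
proof -
  let ?W = "[:-1, 0, 1:] :: real poly"
  let ?A = "?W ^ m * legendre_deriv l m" and ?B = "?W ^ l'" and ?n = "l' + m"
  have van: "poly q z = 0" if "?W ^ Suc k dvd q" "z \<in> {1, -1}" for q k z
    using that by (auto elim!: dvdE)
  have "degree ?A \<le> 2 * m + (2 * l - (l + m))"
    by (rule order_trans[OF degree_mult_le]) (simp add: legendre_deriv_def degree_pderiv_funpow degree_power_eq)
  hence "degree ?A < ?n" using assms by simp
  hence 1: "(pderiv ^^ ?n) ?A = 0" by (rule pderiv_funpow_eq_0)
  have 2: "poly ((pderiv ^^ i) ?A) z * poly ((pderiv ^^ (?n - 1 - i)) ?B) z = 0"
    if "i < ?n" "z \<in> {1, -1}" for i z
  \<comment> \<open>With fewer than \<open>m\<close> derivatives the first factor retains a power of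
    z^2 - 1; otherwise at most l' - 1 derivatives fall on its l'-th power and the second factor
    vanishes at both ends.\<close>
  proof (cases "i < m")
    case True
    have "?W ^ (Suc (m - 1 - i) + i) dvd ?A" using True by simp
    from van[OF power_dvd_pderiv_funpow[OF this] that(2)] show ?thesis by simp
  next
    case False
    have "Suc (i - m) + (?n - 1 - i) = l'" using False that by simp
    hence "?W ^ (Suc (i - m) + (?n - 1 - i)) dvd ?B" by simp
    from van[OF power_dvd_pderiv_funpow[OF this] that(2)] show ?thesis by simp
  qed
  obtain T where "pderiv T = ?A * (pderiv ^^ ?n) ?B" "\<forall>z\<in>{1, -1}. poly T z = 0"
    using antiderivative_mult_pderiv_funpow[OF 1 2] by blast
  thus ?thesis by (auto simp: legendre_deriv_def)
qed

text \<open>The substitution z = cos t turns the integral into a difference of values of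
  \<open>T\<close> at 1 and -1. The sign (-1)^m arises because sin^2 is the negative of z^2 -
  1.\<close>

lemma integral_sin_legendre:
  assumes "l \<noteq> l'" "m \<le> l" "m \<le> l'"
  shows "((\<lambda>t. sin t * ((poly (legendre_deriv l m) (cos t) * sin t ^ m) * (poly (legendre_deriv l' m) (cos t) * sin t ^ m)))
    has_integral 0) {0..pi}"
proof -
  obtain T where T: "pderiv T = [:-1, 0, 1:] ^ m * legendre_deriv l m * legendre_deriv l' m" "poly T 1 = 0" "poly T (-1) = 0"
  proof (cases "l < l'")
    case True
    thus ?thesis using legendre_orthogonal[of l l' m] assms that by blast
  next
    case False
    hence "l' < l" using assms by simp
    thus ?thesis using legendre_orthogonal[of l' l m] assms that by (auto simp: mult_ac)
  qed
  have "((\<lambda>t. - ((-1) ^ m) * poly T (cos t)) has_vector_derivative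
      sin t * ((poly (legendre_deriv l m) (cos t) * sin t ^ m) * (poly (legendre_deriv l' m) (cos t) * sin t ^ m))) (at t within {0..pi})" for t
  proof -
    have s: "sin t ^ m * sin t ^ m = (-1) ^ m * poly ([:-1, 0, 1:] ^ m) (cos t)"
    proof -
      have "sin t * sin t = (-1) * poly [:-1, 0, 1:] (cos t)"
        using sin_squared_eq[of t] by (simp add: power2_eq_square)
      thus ?thesis by (metis power_mult_distrib poly_power)
    qed
    have "((\<lambda>t. - ((-1) ^ m) * poly T (cos t)) has_real_derivative
      - ((-1) ^ m) * (poly (pderiv T) (cos t) * (- sin t))) (at t within {0..pi})"
      by (auto intro!: derivative_eq_intros)
    also have "- ((-1) ^ m) * (poly (pderiv T) (cos t) * (- sin t)) =
      sin t * ((poly (legendre_deriv l m) (cos t) * poly (legendre_deriv l' m) (cos t)) * ((-1) ^ m * poly ([:-1, 0, 1:] ^ m) (cos t)))"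
      by (simp add: T(1))
    also have "\<dots> = sin t * ((poly (legendre_deriv l m) (cos t) * sin t ^ m) * (poly (legendre_deriv l' m) (cos t) * sin t ^ m))"
      unfolding s[symmetric] by (simp only: mult_ac)
    finally show ?thesis by (simp add: has_real_derivative_iff_has_vector_derivative)
  qed
  from fundamental_theorem_of_calculus[OF _ this] show ?thesis using T by simp
qed

lemma integral_cis_int:
  assumes "n \<noteq> 0"
  shows "((\<lambda>t. cis (of_int n * t)) has_integral 0) {0..2*pi}"
proof -
  have "((\<lambda>t. cis (of_int n * t) / (\<i> * of_int n)) has_vector_derivative cis (of_int n * t)) (at t within {0..2*pi})" for t
    using assms unfolding cis_conv_exp
    by (auto intro!: derivative_eq_intros has_vector_derivative_real_field simp: algebra_simps)
  from fundamental_theorem_of_calculus[OF _ this]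
  have "((\<lambda>t. cis (of_int n * t)) has_integral cis (of_int n * (2*pi)) / (\<i> * of_int n) - cis (of_int n * 0) / (\<i> * of_int n)) {0..2*pi}"
    by simp
  moreover have "cis (of_int n * (2*pi)) = 1"
    using cis_multiple_2pi[of "of_int n"] by (simp add: mult.commute)
  ultimately show ?thesis by simp
qed

lemma spherical_harmonic_continuous: "continuous_on A (spherical_harmonic l m)"
proof -
  have "continuous_on A (\<lambda>x::pt. Complex (x $ 1) (x $ 2))"
    unfolding Complex_eq by (intro continuous_intros)
  hence "continuous_on A (spherical_harmonic_nonneg l k)" for k
    unfolding spherical_harmonic_nonneg_def by (intro continuous_intros) auto
  thus ?thesis unfolding spherical_harmonic_def by (cases "m \<ge> 0") (auto intro!: continuous_intros)
qed

text \<open>Separation of variables, with \<open>\<bar>m\<bar>\<close> to include negative orders.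
  The constant stays unspecified, since orthogonality depends only on the two factors.\<close>

lemma spherical_harmonic_sph:
  obtains K where "\<And>q. spherical_harmonic l m (sphere_point q) =
    of_real (K * (poly (legendre_deriv l (nat \<bar>m\<bar>)) (cos (fst q)) * sin (fst q) ^ nat \<bar>m\<bar>)) * cis (of_int m * snd q)"
proof -
  have C: "Complex (sphere_point q $ 1) (sphere_point q $ 2) = of_real (sin (fst q)) * cis (snd q)" for q
    by (simp add: complex_eq_iff)
  define N where "N k = sqrt ((2 * real l + 1) / (4 * pi) * (fact (l - k) / fact (l + k))) * (-1) ^ k / (2 ^ l * fact l)" for k
  have nn: "spherical_harmonic_nonneg l k (sphere_point q) =
     of_real (N k * (poly (legendre_deriv l k) (cos (fst q)) * sin (fst q) ^ k)) * cis (real k * snd q)" for k q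
    unfolding spherical_harmonic_nonneg_def C by (simp add: N_def legendre_deriv_def power_mult_distrib Complex.DeMoivre)
  show ?thesis
  proof (cases "m \<ge> 0")
    case True
    thus ?thesis using that[of "N (nat m)"] nn[of "nat m"] by (simp add: spherical_harmonic_def)
  next
    case False
    have "spherical_harmonic l m (sphere_point q) = of_real ((-1) ^ nat (-m) * N (nat (-m)) * (poly (legendre_deriv l (nat \<bar>m\<bar>)) (cos (fst q)) * sin (fst q) ^ nat \<bar>m\<bar>)) * cis (of_int m * snd q)" for q
      using False by (simp add: spherical_harmonic_def nn cis_cnj)
    thus ?thesis by (rule that)
  qed
qed

text \<open>Waves of one degree share their radial factor, so it is the degrees that have to be
  separated. Different orders are separated by the azimuthal integral, equal orders by the Legendre
  integral.\<close>

lemma spherical_harmonic_orthogonal: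
  assumes "l \<noteq> l'" "\<bar>m\<bar> \<le> int l" "\<bar>m'\<bar> \<le> int l'"
  shows "(LINT \<omega>|sphere_measure. spherical_harmonic l m \<omega> * cnj (spherical_harmonic l' m' \<omega>)) = 0"
proof -
  let ?v = "\<lambda>\<omega>. spherical_harmonic l m \<omega> * cnj (spherical_harmonic l' m' \<omega>)"
  have c: "continuous_on (sphere 0 1) ?v"
    by (intro continuous_intros spherical_harmonic_continuous)
  define F where "F = (\<lambda>l m t. poly (legendre_deriv l (nat \<bar>m\<bar>)) (cos t) * sin t ^ nat \<bar>m\<bar>)"
  obtain K where K: "\<And>q. spherical_harmonic l m (sphere_point q) = of_real (K * F l m (fst q)) * cis (of_int m * snd q)"
    using spherical_harmonic_sph[of l m] unfolding F_def by blast
  obtain K' where K': "\<And>q. spherical_harmonic l' m' (sphere_point q) = of_real (K' * F l' m' (fst q)) * cis (of_int m' * snd q)"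
    using spherical_harmonic_sph[of l' m'] unfolding F_def by blast
  have eq: "sin t *\<^sub>R ?v (sphere_point (t, p)) =
     of_real (K * K' * (sin t * (F l m t * F l' m' t))) * cis (of_int (m - m') * p)" for t p
    by (simp add: K K' cis_cnj cis_mult scaleR_conv_of_real algebra_simps)
  have "integral\<^sup>L sphere_measure ?v = integral (cbox (0,0) (pi, 2*pi)) (\<lambda>q. sin (fst q) *\<^sub>R ?v (sphere_point q))"
    by (rule integral_surf_eq_HK[OF c])
  also have "\<dots> = integral (cbox 0 pi) (\<lambda>t. integral (cbox 0 (2*pi)) (\<lambda>p. sin t *\<^sub>R ?v (sphere_point (t, p))))"
    by (subst integral_prod_continuous) (auto intro!: continuous_intros continuous_on_compose_sph[OF c] simp del: sphere_point_nth)
  also have "\<dots> = integral {0..pi} (\<lambda>t. of_real (K * K' * (sin t * (F l m t * F l' m' t))) *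
      integral {0..2*pi} (\<lambda>p. cis (of_int (m - m') * p)))"
    unfolding eq by simp
  also have "\<dots> = 0"
  proof (cases "m = m'")
    case False
    hence "integral {0..2*pi} (\<lambda>p. cis (of_int (m - m') * p)) = 0"
      by (intro integral_unique integral_cis_int) simp
    thus ?thesis by simp
  next
    case True
    have "((\<lambda>t. sin t * (F l m t * F l' m' t)) has_integral 0) {0..pi}"
      unfolding F_def True by (rule integral_sin_legendre) (use assms True in auto)
    from has_integral_mult_right[OF this, of "K * K'"]
    have "((\<lambda>t. K * K' * (sin t * (F l m t * F l' m' t))) has_integral 0) {0..pi}" by simp
    from has_integral_of_real[OF this]
    have "((\<lambda>t. complex_of_real (K * K' * (sin t * (F l m t * F l' m' t)))) has_integral 0) {0..pi}" by simp
    from integral_unique[OF has_integral_mult_left[OF this, of "integral {0..2*pi} (\<lambda>p. cis (of_int (m - m') * p))"]]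
    show ?thesis by (simp only: mult_zero_left)
  qed
  finally show ?thesis .
qed

section \<open>Spherical Bessel functions\<close>

text \<open>Coefficients with respect to the squared argument after the factor r^l has been taken
  out of \<open>spherical_bessel\<close>.\<close>

definition bessel_coeff :: "nat \<Rightarrow> nat \<Rightarrow> real" where
  "bessel_coeff l k = (-1) ^ k * 2 ^ l * fact (l + k) / (fact k * fact (2 * l + 2 * k + 1))"

text \<open>This two-term recursion is the source both of the exponential bound on the coefficients
  and of the differential equation \<open>bessel_ode\<close>.\<close>

lemma bessel_coeff_Suc:
  "bessel_coeff l (Suc k) = - bessel_coeff l k / (2 * (real k + 1) * (2 * real l + 2 * real k + 3))"
proof -
  have f: "fact (2 * l + 2 * Suc k + 1) = (2 * real l + 2 * real k + 3) * (2 * (real l + real k + 1)) * fact (2 * l + 2 * k + 1)"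
  proof -
    have "2 * l + 2 * Suc k + 1 = Suc (Suc (2 * l + 2 * k + 1))" by simp
    thus ?thesis by (simp only: fact_Suc of_nat_mult of_nat_Suc of_nat_add) (simp add: algebra_simps)
  qed
  have "bessel_coeff l (Suc k) = - ((-1) ^ k * 2 ^ l * ((real l + real k + 1) * fact (l + k))) /
     (((real k + 1) * fact k) * ((2 * real l + 2 * real k + 3) * (2 * (real l + real k + 1)) * fact (2 * l + 2 * k + 1)))"
    unfolding bessel_coeff_def f by (simp add: algebra_simps)
  also have "\<dots> = - bessel_coeff l k / (2 * (real k + 1) * (2 * real l + 2 * real k + 3))"
  proof -
    have "real l + real k + 1 \<noteq> 0" by linarith
    moreover have "- (s * (c * a)) / ((k1 * b) * (d * (2 * c) * e)) = - (s * a / (b * e)) / (2 * k1 * d)"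
      if "c \<noteq> 0" for s c a k1 b d e :: real
      using that by (simp add: field_simps)
    ultimately show ?thesis unfolding bessel_coeff_def by blast
  qed
  finally show ?thesis .
qed

lemma abs_bessel_coeff_0: "bessel_coeff l 0 > 0"
  by (simp add: bessel_coeff_def)

text \<open>In the recursion 2l + 2k + 3 is replaced by 2l + 3, which leaves an exponential series
  with a ratio that decreases in \<open>l\<close>.\<close>

lemma abs_bessel_coeff_le:
  "\<bar>bessel_coeff l k\<bar> \<le> bessel_coeff l 0 * (1 / (2 * (2 * real l + 3))) ^ k / fact k"
proof (induction k)
  case 0
  show ?case using abs_bessel_coeff_0[of l] by simp
next
  case (Suc k)
  have "\<bar>bessel_coeff l (Suc k)\<bar> = \<bar>bessel_coeff l k\<bar> / (2 * (real k + 1) * (2 * real l + 2 * real k + 3))"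
    by (simp add: bessel_coeff_Suc abs_mult)
  also have "\<dots> \<le> \<bar>bessel_coeff l k\<bar> / (2 * (real k + 1) * (2 * real l + 3))"
    by (intro divide_left_mono mult_left_mono mult_pos_pos) auto
  also have "\<dots> \<le> (bessel_coeff l 0 * (1 / (2 * (2 * real l + 3))) ^ k / fact k) / (2 * (real k + 1) * (2 * real l + 3))"
    by (intro divide_right_mono Suc) auto
  also have "\<dots> = bessel_coeff l 0 * (1 / (2 * (2 * real l + 3))) ^ Suc k / fact (Suc k)"
    by (simp add: field_simps)
  finally show ?case .
qed

lemma summable_bessel: "summable (\<lambda>k. bessel_coeff l k * z ^ k)"
proof (rule summable_comparison_test')
  let ?q = "\<bar>z\<bar> / (2 * (2 * real l + 3))"
  show "summable (\<lambda>k. bessel_coeff l 0 * (?q ^ k /\<^sub>R fact k))"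
    by (intro summable_mult summable_exp_generic)
  show "norm (bessel_coeff l k * z ^ k) \<le> bessel_coeff l 0 * (?q ^ k /\<^sub>R fact k)" if "k \<ge> 0" for k
  proof -
    have "norm (bessel_coeff l k * z ^ k) \<le> (bessel_coeff l 0 * (1 / (2 * (2 * real l + 3))) ^ k / fact k) * \<bar>z\<bar> ^ k"
      unfolding real_norm_def abs_mult power_abs by (intro mult_right_mono abs_bessel_coeff_le) simp
    also have "\<dots> = bessel_coeff l 0 * (?q ^ k /\<^sub>R fact k)"
      by (simp add: power_divide field_simps)
    finally show ?thesis .
  qed
qed

definition bessel_series :: "nat \<Rightarrow> real \<Rightarrow> real" where
  "bessel_series l z = (\<Sum>k. bessel_coeff l k * z ^ k)"

lemma spherical_bessel_eq: "spherical_bessel l r = r ^ l * bessel_series l (r\<^sup>2)"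
proof -
  have "spherical_bessel l r = (\<Sum>k. r ^ l * (bessel_coeff l k * (r\<^sup>2) ^ k))"
    unfolding spherical_bessel_def bessel_coeff_def
    by (intro suminf_cong) (simp add: power_add power_mult)
  thus ?thesis by (simp add: bessel_series_def suminf_mult summable_bessel)
qed

lemma isCont_bessel_series: "isCont (bessel_series l) z"
  unfolding bessel_series_def using termdiffs_strong_converges_everywhere[of "bessel_coeff l" z]
  by (intro DERIV_isCont) (auto simp: summable_bessel)

lemma continuous_on_spherical_bessel [continuous_intros]:
  assumes "continuous_on A f"
  shows "continuous_on A (\<lambda>x. spherical_bessel l (f x))"
proof -
  have "continuous_on UNIV (bessel_series l)"
    by (intro continuous_at_imp_continuous_on ballI isCont_bessel_series)
  hence "continuous_on A (\<lambda>x. bessel_series l ((f x)\<^sup>2))"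
    by (rule continuous_on_compose2) (auto intro!: continuous_intros assms)
  thus ?thesis unfolding spherical_bessel_eq by (intro continuous_intros assms)
qed

text \<open>The tail is at most the first coefficient times exp q - 1, where the hypothesis is just
  what gives q \<le> 1/2; then exp q - 1 \<le> q + q^2 \<le> 3/4.\<close>

lemma bessel_series_close:
  assumes "\<bar>z\<bar> \<le> 2 * real l + 3"
  shows "\<bar>bessel_series l z - bessel_coeff l 0\<bar> \<le> 3/4 * bessel_coeff l 0"
proof -
  let ?q = "\<bar>z\<bar> / (2 * (2 * real l + 3))"
  have q: "0 \<le> ?q" "?q \<le> 1/2" using assms by (auto simp: field_simps)
  have b: "\<bar>bessel_coeff l k * z ^ k\<bar> \<le> bessel_coeff l 0 * (?q ^ k /\<^sub>R fact k)" for k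
  proof -
    have "\<bar>bessel_coeff l k * z ^ k\<bar> \<le> (bessel_coeff l 0 * (1 / (2 * (2 * real l + 3))) ^ k / fact k) * \<bar>z\<bar> ^ k"
      unfolding abs_mult power_abs by (intro mult_right_mono abs_bessel_coeff_le) simp
    also have "\<dots> = bessel_coeff l 0 * (?q ^ k /\<^sub>R fact k)"
      by (simp add: power_divide field_simps)
    finally show ?thesis .
  qed
  have s1: "summable (\<lambda>k. bessel_coeff l (Suc k) * z ^ Suc k)"
    using summable_bessel[of l z] summable_Suc_iff[of "\<lambda>k. bessel_coeff l k * z ^ k"] by simp
  have se: "summable (\<lambda>k. bessel_coeff l 0 * (?q ^ k /\<^sub>R fact k))"
    by (intro summable_mult summable_exp_generic)
  hence s2: "summable (\<lambda>k. bessel_coeff l 0 * (?q ^ Suc k /\<^sub>R fact (Suc k)))"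
    using summable_Suc_iff[of "\<lambda>k. bessel_coeff l 0 * (?q ^ k /\<^sub>R fact k)"] by blast
  have "bessel_series l z - bessel_coeff l 0 = (\<Sum>k. bessel_coeff l (Suc k) * z ^ Suc k)"
    using suminf_split_head[OF summable_bessel[of l z]] by (simp add: bessel_series_def)
  also have "\<bar>\<dots>\<bar> \<le> (\<Sum>k. bessel_coeff l 0 * (?q ^ Suc k /\<^sub>R fact (Suc k)))"
    using norm_suminf_le[OF _ s2, of "\<lambda>k. bessel_coeff l (Suc k) * z ^ Suc k"] b[of "Suc _"] by simp
  also have "\<dots> = (\<Sum>k. bessel_coeff l 0 * (?q ^ k /\<^sub>R fact k)) - bessel_coeff l 0"
    using suminf_split_head[OF se] by simp
  also have "\<dots> = bessel_coeff l 0 * (exp ?q - 1)"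
    using suminf_mult[OF summable_exp_generic[of ?q], of "bessel_coeff l 0"]
    unfolding right_diff_distrib by (simp only: exp_def mult_1_right)
  also have "\<dots> \<le> bessel_coeff l 0 * (3/4)"
  proof (intro mult_left_mono)
    have "exp ?q \<le> 1 + ?q + ?q\<^sup>2" by (rule exp_bound) (use q in auto)
    moreover have "?q\<^sup>2 \<le> (1/2)\<^sup>2" using q by (intro power_mono)
    moreover have "(1/2 :: real)\<^sup>2 = 1/4" by (simp add: power2_eq_square)
    ultimately show "exp ?q - 1 \<le> 3/4" using q(2) by linarith
  qed (use abs_bessel_coeff_0[of l] in simp)
  finally show ?thesis by simp
qed

text \<open>For large \<open>l\<close> the power series is dominated by its first term, so \<open>j\<^sub>l(\<kappa> r)\<close> is comparable to
  \<open>r\<^sup>l j\<^sub>l(\<kappa>)\<close>; only finitely many degrees have to be treated by the nonvanishing of \<open>j\<^sub>l(\<kappa>)\<close>.\<close>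

lemma spherical_bessel_ratio_bounded:
  assumes "\<kappa> > 0" "\<And>l. spherical_bessel l \<kappa> \<noteq> 0"
  shows "\<exists>C>0. \<forall>l. \<forall>r\<in>{0..1}. \<bar>spherical_bessel l (\<kappa> * r)\<bar> \<le> C * \<bar>spherical_bessel l \<kappa>\<bar>"
proof -
  obtain L :: nat where L: "\<kappa>\<^sup>2 \<le> real L" using real_arch_simple by blast
  \<comment> \<open>By \<open>bessel_series_close\<close> the series lies between 1/4 and 7/4 of its
    first coefficient, and 7 is the quotient of the two.\<close>
  have large: "\<bar>spherical_bessel l (\<kappa> * r)\<bar> \<le> 7 * \<bar>spherical_bessel l \<kappa>\<bar>" if "l \<ge> L" "0 \<le> r" "r \<le> 1" for l r
  proof -
    have l: "real L \<le> real l" using that by simp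
    have kl: "\<kappa>\<^sup>2 \<le> 2 * real l + 3" using L l by linarith
    have kr: "\<bar>\<kappa> * r\<bar> \<le> \<kappa>" using that assms by (simp add: abs_mult mult_left_le)
    hence "(\<kappa> * r)\<^sup>2 \<le> \<kappa>\<^sup>2" using assms abs_le_square_iff[of "\<kappa> * r" \<kappa>] by simp
    hence "\<bar>(\<kappa> * r)\<^sup>2\<bar> \<le> 2 * real l + 3" using kl by simp
    from bessel_series_close[OF this] abs_bessel_coeff_0[of l] have a: "\<bar>bessel_series l ((\<kappa> * r)\<^sup>2)\<bar> \<le> 7/4 * bessel_coeff l 0" by linarith
    have "\<bar>\<kappa>\<^sup>2\<bar> \<le> 2 * real l + 3" using kl by simp
    from bessel_series_close[OF this] have b: "bessel_coeff l 0 / 4 \<le> \<bar>bessel_series l (\<kappa>\<^sup>2)\<bar>" using abs_bessel_coeff_0[of l] by linarith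
    have "\<bar>spherical_bessel l (\<kappa> * r)\<bar> = \<bar>\<kappa> * r\<bar> ^ l * \<bar>bessel_series l ((\<kappa> * r)\<^sup>2)\<bar>"
      by (simp add: spherical_bessel_eq abs_mult power_abs)
    also have "\<dots> \<le> \<kappa> ^ l * (7/4 * bessel_coeff l 0)"
      using kr a assms by (intro mult_mono power_mono) auto
    also have "\<dots> \<le> \<kappa> ^ l * (7 * \<bar>bessel_series l (\<kappa>\<^sup>2)\<bar>)"
      using b assms by (intro mult_left_mono) auto
    also have "\<dots> = 7 * \<bar>spherical_bessel l \<kappa>\<bar>"
      using assms by (simp add: spherical_bessel_eq abs_mult)
    finally show ?thesis .
  qed
  have "\<exists>c. \<forall>r\<in>{0..1}. \<bar>spherical_bessel l (\<kappa> * r)\<bar> \<le> c * \<bar>spherical_bessel l \<kappa>\<bar>" for l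
  proof -
    have "bounded ((\<lambda>r. spherical_bessel l (\<kappa> * r)) ` {0..1})"
      by (intro compact_imp_bounded compact_continuous_image continuous_intros) auto
    then obtain K where "\<forall>r\<in>{0..1}. \<bar>spherical_bessel l (\<kappa> * r)\<bar> \<le> K" by (auto simp: bounded_iff)
    thus ?thesis using assms(2)[of l] by (intro exI[of _ "K / \<bar>spherical_bessel l \<kappa>\<bar>"]) simp
  qed
  then obtain c where c: "\<And>l r. 0 \<le> r \<Longrightarrow> r \<le> 1 \<Longrightarrow> \<bar>spherical_bessel l (\<kappa> * r)\<bar> \<le> c l * \<bar>spherical_bessel l \<kappa>\<bar>"
    by (metis atLeastAtMost_iff)
  define C where "C = 7 + (\<Sum>l<L. \<bar>c l\<bar>)"
  show ?thesis
  proof (intro exI conjI allI ballI)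
    show "C > 0" unfolding C_def by (intro add_pos_nonneg sum_nonneg) auto
    fix l and r :: real assume "r \<in> {0..1}"
    hence r: "0 \<le> r" "r \<le> 1" by auto
    show "\<bar>spherical_bessel l (\<kappa> * r)\<bar> \<le> C * \<bar>spherical_bessel l \<kappa>\<bar>"
    proof (cases "l < L")
      case True
      have "c l \<le> \<bar>c l\<bar>" by simp
      also have "\<dots> \<le> (\<Sum>l<L. \<bar>c l\<bar>)" using True by (intro member_le_sum) auto
      also have "\<dots> \<le> C" by (simp add: C_def)
      finally show ?thesis using c[OF r, of l] by (meson order_trans mult_right_mono abs_ge_zero)
    next
      case False
      have "7 \<le> C" unfolding C_def by (simp add: sum_nonneg)
      thus ?thesis using large[of l r] False r by (meson order_trans mult_right_mono abs_ge_zero not_less)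
    qed
  qed
qed

section \<open>Bounding the norm over the ball by the norm over the sphere\<close>

lemma of_real_l2norm_power2:
  "complex_of_real ((l2norm M f)\<^sup>2) = integral\<^sup>L M (\<lambda>x. f x * cnj (f x))"
  by (simp add: l2norm_power2 complex_norm_square[symmetric] del: of_real_power)

text \<open>All orders of one degree are lumped together, as they are multiplied by the same Bessel
  function.\<close>

definition harmonic_sum :: "nat \<Rightarrow> (int \<Rightarrow> complex) \<Rightarrow> pt \<Rightarrow> complex" where
  "harmonic_sum l c \<omega> = (\<Sum>m\<in>{- int l..int l}. c m * spherical_harmonic l m \<omega>)"

lemma continuous_on_harmonic_sum [continuous_intros]: "continuous_on A (harmonic_sum l c)"
proof -
  have "continuous_on A (\<lambda>\<omega>. \<Sum>m\<in>{- int l..int l}. c m * spherical_harmonic l m \<omega>)"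
    by (intro continuous_intros spherical_harmonic_continuous)
  thus ?thesis by (simp add: harmonic_sum_def[abs_def])
qed

lemma harmonic_sum_orthogonal:
  assumes "l \<noteq> l'"
  shows "integral\<^sup>L sphere_measure (\<lambda>\<omega>. harmonic_sum l c \<omega> * cnj (harmonic_sum l' c' \<omega>)) = 0"
proof -
  have int: "integrable sphere_measure (\<lambda>\<omega>. c m * cnj (c' m') * (spherical_harmonic l m \<omega> * cnj (spherical_harmonic l' m' \<omega>)))" for m m'
    by (intro integrable_surf continuous_intros spherical_harmonic_continuous)
  have "integral\<^sup>L sphere_measure (\<lambda>\<omega>. harmonic_sum l c \<omega> * cnj (harmonic_sum l' c' \<omega>)) =
    integral\<^sup>L sphere_measure (\<lambda>\<omega>. \<Sum>m\<in>{- int l..int l}. \<Sum>m'\<in>{- int l'..int l'}.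
       c m * cnj (c' m') * (spherical_harmonic l m \<omega> * cnj (spherical_harmonic l' m' \<omega>)))"
    unfolding harmonic_sum_def by (simp add: sum_product mult_ac)
  also have "\<dots> = (\<Sum>m\<in>{- int l..int l}. \<Sum>m'\<in>{- int l'..int l'}.
       c m * cnj (c' m') * integral\<^sup>L sphere_measure (\<lambda>\<omega>. spherical_harmonic l m \<omega> * cnj (spherical_harmonic l' m' \<omega>)))"
    using int by (simp add: Bochner_Integration.integral_sum)
  also have "\<dots> = 0"
    using assms by (intro sum.neutral ballI) (simp add: spherical_harmonic_orthogonal abs_le_iff)
  finally show ?thesis .
qed

lemma harmonic_sum_pythagoras:
  fixes \<alpha> :: "nat \<Rightarrow> real"
  shows "(l2norm sphere_measure (\<lambda>\<omega>. \<Sum>l\<le>L. of_real (\<alpha> l) * harmonic_sum l (c l) \<omega>))\<^sup>2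
    = (\<Sum>l\<le>L. (\<alpha> l)\<^sup>2 * (l2norm sphere_measure (harmonic_sum l (c l)))\<^sup>2)"
proof -
  let ?H = "\<lambda>l. harmonic_sum l (c l)"
  have int: "integrable sphere_measure (\<lambda>\<omega>. of_real (\<alpha> l * \<alpha> l') * (?H l \<omega> * cnj (?H l' \<omega>)))" for l l'
    by (intro integrable_surf continuous_intros)
  have "complex_of_real ((l2norm sphere_measure (\<lambda>\<omega>. \<Sum>l\<le>L. of_real (\<alpha> l) * ?H l \<omega>))\<^sup>2) =
     integral\<^sup>L sphere_measure (\<lambda>\<omega>. \<Sum>l\<le>L. \<Sum>l'\<le>L. of_real (\<alpha> l * \<alpha> l') * (?H l \<omega> * cnj (?H l' \<omega>)))"
    unfolding of_real_l2norm_power2 by (simp add: sum_product mult_ac)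
  also have "\<dots> = (\<Sum>l\<le>L. \<Sum>l'\<le>L. of_real (\<alpha> l * \<alpha> l') * integral\<^sup>L sphere_measure (\<lambda>\<omega>. ?H l \<omega> * cnj (?H l' \<omega>)))"
    using int by (simp add: Bochner_Integration.integral_sum)
  also have "\<dots> = (\<Sum>l\<le>L. \<Sum>l'\<le>L. if l' = l then of_real ((\<alpha> l)\<^sup>2 * (l2norm sphere_measure (?H l))\<^sup>2) else 0)"
    by (intro sum.cong refl)
       (auto simp: harmonic_sum_orthogonal of_real_l2norm_power2 power2_eq_square[of "\<alpha> _"] simp del: of_real_power)
  also have "\<dots> = of_real (\<Sum>l\<le>L. (\<alpha> l)\<^sup>2 * (l2norm sphere_measure (?H l))\<^sup>2)"
    by simp
  finally show ?thesis by (simp only: of_real_eq_iff)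
qed

lemma spherical_wave_polar:
  "norm \<omega> = 1 \<Longrightarrow> r > 0 \<Longrightarrow>
    spherical_wave \<kappa> l m (r *\<^sub>R \<omega>) = of_real (spherical_bessel l (\<kappa> * r)) * spherical_harmonic l m \<omega>"
  by (simp add: spherical_wave_def)

text \<open>The condition \<open>r > 0\<close> matters: at the origin
  \<open>x /\<^sub>R norm x\<close> is 0, which is not a direction.\<close>

lemma spherical_wave_span_polar:
  assumes "s \<in> spherical_wave_span \<kappa>"
  shows "\<exists>L c. \<forall>r \<omega>. norm \<omega> = 1 \<longrightarrow> r > 0 \<longrightarrow>
    s (r *\<^sub>R \<omega>) = (\<Sum>l\<le>L. of_real (spherical_bessel l (\<kappa> * r)) * harmonic_sum l (c l) \<omega>)"
proof -
  obtain L c where s: "s = (\<lambda>x. \<Sum>l\<le>L. \<Sum>m\<in>{- int l..int l}. c l m * spherical_wave \<kappa> l m x)"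
    using assms by (auto simp: spherical_wave_span_def)
  have "s (r *\<^sub>R \<omega>) = (\<Sum>l\<le>L. of_real (spherical_bessel l (\<kappa> * r)) * harmonic_sum l (c l) \<omega>)"
    if "norm \<omega> = 1" "r > 0" for r \<omega>
    unfolding s harmonic_sum_def sum_distrib_left
    by (intro sum.cong refl) (simp add: spherical_wave_polar[OF that])
  thus ?thesis by blast
qed

lemma spherical_wave_bounded_measurable:
  "spherical_wave \<kappa> l m \<in> borel_measurable borel"
  "\<exists>K. \<forall>x. norm x < 1 \<longrightarrow> norm (spherical_wave \<kappa> l m x) \<le> K"
proof -
  have "(\<lambda>x::pt. x /\<^sub>R norm x) \<in> borel_measurable borel" by measurable
  moreover have "spherical_harmonic l m \<in> borel_measurable borel"
    by (rule borel_measurable_continuous_onI[OF spherical_harmonic_continuous])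
  ultimately have 1: "(\<lambda>x::pt. spherical_harmonic l m (x /\<^sub>R norm x)) \<in> borel_measurable borel"
    by (rule measurable_compose)
  have 2: "(\<lambda>x::pt. spherical_bessel l (\<kappa> * norm x)) \<in> borel_measurable borel"
    by (intro borel_measurable_continuous_onI continuous_intros)
  show "spherical_wave \<kappa> l m \<in> borel_measurable borel"
    using 1 2 unfolding spherical_wave_def[abs_def] by measurable
  \<comment> \<open>The bound is taken over the closed ball instead of the sphere because the
    direction assigned to the origin is 0.\<close>
  obtain K1 where K1: "\<And>x. x \<in> cball (0::pt) 1 \<Longrightarrow> norm (spherical_harmonic l m x) \<le> K1"
    using compact_norm_bound[OF compact_cball spherical_harmonic_continuous] by blast
  have "continuous_on (cball (0::pt) 1) (\<lambda>x. spherical_bessel l (\<kappa> * norm x))"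
    by (intro continuous_intros)
  then obtain K2 where K2: "\<And>x. x \<in> cball (0::pt) 1 \<Longrightarrow> norm (spherical_bessel l (\<kappa> * norm x)) \<le> K2"
    using compact_norm_bound[OF compact_cball] by blast
  have "norm (spherical_wave \<kappa> l m x) \<le> K2 * K1" if "norm x < 1" for x
  proof -
    have "norm (x /\<^sub>R norm x) \<le> 1" by (cases "x = 0") simp_all
    hence "norm (spherical_harmonic l m (x /\<^sub>R norm x)) \<le> K1" using K1 by simp
    moreover have "norm (spherical_bessel l (\<kappa> * norm x)) \<le> K2" using K2[of x] that by simp
    ultimately show ?thesis unfolding spherical_wave_def norm_mult norm_of_real
      by (intro mult_mono) (auto intro: order_trans[OF norm_ge_zero] order_trans[OF abs_ge_zero])
  qed
  thus "\<exists>K. \<forall>x. norm x < 1 \<longrightarrow> norm (spherical_wave \<kappa> l m x) \<le> K" by blast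
qed

lemma spherical_wave_span_bounded_measurable:
  assumes "s \<in> spherical_wave_span \<kappa>"
  shows "s \<in> borel_measurable borel" "\<exists>K. \<forall>x. norm x < 1 \<longrightarrow> norm (s x) \<le> K"
proof -
  obtain L c where s: "s = (\<lambda>x. \<Sum>l\<le>L. \<Sum>m\<in>{- int l..int l}. c l m * spherical_wave \<kappa> l m x)"
    using assms by (auto simp: spherical_wave_span_def)
  show "s \<in> borel_measurable borel"
    unfolding s using spherical_wave_bounded_measurable(1) by simp
  obtain K where K: "\<And>l m x. norm x < 1 \<Longrightarrow> norm (spherical_wave \<kappa> l m x) \<le> K l m"
    using spherical_wave_bounded_measurable(2)[of \<kappa>] by metis
  have "norm (s x) \<le> (\<Sum>l\<le>L. \<Sum>m\<in>{- int l..int l}. norm (c l m) * K l m)" if "norm x < 1" for x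
    unfolding s by (intro sum_norm_le) (auto simp: norm_mult intro!: mult_left_mono K that)
  thus "\<exists>K. \<forall>x. norm x < 1 \<longrightarrow> norm (s x) \<le> K" by blast
qed

lemma spherical_wave_span_add:
  assumes "s \<in> spherical_wave_span \<kappa>" "t \<in> spherical_wave_span \<kappa>"
  shows "(\<lambda>x. s x + t x) \<in> spherical_wave_span \<kappa>"
proof -
  obtain L c where s: "s = (\<lambda>x. \<Sum>l\<le>L. \<Sum>m\<in>{- int l..int l}. c l m * spherical_wave \<kappa> l m x)"
    using assms by (auto simp: spherical_wave_span_def)
  obtain L' c' where t: "t = (\<lambda>x. \<Sum>l\<le>L'. \<Sum>m\<in>{- int l..int l}. c' l m * spherical_wave \<kappa> l m x)"
    using assms by (auto simp: spherical_wave_span_def)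
  \<comment> \<open>The shorter of the two sums is padded with zero coefficients up to the larger
    degree.\<close>
  define d where "d l m = (if l \<le> L then c l m else 0) + (if l \<le> L' then c' l m else 0)" for l m
  let ?M = "max L L'"
  have exL: "(\<Sum>l\<le>L. f l) = (\<Sum>l\<le>?M. if l \<le> L then f l else 0)" for f :: "nat \<Rightarrow> complex"
    by (rule sum.mono_neutral_cong_left) auto
  have exL': "(\<Sum>l\<le>L'. f l) = (\<Sum>l\<le>?M. if l \<le> L' then f l else 0)" for f :: "nat \<Rightarrow> complex"
    by (rule sum.mono_neutral_cong_left) auto
  have "(\<lambda>x. s x + t x) = (\<lambda>x. \<Sum>l\<le>?M. \<Sum>m\<in>{- int l..int l}. d l m * spherical_wave \<kappa> l m x)"
    unfolding s t exL exL' sum.distrib[symmetric]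
    by (intro ext sum.cong refl) (auto simp: d_def sum.distrib ring_distribs)
  thus ?thesis unfolding spherical_wave_span_def by blast
qed

lemma spherical_wave_span_cmult:
  assumes "s \<in> spherical_wave_span \<kappa>"
  shows "(\<lambda>x. a * s x) \<in> spherical_wave_span \<kappa>"
proof -
  obtain L c where s: "s = (\<lambda>x. \<Sum>l\<le>L. \<Sum>m\<in>{- int l..int l}. c l m * spherical_wave \<kappa> l m x)"
    using assms by (auto simp: spherical_wave_span_def)
  have "(\<lambda>x. a * s x) = (\<lambda>x. \<Sum>l\<le>L. \<Sum>m\<in>{- int l..int l}. (a * c l m) * spherical_wave \<kappa> l m x)"
    unfolding s sum_distrib_left by (simp add: mult.assoc)
  thus ?thesis unfolding spherical_wave_span_def by (intro CollectI exI)
qed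

text \<open>The weight r^2 loses the point 0, whose value is recovered from the continuity of
  \<open>f\<close>.\<close>

lemma continuous_on_eq_0_of_l2norm_rad:
  fixes f :: "real \<Rightarrow> complex"
  assumes c: "continuous_on {0..1} f" and z: "l2norm radius_measure f = 0"
    and r: "0 \<le> r" "r \<le> 1"
  shows "f r = 0"
proof -
  let ?g = "\<lambda>r. r\<^sup>2 * (norm (f r))\<^sup>2"
  have cg: "continuous_on (cbox 0 1) ?g" using c by (auto intro!: continuous_intros)
  have "set_integrable lborel {0..1} ?g"
    unfolding set_integrable_def by (rule borel_integrable_compact) (use cg in auto)
  hence s: "set_integrable lborel {0<..<1} ?g"
    by (rule set_integrable_subset) auto
  have m: "(\<lambda>r. (norm (f r))\<^sup>2) \<in> borel_measurable (restrict_space lborel {0<..<1})"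
  proof -
    have "continuous_on {0<..<1} (\<lambda>r. (norm (f r))\<^sup>2)"
      by (intro continuous_intros continuous_on_subset[OF c]) auto
    from borel_measurable_continuous_on_restrict[OF this] show ?thesis
      by (subst measurable_cong_sets[of _ "restrict_space borel {0<..<1}"]) (auto simp: sets_restrict_space)
  qed
  have "(l2norm radius_measure f)\<^sup>2 = set_lebesgue_integral lborel {0<..<1} ?g"
    unfolding l2norm_power2 radius_measure_def set_lebesgue_integral_def
    by (subst integral_density)
       (use m in \<open>auto simp: integral_restrict_space intro!: measurable_restrict_space1\<close>)
  also have "\<dots> = integral (cbox 0 1) ?g"
    using set_borel_integral_eq_integral(2)[OF s] integral_open_interval_real[of 0 1 ?g] by simp
  finally have "(?g has_integral 0) (cbox 0 1)"
    using z integrable_integral[OF integrable_continuous[OF cg]] by simp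
  hence g0: "?g t = 0" if "t \<in> cbox 0 1" for t
    by (rule has_integral_0_cbox_imp_0[OF cg, rotated]) (use that in auto)
  have "f t = 0" if "t \<in> {0<..1}" for t using g0[of t] that by simp
  moreover have "closure {0<..<1::real} = {0..1}" by simp
  ultimately show ?thesis
    using continuous_constant_on_closure[of "{0<..<1}" f 0 r] c r by simp
qed

lemma borel_measurable_rad:
  "continuous_on {0..1} f \<Longrightarrow> f \<in> borel_measurable radius_measure"
  by (subst measurable_cong_sets[OF sets_rad refl])
     (rule borel_measurable_continuous_on_restrict, auto elim: continuous_on_subset)

lemma square_integrable_rad:
  fixes f :: "real \<Rightarrow> 'b::{banach,second_countable_topology}"
  assumes "continuous_on {0..1} f"
  shows "square_integrable radius_measure f"
proof -
  obtain K where "\<And>x. x \<in> {0..1} \<Longrightarrow> norm (f x) \<le> K"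
    using compact_norm_bound[OF compact_Icc assms] by blast
  thus ?thesis
    by (intro square_integrable_bounded[OF finite_measure_rad borel_measurable_rad[OF assms], of K]) simp
qed

text \<open>The line spanned by \<open>g\<close> is closed: \<open>f\<close> coincides with its
  orthogonal projection onto \<open>g\<close>. The condition at 1 excludes \<open>g\<close> = 0, and
  continuity turns equality in norm into equality at every radius.\<close>

lemma rad_limit_of_multiples:
  fixes f g :: "real \<Rightarrow> complex"
  assumes f: "continuous_on {0..1} f" and g: "continuous_on {0..1} g" and g1: "g 1 \<noteq> 0"
    and approx: "\<And>e. e > 0 \<Longrightarrow> \<exists>b. l2norm radius_measure (\<lambda>r. f r - b * g r) < e"
  obtains a where "\<And>r. 0 \<le> r \<Longrightarrow> r \<le> 1 \<Longrightarrow> f r = a * g r"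
proof -
  define I where "I = (l2norm radius_measure g)\<^sup>2"
  have I0: "I \<noteq> 0" using continuous_on_eq_0_of_l2norm_rad[OF g, of 1] g1 by (auto simp: I_def)
  define a where "a = integral\<^sup>L radius_measure (\<lambda>r. f r * cnj (g r)) / of_real I"
  let ?d = "\<lambda>r. f r - a * g r"
  have d: "continuous_on {0..1} ?d" by (intro continuous_intros f g)
  have int: "integrable radius_measure (\<lambda>r. h1 r * cnj (h2 r))"
    if "continuous_on {0..1} h1" "continuous_on {0..1} h2" for h1 h2
    using that by (intro integrable_mult_square_integrable square_integrable_cnj square_integrable_rad)
  have orth: "integral\<^sup>L radius_measure (\<lambda>r. ?d r * cnj (g r)) = 0"
  proof -
    have "integral\<^sup>L radius_measure (\<lambda>r. ?d r * cnj (g r)) =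
      integral\<^sup>L radius_measure (\<lambda>r. f r * cnj (g r)) - a * integral\<^sup>L radius_measure (\<lambda>r. g r * cnj (g r))"
      using int[OF f g] int[OF g g] by (simp add: left_diff_distrib mult.assoc)
    thus ?thesis using I0 by (simp add: a_def I_def of_real_l2norm_power2[symmetric] del: of_real_power)
  qed
  \<comment> \<open>The projection minimizes the distance: as \<open>?d\<close> is orthogonal to
    \<open>g\<close>, its squared norm is the pairing of \<open>?d\<close> with
    \<open>f - b g\<close>, to which Cauchy-Schwarz applies.\<close>
  have le: "l2norm radius_measure ?d \<le> l2norm radius_measure (\<lambda>r. f r - b * g r)" for b
  proof -
    let ?b = "\<lambda>r. f r - b * g r"
    have bc: "continuous_on {0..1} ?b" by (intro continuous_intros f g)
    have "complex_of_real ((l2norm radius_measure ?d)\<^sup>2) = integral\<^sup>L radius_measure (\<lambda>r. ?d r * cnj (?b r) + cnj (b - a) * (?d r * cnj (g r)))"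
      unfolding of_real_l2norm_power2 by (intro Bochner_Integration.integral_cong refl) (simp add: algebra_simps)
    also have "\<dots> = integral\<^sup>L radius_measure (\<lambda>r. ?d r * cnj (?b r)) + cnj (b - a) * integral\<^sup>L radius_measure (\<lambda>r. ?d r * cnj (g r))"
      using int[OF d bc] int[OF d g] by (simp del: complex_cnj_diff)
    also have "\<dots> = integral\<^sup>L radius_measure (\<lambda>r. ?d r * cnj (?b r))" by (simp only: orth mult_zero_right add_0_right)
    finally have "(l2norm radius_measure ?d)\<^sup>2 = norm (integral\<^sup>L radius_measure (\<lambda>r. ?d r * cnj (?b r)))"
      by (metis norm_of_real abs_power2)
    also have "\<dots> \<le> l2norm radius_measure ?d * l2norm radius_measure ?b"
      using norm_integral_mult_le[OF square_integrable_rad[OF d] square_integrable_cnj[OF square_integrable_rad[OF bc]]]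
      by (simp only: l2norm_cnj)
    finally show ?thesis
      by (cases "l2norm radius_measure ?d = 0") (auto simp: power2_eq_square mult_le_cancel_left less_le)
  qed
  have "l2norm radius_measure ?d \<le> 0"
  proof (rule field_le_epsilon)
    fix e :: real assume "e > 0"
    then obtain b where "l2norm radius_measure (\<lambda>r. f r - b * g r) < e" using approx by blast
    thus "l2norm radius_measure ?d \<le> 0 + e" using le[of b] by simp
  qed
  hence "l2norm radius_measure ?d = 0" using l2norm_nonneg[of radius_measure ?d] by linarith
  from continuous_on_eq_0_of_l2norm_rad[OF d this] show ?thesis using that[of a] by simp
qed

lemma borel_measurable_slice:
  assumes "f \<in> borel_measurable (restrict_space borel B1)" "r \<in> {0<..<1}"
  shows "(\<lambda>\<omega>::pt. f (r *\<^sub>R \<omega>)) \<in> borel_measurable sphere_measure"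
proof -
  have "(\<lambda>\<omega>::pt. r *\<^sub>R \<omega>) \<in> measurable sphere_measure (restrict_space borel B1)"
    by (rule measurable_restrict_space2)
       (use assms(2) in \<open>auto intro!: borel_measurable_surf continuous_intros\<close>)
  thus ?thesis using assms(1) by (rule measurable_compose)
qed

text \<open>Continuity of the moment in the norm of the ball: Cauchy-Schwarz on each sphere,
  followed by integration over the radii.\<close>

lemma l2norm_moment_le:
  fixes d h :: "pt \<Rightarrow> complex"
  assumes d: "d \<in> borel_measurable (restrict_space borel B1)" and K: "\<And>x. norm x < 1 \<Longrightarrow> norm (d x) \<le> K"
    and h: "continuous_on (sphere 0 1) h"
    and M: "(\<lambda>r. integral\<^sup>L sphere_measure (\<lambda>\<omega>. d (r *\<^sub>R \<omega>) * h \<omega>)) \<in> borel_measurable radius_measure"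
  shows "l2norm radius_measure (\<lambda>r. integral\<^sup>L sphere_measure (\<lambda>\<omega>. d (r *\<^sub>R \<omega>) * h \<omega>)) \<le> l2norm sphere_measure h * l2norm (lebesgue_on B1) d"
proof (rule power2_le_imp_le)
  interpret sphere_measure: finite_measure sphere_measure by (rule finite_measure_surf)
  interpret radius_measure: finite_measure radius_measure by (rule finite_measure_rad)
  interpret pair_sigma_finite radius_measure sphere_measure ..
  let ?M = "\<lambda>r. integral\<^sup>L sphere_measure (\<lambda>\<omega>. d (r *\<^sub>R \<omega>) * h \<omega>)"
  let ?N = "\<lambda>r. integral\<^sup>L sphere_measure (\<lambda>\<omega>. (norm (d (r *\<^sub>R \<omega>)))\<^sup>2)"
  have d2: "(\<lambda>x. (norm (d x))\<^sup>2) \<in> borel_measurable (restrict_space borel B1)" using d by measurable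
  have i2: "integrable (lebesgue_on B1) (\<lambda>x. (norm (d x))\<^sup>2)"
    using square_integrable_ball[OF d K] by (simp add: square_integrable_def)
  note pol = integral_ball_polar[OF d2 i2]
  have slice: "square_integrable sphere_measure (\<lambda>\<omega>. d (r *\<^sub>R \<omega>))" if "r \<in> space radius_measure" for r
    by (rule square_integrable_bounded[OF finite_measure_surf, of _ K])
       (use that in \<open>auto intro!: borel_measurable_slice[OF d] K\<close>)
  have pw: "(norm (?M r))\<^sup>2 \<le> (l2norm sphere_measure h)\<^sup>2 * ?N r" if "r \<in> space radius_measure" for r
  proof -
    have "norm (?M r) \<le> l2norm sphere_measure (\<lambda>\<omega>. d (r *\<^sub>R \<omega>)) * l2norm sphere_measure h"
      by (rule norm_integral_mult_le[OF slice[OF that] square_integrable_surf[OF h]])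
    hence "(norm (?M r))\<^sup>2 \<le> (l2norm sphere_measure (\<lambda>\<omega>. d (r *\<^sub>R \<omega>)) * l2norm sphere_measure h)\<^sup>2"
      by (intro power_mono) auto
    thus ?thesis by (simp add: power_mult_distrib l2norm_power2 mult.commute)
  qed
  have iN: "integrable radius_measure (\<lambda>r. (l2norm sphere_measure h)\<^sup>2 * ?N r)"
    using integrable_fst'[OF pol(1)] by simp
  have iM: "integrable radius_measure (\<lambda>r. (norm (?M r))\<^sup>2)"
    by (rule Bochner_Integration.integrable_bound[OF iN])
       (use M pw in \<open>auto intro!: AE_I2 simp: order_trans[OF _ abs_ge_self]\<close>)
  have "(l2norm radius_measure ?M)\<^sup>2 \<le> integral\<^sup>L radius_measure (\<lambda>r. (l2norm sphere_measure h)\<^sup>2 * ?N r)"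
    unfolding l2norm_power2[of radius_measure] by (rule integral_mono[OF iM iN pw])
  also have "\<dots> = (l2norm sphere_measure h * l2norm (lebesgue_on B1) d)\<^sup>2"
    using pol(2) by (simp add: power_mult_distrib l2norm_power2[of "lebesgue_on B1"])
  finally show "(l2norm radius_measure ?M)\<^sup>2 \<le> (l2norm sphere_measure h * l2norm (lebesgue_on B1) d)\<^sup>2" .
qed simp

definition wave_approximable :: "real \<Rightarrow> (pt \<Rightarrow> complex) \<Rightarrow> bool" where
  "wave_approximable \<kappa> v \<longleftrightarrow> (\<forall>e>0. \<exists>s\<in>spherical_wave_span \<kappa>. l2norm (lebesgue_on B1) (\<lambda>x. v x - s x) < e)"

lemma wave_span_square_integrable:
  assumes "s \<in> spherical_wave_span \<kappa>"
  shows "square_integrable (lebesgue_on B1) s" "s \<in> borel_measurable (restrict_space borel B1)"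
proof -
  show m: "s \<in> borel_measurable (restrict_space borel B1)"
    using spherical_wave_span_bounded_measurable(1)[OF assms] by (rule measurable_restrict_space1)
  show "square_integrable (lebesgue_on B1) s"
    using spherical_wave_span_bounded_measurable(2)[OF assms] square_integrable_ball[OF m] by blast
qed

lemma moment_wave_span:
  assumes s: "\<And>r \<omega>. norm \<omega> = 1 \<Longrightarrow> r > 0 \<Longrightarrow>
    s (r *\<^sub>R \<omega>) = (\<Sum>l\<le>L. of_real (spherical_bessel l (\<kappa> * r)) * harmonic_sum l (c l) \<omega>)" and r: "r > 0"
  shows "integral\<^sup>L sphere_measure (\<lambda>\<omega>. s (r *\<^sub>R \<omega>) * cnj (harmonic_sum l h \<omega>)) =
    (if l \<le> L then integral\<^sup>L sphere_measure (\<lambda>\<omega>. harmonic_sum l (c l) \<omega> * cnj (harmonic_sum l h \<omega>)) else 0)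
      * of_real (spherical_bessel l (\<kappa> * r))"
proof -
  let ?j = "\<lambda>l. complex_of_real (spherical_bessel l (\<kappa> * r))"
  have int: "integrable sphere_measure (\<lambda>\<omega>. ?j k * (harmonic_sum k (c k) \<omega> * cnj (harmonic_sum l h \<omega>)))" for k
    by (intro integrable_surf continuous_intros)
  have "integral\<^sup>L sphere_measure (\<lambda>\<omega>. s (r *\<^sub>R \<omega>) * cnj (harmonic_sum l h \<omega>)) =
    integral\<^sup>L sphere_measure (\<lambda>\<omega>. \<Sum>k\<le>L. ?j k * (harmonic_sum k (c k) \<omega> * cnj (harmonic_sum l h \<omega>)))"
    by (intro Bochner_Integration.integral_cong refl) (simp add: s r sum_distrib_right mult.assoc)
  also have "\<dots> = (\<Sum>k\<le>L. ?j k * integral\<^sup>L sphere_measure (\<lambda>\<omega>. harmonic_sum k (c k) \<omega> * cnj (harmonic_sum l h \<omega>)))"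
    using int by (simp add: Bochner_Integration.integral_sum)
  also have "\<dots> = (\<Sum>k\<le>L. if k = l then ?j l * integral\<^sup>L sphere_measure (\<lambda>\<omega>. harmonic_sum l (c l) \<omega> * cnj (harmonic_sum l h \<omega>)) else 0)"
    by (intro sum.cong refl) (simp add: harmonic_sum_orthogonal)
  finally show ?thesis by (simp add: sum.delta)
qed

text \<open>For a finite sum of waves the moment is exactly a multiple of the Bessel function. By
  \<open>l2norm_moment_le\<close> the moment of \<open>v\<close> is then a limit of such multiples
  in the radial norm, and \<open>rad_limit_of_multiples\<close> applies.\<close>

lemma moment_wave_approximable:
  assumes v: "continuous_on (cball 0 1) v" and a: "wave_approximable \<kappa> v"
    and j: "spherical_bessel l \<kappa> \<noteq> 0"
  shows "\<exists>a. \<forall>r\<in>{0..1}.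
    integral\<^sup>L sphere_measure (\<lambda>\<omega>. v (r *\<^sub>R \<omega>) * cnj (harmonic_sum l h \<omega>)) = a * of_real (spherical_bessel l (\<kappa> * r))"
proof -
  let ?h = "\<lambda>\<omega>. cnj (harmonic_sum l h \<omega>)"
  let ?M = "\<lambda>v r. integral\<^sup>L sphere_measure (\<lambda>\<omega>. v (r *\<^sub>R \<omega>) * ?h \<omega>)"
  let ?g = "\<lambda>r. complex_of_real (spherical_bessel l (\<kappa> * r))"
  have h: "continuous_on (sphere 0 1) ?h" by (intro continuous_intros)
  have Mv: "continuous_on {0..1} (?M v)" by (rule continuous_on_moment[OF v h])
  have g: "continuous_on {0..1} ?g" by (intro continuous_intros)
  have approx: "\<exists>b. l2norm radius_measure (\<lambda>r. ?M v r - b * ?g r) < e" if e: "e > 0" for e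
  proof -
    let ?N = "l2norm sphere_measure ?h"
    obtain s where s: "s \<in> spherical_wave_span \<kappa>" and le: "l2norm (lebesgue_on B1) (\<lambda>x. v x - s x) < e / (?N + 1)"
    proof -
      have "e / (?N + 1) > 0" using e by (intro divide_pos_pos add_nonneg_pos) auto
      thus ?thesis using a that unfolding wave_approximable_def by blast
    qed
    obtain L c where sp0: "\<forall>r \<omega>. norm \<omega> = 1 \<longrightarrow> r > 0 \<longrightarrow>
      s (r *\<^sub>R \<omega>) = (\<Sum>l\<le>L. of_real (spherical_bessel l (\<kappa> * r)) * harmonic_sum l (c l) \<omega>)"
    using spherical_wave_span_polar[OF s] by blast
  have sp: "s (r *\<^sub>R \<omega>) = (\<Sum>l\<le>L. of_real (spherical_bessel l (\<kappa> * r)) * harmonic_sum l (c l) \<omega>)" if "norm \<omega> = 1" "r > 0" for r \<omega>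
    using sp0 that by blast
    define b where "b = (if l \<le> L then integral\<^sup>L sphere_measure (\<lambda>\<omega>. harmonic_sum l (c l) \<omega> * cnj (harmonic_sum l h \<omega>)) else 0)"
    have b: "?M s r = b * ?g r" if "r > 0" for r
      unfolding b_def by (rule moment_wave_span[OF sp that])
    let ?d = "\<lambda>x. v x - s x"
    have dm: "?d \<in> borel_measurable (restrict_space borel B1)"
      using borel_measurable_ball[OF v] wave_span_square_integrable(2)[OF s] by measurable
    obtain K1 where K1: "\<And>x. x \<in> cball 0 1 \<Longrightarrow> norm (v x) \<le> K1" using compact_norm_bound[OF compact_cball v] by blast
    obtain K2 where K2: "\<And>x. norm x < 1 \<Longrightarrow> norm (s x) \<le> K2"
      using spherical_wave_span_bounded_measurable(2)[OF s] by blast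
    have K: "norm (?d x) \<le> K1 + K2" if "norm x < 1" for x
      using K1[of x] K2[of x] norm_triangle_ineq4[of "v x" "s x"] that by simp
    have Md: "?M ?d r = ?M v r - b * ?g r" if "r \<in> {0<..<1}" for r
    proof -
      have "square_integrable sphere_measure (\<lambda>\<omega>. s (r *\<^sub>R \<omega>))"
        by (rule square_integrable_bounded[OF finite_measure_surf, of _ K2])
           (use that in \<open>auto intro!: borel_measurable_slice wave_span_square_integrable(2)[OF s] K2\<close>)
      hence "integrable sphere_measure (\<lambda>\<omega>. s (r *\<^sub>R \<omega>) * ?h \<omega>)"
        by (rule integrable_mult_square_integrable[OF _ square_integrable_surf[OF h]])
      moreover have "integrable sphere_measure (\<lambda>\<omega>. v (r *\<^sub>R \<omega>) * ?h \<omega>)"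
        using that by (intro integrable_surf continuous_on_mult continuous_on_slice v h) auto
      ultimately have "?M ?d r = ?M v r - ?M s r" by (simp add: left_diff_distrib)
      thus ?thesis using b that by simp
    qed
    have mc: "continuous_on {0..1} (\<lambda>r. ?M v r - b * ?g r)" by (intro continuous_intros Mv)
    \<comment> \<open>Since \<open>?d\<close> is only bounded and measurable, measurability of its
      moment is read off from the continuous expression that it equals for 0 < r < 1.\<close>
    have mm: "?M ?d \<in> borel_measurable radius_measure"
    proof (rule measurable_cong[THEN iffD2, OF _ borel_measurable_rad[OF mc]])
      fix r assume "r \<in> space radius_measure"
      thus "?M ?d r = ?M v r - b * ?g r" using Md by simp
    qed
    have "l2norm radius_measure (\<lambda>r. ?M v r - b * ?g r) = l2norm radius_measure (?M ?d)"
      unfolding l2norm_def by (intro arg_cong[where f=sqrt] Bochner_Integration.integral_cong refl) (simp add: Md)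
    also have "\<dots> \<le> ?N * l2norm (lebesgue_on B1) ?d" by (rule l2norm_moment_le[OF dm K h mm])
    also have "\<dots> \<le> ?N * (e / (?N + 1))" using le by (intro mult_left_mono) auto
    also have "\<dots> < e" using e l2norm_nonneg[of sphere_measure ?h] by (simp add: field_simps del: l2norm_nonneg)
    finally show ?thesis by blast
  qed
  have "?g 1 \<noteq> 0" using j by simp
  from rad_limit_of_multiples[OF Mv g this approx] show ?thesis by (metis atLeastAtMost_iff)
qed

text \<open>Pairing \<open>v\<close> with a finite sum of waves \<open>s = \<Sum>\<^sub>l j\<^sub>l(\<kappa> r) H\<^sub>l\<close> moves to the boundary: since the moments
  of \<open>v\<close> are multiples of \<open>j\<^sub>l(\<kappa> r)\<close>, one has \<open>(v, s)\<close> over the ball equal to \<open>(v, Z)\<close> over the sphere with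
  \<open>Z = \<Sum>\<^sub>l (I\<^sub>l / j\<^sub>l(\<kappa>)) H\<^sub>l\<close> and \<open>I\<^sub>l\<close> the weighted square integral of \<open>j\<^sub>l(\<kappa> r)\<close>.\<close>

lemma ball_pairing_le:
  assumes v: "continuous_on (cball 0 1) v" and app: "wave_approximable \<kappa> v"
    and s: "s \<in> spherical_wave_span \<kappa>"
    and j: "\<And>l. spherical_bessel l \<kappa> \<noteq> 0"
    and C: "C > 0" "\<And>l r. 0 \<le> r \<Longrightarrow> r \<le> 1 \<Longrightarrow> \<bar>spherical_bessel l (\<kappa> * r)\<bar> \<le> C * \<bar>spherical_bessel l \<kappa>\<bar>"
  shows "norm (integral\<^sup>L (lebesgue_on B1) (\<lambda>x. v x * cnj (s x)))
    \<le> C * sqrt (measure radius_measure (space radius_measure)) * l2norm sphere_measure v * l2norm (lebesgue_on B1) s"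
proof -
  interpret radius_measure: finite_measure radius_measure by (rule finite_measure_rad)
  obtain L c where sp0: "\<forall>r \<omega>. norm \<omega> = 1 \<longrightarrow> r > 0 \<longrightarrow>
    s (r *\<^sub>R \<omega>) = (\<Sum>l\<le>L. of_real (spherical_bessel l (\<kappa> * r)) * harmonic_sum l (c l) \<omega>)"
    using spherical_wave_span_polar[OF s] by blast
  have sp: "s (r *\<^sub>R \<omega>) = (\<Sum>l\<le>L. of_real (spherical_bessel l (\<kappa> * r)) * harmonic_sum l (c l) \<omega>)" if "norm \<omega> = 1" "r > 0" for r \<omega>
    using sp0 that by blast
  let ?g = "\<lambda>l r. spherical_bessel l (\<kappa> * r)"
  let ?H = "\<lambda>l. harmonic_sum l (c l)"
  let ?M = "\<lambda>l r. integral\<^sup>L sphere_measure (\<lambda>\<omega>. v (r *\<^sub>R \<omega>) * cnj (?H l \<omega>))"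
  define I where "I l = integral\<^sup>L radius_measure (\<lambda>r. (?g l r)\<^sup>2)" for l
  define z where "z l = I l / spherical_bessel l \<kappa>" for l
  define Z where "Z = (\<lambda>\<omega>. \<Sum>l\<le>L. of_real (z l) * ?H l \<omega>)"
  have gc: "continuous_on {0..1} (?g l)" for l by (intro continuous_intros)
  have ig2: "integrable radius_measure (\<lambda>r. (?g l r)\<^sup>2)" for l
    using square_integrable_rad[OF gc, of l] by (simp add: square_integrable_def)
  have Zc: "continuous_on (sphere 0 1) Z" unfolding Z_def by (intro continuous_intros)
  have vc: "continuous_on (sphere 0 1) v" by (rule continuous_on_subset[OF v]) auto
  \<comment> \<open>The unknown multiple is eliminated by evaluation at r = 1, which is possible
    because \<open>spherical_bessel l \<kappa>\<close> is not zero.\<close>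
  have radM: "?M l r = ?M l 1 * of_real (?g l r / spherical_bessel l \<kappa>)" if r: "0 \<le> r" "r \<le> 1" for l r
  proof -
    obtain a where a': "\<forall>r\<in>{0..1}. ?M l r = a * of_real (?g l r)"
      using moment_wave_approximable[OF v app j] by blast
    have a: "?M l r = a * of_real (?g l r)" if "0 \<le> r" "r \<le> 1" for r
      using a' that by simp
    have "?M l 1 = a * of_real (spherical_bessel l \<kappa>)" using a[of 1] by simp
    thus ?thesis using a[OF r] j[of l] by simp
  qed
  have siv: "square_integrable (lebesgue_on B1) v" by (rule square_integrable_ball_continuous[OF v])
  note sis = wave_span_square_integrable[OF s]
  have ivs: "integrable (lebesgue_on B1) (\<lambda>x. v x * cnj (s x))"
    by (rule integrable_mult_square_integrable[OF siv square_integrable_cnj[OF sis(1)]])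
  have mvs: "(\<lambda>x. v x * cnj (s x)) \<in> borel_measurable (restrict_space borel B1)"
    by (intro borel_measurable_times borel_measurable_ball[OF v] measurable_compose[OF sis(2)] borel_measurable_continuous_onI continuous_intros)
  have "integral\<^sup>L (lebesgue_on B1) (\<lambda>x. v x * cnj (s x)) =
    integral\<^sup>L radius_measure (\<lambda>r. integral\<^sup>L sphere_measure (\<lambda>\<omega>. v (r *\<^sub>R \<omega>) * cnj (s (r *\<^sub>R \<omega>))))"
    by (rule integral_ball_polar(2)[OF mvs ivs])
  also have "\<dots> = integral\<^sup>L radius_measure (\<lambda>r. \<Sum>l\<le>L. of_real (?g l r) * ?M l r)"
  proof (intro Bochner_Integration.integral_cong refl)
    fix r assume "r \<in> space radius_measure"
    hence r: "0 < r" "r < 1" by auto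
    have int: "integrable sphere_measure (\<lambda>\<omega>. of_real (?g l r) * (v (r *\<^sub>R \<omega>) * cnj (?H l \<omega>)))" for l
      using r by (intro integrable_surf continuous_intros continuous_on_slice[OF v]) auto
    have "integral\<^sup>L sphere_measure (\<lambda>\<omega>. v (r *\<^sub>R \<omega>) * cnj (s (r *\<^sub>R \<omega>))) =
      integral\<^sup>L sphere_measure (\<lambda>\<omega>. \<Sum>l\<le>L. of_real (?g l r) * (v (r *\<^sub>R \<omega>) * cnj (?H l \<omega>)))"
      using r by (intro Bochner_Integration.integral_cong refl) (simp add: sp sum_distrib_left mult_ac)
    also have "\<dots> = (\<Sum>l\<le>L. of_real (?g l r) * ?M l r)"
      using int by (simp add: Bochner_Integration.integral_sum)
    finally show "integral\<^sup>L sphere_measure (\<lambda>\<omega>. v (r *\<^sub>R \<omega>) * cnj (s (r *\<^sub>R \<omega>))) = (\<Sum>l\<le>L. of_real (?g l r) * ?M l r)" .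
  qed
  also have "\<dots> = integral\<^sup>L radius_measure (\<lambda>r. \<Sum>l\<le>L. ?M l 1 / of_real (spherical_bessel l \<kappa>) * of_real ((?g l r)\<^sup>2))"
  proof (intro Bochner_Integration.integral_cong refl sum.cong)
    fix r l assume "r \<in> space radius_measure"
    hence "0 \<le> r" "r \<le> 1" by auto
    from radM[OF this, of l] show "of_real (?g l r) * ?M l r = ?M l 1 / of_real (spherical_bessel l \<kappa>) * of_real ((?g l r)\<^sup>2)"
      by (simp add: power2_eq_square)
  qed
  also have "\<dots> = (\<Sum>l\<le>L. ?M l 1 / of_real (spherical_bessel l \<kappa>) * of_real (I l))"
    using ig2 by (simp add: Bochner_Integration.integral_sum I_def del: of_real_power)
  also have "\<dots> = integral\<^sup>L sphere_measure (\<lambda>\<omega>. v \<omega> * cnj (Z \<omega>))"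
  proof -
    have int: "integrable sphere_measure (\<lambda>\<omega>. of_real (z l) * (v \<omega> * cnj (?H l \<omega>)))" for l
      by (intro integrable_surf continuous_intros vc)
    have "integral\<^sup>L sphere_measure (\<lambda>\<omega>. v \<omega> * cnj (Z \<omega>)) = integral\<^sup>L sphere_measure (\<lambda>\<omega>. \<Sum>l\<le>L. of_real (z l) * (v \<omega> * cnj (?H l \<omega>)))"
      by (intro Bochner_Integration.integral_cong refl) (simp add: Z_def sum_distrib_left mult_ac)
    also have "\<dots> = (\<Sum>l\<le>L. of_real (z l) * ?M l 1)"
      using int by (simp add: Bochner_Integration.integral_sum)
    also have "\<dots> = (\<Sum>l\<le>L. ?M l 1 / of_real (spherical_bessel l \<kappa>) * of_real (I l))"
      by (intro sum.cong refl) (simp add: z_def)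
    finally show ?thesis ..
  qed
  also have "norm \<dots> \<le> l2norm sphere_measure v * l2norm sphere_measure Z"
    using norm_integral_mult_le[OF square_integrable_surf[OF vc] square_integrable_cnj[OF square_integrable_surf[OF Zc]]]
    by simp
  finally have 1: "norm (integral\<^sup>L (lebesgue_on B1) (\<lambda>x. v x * cnj (s x))) \<le> l2norm sphere_measure v * l2norm sphere_measure Z" .
  have I0: "0 \<le> I l" for l by (simp add: I_def)
  \<comment> \<open>The ratio bound gives \<open>I l\<close> at most C^2 times the mass times the
    square of \<open>spherical_bessel l \<kappa>\<close>; one of the two factors \<open>I l\<close>
    in the square of \<open>z l\<close> is estimated in this way, so that no dependence on
    \<open>l\<close> remains in the constant.\<close>
  have zI: "(z l)\<^sup>2 \<le> C\<^sup>2 * measure radius_measure (space radius_measure) * I l" for l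
  proof -
    have "I l \<le> integral\<^sup>L radius_measure (\<lambda>r. (C * spherical_bessel l \<kappa>)\<^sup>2)"
      unfolding I_def
    proof (rule integral_mono[OF ig2])
      fix r assume "r \<in> space radius_measure"
      hence "\<bar>?g l r\<bar> \<le> \<bar>C * spherical_bessel l \<kappa>\<bar>" using C(2)[of r l] C(1) by (simp add: abs_mult)
      thus "(?g l r)\<^sup>2 \<le> (C * spherical_bessel l \<kappa>)\<^sup>2" by (simp add: abs_le_square_iff)
    qed simp
    also have "\<dots> = C\<^sup>2 * measure radius_measure (space radius_measure) * (spherical_bessel l \<kappa>)\<^sup>2"
      by (simp add: power_mult_distrib)
    finally have "I l * I l \<le> C\<^sup>2 * measure radius_measure (space radius_measure) * (spherical_bessel l \<kappa>)\<^sup>2 * I l"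
      by (intro mult_right_mono I0)
    thus ?thesis using j[of l] by (simp add: z_def power_divide power2_eq_square[of "I l"] field_simps)
  qed
  have sn: "(l2norm (lebesgue_on B1) s)\<^sup>2 = (\<Sum>l\<le>L. I l * (l2norm sphere_measure (?H l))\<^sup>2)"
  proof -
    have m: "(\<lambda>x. (norm (s x))\<^sup>2) \<in> borel_measurable (restrict_space borel B1)" using sis(2) by measurable
    have i: "integrable (lebesgue_on B1) (\<lambda>x. (norm (s x))\<^sup>2)" using sis(1) by (simp add: square_integrable_def)
    have "(l2norm (lebesgue_on B1) s)\<^sup>2 = integral\<^sup>L radius_measure (\<lambda>r. integral\<^sup>L sphere_measure (\<lambda>\<omega>. (norm (s (r *\<^sub>R \<omega>)))\<^sup>2))"
      unfolding l2norm_power2 by (rule integral_ball_polar(2)[OF m i])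
    also have "\<dots> = integral\<^sup>L radius_measure (\<lambda>r. \<Sum>l\<le>L. (?g l r)\<^sup>2 * (l2norm sphere_measure (?H l))\<^sup>2)"
    proof (intro Bochner_Integration.integral_cong refl)
      fix r assume r: "r \<in> space radius_measure"
      have "integral\<^sup>L sphere_measure (\<lambda>\<omega>. (norm (s (r *\<^sub>R \<omega>)))\<^sup>2) =
        (l2norm sphere_measure (\<lambda>\<omega>. \<Sum>l\<le>L. of_real (?g l r) * ?H l \<omega>))\<^sup>2"
        unfolding l2norm_power2 using r by (intro Bochner_Integration.integral_cong refl) (simp add: sp)
      thus "integral\<^sup>L sphere_measure (\<lambda>\<omega>. (norm (s (r *\<^sub>R \<omega>)))\<^sup>2) = (\<Sum>l\<le>L. (?g l r)\<^sup>2 * (l2norm sphere_measure (?H l))\<^sup>2)"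
        by (simp only: harmonic_sum_pythagoras)
    qed
    also have "\<dots> = (\<Sum>l\<le>L. I l * (l2norm sphere_measure (?H l))\<^sup>2)"
      using ig2 by (simp add: Bochner_Integration.integral_sum I_def)
    finally show ?thesis .
  qed
  have "l2norm sphere_measure Z \<le> C * sqrt (measure radius_measure (space radius_measure)) * l2norm (lebesgue_on B1) s"
  proof (rule power2_le_imp_le)
    have "(l2norm sphere_measure Z)\<^sup>2 = (\<Sum>l\<le>L. (z l)\<^sup>2 * (l2norm sphere_measure (?H l))\<^sup>2)"
      unfolding Z_def by (rule harmonic_sum_pythagoras)
    also have "\<dots> \<le> (\<Sum>l\<le>L. C\<^sup>2 * measure radius_measure (space radius_measure) * I l * (l2norm sphere_measure (?H l))\<^sup>2)"
      by (intro sum_mono mult_right_mono zI) simp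
    also have "\<dots> = (C * sqrt (measure radius_measure (space radius_measure)) * l2norm (lebesgue_on B1) s)\<^sup>2"
      by (simp add: power_mult_distrib sn sum_distrib_left mult_ac)
    finally show "(l2norm sphere_measure Z)\<^sup>2 \<le> (C * sqrt (measure radius_measure (space radius_measure)) * l2norm (lebesgue_on B1) s)\<^sup>2" .
  qed (use C(1) in simp)
  from order_trans[OF 1 mult_left_mono[OF this l2norm_nonneg[of sphere_measure v]]] show ?thesis
    by (simp only: mult_ac)
qed

text \<open>The squared norm of \<open>v\<close> is its pairing with a nearby finite sum
  \<open>s\<close> plus a small remainder. \<open>ball_pairing_le\<close> bounds the pairing, and as
  \<open>s\<close> approaches \<open>v\<close> one factor of the norm of \<open>v\<close>
  cancels.\<close>

lemma ball_le_sphere: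
  assumes "\<kappa> > 0" "\<And>l. spherical_bessel l \<kappa> \<noteq> 0"
  obtains D where "D > 0"
    "\<And>v. continuous_on (cball 0 1) v \<Longrightarrow> wave_approximable \<kappa> v \<Longrightarrow>
      l2norm (lebesgue_on B1) v \<le> D * l2norm sphere_measure v"
proof -
  obtain C where C0: "C > 0" "\<forall>l. \<forall>r\<in>{0..1}. \<bar>spherical_bessel l (\<kappa> * r)\<bar> \<le> C * \<bar>spherical_bessel l \<kappa>\<bar>"
    using spherical_bessel_ratio_bounded[OF assms] by blast
  have C: "C > 0" "\<And>l r. 0 \<le> r \<Longrightarrow> r \<le> 1 \<Longrightarrow> \<bar>spherical_bessel l (\<kappa> * r)\<bar> \<le> C * \<bar>spherical_bessel l \<kappa>\<bar>"
    using C0 by auto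
  define D where "D = C * sqrt (measure radius_measure (space radius_measure)) + 1"
  have D: "D > 0" unfolding D_def using C(1) by (intro add_nonneg_pos) auto
  show ?thesis
  proof (rule that[OF D])
    fix v assume v: "continuous_on (cball 0 1) v" and app: "wave_approximable \<kappa> v"
    let ?N = "l2norm (lebesgue_on B1)" and ?b = "l2norm sphere_measure v"
    have siv: "square_integrable (lebesgue_on B1) v" by (rule square_integrable_ball_continuous[OF v])
    have "(?N v)\<^sup>2 \<le> D * ?b * ?N v"
    proof (rule field_le_epsilon)
      fix e :: real assume e: "e > 0"
      \<comment> \<open>\<open>q\<close> dominates the two coefficients with which the approximation
        error occurs: \<open>D * ?b\<close> from replacing the norm of \<open>s\<close> by that of
        \<open>v\<close>, and the norm of \<open>v\<close> from the remainder.\<close>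
      define q where "q = D * ?b + ?N v + 1"
      have q: "q > 0" unfolding q_def using D by (intro add_nonneg_pos add_nonneg_nonneg) auto
      obtain s where s: "s \<in> spherical_wave_span \<kappa>" and le: "?N (\<lambda>x. v x - s x) < e / q"
        using app divide_pos_pos[OF e q] unfolding wave_approximable_def by blast
      note sis = wave_span_square_integrable(1)[OF s]
      have sid: "square_integrable (lebesgue_on B1) (\<lambda>x. v x - s x)" by (rule square_integrable_diff[OF siv sis])
      have "square_integrable (lebesgue_on B1) (\<lambda>x. s x - v x)" by (rule square_integrable_diff[OF sis siv])
      from l2norm_triangle[OF this siv] have ns: "?N s \<le> ?N v + ?N (\<lambda>x. v x - s x)"
        by (simp add: l2norm_def norm_minus_commute)
      have "complex_of_real ((?N v)\<^sup>2) = integral\<^sup>L (lebesgue_on B1) (\<lambda>x. v x * cnj (s x) + v x * cnj (v x - s x))"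
        unfolding of_real_l2norm_power2 by (simp add: algebra_simps)
      also have "\<dots> = integral\<^sup>L (lebesgue_on B1) (\<lambda>x. v x * cnj (s x)) + integral\<^sup>L (lebesgue_on B1) (\<lambda>x. v x * cnj (v x - s x))"
        by (intro Bochner_Integration.integral_add integrable_mult_square_integrable siv square_integrable_cnj sis sid)
      finally have "norm (complex_of_real ((?N v)\<^sup>2)) \<le> norm (integral\<^sup>L (lebesgue_on B1) (\<lambda>x. v x * cnj (s x))) + norm (integral\<^sup>L (lebesgue_on B1) (\<lambda>x. v x * cnj (v x - s x)))"
        by (simp only: norm_triangle_ineq)
      hence "(?N v)\<^sup>2 \<le> norm (integral\<^sup>L (lebesgue_on B1) (\<lambda>x. v x * cnj (s x))) + norm (integral\<^sup>L (lebesgue_on B1) (\<lambda>x. v x * cnj (v x - s x)))"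
        by (simp only: norm_of_real abs_power2)
      also have "\<dots> \<le> D * ?b * ?N s + ?N v * ?N (\<lambda>x. v x - s x)"
      proof (rule add_mono)
        have "norm (integral\<^sup>L (lebesgue_on B1) (\<lambda>x. v x * cnj (s x))) \<le> C * sqrt (measure radius_measure (space radius_measure)) * ?b * ?N s"
          by (rule ball_pairing_le[OF v app s assms(2) C])
        also have "\<dots> \<le> D * ?b * ?N s" by (intro mult_right_mono) (simp_all add: D_def)
        finally show "norm (integral\<^sup>L (lebesgue_on B1) (\<lambda>x. v x * cnj (s x))) \<le> D * ?b * ?N s" .
        show "norm (integral\<^sup>L (lebesgue_on B1) (\<lambda>x. v x * cnj (v x - s x))) \<le> ?N v * ?N (\<lambda>x. v x - s x)"
          using norm_integral_mult_le[OF siv square_integrable_cnj[OF sid]] by (simp only: l2norm_cnj)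
      qed
      also have "\<dots> \<le> D * ?b * (?N v + ?N (\<lambda>x. v x - s x)) + ?N v * ?N (\<lambda>x. v x - s x)"
        using ns D by (intro add_right_mono mult_left_mono) auto
      also have "\<dots> \<le> D * ?b * ?N v + q * ?N (\<lambda>x. v x - s x)"
        by (simp add: q_def algebra_simps)
      also have "q * ?N (\<lambda>x. v x - s x) \<le> e" using mult_strict_left_mono[OF le q] q by simp
      finally show "(?N v)\<^sup>2 \<le> D * ?b * ?N v + e" by simp
    qed
    hence sq: "?N v * ?N v \<le> (D * ?b) * ?N v" by (simp only: power2_eq_square)
    show "?N v \<le> D * ?b"
    proof (cases "?N v = 0")
      case True
      thus ?thesis using D by simp
    next
      case False
      hence "?N v > 0" using l2norm_nonneg[of "lebesgue_on B1" v] by linarith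
      thus ?thesis using mult_right_le_imp_le[OF sq] by blast
    qed
  qed
qed

section \<open>The trace inequality\<close>

text \<open>The pointwise differentiability clause of \<open>test_function\<close>, with a complex
  gradient for a complex function of real variables.\<close>

definition grad_at :: "(pt \<Rightarrow> complex) \<Rightarrow> pt \<Rightarrow> complex^3 \<Rightarrow> bool" where
  "grad_at f x g \<longleftrightarrow> (f has_derivative (\<lambda>h. \<Sum>i\<in>UNIV. of_real (h $ i) * g $ i)) (at x)"

lemma sum_axis_mult: "(\<Sum>j\<in>UNIV. of_real ((axis i 1 :: pt) $ j) * (g :: complex^3) $ j) = g $ i"
proof -
  have "(\<Sum>j\<in>UNIV. of_real ((axis i 1 :: pt) $ j) * g $ j) = (\<Sum>j\<in>UNIV. if j = i then g $ j else 0)"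
    by (intro sum.cong) (auto simp: axis_def)
  thus ?thesis by simp
qed

lemma grad_at_unique: "grad_at f x g \<Longrightarrow> grad_at f x g' \<Longrightarrow> g = g'"
proof -
  assume "grad_at f x g" "grad_at f x g'"
  from has_derivative_unique[OF this[unfolded grad_at_def]]
  have "(\<Sum>j\<in>UNIV. of_real ((axis i 1 :: pt) $ j) * g $ j) = (\<Sum>j\<in>UNIV. of_real ((axis i 1 :: pt) $ j) * g' $ j)" for i
    by metis
  thus "g = g'" by (simp add: sum_axis_mult Finite_Cartesian_Product.vec_eq_iff)
qed

lemma grad_at_zero: "open A \<Longrightarrow> x \<in> A \<Longrightarrow> (\<And>y. y \<in> A \<Longrightarrow> f y = 0) \<Longrightarrow> grad_at f x 0"
  unfolding grad_at_def
  by (rule has_derivative_transform_within_open[of "\<lambda>_. 0"]) auto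

lemma grad_at_const: "grad_at (\<lambda>_. c) x 0"
  by (simp add: grad_at_def)

lemma grad_at_add: "grad_at f x g \<Longrightarrow> grad_at f' x g' \<Longrightarrow> grad_at (\<lambda>x. f x + f' x) x (g + g')"
  unfolding grad_at_def by (rule has_derivative_eq_rhs, erule (1) has_derivative_add)
    (simp add: algebra_simps sum.distrib)

lemma grad_at_mult:
  "grad_at f x g \<Longrightarrow> grad_at f' x g' \<Longrightarrow> grad_at (\<lambda>x. f x * f' x) x (\<chi> i. f x * g' $ i + f' x * g $ i)"
  unfolding grad_at_def by (rule has_derivative_eq_rhs, erule (1) has_derivative_mult)
    (simp add: algebra_simps sum.distrib sum_distrib_left)

lemma grad_at_coord: "grad_at (\<lambda>x. of_real (x $ i)) x (axis i 1)"
proof -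
  have "((\<lambda>x::pt. complex_of_real (x $ i)) has_derivative (\<lambda>h. of_real (h $ i))) (at x)"
    by (intro has_derivative_of_real has_derivative_nth)
  moreover have "(\<lambda>h::pt. \<Sum>j\<in>UNIV. of_real (h $ j) * (axis i 1 :: complex^3) $ j) = (\<lambda>h. of_real (h $ i))"
  proof
    fix h :: pt
    have "(\<Sum>j\<in>UNIV. of_real (h $ j) * (axis i 1 :: complex^3) $ j) = (\<Sum>j\<in>UNIV. if j = i then of_real (h $ j) else 0)"
      by (intro sum.cong) (auto simp: axis_def)
    thus "(\<Sum>j\<in>UNIV. of_real (h $ j) * (axis i 1 :: complex^3) $ j) = of_real (h $ i)" by simp
  qed
  ultimately show ?thesis by (simp add: grad_at_def)
qed

lemma grad_at_of_real_comp:
  assumes R: "(R has_real_derivative R') (at (q x))" and q: "(q has_derivative (\<lambda>h. \<Sum>i\<in>UNIV. h $ i * g $ i)) (at x)"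
  shows "grad_at (\<lambda>x. of_real (R (q x))) x (\<chi> i. of_real (R' * g $ i))"
proof -
  have "((\<lambda>x. R (q x)) has_derivative (\<lambda>h. R' * (\<Sum>i\<in>UNIV. h $ i * g $ i))) (at x)"
    using has_derivative_compose[OF q, of R "(*) R'"] R by (simp add: has_field_derivative_def)
  from has_derivative_of_real[OF this] show ?thesis
    unfolding grad_at_def by (rule has_derivative_eq_rhs) (simp add: sum_distrib_left mult_ac)
qed

lemma grad_at_radial:
  assumes "(R has_real_derivative R') (at (norm x))" "x \<noteq> 0"
  shows "grad_at (\<lambda>x. of_real (R (norm x))) x (\<chi> i. of_real (R' * (x $ i / norm x)))"
proof -
  have "(norm has_derivative (\<lambda>h. \<Sum>i\<in>UNIV. h $ i * (\<chi> i. x $ i / norm x) $ i)) (at x)"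
    by (rule has_derivative_eq_rhs[OF has_derivative_norm[OF assms(2)]])
       (simp add: inner_vec_def sgn_div_norm divide_inverse mult_ac sum_distrib_left fun_eq_iff)
  from grad_at_of_real_comp[OF _ this, of R R'] assms(1) show ?thesis by simp
qed

lemma grad_at_square:
  assumes "(R has_real_derivative R') (at (inner x x))"
  shows "grad_at (\<lambda>x. of_real (R (inner x x))) x (\<chi> i. of_real (R' * (2 * x $ i)))"
proof -
  have "((\<lambda>x::pt. inner x x) has_derivative (\<lambda>h. \<Sum>i\<in>UNIV. h $ i * (\<chi> i. 2 * x $ i) $ i)) (at x)"
    by (rule has_derivative_eq_rhs[OF has_derivative_inner[OF has_derivative_ident has_derivative_ident]])
       (simp add: inner_vec_def algebra_simps sum.distrib[symmetric] fun_eq_iff)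
  from grad_at_of_real_comp[OF _ this, of R R'] assms show ?thesis by simp
qed

lemma test_function_D_zero:
  assumes "test_function \<phi> D" "compact K" "\<And>x. x \<notin> K \<Longrightarrow> \<phi> x = 0" "x \<notin> K"
  shows "D x = 0"
proof -
  have "grad_at \<phi> x (D x)" using assms(1) by (simp add: test_function_def grad_at_def)
  moreover have "grad_at \<phi> x 0"
    by (rule grad_at_zero[of "- K"]) (use assms in \<open>auto intro: open_Compl compact_imp_closed\<close>)
  ultimately show ?thesis by (rule grad_at_unique)
qed

text \<open>A gradient formula known only on the open set \<open>U\<close> is glued with the zero
  function off \<open>K\<close>. The two open sets cover the space and the gradients agree on the
  overlap by uniqueness.\<close>

lemma test_functionI:
  assumes K: "compact K" "K \<subseteq> B1" "K \<subseteq> U" and U: "open U" and z: "\<And>x. x \<notin> K \<Longrightarrow> f x = 0"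
    and g: "\<And>x. x \<in> U \<Longrightarrow> grad_at f x (D x)" and c: "continuous_on U D"
  shows "test_function f (\<lambda>x. if x \<in> U then D x else 0)"
proof -
  let ?D = "\<lambda>x. if x \<in> U then D x else 0"
  have Kc: "open (- K)" using K(1) by (simp add: compact_imp_closed open_Compl)
  have g0: "grad_at f x 0" if "x \<notin> K" for x
    by (rule grad_at_zero[OF Kc]) (use that z in auto)
  have "grad_at f x (?D x)" for x
    using g[of x] g0[of x] K(3) by auto
  moreover have "continuous_on (U \<union> - K) ?D"
  proof (rule continuous_on_open_Un[OF U Kc])
    show "continuous_on U ?D" using c by simp
    have "0 = ?D x" if "x \<in> - K" for x
      using grad_at_unique[OF g g0, of x] that by auto
    thus "continuous_on (- K) ?D" by (rule continuous_on_eq[OF continuous_on_const])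
  qed
  moreover have "U \<union> - K = UNIV" using K(3) by auto
  ultimately show ?thesis
    unfolding test_function_def grad_at_def using K z by auto
qed

section \<open>Piecewise quadratic cutoff functions\<close>

definition pos_sq :: "real \<Rightarrow> real" where "pos_sq t = (max 0 t)\<^sup>2"

lemma pos_sq_simps [simp]: "t \<le> 0 \<Longrightarrow> pos_sq t = 0" "0 \<le> t \<Longrightarrow> pos_sq t = t\<^sup>2" "0 \<le> pos_sq t"
  by (auto simp: pos_sq_def max_def)

lemma has_real_derivative_pos_sq: "(pos_sq has_real_derivative 2 * max 0 t) (at t)"
proof -
  consider "t < 0" | "t = 0" | "t > 0" by linarith
  thus ?thesis
  proof cases
    case 1
    have "((\<lambda>_. 0) has_real_derivative 2 * max 0 t) (at t)" using 1 by simp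
    thus ?thesis
      by (rule has_field_derivative_transform_within_open[where S="{..<0}"]) (use 1 in auto)
  next
    case 2
    have "((\<lambda>h. (pos_sq (0 + h) - pos_sq 0) / h) \<longlongrightarrow> 0) (at 0)"
    proof (rule Lim_null_comparison)
      show "\<forall>\<^sub>F h in at 0. norm ((pos_sq (0 + h) - pos_sq 0) / h) \<le> \<bar>h\<bar>"
        by (intro always_eventually allI) (auto simp: pos_sq_def max_def power2_eq_square)
      show "((\<lambda>h. \<bar>h\<bar>) \<longlongrightarrow> (0::real)) (at 0)" by (rule tendsto_rabs_zero) (rule tendsto_ident_at)
    qed
    thus ?thesis using 2 by (simp add: DERIV_def)
  next
    case 3
    have "((\<lambda>t. t\<^sup>2) has_real_derivative 2 * max 0 t) (at t)"
      using 3 by (auto intro!: derivative_eq_intros simp: max_def)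
    thus ?thesis
      by (rule has_field_derivative_transform_within_open[where S="{0<..}"]) (use 3 in auto)
  qed
qed

lemma continuous_on_pos_sq [continuous_intros]: "continuous_on A f \<Longrightarrow> continuous_on A (\<lambda>x. pos_sq (f x))"
  unfolding pos_sq_def by (intro continuous_intros)

text \<open>Equal to 1 up to 1 - 2a and to 0 from 1 - a on, the inner quotient running from 0 to 1
  between them. Composing the positive part squared with itself is enough because test functions
  need only be continuously differentiable.\<close>

definition cutoff :: "real \<Rightarrow> real \<Rightarrow> real" where
  "cutoff a r = pos_sq (1 - pos_sq ((r - 1 + 2 * a) / a))"

definition cutoff' :: "real \<Rightarrow> real \<Rightarrow> real" where
  "cutoff' a r = - (4 / a * max 0 (1 - pos_sq ((r - 1 + 2 * a) / a)) * max 0 ((r - 1 + 2 * a) / a))"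

lemma has_real_derivative_cutoff:
  assumes "a > 0"
  shows "(cutoff a has_real_derivative cutoff' a r) (at r)"
proof -
  let ?s = "\<lambda>r. (r - 1 + 2 * a) / a"
  have s: "(?s has_real_derivative 1 / a) (at r)" using assms by (auto intro!: derivative_eq_intros)
  have "((\<lambda>r. 1 - pos_sq (?s r)) has_real_derivative 0 - 2 * max 0 (?s r) * (1 / a)) (at r)"
    by (intro DERIV_diff DERIV_const DERIV_chain2[OF has_real_derivative_pos_sq s])
  from DERIV_chain2[OF has_real_derivative_pos_sq this] show ?thesis
    unfolding cutoff_def[abs_def] cutoff'_def by (rule DERIV_cong) simp
qed

lemma cutoff_props:
  assumes "a > 0"
  shows "0 \<le> cutoff a r" "cutoff a r \<le> 1" "r \<le> 1 - 2 * a \<Longrightarrow> cutoff a r = 1" "1 - a \<le> r \<Longrightarrow> cutoff a r = 0"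
    "cutoff' a r \<le> 0" "r \<le> 1 - 2 * a \<Longrightarrow> cutoff' a r = 0" "1 - a \<le> r \<Longrightarrow> cutoff' a r = 0"
    "\<bar>cutoff' a r\<bar> \<le> 4 / a"
proof -
  let ?s = "(r - 1 + 2 * a) / a"
  show "0 \<le> cutoff a r" by (simp add: cutoff_def)
  show "cutoff a r \<le> 1" by (simp add: cutoff_def pos_sq_def[of "1 - _"] power_le_one)
  have lo: "?s \<le> 0" if "r \<le> 1 - 2 * a" using that assms by (simp add: divide_nonpos_pos)
  show "cutoff a r = 1" "cutoff' a r = 0" if "r \<le> 1 - 2 * a"
    using lo[OF that] by (simp_all add: cutoff_def cutoff'_def max_def)
  have hi: "1 \<le> pos_sq ?s" if "1 - a \<le> r"
  proof -
    have "1 \<le> ?s" using that assms by simp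
    thus ?thesis by simp
  qed
  show "cutoff a r = 0" "cutoff' a r = 0" if "1 - a \<le> r"
    using hi[OF that] by (simp_all add: cutoff_def cutoff'_def max_def)
  show "cutoff' a r \<le> 0" using assms by (simp add: cutoff'_def)
  \<comment> \<open>For ?s \<le> 1 both factors are at most 1; beyond that the first one is
    zero.\<close>
  have "max 0 (1 - pos_sq ?s) * max 0 ?s \<le> 1"
  proof (cases "?s \<le> 1")
    case True
    thus ?thesis by (intro mult_le_one) auto
  next
    case False
    hence "1 \<le> pos_sq ?s" by simp
    thus ?thesis by (simp add: max_def)
  qed
  from mult_left_mono[OF this, of "4 / a"] assms show "\<bar>cutoff' a r\<bar> \<le> 4 / a"
    by (simp add: cutoff'_def abs_mult mult.assoc)
qed

lemma continuous_on_cutoff [continuous_intros]: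
  "continuous_on A f \<Longrightarrow> continuous_on A (\<lambda>x. cutoff a (f x))"
  "continuous_on A f \<Longrightarrow> continuous_on A (\<lambda>x. cutoff' a (f x))"
  unfolding cutoff_def cutoff'_def divide_inverse by (intro continuous_intros; assumption)+

section \<open>Continuously differentiable functions, mostly on the complement of the origin\<close>

definition c1_on :: "pt set \<Rightarrow> (pt \<Rightarrow> complex) \<Rightarrow> bool" where
  "c1_on U f \<longleftrightarrow> (\<exists>D. continuous_on U D \<and> (\<forall>x\<in>U. grad_at f x (D x)))"

lemma grad_at_continuous: "grad_at f x g \<Longrightarrow> isCont f x"
  unfolding grad_at_def by (rule has_derivative_continuous)

lemma c1_on_continuous: "c1_on U f \<Longrightarrow> continuous_on U f"
  unfolding c1_on_def by (meson grad_at_continuous continuous_at_imp_continuous_on)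

lemma c1_on_const: "c1_on U (\<lambda>_. c)"
  unfolding c1_on_def using grad_at_const continuous_on_const by blast

lemma c1_on_add:
  assumes "c1_on U f" "c1_on U g"
  shows "c1_on U (\<lambda>x. f x + g x)"
proof -
  obtain D where D: "continuous_on U D" "\<And>x. x \<in> U \<Longrightarrow> grad_at f x (D x)" using assms(1) by (auto simp: c1_on_def)
  obtain E where E: "continuous_on U E" "\<And>x. x \<in> U \<Longrightarrow> grad_at g x (E x)" using assms(2) by (auto simp: c1_on_def)
  have "continuous_on U (\<lambda>x. D x + E x)" by (intro continuous_intros D E)
  thus ?thesis unfolding c1_on_def using grad_at_add[OF D(2) E(2)] by blast
qed

lemma c1_on_mult:
  assumes "c1_on U f" "c1_on U g"
  shows "c1_on U (\<lambda>x. f x * g x)"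
proof -
  obtain D where D: "continuous_on U D" "\<And>x. x \<in> U \<Longrightarrow> grad_at f x (D x)" using assms(1) by (auto simp: c1_on_def)
  obtain E where E: "continuous_on U E" "\<And>x. x \<in> U \<Longrightarrow> grad_at g x (E x)" using assms(2) by (auto simp: c1_on_def)
  have "continuous_on U (\<lambda>x. \<chi> i. f x * E x $ i + g x * D x $ i)"
    by (intro continuous_intros continuous_on_vec_lambda c1_on_continuous assms D(1) E(1))
  thus ?thesis unfolding c1_on_def using grad_at_mult[OF D(2) E(2)] by blast
qed

lemma c1_on_sum: "(\<And>i. i \<in> I \<Longrightarrow> c1_on U (f i)) \<Longrightarrow> c1_on U (\<lambda>x. \<Sum>i\<in>I. f i x)"
  by (induction I rule: infinite_finite_induct) (auto intro: c1_on_const c1_on_add)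

lemma c1_on_coord: "c1_on U (\<lambda>x. of_real (x $ i))"
  unfolding c1_on_def using grad_at_coord continuous_on_const by blast

lemma c1_on_radial:
  assumes "\<And>r. r > 0 \<Longrightarrow> (R has_real_derivative R' r) (at r)" "continuous_on {0<..} R'"
  shows "c1_on (- {0}) (\<lambda>x. of_real (R (norm x)))"
proof -
  have "continuous_on (- {0::pt}) (\<lambda>x. R' (norm x))"
    by (rule continuous_on_compose2[OF assms(2)]) (auto intro!: continuous_intros)
  hence "continuous_on (- {0::pt}) (\<lambda>x. \<chi> i. complex_of_real (R' (norm x) * (x $ i / norm x)))"
    by (intro continuous_on_vec_lambda continuous_intros) auto
  moreover have "grad_at (\<lambda>x. of_real (R (norm x))) x (\<chi> i. of_real (R' (norm x) * (x $ i / norm x)))" if "x \<in> - {0}" for x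
    using that by (intro grad_at_radial assms) auto
  ultimately show ?thesis unfolding c1_on_def by blast
qed

lemma c1_on_inverse_norm: "c1_on (- {0}) (\<lambda>x. of_real (inverse (norm x)))"
  by (rule c1_on_radial[of inverse "\<lambda>r. - (inverse r * inverse r)"])
     (auto intro!: continuous_intros derivative_eq_intros)

text \<open>Polynomials on the sphere, extended homogeneously of degree 0, are smooth enough for
  test fields, and by Stone-Weierstrass there are enough of them to reach every continuous function
  on the sphere.\<close>

lemma c1_on_polynomial_direction:
  assumes "real_polynomial_function p"
  shows "c1_on (- {0}) (\<lambda>x. of_real (p (x /\<^sub>R norm x)))"
  using assms
proof induction
  case (linear f)
  have "complex_of_real (f (x /\<^sub>R norm x)) = (\<Sum>i\<in>UNIV. of_real (f (axis i 1)) * (of_real (x $ i) * of_real (inverse (norm x))))" for x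
  proof -
    interpret bounded_linear f by (rule linear)
    have "f x = f (\<Sum>i\<in>UNIV. x $ i *\<^sub>R axis i 1)"
      using basis_expansion[of x] by (simp add: scalar_mult_eq_scaleR)
    also have "\<dots> = (\<Sum>i\<in>UNIV. x $ i * f (axis i 1))" by (simp add: sum scaleR)
    finally show ?thesis by (simp add: scaleR sum_distrib_left mult_ac)
  qed
  thus ?case by (simp only:) (intro c1_on_sum c1_on_mult c1_on_const c1_on_coord c1_on_inverse_norm)
next
  case (const c)
  show ?case by (rule c1_on_const)
next
  case (add f g)
  thus ?case by (simp add: c1_on_add)
next
  case (mult f g)
  thus ?case by (simp add: c1_on_mult)
qed

lemma integral_rad_eq_HK:
  fixes f :: "real \<Rightarrow> 'b::euclidean_space"
  assumes c: "continuous_on {0..1} f"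
  shows "integral\<^sup>L radius_measure f = integral {0..1} (\<lambda>r. r\<^sup>2 *\<^sub>R f r)"
proof -
  let ?g = "\<lambda>r. r\<^sup>2 *\<^sub>R f r"
  have "set_integrable lborel {0..1} ?g"
    unfolding set_integrable_def by (rule borel_integrable_compact) (use c in \<open>auto intro!: continuous_intros\<close>)
  hence s: "set_integrable lborel {0<..<1} ?g" by (rule set_integrable_subset) auto
  have m: "f \<in> borel_measurable (restrict_space lborel {0<..<1})"
  proof -
    have "continuous_on {0<..<1} f" by (rule continuous_on_subset[OF c]) auto
    from borel_measurable_continuous_on_restrict[OF this] show ?thesis
      by (subst measurable_cong_sets[of _ "restrict_space borel {0<..<1}"]) (auto simp: sets_restrict_space)
  qed
  have "integral\<^sup>L radius_measure f = set_lebesgue_integral lborel {0<..<1} ?g"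
    unfolding radius_measure_def set_lebesgue_integral_def
    by (subst integral_density)
       (use m in \<open>auto simp: integral_restrict_space intro!: measurable_restrict_space1\<close>)
  also have "\<dots> = integral {0..1} ?g"
    using set_borel_integral_eq_integral(2)[OF s] integral_open_interval_real[of 0 1 ?g] by simp
  finally show ?thesis .
qed

lemma square_integrable_component:
  fixes g :: "'a \<Rightarrow> complex^3"
  assumes "square_integrable M g"
  shows "square_integrable M (\<lambda>x. g x $ i)" "l2norm M (\<lambda>x. g x $ i) \<le> l2norm M g"
proof -
  have m: "(\<lambda>x. g x $ i) \<in> borel_measurable M"
    by (rule measurable_compose[OF square_integrable_measurable[OF assms]])
       (intro borel_measurable_continuous_onI continuous_intros)
  have ig: "integrable M (\<lambda>x. (norm (g x))\<^sup>2)" using assms by (simp add: square_integrable_def)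
  have le: "(norm (g x $ i))\<^sup>2 \<le> (norm (g x))\<^sup>2" for x
    by (intro power_mono Finite_Cartesian_Product.norm_nth_le) simp
  have i: "integrable M (\<lambda>x. (norm (g x $ i))\<^sup>2)"
  proof (rule Bochner_Integration.integrable_bound[OF ig])
    show "(\<lambda>x. (norm (g x $ i))\<^sup>2) \<in> borel_measurable M" using m by measurable
    show "AE x in M. norm ((norm (g x $ i))\<^sup>2) \<le> norm ((norm (g x))\<^sup>2)"
      using le by (intro AE_I2) simp
  qed
  show "square_integrable M (\<lambda>x. g x $ i)" using m i by (simp add: square_integrable_def)
  show "l2norm M (\<lambda>x. g x $ i) \<le> l2norm M g"
    unfolding l2norm_def by (intro real_sqrt_le_mono integral_mono i ig le)
qed

definition radial_ext :: "(pt \<Rightarrow> complex) \<Rightarrow> (real \<Rightarrow> real) \<Rightarrow> pt \<Rightarrow> complex" where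
  "radial_ext \<psi> \<tau> x = \<psi> (x /\<^sub>R norm x) * of_real (\<tau> (norm x))"

lemma radial_ext_polar: "norm \<omega> = 1 \<Longrightarrow> r > 0 \<Longrightarrow> radial_ext \<psi> \<tau> (r *\<^sub>R \<omega>) = \<psi> \<omega> * of_real (\<tau> r)"
  by (simp add: radial_ext_def)

text \<open>Testing the weak gradient with the radial field \<open>x F(x)\<close>, where \<open>F\<close> is homogeneous of degree \<open>0\<close> up to
  a radial factor: its divergence involves no tangential derivative of \<open>\<psi>\<close>.\<close>

lemma weak_gradient_radial:
  assumes w: "has_weak_gradient v g" and v: "continuous_on (cball 0 1) v"
    and \<psi>: "c1_on (- {0}) (\<lambda>x. \<psi> (x /\<^sub>R norm x))"
    and \<tau>: "\<And>r. (\<tau> has_real_derivative \<tau>' r) (at r)" "continuous_on UNIV \<tau>'"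
    and a: "a > 0" and \<tau>0: "\<And>r. r \<le> 1/4 \<Longrightarrow> \<tau> r = 0" "\<And>r. 1 - a \<le> r \<Longrightarrow> \<tau> r = 0"
  shows "continuous_on (cball 0 1) (\<lambda>x. v x * radial_ext \<psi> (\<lambda>r. 3 * \<tau> r + r * \<tau>' r) x)"
    and "continuous_on UNIV (\<lambda>x. of_real (x $ i) * radial_ext \<psi> \<tau> x)"
    and "integral\<^sup>L (lebesgue_on B1) (\<lambda>x. v x * radial_ext \<psi> (\<lambda>r. 3 * \<tau> r + r * \<tau>' r) x)
      = - (\<Sum>i\<in>UNIV. integral\<^sup>L (lebesgue_on B1) (\<lambda>x. g x $ i * (of_real (x $ i) * radial_ext \<psi> \<tau> x)))"
proof -
  let ?F = "radial_ext \<psi> \<tau>"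
  let ?U = "- {0::pt}"
  have "c1_on ?U ?F" unfolding radial_ext_def[abs_def]
    using \<tau> by (intro c1_on_mult \<psi> c1_on_radial[of \<tau> \<tau>']) (auto elim: continuous_on_subset)
  then obtain G where G: "continuous_on ?U G" "\<And>x. x \<in> ?U \<Longrightarrow> grad_at ?F x (G x)" by (auto simp: c1_on_def)
  \<comment> \<open>The derivative in direction \<open>x\<close> is computed along the ray through
    \<open>x\<close>, where the factor \<psi> is constant; no formula for the tangential part of
    \<open>G\<close> has to be known.\<close>
  have radial: "(\<Sum>i\<in>UNIV. of_real (x $ i) * G x $ i) = \<psi> (x /\<^sub>R norm x) * of_real (norm x * \<tau>' (norm x))" if x: "x \<noteq> 0" for x
  proof -
    have "((\<lambda>t. t *\<^sub>R x) has_derivative (\<lambda>t. t *\<^sub>R x)) (at (1::real))"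
      by (auto intro!: derivative_eq_intros)
    moreover have "(?F has_derivative (\<lambda>h. \<Sum>i\<in>UNIV. of_real (h $ i) * G x $ i)) (at (1 *\<^sub>R x))"
      using G(2)[of x] x by (simp add: grad_at_def)
    ultimately have "((\<lambda>t. ?F (t *\<^sub>R x)) has_derivative (\<lambda>t. \<Sum>i\<in>UNIV. of_real ((t *\<^sub>R x) $ i) * G x $ i)) (at (1::real))"
      by (rule has_derivative_compose)
    hence 1: "((\<lambda>t. ?F (t *\<^sub>R x)) has_vector_derivative (\<Sum>i\<in>UNIV. of_real (x $ i) * G x $ i)) (at (1::real))"
      unfolding has_vector_derivative_def
      by (rule has_derivative_eq_rhs) (simp add: fun_eq_iff scaleR_conv_of_real[where 'a=complex] mult.assoc sum_distrib_left[symmetric])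
    have "((\<lambda>t. \<tau> (t * norm x)) has_real_derivative \<tau>' (1 * norm x) * norm x) (at 1)"
      by (rule DERIV_chain2[OF \<tau>(1)]) (auto intro!: derivative_eq_intros)
    hence hv: "((\<lambda>t. \<psi> (x /\<^sub>R norm x) * of_real (\<tau> (t * norm x))) has_vector_derivative \<psi> (x /\<^sub>R norm x) * of_real (norm x * \<tau>' (norm x))) (at 1)"
      by (auto intro!: derivative_eq_intros simp: has_real_derivative_iff_has_vector_derivative mult.commute)
    have tr: "\<psi> (x /\<^sub>R norm x) * of_real (\<tau> (t * norm x)) = ?F (t *\<^sub>R x)" if "t > 0" for t
    proof -
      have "inverse (t * norm x) * t = inverse (norm x)" using that by (simp add: field_simps)
      hence e: "(t *\<^sub>R x) /\<^sub>R norm (t *\<^sub>R x) = x /\<^sub>R norm x" using that by (simp only: scaleR_scaleR norm_scaleR abs_of_pos)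
      show ?thesis unfolding radial_ext_def e using that by simp
    qed
    have "((\<lambda>t. ?F (t *\<^sub>R x)) has_vector_derivative \<psi> (x /\<^sub>R norm x) * of_real (norm x * \<tau>' (norm x))) (at 1)"
      by (rule has_vector_derivative_transform_within_open[OF hv, of "{0<..}"]) (use tr in auto)
    from vector_derivative_unique_at[OF 1 this] show ?thesis .
  qed
  \<comment> \<open>A closed shell: \<tau> vanishes near the origin, where the direction is
    undefined, and near the boundary.\<close>
  define K where "K = cball (0::pt) (1 - a) - ball 0 (1/4)"
  have K: "compact K" "K \<subseteq> B1" "K \<subseteq> ?U" using a unfolding K_def by (auto intro!: compact_diff)
  define D where "D i x = (\<chi> j. of_real (x $ i) * G x $ j + ?F x * axis i 1 $ j)" for i x
  have Fz: "?F x = 0" if "x \<notin> K" for x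
    using that \<tau>0[of "norm x"] unfolding K_def radial_ext_def by auto
  have tf: "test_function (\<lambda>x. of_real (x $ i) * ?F x) (\<lambda>x. if x \<in> ?U then D i x else 0)" for i
  proof (rule test_functionI[OF K])
    show "open ?U" by (rule open_Compl[OF closed_singleton])
    show "of_real (x $ i) * ?F x = 0" if "x \<notin> K" for x using Fz[OF that] by simp
    show "grad_at (\<lambda>x. of_real (x $ i) * ?F x) x (D i x)" if "x \<in> ?U" for x
      unfolding D_def by (rule grad_at_mult[OF grad_at_coord G(2)[OF that]])
    have "continuous_on ?U ?F" using G(2) by (meson grad_at_continuous continuous_at_imp_continuous_on)
    thus "continuous_on ?U (D i)"
      unfolding D_def[abs_def] by (intro continuous_on_vec_lambda continuous_intros G(1))
  qed
  have D'c: "continuous_on A (\<lambda>x. if x \<in> ?U then D i x else 0)" for A i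
    using tf[of i] unfolding test_function_def by (meson continuous_on_subset subset_UNIV)
  \<comment> \<open>The divergence of \<open>x F(x)\<close> is 3 F plus the radial derivative, 3
    being the dimension.\<close>
  have div: "(\<Sum>i\<in>UNIV. (if x \<in> ?U then D i x else 0) $ i) = radial_ext \<psi> (\<lambda>r. 3 * \<tau> r + r * \<tau>' r) x" for x
  proof (cases "x = 0")
    case False
    have "(\<Sum>i\<in>UNIV. D i x $ i) = (\<Sum>i\<in>UNIV. of_real (x $ i) * G x $ i) + 3 * ?F x"
      unfolding D_def by (simp add: sum.distrib axis_def)
    thus ?thesis using False radial[OF False] by (simp add: radial_ext_def algebra_simps)
  next
    case True
    thus ?thesis using \<tau>0(1)[of 0] by (simp add: radial_ext_def)
  qed
  show fc: "continuous_on UNIV (\<lambda>x. of_real (x $ i) * ?F x)" for i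
    using tf[of i] unfolding test_function_def by (meson has_derivative_continuous continuous_at_imp_continuous_on)
  have vD: "continuous_on (cball 0 1) (\<lambda>x. v x * (if x \<in> ?U then D i x else 0) $ i)" for i
    by (intro continuous_intros v D'c)
  have eq: "v x * radial_ext \<psi> (\<lambda>r. 3 * \<tau> r + r * \<tau>' r) x = (\<Sum>i\<in>UNIV. v x * (if x \<in> ?U then D i x else 0) $ i)" for x
    unfolding div[symmetric] by (rule sum_distrib_left)
  show "continuous_on (cball 0 1) (\<lambda>x. v x * radial_ext \<psi> (\<lambda>r. 3 * \<tau> r + r * \<tau>' r) x)"
    unfolding eq by (intro continuous_on_sum vD)
  have iD: "integrable (lebesgue_on B1) (\<lambda>x. v x * (if x \<in> ?U then D i x else 0) $ i)" for i
  proof (intro integrable_mult_square_integrable square_integrable_ball_continuous v)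
    show "continuous_on (cball 0 1) (\<lambda>x. (if x \<in> ?U then D i x else 0) $ i)"
      by (intro continuous_on_component D'c)
  qed
  have "integral\<^sup>L (lebesgue_on B1) (\<lambda>x. v x * radial_ext \<psi> (\<lambda>r. 3 * \<tau> r + r * \<tau>' r) x)
     = (\<Sum>i\<in>UNIV. integral\<^sup>L (lebesgue_on B1) (\<lambda>x. v x * (if x \<in> ?U then D i x else 0) $ i))"
    unfolding eq using iD by (rule Bochner_Integration.integral_sum)
  also have "\<dots> = (\<Sum>i\<in>UNIV. - integral\<^sup>L (lebesgue_on B1) (\<lambda>x. g x $ i * (of_real (x $ i) * ?F x)))"
    using w tf unfolding has_weak_gradient_def by (intro sum.cong refl) blast
  also have "\<dots> = - (\<Sum>i\<in>UNIV. integral\<^sup>L (lebesgue_on B1) (\<lambda>x. g x $ i * (of_real (x $ i) * ?F x)))"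
    by (rule sum_negf)
  finally show "integral\<^sup>L (lebesgue_on B1) (\<lambda>x. v x * radial_ext \<psi> (\<lambda>r. 3 * \<tau> r + r * \<tau>' r) x)
      = - (\<Sum>i\<in>UNIV. integral\<^sup>L (lebesgue_on B1) (\<lambda>x. g x $ i * (of_real (x $ i) * ?F x)))" .
qed

text \<open>On the ball both the coordinate and \<tau> are at most 1 in modulus, so each sphere
  contributes at most the squared norm of \<psi>.\<close>

lemma l2norm_radial_field_le:
  assumes c: "continuous_on UNIV (\<lambda>x. of_real (x $ i) * radial_ext \<psi> \<tau> x)"
    and \<psi>: "continuous_on (sphere 0 1) \<psi>" and \<tau>: "\<And>r. r \<in> {0<..<1} \<Longrightarrow> \<bar>\<tau> r\<bar> \<le> 1"
  shows "l2norm (lebesgue_on B1) (\<lambda>x. of_real (x $ i) * radial_ext \<psi> \<tau> x) \<le> sqrt (measure radius_measure (space radius_measure)) * l2norm sphere_measure \<psi>"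
proof (rule power2_le_imp_le)
  interpret sphere_measure: finite_measure sphere_measure by (rule finite_measure_surf)
  interpret radius_measure: finite_measure radius_measure by (rule finite_measure_rad)
  interpret pair_sigma_finite radius_measure sphere_measure ..
  let ?f = "\<lambda>x. complex_of_real (x $ i) * radial_ext \<psi> \<tau> x"
  have c': "continuous_on A ?f" for A using continuous_on_subset[OF c] by blast
  have si: "square_integrable (lebesgue_on B1) ?f" by (rule square_integrable_ball_continuous[OF c'])
  have m: "(\<lambda>x. (norm (?f x))\<^sup>2) \<in> borel_measurable (restrict_space borel B1)"
    by (intro borel_measurable_continuous_on_restrict continuous_intros c')
  have int: "integrable (lebesgue_on B1) (\<lambda>x. (norm (?f x))\<^sup>2)" using si by (simp add: square_integrable_def)
  note pol = integral_ball_polar[OF m int]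
  have ir: "integrable radius_measure (\<lambda>r. integral\<^sup>L sphere_measure (\<lambda>\<omega>. (norm (?f (r *\<^sub>R \<omega>)))\<^sup>2))"
    using integrable_fst'[OF pol(1)] by simp
  have le: "integral\<^sup>L sphere_measure (\<lambda>\<omega>. (norm (?f (r *\<^sub>R \<omega>)))\<^sup>2) \<le> (l2norm sphere_measure \<psi>)\<^sup>2" if r: "r \<in> space radius_measure" for r
    unfolding l2norm_power2
  proof (rule integral_mono)
    show "integrable sphere_measure (\<lambda>\<omega>. (norm (?f (r *\<^sub>R \<omega>)))\<^sup>2)"
      using r by (intro integrable_surf continuous_on_slice[of "\<lambda>x. (norm (?f x))\<^sup>2"] continuous_intros c') auto
    show "integrable sphere_measure (\<lambda>\<omega>. (norm (\<psi> \<omega>))\<^sup>2)" by (intro integrable_surf continuous_intros \<psi>)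
    fix \<omega> assume o: "\<omega> \<in> space sphere_measure"
    have "norm (?f (r *\<^sub>R \<omega>)) = (\<bar>r * \<omega> $ i\<bar> * \<bar>\<tau> r\<bar>) * norm (\<psi> \<omega>)"
      using o r by (simp add: radial_ext_polar norm_mult abs_mult mult_ac)
    also have "\<dots> \<le> 1 * norm (\<psi> \<omega>)"
    proof (intro mult_right_mono mult_le_one)
      have "\<bar>\<omega> $ i\<bar> \<le> 1" using Finite_Cartesian_Product.norm_nth_le[of \<omega> i] o by simp
      thus "\<bar>r * \<omega> $ i\<bar> \<le> 1" using r by (simp add: abs_mult mult_le_one)
      show "\<bar>\<tau> r\<bar> \<le> 1" using \<tau> r by simp
    qed auto
    finally show "(norm (?f (r *\<^sub>R \<omega>)))\<^sup>2 \<le> (norm (\<psi> \<omega>))\<^sup>2" by (intro power_mono) auto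
  qed
  have "(l2norm (lebesgue_on B1) ?f)\<^sup>2 = integral\<^sup>L radius_measure (\<lambda>r. integral\<^sup>L sphere_measure (\<lambda>\<omega>. (norm (?f (r *\<^sub>R \<omega>)))\<^sup>2))"
    unfolding l2norm_power2 by (rule pol(2))
  also have "\<dots> \<le> integral\<^sup>L radius_measure (\<lambda>r. (l2norm sphere_measure \<psi>)\<^sup>2)"
    by (rule integral_mono[OF ir _ le]) simp
  also have "\<dots> = (sqrt (measure radius_measure (space radius_measure)) * l2norm sphere_measure \<psi>)\<^sup>2"
    by (simp add: power_mult_distrib)
  finally show "(l2norm (lebesgue_on B1) ?f)\<^sup>2 \<le> (sqrt (measure radius_measure (space radius_measure)) * l2norm sphere_measure \<psi>)\<^sup>2" .
qed simp

text \<open>Removes the singularity of the direction at the origin: zero up to 1/4, and the divisor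
  9 normalizes the value at 1 to 1.\<close>

definition ramp :: "real \<Rightarrow> real" where "ramp r = pos_sq (4 * r - 1) / 9"
definition ramp' :: "real \<Rightarrow> real" where "ramp' r = 8 * max 0 (4 * r - 1) / 9"

lemma has_real_derivative_ramp: "(ramp has_real_derivative ramp' r) (at r)"
proof -
  have "((\<lambda>r. 4 * r - 1) has_real_derivative 4) (at r)" by (auto intro!: derivative_eq_intros)
  from DERIV_cdivide[OF DERIV_chain2[OF has_real_derivative_pos_sq this], of 9] show ?thesis
    unfolding ramp_def[abs_def] ramp'_def by (rule DERIV_cong) simp
qed

lemma ramp_props:
  "r \<le> 1/4 \<Longrightarrow> ramp r = 0" "ramp 1 = 1" "0 \<le> ramp r" "0 \<le> ramp' r"
  "0 \<le> r \<Longrightarrow> r \<le> 1 \<Longrightarrow> ramp r \<le> 1" "0 \<le> r \<Longrightarrow> r \<le> 1 \<Longrightarrow> ramp' r \<le> 3"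
proof -
  show "r \<le> 1/4 \<Longrightarrow> ramp r = 0" "ramp 1 = 1" "0 \<le> ramp r" "0 \<le> ramp' r" "0 \<le> r \<Longrightarrow> r \<le> 1 \<Longrightarrow> ramp' r \<le> 3"
    by (auto simp: ramp_def ramp'_def max_def)
  assume r: "0 \<le> r" "r \<le> 1"
  have "(max 0 (4 * r - 1))\<^sup>2 \<le> 3\<^sup>2" using r by (intro power_mono) auto
  thus "ramp r \<le> 1" by (simp add: ramp_def pos_sq_def)
qed

lemma continuous_on_ramp [continuous_intros]:
  "continuous_on A f \<Longrightarrow> continuous_on A (\<lambda>x. ramp (f x))"
  "continuous_on A f \<Longrightarrow> continuous_on A (\<lambda>x. ramp' (f x))"
  unfolding ramp_def ramp'_def by (intro continuous_intros; simp)+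

text \<open>Minus the derivative of the cutoff is a probability density. The condition
  \<open>a < 1/2\<close> ensures that the cutoff equals 1 at 0.\<close>

lemma integral_cutoff':
  assumes a: "0 < a" "a < 1/2"
  shows "(cutoff' a has_integral -1) {0..1}"
proof -
  have "(cutoff' a has_integral cutoff a 1 - cutoff a 0) {0..1}"
    by (rule fundamental_theorem_of_calculus)
       (auto intro: has_vector_derivative_at_within has_real_derivative_cutoff[OF a(1), unfolded has_real_derivative_iff_has_vector_derivative])
  thus ?thesis using cutoff_props(3)[of a 0] cutoff_props(4)[of a 1] a by simp
qed

text \<open>The density lives where 1 - 2a \<le> r \<le> 1 - a, so only the oscillation of
  \<open>q\<close> on that interval against its value at 1 matters.\<close>

lemma approximate_identity:
  fixes q :: "real \<Rightarrow> complex"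
  assumes a: "0 < a" "a < 1/2" and q: "continuous_on {0..1} q"
    and e: "\<And>r. 1 - 2 * a \<le> r \<Longrightarrow> r \<le> 1 \<Longrightarrow> norm (q r - q 1) \<le> e"
  shows "norm (integral {0..1} (\<lambda>r. of_real (cutoff' a r) * q r) + q 1) \<le> e"
proof -
  have i1: "((\<lambda>r. of_real (cutoff' a r) * q 1) has_integral of_real (-1) * q 1) {0..1}"
    using has_integral_mult_left[OF has_integral_of_real[OF integral_cutoff'[OF a]]] .
  have c: "continuous_on {0..1} (\<lambda>r. of_real (cutoff' a r) * (q r - q 1))"
    by (intro continuous_intros q)
  have i2: "(\<lambda>r. of_real (cutoff' a r) * (q r - q 1)) integrable_on {0..1}"
    by (rule integrable_continuous_real[OF c])
  have "integral {0..1} (\<lambda>r. of_real (cutoff' a r) * q r) =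
     integral {0..1} (\<lambda>r. of_real (cutoff' a r) * (q r - q 1) + of_real (cutoff' a r) * q 1)"
    by (simp add: algebra_simps)
  also have "\<dots> = integral {0..1} (\<lambda>r. of_real (cutoff' a r) * (q r - q 1)) + integral {0..1} (\<lambda>r. of_real (cutoff' a r) * q 1)"
    by (rule Henstock_Kurzweil_Integration.integral_add[OF i2 has_integral_integrable[OF i1]])
  finally have "integral {0..1} (\<lambda>r. of_real (cutoff' a r) * q r) + q 1 = integral {0..1} (\<lambda>r. of_real (cutoff' a r) * (q r - q 1))"
    using integral_unique[OF i1] by simp
  also have "norm \<dots> \<le> integral {0..1} (\<lambda>r. - cutoff' a r * e)"
  proof (rule integral_norm_bound_integral[OF i2])
    show "(\<lambda>r. - cutoff' a r * e) integrable_on {0..1}"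
      by (intro integrable_continuous_real continuous_intros)
    fix r :: real assume r: "r \<in> {0..1}"
    show "norm (of_real (cutoff' a r) * (q r - q 1)) \<le> - cutoff' a r * e"
    proof (cases "r \<le> 1 - 2 * a")
      case True
      thus ?thesis using cutoff_props(6)[OF a(1)] by simp
    next
      case False
      thus ?thesis using e[of r] r cutoff_props(5)[OF a(1), of r] by (simp add: norm_mult mult_left_mono_neg)
    qed
  qed
  also have "integral {0..1} (\<lambda>r. - cutoff' a r * e) = e"
    using integral_unique[OF has_integral_mult_left[OF has_integral_neg[OF integral_cutoff'[OF a]], of e]] by simp
  finally show ?thesis .
qed

lemma integrable_ball_continuous:
  fixes f :: "pt \<Rightarrow> complex"
  assumes "continuous_on (cball 0 1) f"
  shows "integrable (lebesgue_on B1) f"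
  using integrable_mult_square_integrable[OF square_integrable_ball_continuous[OF assms]
    square_integrable_ball_continuous[of "\<lambda>_. 1 :: complex"]] by simp

text \<open>In \<open>weak_gradient_radial\<close>, take for \<tau> the product of
  \<open>ramp\<close> and \<open>cutoff a\<close>. The derivative of the cutoff concentrates near r
  = 1 and reproduces minus the boundary integral up to \<open>e\<close>; all other terms are bounded
  independently of \<open>a\<close>. Only the norm of \<psi> itself appears, which is what makes a
  density argument possible.\<close>

lemma trace_pairing_le:
  assumes w: "has_weak_gradient v g" and v: "continuous_on (cball 0 1) v"
    and \<psi>: "c1_on (- {0}) (\<lambda>x. \<psi> (x /\<^sub>R norm x))" and \<psi>c: "continuous_on (sphere 0 1) \<psi>"
  shows "norm (integral\<^sup>L sphere_measure (\<lambda>\<omega>. v \<omega> * \<psi> \<omega>)) \<le>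
    6 * sqrt (measure radius_measure (space radius_measure)) * (l2norm (lebesgue_on B1) v + l2norm (lebesgue_on B1) g) * l2norm sphere_measure \<psi>"
proof (rule field_le_epsilon)
  interpret radius_measure: finite_measure radius_measure by (rule finite_measure_rad)
  fix e :: real assume e: "e > 0"
  define R where "R = sqrt (measure radius_measure (space radius_measure))"
  have R0: "R \<ge> 0" by (simp add: R_def)
  let ?m = "\<lambda>r. integral\<^sup>L sphere_measure (\<lambda>\<omega>. v (r *\<^sub>R \<omega>) * \<psi> \<omega>)"
  have mc: "continuous_on {0..1} ?m" by (rule continuous_on_moment[OF v \<psi>c])
  \<comment> \<open>The power r^3 collects r^2 from the radial measure and r from the term r
    \<tau>'(r) of the divergence; at r = 1 the value is the boundary integral.\<close>
  define q where "q r = of_real (r ^ 3 * ramp r) * ?m r" for r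
  have qc: "continuous_on {0..1} q" unfolding q_def by (intro continuous_intros mc)
  have "1 \<in> {0..1::real}" by simp
  from qc[unfolded continuous_on_iff, THEN bspec, OF this, rule_format, OF e]
  obtain d where d: "d > 0" "\<forall>r\<in>{0..1}. dist r 1 < d \<longrightarrow> dist (q r) (q 1) < e" by blast
  \<comment> \<open>A quarter of the modulus of continuity \<open>d\<close> keeps 1 - 2a within
    \<open>d\<close> of 1, and 1/4 keeps \<open>a\<close> below 1/2.\<close>
  define a where "a = min (1/4) (d/4)"
  have a: "0 < a" "a < 1/2" using d(1) by (auto simp: a_def)
  have q1: "norm (q r - q 1) \<le> e" if "1 - 2 * a \<le> r" "r \<le> 1" for r
  proof -
    have "r \<in> {0..1}" "dist r 1 < d" using that d(1) by (auto simp: a_def dist_real_def)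
    hence "dist (q r) (q 1) < e" using d(2) by blast
    thus ?thesis by (simp add: dist_norm)
  qed
  define \<tau> where "\<tau> r = ramp r * cutoff a r" for r
  define \<tau>' where "\<tau>' r = ramp r * cutoff' a r + ramp' r * cutoff a r" for r
  have \<tau>d: "(\<tau> has_real_derivative \<tau>' r) (at r)" for r
    unfolding \<tau>_def[abs_def] \<tau>'_def
    by (rule DERIV_cong[OF DERIV_mult[OF has_real_derivative_ramp has_real_derivative_cutoff[OF a(1)]]]) simp
  have \<tau>c: "continuous_on UNIV \<tau>'" unfolding \<tau>'_def[abs_def] by (intro continuous_intros)
  have \<tau>0: "\<tau> r = 0" if "r \<le> 1/4" for r using ramp_props(1)[OF that] by (simp add: \<tau>_def)
  have \<tau>1: "\<tau> r = 0" if "1 - a \<le> r" for r using cutoff_props(4)[OF a(1) that] by (simp add: \<tau>_def)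
  have wr1: "continuous_on (cball 0 1) (\<lambda>x. v x * radial_ext \<psi> (\<lambda>r. 3 * \<tau> r + r * \<tau>' r) x)"
    by (rule weak_gradient_radial(1)[OF w v \<psi> \<tau>d \<tau>c a(1)]) (simp_all add: \<tau>0 \<tau>1)
  have wr2: "continuous_on UNIV (\<lambda>x. of_real (x $ i) * radial_ext \<psi> \<tau> x)" for i
    by (rule weak_gradient_radial(2)[OF w v \<psi> \<tau>d \<tau>c a(1)]) (simp_all add: \<tau>0 \<tau>1)
  have wr3: "integral\<^sup>L (lebesgue_on B1) (\<lambda>x. v x * radial_ext \<psi> (\<lambda>r. 3 * \<tau> r + r * \<tau>' r) x)
      = - (\<Sum>i\<in>UNIV. integral\<^sup>L (lebesgue_on B1) (\<lambda>x. g x $ i * (of_real (x $ i) * radial_ext \<psi> \<tau> x)))"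
    by (rule weak_gradient_radial(3)[OF w v \<psi> \<tau>d \<tau>c a(1)]) (simp_all add: \<tau>0 \<tau>1)
  let ?f = "\<lambda>x. v x * radial_ext \<psi> (\<lambda>r. 3 * \<tau> r + r * \<tau>' r) x"
  \<comment> \<open>\<open>?A\<close> is the bounded part of the divergence, at most 3 + 3 = 6;
    \<open>?B\<close> contains the derivative of the cutoff, which grows as \<open>a\<close>
    shrinks.\<close>
  let ?A = "\<lambda>r. 3 * \<tau> r + r * (ramp' r * cutoff a r)"
  let ?B = "\<lambda>r. r * (ramp r * cutoff' a r)"
  have Ac: "continuous_on {0..1} ?A" unfolding \<tau>_def by (intro continuous_intros)
  have Ab: "\<bar>?A r\<bar> \<le> 6" if "r \<in> space radius_measure" for r
  proof -
    have r: "0 \<le> r" "r \<le> 1" using that by auto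
    have "\<tau> r \<le> 1" "0 \<le> \<tau> r" unfolding \<tau>_def using ramp_props(3,5)[of r] cutoff_props(1,2)[OF a(1), of r] r
      by (auto intro!: mult_le_one)
    moreover have c: "0 \<le> ramp' r" "ramp' r \<le> 3" "0 \<le> cutoff a r" "cutoff a r \<le> 1"
      using ramp_props(4,6)[of r] cutoff_props(1,2)[OF a(1), of r] r by auto
    moreover have "ramp' r * cutoff a r \<le> 3 * 1" using c by (intro mult_mono) auto
    hence "r * (ramp' r * cutoff a r) \<le> 1 * (3 * 1)" using c r by (intro mult_mono) auto
    moreover have "0 \<le> r * (ramp' r * cutoff a r)" using c r by simp
    ultimately show ?thesis by simp
  qed
  have siB: "square_integrable (lebesgue_on B1) g" using w by (simp add: has_weak_gradient_def L2_space_eq)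
  have slice: "integral\<^sup>L sphere_measure (\<lambda>\<omega>. ?f (r *\<^sub>R \<omega>)) = of_real (?A r) * ?m r + of_real (?B r) * ?m r"
    if "r \<in> space radius_measure" for r
  proof -
    have r: "0 < r" "r < 1" using that by auto
    have AB: "3 * \<tau> r + r * \<tau>' r = ?A r + ?B r" by (simp add: \<tau>'_def algebra_simps)
    have "integral\<^sup>L sphere_measure (\<lambda>\<omega>. ?f (r *\<^sub>R \<omega>)) = integral\<^sup>L sphere_measure (\<lambda>\<omega>. of_real (3 * \<tau> r + r * \<tau>' r) * (v (r *\<^sub>R \<omega>) * \<psi> \<omega>))"
      using r by (intro Bochner_Integration.integral_cong refl) (simp add: radial_ext_polar mult_ac del: of_real_add of_real_mult)
    also have "\<dots> = of_real (3 * \<tau> r + r * \<tau>' r) * ?m r"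
      by (rule integral_mult_right_zero)
    finally show ?thesis unfolding AB by (simp only: of_real_add distrib_right)
  qed
  have 1: "integral\<^sup>L (lebesgue_on B1) ?f = integral\<^sup>L radius_measure (\<lambda>r. integral\<^sup>L sphere_measure (\<lambda>\<omega>. ?f (r *\<^sub>R \<omega>)))"
    by (rule integral_ball_polar(2)[OF borel_measurable_ball[OF wr1] integrable_ball_continuous[OF wr1]])
  have 2: "integral\<^sup>L radius_measure (\<lambda>r. integral\<^sup>L sphere_measure (\<lambda>\<omega>. ?f (r *\<^sub>R \<omega>))) = integral\<^sup>L radius_measure (\<lambda>r. of_real (?A r) * ?m r + of_real (?B r) * ?m r)"
    by (rule Bochner_Integration.integral_cong[OF refl slice])
  have sm: "square_integrable radius_measure ?m" by (rule square_integrable_rad[OF mc])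
  have sA: "square_integrable radius_measure (\<lambda>r. complex_of_real (?A r))" by (rule square_integrable_rad[OF continuous_on_of_real[OF Ac]])
  have Bc: "continuous_on {0..1} (\<lambda>r. complex_of_real (?B r))" by (intro continuous_intros)
  have 3: "integral\<^sup>L radius_measure (\<lambda>r. of_real (?A r) * ?m r + of_real (?B r) * ?m r) =
     integral\<^sup>L radius_measure (\<lambda>r. of_real (?A r) * ?m r) + integral\<^sup>L radius_measure (\<lambda>r. of_real (?B r) * ?m r)"
    by (rule Bochner_Integration.integral_add[OF integrable_mult_square_integrable[OF sA sm]
         integrable_mult_square_integrable[OF square_integrable_rad[OF Bc] sm]])
  have 4: "integral\<^sup>L radius_measure (\<lambda>r. of_real (?B r) * ?m r) = integral {0..1} (\<lambda>r. of_real (cutoff' a r) * q r)"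
  proof -
    have "r\<^sup>2 *\<^sub>R (of_real (?B r) * ?m r) = of_real (cutoff' a r) * q r" for r
      by (simp add: q_def scaleR_conv_of_real power2_eq_square power3_eq_cube mult_ac)
    thus ?thesis using integral_rad_eq_HK[OF continuous_on_mult[OF Bc mc]] by (simp only:)
  qed
  have eq: "integral\<^sup>L (lebesgue_on B1) ?f = integral\<^sup>L radius_measure (\<lambda>r. of_real (?A r) * ?m r) + integral {0..1} (\<lambda>r. of_real (cutoff' a r) * q r)"
    by (simp only: 1 2 3 4)
  let ?I = "integral {0..1} (\<lambda>r. of_real (cutoff' a r) * q r)"
  have q1m: "q 1 = integral\<^sup>L sphere_measure (\<lambda>\<omega>. v \<omega> * \<psi> \<omega>)" by (simp add: q_def ramp_props(2))
  have bI: "norm (?I + q 1) \<le> e" by (rule approximate_identity[OF a qc q1])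
  have bA: "norm (integral\<^sup>L radius_measure (\<lambda>r. of_real (?A r) * ?m r)) \<le> 6 * R * (l2norm sphere_measure \<psi> * l2norm (lebesgue_on B1) v)"
  proof -
    obtain K where K: "\<And>x. x \<in> cball 0 1 \<Longrightarrow> norm (v x) \<le> K" using compact_norm_bound[OF compact_cball v] by blast
    have m: "l2norm radius_measure ?m \<le> l2norm sphere_measure \<psi> * l2norm (lebesgue_on B1) v"
      by (rule l2norm_moment_le[OF borel_measurable_ball[OF v] _ \<psi>c borel_measurable_rad[OF mc], of K]) (use K in auto)
    have one: "square_integrable radius_measure (\<lambda>_. 1::complex)" by (rule square_integrable_rad) simp
    have "l2norm radius_measure (\<lambda>_. 1::complex) = R" by (simp add: l2norm_def R_def)
    moreover have "l2norm radius_measure (\<lambda>r. complex_of_real (?A r) * 1) \<le> \<bar>6\<bar> * l2norm radius_measure (\<lambda>_. 1::complex)"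
    proof (rule square_integrable_bounded_mult(2)[OF one])
      show "(\<lambda>r. complex_of_real (?A r)) \<in> borel_measurable radius_measure" by (intro borel_measurable_rad continuous_on_of_real Ac)
      show "norm (complex_of_real (?A r)) \<le> 6" if "r \<in> space radius_measure" for r using Ab[OF that] by (simp only: norm_of_real)
    qed
    ultimately have A: "l2norm radius_measure (\<lambda>r. complex_of_real (?A r)) \<le> 6 * R" by simp
    have "norm (integral\<^sup>L radius_measure (\<lambda>r. of_real (?A r) * ?m r)) \<le> l2norm radius_measure (\<lambda>r. complex_of_real (?A r)) * l2norm radius_measure ?m"
      by (intro norm_integral_mult_le square_integrable_rad mc continuous_on_of_real Ac)
    also have "\<dots> \<le> 6 * R * (l2norm sphere_measure \<psi> * l2norm (lebesgue_on B1) v)"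
      using A m R0 by (intro mult_mono) auto
    finally show ?thesis .
  qed
  have bG: "norm (integral\<^sup>L (lebesgue_on B1) ?f) \<le> 3 * (l2norm (lebesgue_on B1) g * (R * l2norm sphere_measure \<psi>))"
  proof -
    have "norm (integral\<^sup>L (lebesgue_on B1) (\<lambda>x. g x $ i * (of_real (x $ i) * radial_ext \<psi> \<tau> x))) \<le> l2norm (lebesgue_on B1) g * (R * l2norm sphere_measure \<psi>)" for i
    proof -
      have cf: "continuous_on (cball 0 1) (\<lambda>x. of_real (x $ i) * radial_ext \<psi> \<tau> x)" using continuous_on_subset[OF wr2] by blast
      have "l2norm (lebesgue_on B1) (\<lambda>x. of_real (x $ i) * radial_ext \<psi> \<tau> x) \<le> R * l2norm sphere_measure \<psi>"
        unfolding R_def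
      proof (rule l2norm_radial_field_le[OF wr2 \<psi>c])
        fix r :: real assume "r \<in> {0<..<1}"
        thus "\<bar>\<tau> r\<bar> \<le> 1" unfolding \<tau>_def using ramp_props(3,5)[of r] cutoff_props(1,2)[OF a(1), of r]
          by (auto simp: abs_mult intro!: mult_le_one)
      qed
      moreover have "norm (integral\<^sup>L (lebesgue_on B1) (\<lambda>x. g x $ i * (of_real (x $ i) * radial_ext \<psi> \<tau> x))) \<le>
        l2norm (lebesgue_on B1) (\<lambda>x. g x $ i) * l2norm (lebesgue_on B1) (\<lambda>x. of_real (x $ i) * radial_ext \<psi> \<tau> x)"
        by (intro norm_integral_mult_le square_integrable_component[OF siB] square_integrable_ball_continuous cf)
      ultimately show ?thesis
        using square_integrable_component(2)[OF siB, of i] by (meson order_trans mult_mono l2norm_nonneg)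
    qed
    hence "norm (\<Sum>i\<in>UNIV. integral\<^sup>L (lebesgue_on B1) (\<lambda>x. g x $ i * (of_real (x $ i) * radial_ext \<psi> \<tau> x))) \<le> (\<Sum>i\<in>(UNIV::3 set). l2norm (lebesgue_on B1) g * (R * l2norm sphere_measure \<psi>))"
      by (intro sum_norm_le)
    thus ?thesis unfolding wr3 norm_minus_cancel by simp
  qed
  have nd: "norm z \<le> norm P + (norm Y + norm Z)" if "z = P - (Y - Z)" for z P Y Z :: complex
    unfolding that by (rule order_trans[OF norm_triangle_ineq4 add_left_mono[OF norm_triangle_ineq4]])
  have "q 1 = (?I + q 1) - (integral\<^sup>L (lebesgue_on B1) ?f - integral\<^sup>L radius_measure (\<lambda>r. of_real (?A r) * ?m r))"
    unfolding eq by simp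
  note nd[OF this]
  note order_trans[OF this add_mono[OF bI add_mono[OF bG bA]]]
  also have "e + (3 * (l2norm (lebesgue_on B1) g * (R * l2norm sphere_measure \<psi>)) + 6 * R * (l2norm sphere_measure \<psi> * l2norm (lebesgue_on B1) v))
     \<le> 6 * R * (l2norm (lebesgue_on B1) v + l2norm (lebesgue_on B1) g) * l2norm sphere_measure \<psi> + e"
  proof -
    have "0 \<le> l2norm (lebesgue_on B1) g * (R * l2norm sphere_measure \<psi>)" using R0 by simp
    thus ?thesis by (simp add: algebra_simps)
  qed
  finally show "norm (integral\<^sup>L sphere_measure (\<lambda>\<omega>. v \<omega> * \<psi> \<omega>)) \<le>
    6 * sqrt (measure radius_measure (space radius_measure)) * (l2norm (lebesgue_on B1) v + l2norm (lebesgue_on B1) g) * l2norm sphere_measure \<psi> + e"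
    unfolding q1m R_def .
qed

lemma c1_on_polynomial_direction_complex:
  fixes p :: "pt \<Rightarrow> complex"
  assumes "polynomial_function p"
  shows "c1_on (- {0}) (\<lambda>x. p (x /\<^sub>R norm x))"
proof -
  have "real_polynomial_function (Re \<circ> p)" "real_polynomial_function (Im \<circ> p)"
    using assms unfolding polynomial_function_def by (auto intro: bounded_linear_Re bounded_linear_Im)
  hence "c1_on (- {0}) (\<lambda>x. of_real ((Re \<circ> p) (x /\<^sub>R norm x)) + \<i> * of_real ((Im \<circ> p) (x /\<^sub>R norm x)))"
    by (intro c1_on_add c1_on_mult c1_on_const c1_on_polynomial_direction)
  thus ?thesis by (simp add: complex_eq[symmetric])
qed

text \<open>The squared boundary norm is the pairing of \<open>v\<close> with its conjugate. The
  conjugate is only continuous, so it is replaced by a uniformly close polynomial before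
  \<open>trace_pairing_le\<close> is used; one factor of the norm then cancels.\<close>

lemma trace_inequality:
  assumes w: "has_weak_gradient v g" and v: "continuous_on (cball 0 1) v"
  shows "l2norm sphere_measure v \<le>
    6 * sqrt (measure radius_measure (space radius_measure)) * (l2norm (lebesgue_on B1) v + l2norm (lebesgue_on B1) g)"
proof -
  interpret finite_measure sphere_measure by (rule finite_measure_surf)
  let ?C = "6 * sqrt (measure radius_measure (space radius_measure)) * (l2norm (lebesgue_on B1) v + l2norm (lebesgue_on B1) g)"
  have C0: "?C \<ge> 0" by (intro mult_nonneg_nonneg add_nonneg_nonneg) auto
  have vc: "continuous_on (sphere 0 1) v" by (rule continuous_on_subset[OF v]) auto
  let ?n = "l2norm sphere_measure v"
  have "?n\<^sup>2 \<le> ?C * ?n"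
  proof (rule field_le_epsilon)
    fix e :: real assume e: "e > 0"
    define A where "A = sqrt (measure sphere_measure (space sphere_measure))"
    define Q where "Q = (?C + ?n) * A + 1"
    have Q: "Q > 0" unfolding Q_def using C0 by (intro add_nonneg_pos mult_nonneg_nonneg) (auto simp: A_def)
    have eQ: "e / Q > 0" using e Q by simp
    have cc: "continuous_on (sphere 0 1) (\<lambda>x. cnj (v x))" by (intro continuous_intros vc)
    obtain p where p: "polynomial_function p" "\<forall>x\<in>sphere 0 1. norm (cnj (v x) - p x) < e / Q"
      using Stone_Weierstrass_polynomial_function[OF compact_sphere cc eQ] by blast
    have pc: "continuous_on A p" for A by (rule continuous_on_polymonial_function[OF p(1)])
    let ?d = "\<lambda>x. cnj (v x) - p x"
    have dc: "continuous_on (sphere 0 1) ?d" by (intro continuous_intros vc pc)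
    have nd: "l2norm sphere_measure ?d \<le> e / Q * A"
    proof (rule power2_le_imp_le)
      have "(l2norm sphere_measure ?d)\<^sup>2 \<le> integral\<^sup>L sphere_measure (\<lambda>x. (e / Q)\<^sup>2)"
        unfolding l2norm_power2
      proof (rule integral_mono)
        show "integrable sphere_measure (\<lambda>x. (norm (?d x))\<^sup>2)" by (intro integrable_surf continuous_intros dc)
        fix x assume "x \<in> space sphere_measure"
        hence "x \<in> sphere 0 1" by (simp only: space_surf)
        hence "norm (?d x) < e / Q" using p(2) by blast
        hence "norm (?d x) \<le> e / Q" by (rule less_imp_le)
        thus "(norm (?d x))\<^sup>2 \<le> (e / Q)\<^sup>2" by (intro power_mono) auto
      qed simp
      thus "(l2norm sphere_measure ?d)\<^sup>2 \<le> (e / Q * A)\<^sup>2" by (simp add: A_def power_mult_distrib power_divide mult.commute)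
    qed (rule mult_nonneg_nonneg, rule less_imp_le[OF eQ], simp add: A_def)
    have np: "l2norm sphere_measure p \<le> ?n + l2norm sphere_measure ?d"
    proof -
      have "l2norm sphere_measure (\<lambda>x. cnj (v x) + (p x - cnj (v x))) \<le> l2norm sphere_measure (\<lambda>x. cnj (v x)) + l2norm sphere_measure (\<lambda>x. p x - cnj (v x))"
        by (intro l2norm_triangle square_integrable_surf continuous_intros vc pc)
      moreover have "l2norm sphere_measure (\<lambda>x. p x - cnj (v x)) = l2norm sphere_measure ?d"
        by (simp add: l2norm_def norm_minus_commute)
      ultimately show ?thesis by simp
    qed
    have "complex_of_real (?n\<^sup>2) = integral\<^sup>L sphere_measure (\<lambda>x. v x * p x + v x * ?d x)"
      unfolding of_real_l2norm_power2 by (simp add: algebra_simps)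
    also have "\<dots> = integral\<^sup>L sphere_measure (\<lambda>x. v x * p x) + integral\<^sup>L sphere_measure (\<lambda>x. v x * ?d x)"
      by (intro Bochner_Integration.integral_add integrable_surf continuous_on_mult vc pc dc)
    finally have "norm (complex_of_real (?n\<^sup>2)) \<le> norm (integral\<^sup>L sphere_measure (\<lambda>x. v x * p x)) + norm (integral\<^sup>L sphere_measure (\<lambda>x. v x * ?d x))"
      by (simp only: norm_triangle_ineq)
    hence "?n\<^sup>2 \<le> norm (integral\<^sup>L sphere_measure (\<lambda>x. v x * p x)) + norm (integral\<^sup>L sphere_measure (\<lambda>x. v x * ?d x))"
      by (simp only: norm_of_real abs_power2)
    also have "\<dots> \<le> ?C * l2norm sphere_measure p + ?n * l2norm sphere_measure ?d"
      by (intro add_mono trace_pairing_le[OF w v c1_on_polynomial_direction_complex[OF p(1)] pc]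
        norm_integral_mult_le square_integrable_surf vc dc)
    also have "\<dots> \<le> ?C * (?n + l2norm sphere_measure ?d) + ?n * l2norm sphere_measure ?d"
      using np C0 by (intro add_right_mono mult_left_mono) auto
    also have "\<dots> = ?C * ?n + (?C + ?n) * l2norm sphere_measure ?d" by (simp only: distrib_left distrib_right add.assoc)
    also have "(?C + ?n) * l2norm sphere_measure ?d \<le> (?C + ?n) * (e / Q * A)"
      using nd C0 by (intro mult_left_mono add_nonneg_nonneg) auto
    also have "\<dots> = (Q - 1) * (e / Q)" by (simp add: Q_def)
    also have "\<dots> \<le> Q * (e / Q)" using eQ by (intro mult_right_mono) auto
    also have "\<dots> = e" using Q by simp
    finally show "?n\<^sup>2 \<le> ?C * ?n + e" by simp
  qed
  hence sq: "?n * ?n \<le> ?C * ?n" by (simp only: power2_eq_square)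
  show ?thesis
  proof (cases "?n = 0")
    case True
    thus ?thesis using C0 by simp
  next
    case False
    hence "?n > 0" using l2norm_nonneg[of sphere_measure v] by linarith
    thus ?thesis using mult_right_le_imp_le[OF sq] by blast
  qed
qed

section \<open>Sampling on finite-dimensional spaces\<close>

lemma integral_sum_cmult:
  fixes f :: "'i \<Rightarrow> 'a \<Rightarrow> complex"
  assumes "\<And>j. j \<in> I \<Longrightarrow> integrable M (f j)"
  shows "integral\<^sup>L M (\<lambda>x. \<Sum>j\<in>I. c j * f j x) = (\<Sum>j\<in>I. c j * integral\<^sup>L M (f j))"
  using assms by (subst Bochner_Integration.integral_sum) auto

text \<open>The given functions may be linearly dependent on the sphere. A remainder of norm zero
  vanishes at every point by continuity, so the representations hold pointwise, as evaluation at
  nodes requires.\<close>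

lemma gram_schmidt_surf:
  fixes f :: "nat \<Rightarrow> pt \<Rightarrow> complex"
  assumes "\<forall>i<n. continuous_on (sphere 0 1) (f i)"
  shows "\<exists>(r::nat) E. (\<forall>j<r. continuous_on (sphere 0 1) (E j)) \<and>
    (\<forall>i<r. \<forall>j<r. integral\<^sup>L sphere_measure (\<lambda>\<omega>. E i \<omega> * cnj (E j \<omega>)) = (if i = j then 1 else 0)) \<and>
    (\<forall>i<n. \<exists>c. \<forall>\<omega>\<in>sphere 0 1. f i \<omega> = (\<Sum>j<r. c j * E j \<omega>))"
  using assms
proof (induction n)
  case 0
  show ?case by (rule exI[where x="0::nat"]) simp
next
  case (Suc n)
  have "\<forall>i<n. continuous_on (sphere 0 1) (f i)" using Suc.prems by simp
  from Suc.IH[OF this] obtain r :: nat where "\<exists>E. (\<forall>j<r. continuous_on (sphere 0 1) (E j)) \<and>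
    (\<forall>i<r. \<forall>j<r. integral\<^sup>L sphere_measure (\<lambda>\<omega>. E i \<omega> * cnj (E j \<omega>)) = (if i = j then 1 else 0)) \<and>
    (\<forall>i<n. \<exists>c. \<forall>\<omega>\<in>sphere 0 1. f i \<omega> = (\<Sum>j<r. c j * E j \<omega>))" ..
  then obtain E where E0: "(\<forall>j<r. continuous_on (sphere 0 1) (E j)) \<and>
    (\<forall>i<r. \<forall>j<r. integral\<^sup>L sphere_measure (\<lambda>\<omega>. E i \<omega> * cnj (E j \<omega>)) = (if i = j then 1 else 0)) \<and>
    (\<forall>i<n. \<exists>c. \<forall>\<omega>\<in>sphere 0 1. f i \<omega> = (\<Sum>j<r. c j * E j \<omega>))" ..
  note E = E0[THEN conjunct1] E0[THEN conjunct2, THEN conjunct1] E0[THEN conjunct2, THEN conjunct2]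
  have fc: "continuous_on (sphere 0 1) (f n)" using Suc.prems by simp
  define a where "a j = integral\<^sup>L sphere_measure (\<lambda>\<omega>. f n \<omega> * cnj (E j \<omega>))" for j
  define g where "g \<omega> = f n \<omega> - (\<Sum>j<r. a j * E j \<omega>)" for \<omega>
  have gc: "continuous_on (sphere 0 1) g"
    unfolding g_def using E(1) by (intro continuous_intros fc) auto
  have gE: "integral\<^sup>L sphere_measure (\<lambda>\<omega>. g \<omega> * cnj (E i \<omega>)) = 0" if i: "i < r" for i
  proof -
    have i1: "integrable sphere_measure (\<lambda>\<omega>. E j \<omega> * cnj (E i \<omega>))" if "j \<in> {..<r}" for j
      using E(1) i that by (intro integrable_surf continuous_intros) auto
    have i3: "integrable sphere_measure (\<lambda>\<omega>. \<Sum>j<r. a j * (E j \<omega> * cnj (E i \<omega>)))"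
      using i1 by (intro Bochner_Integration.integrable_sum integrable_mult_right)
    have i2: "integrable sphere_measure (\<lambda>\<omega>. f n \<omega> * cnj (E i \<omega>))"
      using E(1) i by (intro integrable_surf continuous_intros fc) auto
    have "integral\<^sup>L sphere_measure (\<lambda>\<omega>. g \<omega> * cnj (E i \<omega>)) =
      integral\<^sup>L sphere_measure (\<lambda>\<omega>. f n \<omega> * cnj (E i \<omega>) - (\<Sum>j<r. a j * (E j \<omega> * cnj (E i \<omega>))))"
      by (simp add: g_def left_diff_distrib sum_distrib_right mult.assoc)
    also have "\<dots> = a i - (\<Sum>j<r. a j * integral\<^sup>L sphere_measure (\<lambda>\<omega>. E j \<omega> * cnj (E i \<omega>)))"
    proof -
      have "integral\<^sup>L sphere_measure (\<lambda>\<omega>. \<Sum>j<r. a j * (E j \<omega> * cnj (E i \<omega>))) = (\<Sum>j<r. a j * integral\<^sup>L sphere_measure (\<lambda>\<omega>. E j \<omega> * cnj (E i \<omega>)))"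
        by (rule integral_sum_cmult) (rule i1)
      thus ?thesis by (simp only: Bochner_Integration.integral_diff[OF i2 i3]) (simp only: a_def)
    qed
    also have "(\<Sum>j<r. a j * integral\<^sup>L sphere_measure (\<lambda>\<omega>. E j \<omega> * cnj (E i \<omega>))) = (\<Sum>j<r. if j = i then a j else 0)"
      using E(2) i by (intro sum.cong refl) auto
    also have "\<dots> = a i" using i by simp
    finally show ?thesis by simp
  qed
  define t where "t = l2norm sphere_measure g"
  show ?case
  proof (cases "t = 0")
    case True
    have "f n \<omega> = (\<Sum>j<r. a j * E j \<omega>)" if "\<omega> \<in> sphere 0 1" for \<omega>
      using l2norm_surf_eq_0[OF gc, of \<omega>] True that by (simp add: t_def g_def)
    hence n: "\<exists>c. \<forall>\<omega>\<in>sphere 0 1. f n \<omega> = (\<Sum>j<r. c j * E j \<omega>)" by (intro exI ballI)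
    have "\<exists>c. \<forall>\<omega>\<in>sphere 0 1. f i \<omega> = (\<Sum>j<r. c j * E j \<omega>)" if i: "i < Suc n" for i
    proof (cases "i = n")
      case True
      show ?thesis unfolding True by (rule n)
    next
      case False
      thus ?thesis using E(3) i by simp
    qed
    thus ?thesis using E(1,2) by (intro exI[of _ r] exI[of _ E] conjI allI impI) simp_all
  next
    case False
    define E' where "E' j = (if j = r then (\<lambda>\<omega>. of_real (inverse t) * g \<omega>) else E j)" for j
    have E'E: "E' j = E j" if "j < r" for j using that by (simp add: E'_def)
    have E'r: "E' r = (\<lambda>\<omega>. of_real (inverse t) * g \<omega>)" by (simp add: E'_def)
    have 1: "\<forall>j<Suc r. continuous_on (sphere 0 1) (E' j)"
      using E(1) gc by (auto simp: E'_def intro!: continuous_intros)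
    have cross: "integral\<^sup>L sphere_measure (\<lambda>\<omega>. E' r \<omega> * cnj (E j \<omega>)) = 0" if "j < r" for j
      using gE[OF that] by (simp add: E'r mult.assoc)
    have cross': "integral\<^sup>L sphere_measure (\<lambda>\<omega>. E j \<omega> * cnj (E' r \<omega>)) = 0" if "j < r" for j
    proof -
      have "integral\<^sup>L sphere_measure (\<lambda>\<omega>. E j \<omega> * cnj (E' r \<omega>)) = cnj (integral\<^sup>L sphere_measure (\<lambda>\<omega>. E' r \<omega> * cnj (E j \<omega>)))"
        using Bochner_Integration.integral_cnj[of sphere_measure "\<lambda>\<omega>. E' r \<omega> * cnj (E j \<omega>)"] by (simp add: mult.commute)
      thus ?thesis using cross[OF that] by simp
    qed
    have self: "integral\<^sup>L sphere_measure (\<lambda>\<omega>. E' r \<omega> * cnj (E' r \<omega>)) = 1"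
    proof -
      have "l2norm sphere_measure (E' r) = \<bar>inverse t\<bar> * t" unfolding E'r l2norm_cmult norm_of_real by (simp add: t_def)
      also have "\<dots> = 1" using False l2norm_nonneg[of sphere_measure g] by (simp add: t_def del: l2norm_nonneg)
      finally show ?thesis using of_real_l2norm_power2[of sphere_measure "E' r"] by simp
    qed
    have 2: "\<forall>i<Suc r. \<forall>j<Suc r. integral\<^sup>L sphere_measure (\<lambda>\<omega>. E' i \<omega> * cnj (E' j \<omega>)) = (if i = j then 1 else 0)"
    proof (intro allI impI)
      fix i j assume "i < Suc r" "j < Suc r"
      then consider "i < r" "j < r" | "i < r" "j = r" | "i = r" "j < r" | "i = r" "j = r" by linarith
      thus "integral\<^sup>L sphere_measure (\<lambda>\<omega>. E' i \<omega> * cnj (E' j \<omega>)) = (if i = j then 1 else 0)"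
        by cases (use E(2) cross cross' self in \<open>simp_all add: E'E\<close>)
    qed
    have 3: "\<exists>c. \<forall>\<omega>\<in>sphere 0 1. f i \<omega> = (\<Sum>j<Suc r. c j * E' j \<omega>)" if i: "i < Suc n" for i
    proof (cases "i = n")
      case True
      have "f n \<omega> = (\<Sum>j<Suc r. (if j = r then of_real t else a j) * E' j \<omega>)" for \<omega>
        using False by (simp add: E'E E'r g_def mult.assoc[symmetric] of_real_inverse)
      thus ?thesis unfolding True by (intro exI ballI)
    next
      case False
      hence "i < n" using i by simp
      then obtain c where c: "\<forall>\<omega>\<in>sphere 0 1. f i \<omega> = (\<Sum>j<r. c j * E j \<omega>)" using E(3) by blast
      have "\<forall>\<omega>\<in>sphere 0 1. f i \<omega> = (\<Sum>j<Suc r. (if j = r then 0 else c j) * E' j \<omega>)"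
        using c by (simp add: E'E)
      thus ?thesis by (rule exI[of _ "\<lambda>j. if j = r then 0 else c j"])
    qed
    show ?thesis using 1 2 3 by (intro exI[of _ "Suc r"] exI[of _ E'] conjI allI impI) simp_all
  qed
qed

definition sample_norm :: "(nat \<Rightarrow> nat \<Rightarrow> pt) \<Rightarrow> (nat \<Rightarrow> nat \<Rightarrow> real) \<Rightarrow> nat \<Rightarrow> (pt \<Rightarrow> complex) \<Rightarrow> real" where
  "sample_norm x w S v = sqrt (\<Sum>s<S. w S s * (norm (v (x S s)))\<^sup>2)"

text \<open>On a finite-dimensional space it suffices that the finitely many products of basis
  functions are integrated accurately: the discrete Gram matrix is then close to the identity, and
  one \<open>S0\<close> serves all coefficient vectors.\<close>

lemma uniform_sampling:
  fixes f :: "nat \<Rightarrow> pt \<Rightarrow> complex"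
  assumes quad: "convergent_quadrature x w" and f: "\<forall>i<n. continuous_on (sphere 0 1) (f i)"
  shows "\<exists>S0. \<forall>S\<ge>S0. \<forall>v. (\<exists>c. \<forall>\<omega>\<in>sphere 0 1. v \<omega> = (\<Sum>i<n. c i * f i \<omega>)) \<longrightarrow>
    l2norm sphere_measure v \<le> 2 * sample_norm x w S v \<and> sample_norm x w S v \<le> 2 * l2norm sphere_measure v"
proof -
  from gram_schmidt_surf[of n f, OF f]
  obtain r :: nat where "\<exists>E. (\<forall>j<r. continuous_on (sphere 0 1) (E j)) \<and>
    (\<forall>i<r. \<forall>j<r. integral\<^sup>L sphere_measure (\<lambda>\<omega>. E i \<omega> * cnj (E j \<omega>)) = (if i = j then 1 else 0)) \<and>
    (\<forall>i<n. \<exists>c. \<forall>\<omega>\<in>sphere 0 1. f i \<omega> = (\<Sum>j<r. c j * E j \<omega>))" ..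
  then obtain E where E0: "(\<forall>j<r. continuous_on (sphere 0 1) (E j)) \<and>
    (\<forall>i<r. \<forall>j<r. integral\<^sup>L sphere_measure (\<lambda>\<omega>. E i \<omega> * cnj (E j \<omega>)) = (if i = j then 1 else 0)) \<and>
    (\<forall>i<n. \<exists>c. \<forall>\<omega>\<in>sphere 0 1. f i \<omega> = (\<Sum>j<r. c j * E j \<omega>))" ..
  note E = E0[THEN conjunct1] E0[THEN conjunct2, THEN conjunct1] E0[THEN conjunct2, THEN conjunct2]
  define b where "b i = (SOME c. \<forall>\<omega>\<in>sphere 0 1. f i \<omega> = (\<Sum>j<r. c j * E j \<omega>))" for i
  have b: "f i \<omega> = (\<Sum>j<r. b i j * E j \<omega>)" if "i < n" "\<omega> \<in> sphere 0 1" for i \<omega>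
    using someI_ex[OF E(3)[rule_format, OF that(1)], folded b_def] that(2) by blast
  define G where "G S i j = (\<Sum>s<S. of_real (w S s) * (E i (x S s) * cnj (E j (x S s))))" for S i j
  have xs: "x S s \<in> sphere 0 1" "w S s > 0" if "s < S" for S s
    using quad that by (auto simp: convergent_quadrature_def)
  \<comment> \<open>Entrywise error \<theta> perturbs the quadratic form by at most \<theta> r times
    the squared norm, hence by 3/4 of it; the added 1 avoids division by zero for r = 0. The squared
    discrete norm stays between 1/4 and 7/4 of the exact one, whence the factors 2.\<close>
  define \<theta> where "\<theta> = 3 / (4 * (real r + 1))"
  have th: "\<theta> > 0" "\<theta> * real r \<le> 3/4" by (auto simp: \<theta>_def field_simps)
  have "eventually (\<lambda>S. \<forall>i\<in>{..<r}. \<forall>j\<in>{..<r}. norm (G S i j - (if i = j then 1 else 0)) < \<theta>) sequentially"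
  proof (intro eventually_ball_finite ballI)
    fix i j assume ij: "i \<in> {..<r}" "j \<in> {..<r}"
    have "(\<lambda>S. G S i j) \<longlonglongrightarrow> integral\<^sup>L sphere_measure (\<lambda>\<omega>. E i \<omega> * cnj (E j \<omega>))"
      unfolding G_def using E(1) ij by (intro quadrature_tendsto[OF quad] continuous_intros) auto
    hence "(\<lambda>S. G S i j) \<longlonglongrightarrow> (if i = j then 1 else 0)" using E(2) ij by simp
    from tendstoD[OF this th(1)] show "eventually (\<lambda>S. norm (G S i j - (if i = j then 1 else 0)) < \<theta>) sequentially"
      by (simp add: dist_norm)
  qed auto
  then obtain S0 where S0: "\<And>S i j. S \<ge> S0 \<Longrightarrow> i < r \<Longrightarrow> j < r \<Longrightarrow> norm (G S i j - (if i = j then 1 else 0)) < \<theta>"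
    unfolding eventually_sequentially by (metis lessThan_iff)
  have "l2norm sphere_measure v \<le> 2 * sample_norm x w S v \<and> sample_norm x w S v \<le> 2 * l2norm sphere_measure v"
    if S: "S \<ge> S0" and v: "\<forall>\<omega>\<in>sphere 0 1. v \<omega> = (\<Sum>i<n. c i * f i \<omega>)" for S v c
  proof -
    define a where "a j = (\<Sum>i<n. c i * b i j)" for j
    have va: "v \<omega> = (\<Sum>j<r. a j * E j \<omega>)" if "\<omega> \<in> sphere 0 1" for \<omega>
    proof -
      have "v \<omega> = (\<Sum>i<n. \<Sum>j<r. c i * b i j * E j \<omega>)" using v b that by (simp add: sum_distrib_left mult.assoc)
      also have "\<dots> = (\<Sum>j<r. a j * E j \<omega>)" unfolding a_def sum_distrib_right by (rule sum.swap)
      finally show ?thesis .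
    qed
    define Q where "Q = (\<Sum>j<r. (norm (a j))\<^sup>2)"
    have vv: "v \<omega> * cnj (v \<omega>) = (\<Sum>i<r. \<Sum>j<r. a i * cnj (a j) * (E i \<omega> * cnj (E j \<omega>)))" if "\<omega> \<in> sphere 0 1" for \<omega>
      using va[OF that] by (simp add: sum_product mult_ac)
    have delta: "(\<Sum>i<r. \<Sum>j<r. a i * cnj (a j) * (if i = j then 1 else 0)) = of_real Q"
    proof -
      have "(\<Sum>i<r. \<Sum>j<r. a i * cnj (a j) * (if i = j then 1 else 0)) = (\<Sum>i<r. \<Sum>j<r. if i = j then a i * cnj (a j) else 0)"
        by (intro sum.cong) auto
      also have "\<dots> = (\<Sum>i<r. a i * cnj (a i))" by (intro sum.cong) auto
      finally show ?thesis by (simp add: Q_def complex_norm_square[symmetric] del: of_real_power)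
    qed
    have 1: "(l2norm sphere_measure v)\<^sup>2 = Q"
    proof -
      have i1: "integrable sphere_measure (\<lambda>\<omega>. E i \<omega> * cnj (E j \<omega>))" if "i \<in> {..<r}" "j \<in> {..<r}" for i j
        using E(1) that by (intro integrable_surf continuous_intros) auto
      have i2: "integrable sphere_measure (\<lambda>\<omega>. \<Sum>j<r. a i * cnj (a j) * (E i \<omega> * cnj (E j \<omega>)))" if "i \<in> {..<r}" for i
        using i1[OF that] by (intro Bochner_Integration.integrable_sum integrable_mult_right)
      have "complex_of_real ((l2norm sphere_measure v)\<^sup>2) = integral\<^sup>L sphere_measure (\<lambda>\<omega>. \<Sum>i<r. \<Sum>j<r. a i * cnj (a j) * (E i \<omega> * cnj (E j \<omega>)))"
        unfolding of_real_l2norm_power2 by (intro Bochner_Integration.integral_cong refl) (simp add: vv)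
      also have "\<dots> = (\<Sum>i<r. integral\<^sup>L sphere_measure (\<lambda>\<omega>. \<Sum>j<r. a i * cnj (a j) * (E i \<omega> * cnj (E j \<omega>))))"
        by (rule Bochner_Integration.integral_sum) (rule i2)
      also have "\<dots> = (\<Sum>i<r. \<Sum>j<r. a i * cnj (a j) * integral\<^sup>L sphere_measure (\<lambda>\<omega>. E i \<omega> * cnj (E j \<omega>)))"
        by (rule sum.cong[OF refl], rule integral_sum_cmult, rule i1)
      also have "\<dots> = (\<Sum>i<r. \<Sum>j<r. a i * cnj (a j) * (if i = j then 1 else 0))"
        using E(2) by (intro sum.cong refl) simp
      finally show ?thesis unfolding delta of_real_eq_iff .
    qed
    define P where "P = (\<Sum>s<S. w S s * (norm (v (x S s)))\<^sup>2)"
    have P: "complex_of_real P = (\<Sum>i<r. \<Sum>j<r. a i * cnj (a j) * G S i j)"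
    proof -
      have "complex_of_real P = (\<Sum>s<S. of_real (w S s) * (v (x S s) * cnj (v (x S s))))"
        by (simp add: P_def complex_norm_square[symmetric] del: of_real_power)
      also have "\<dots> = (\<Sum>s<S. \<Sum>i<r. \<Sum>j<r. a i * cnj (a j) * (of_real (w S s) * (E i (x S s) * cnj (E j (x S s)))))"
      proof (intro sum.cong refl)
        fix s assume "s \<in> {..<S}"
        hence "x S s \<in> sphere 0 1" using xs by simp
        from vv[OF this] show "of_real (w S s) * (v (x S s) * cnj (v (x S s))) = (\<Sum>i<r. \<Sum>j<r. a i * cnj (a j) * (of_real (w S s) * (E i (x S s) * cnj (E j (x S s)))))"
          by (simp add: sum_distrib_left mult_ac)
      qed
      also have "\<dots> = (\<Sum>i<r. \<Sum>s<S. \<Sum>j<r. a i * cnj (a j) * (of_real (w S s) * (E i (x S s) * cnj (E j (x S s)))))"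
        by (rule sum.swap)
      also have "\<dots> = (\<Sum>i<r. \<Sum>j<r. a i * cnj (a j) * G S i j)"
        unfolding G_def sum_distrib_left by (intro sum.cong refl sum.swap)
      finally show ?thesis .
    qed
    have "norm (complex_of_real (P - Q)) = norm (\<Sum>i<r. \<Sum>j<r. a i * cnj (a j) * (G S i j - (if i = j then 1 else 0)))"
      unfolding of_real_diff P delta[symmetric] by (simp add: sum_subtractf[symmetric] right_diff_distrib)
    also have "\<dots> \<le> (\<Sum>i<r. \<Sum>j<r. norm (a i) * norm (a j) * \<theta>)"
    proof (intro sum_norm_le)
      fix i j assume "i \<in> {..<r}" "j \<in> {..<r}"
      hence "norm (G S i j - (if i = j then 1 else 0)) \<le> \<theta>" using S0[OF S, of i j] by (intro less_imp_le) simp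
      thus "norm (a i * cnj (a j) * (G S i j - (if i = j then 1 else 0))) \<le> norm (a i) * norm (a j) * \<theta>"
        unfolding norm_mult complex_mod_cnj by (intro mult_left_mono) simp_all
    qed
    also have "\<dots> = \<theta> * (\<Sum>i<r. norm (a i))\<^sup>2"
      by (simp add: power2_eq_square sum_product sum_distrib_left mult_ac)
    also have "\<dots> \<le> \<theta> * (Q * real r)"
      using sum_squared_le_sum_of_squares[of "\<lambda>i. norm (a i)" "{..<r}"] th(1) by (intro mult_left_mono) (auto simp: Q_def)
    also have "\<dots> = (\<theta> * real r) * Q" by simp
    also have "\<dots> \<le> 3/4 * Q" using th(2) by (intro mult_right_mono) (auto simp: Q_def sum_nonneg)
    finally have PQ: "\<bar>P - Q\<bar> \<le> 3/4 * Q" by (simp only: norm_of_real)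
    have Q0: "Q \<ge> 0" by (simp add: Q_def sum_nonneg)
    have l: "l2norm sphere_measure v = sqrt Q" using 1 by (metis l2norm_nonneg real_sqrt_unique)
    have s: "sample_norm x w S v = sqrt P" by (simp add: sample_norm_def P_def)
    have "sqrt Q \<le> sqrt (4 * P)" using PQ by (intro real_sqrt_le_mono) linarith
    moreover have "sqrt P \<le> sqrt (4 * Q)" using PQ Q0 by (intro real_sqrt_le_mono) linarith
    ultimately show ?thesis by (simp add: l s real_sqrt_mult)
  qed
  thus ?thesis by blast
qed

section \<open>Dirichlet eigenfunctions from zeros of Bessel functions\<close>

lemma integral_lborel_translate:
  fixes f :: "pt \<Rightarrow> complex"
  assumes "f \<in> borel_measurable borel"
  shows "integral\<^sup>L lborel (\<lambda>x. f (x + c)) = integral\<^sup>L lborel f"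
proof -
  have "integral\<^sup>L lborel f = integral\<^sup>L (distr lborel borel ((+) c)) f"
    by (simp add: lborel_distr_plus)
  also have "\<dots> = integral\<^sup>L lborel (\<lambda>x. f (c + x))"
    by (rule integral_distr) (use assms in simp_all)
  finally show ?thesis by (simp add: add.commute)
qed

lemma grad_at_line:
  assumes "grad_at F (x + t *\<^sub>R axis i 1) g"
  shows "((\<lambda>t. F (x + t *\<^sub>R axis i 1)) has_vector_derivative g $ i) (at t)"
proof -
  have "((\<lambda>t. x + t *\<^sub>R axis i 1) has_derivative (\<lambda>t. t *\<^sub>R axis i 1)) (at t)"
    by (auto intro!: derivative_eq_intros)
  from has_derivative_compose[OF this assms[unfolded grad_at_def]]
  show ?thesis unfolding has_vector_derivative_def
  proof (rule has_derivative_eq_rhs)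
    have "(\<Sum>j\<in>UNIV. of_real ((h *\<^sub>R axis i 1) $ j) * g $ j) = h *\<^sub>R g $ i" for h
    proof -
      have "(\<Sum>j\<in>UNIV. of_real ((h *\<^sub>R axis i 1 :: pt) $ j) * g $ j) = (\<Sum>j\<in>UNIV. if j = i then of_real h * g $ j else 0)"
        by (intro sum.cong refl) (simp add: axis_def)
      thus ?thesis by (simp add: scaleR_conv_of_real[where 'a=complex])
    qed
    thus "(\<lambda>h. \<Sum>j\<in>UNIV. of_real ((h *\<^sub>R axis i 1) $ j) * g $ j) = (\<lambda>h. h *\<^sub>R g $ i)" by simp
  qed
qed

text \<open>Difference quotients of a compactly supported function have integral zero by translation
  invariance, and they converge to the partial derivative dominatedly.\<close>

lemma integral_partial_derivative_eq_0:
  assumes tf: "test_function F D"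
  shows "integral\<^sup>L (lebesgue_on B1) (\<lambda>x. D x $ i) = 0"
proof -
  obtain K where K: "compact K" "K \<subseteq> B1" "\<And>x. x \<notin> K \<Longrightarrow> F x = 0"
    using tf unfolding test_function_def by blast
  have gr: "grad_at F x (D x)" for x using tf by (simp add: test_function_def grad_at_def)
  have Dc: "continuous_on A (\<lambda>x. D x $ i)" for A
    using tf unfolding test_function_def by (intro continuous_on_component) (meson continuous_on_subset subset_UNIV)
  have Fc: "continuous_on A F" for A
    using gr by (meson grad_at_continuous continuous_at_imp_continuous_on)
  have F0: "F x = 0" if "norm x \<ge> 1" for x using K(2) that by (intro K(3)) auto
  have D0: "D x $ i = 0" if "norm x \<ge> 1" for x
  proof -
    have "x \<notin> K" using K(2) that by auto
    thus ?thesis using test_function_D_zero[OF tf K(1) K(3)] by simp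
  qed
  obtain M where M: "\<And>x. x \<in> cball 0 1 \<Longrightarrow> norm (D x $ i) \<le> M"
    using compact_norm_bound[OF compact_cball Dc] by blast
  have M0: "0 \<le> M" using M[of 0] norm_ge_zero[of "D 0 $ i"] by (simp add: order_trans[OF norm_ge_zero])
  have DM: "norm (D x $ i) \<le> M" for x
    using M[of x] D0[of x] M0 by (cases "norm x \<le> 1") auto
  have Fm: "F \<in> borel_measurable borel" by (rule borel_measurable_continuous_onI[OF Fc])
  have Fi: "integrable lborel F"
  proof -
    have "integrable lborel (\<lambda>x. indicator (cball 0 1) x *\<^sub>R F x)"
      by (rule borel_integrable_compact[OF compact_cball Fc])
    moreover have "(\<lambda>x. indicator (cball 0 1) x *\<^sub>R F x) = F"
      using F0 by (auto simp: indicator_def fun_eq_iff)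
    ultimately show ?thesis by simp
  qed
  \<comment> \<open>Steps of length at most 1 keep the supports of all difference quotients in the
    ball of radius 2.\<close>
  define h where "h n = inverse (real (Suc n))" for n
  have h: "0 < h n" "h n \<le> 1" for n by (auto simp: h_def field_simps)
  have h0: "h \<longlonglongrightarrow> 0" unfolding h_def by (rule LIMSEQ_inverse_real_of_nat)
  let ?e = "axis i 1 :: pt"
  define d where "d n x = (F (x + h n *\<^sub>R ?e) - F x) /\<^sub>R h n" for n x
  have shm: "(\<lambda>x. F (x + c)) \<in> borel_measurable borel" for c
    by (rule measurable_compose[OF _ Fm]) simp
  have shi: "integrable lborel (\<lambda>x. F (x + c))" for c
  proof -
    have "integrable (distr lborel borel ((+) c)) F" using Fi by (simp add: lborel_distr_plus)
    thus ?thesis by (subst (asm) integrable_distr_eq) (auto simp: Fm add.commute)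
  qed
  have zero: "integral\<^sup>L lborel (d n) = 0" for n
  proof -
    have "integral\<^sup>L lborel (d n) = (integral\<^sup>L lborel (\<lambda>x. F (x + h n *\<^sub>R ?e)) - integral\<^sup>L lborel F) /\<^sub>R h n"
      unfolding d_def by (simp add: Bochner_Integration.integral_diff[OF shi Fi])
    thus ?thesis by (simp add: integral_lborel_translate[OF Fm])
  qed
  have lim: "(\<lambda>n. integral\<^sup>L lborel (d n)) \<longlonglongrightarrow> integral\<^sup>L lborel (\<lambda>x. D x $ i)"
  proof (rule integral_dominated_convergence[where w="\<lambda>x. indicator (cball 0 2) x *\<^sub>R M"])
    show "(\<lambda>x. D x $ i) \<in> borel_measurable lborel" using borel_measurable_continuous_onI[OF Dc] by simp
    show "d n \<in> borel_measurable lborel" for n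
      unfolding d_def using shm Fm by simp
    show "integrable lborel (\<lambda>x. indicator (cball (0::pt) 2) x *\<^sub>R M)"
      by (rule borel_integrable_compact[OF compact_cball continuous_on_const])
    show "AE x in lborel. (\<lambda>n. d n x) \<longlonglongrightarrow> D x $ i"
    proof (rule AE_I2)
      fix x
      have "((\<lambda>t. F (x + t *\<^sub>R ?e)) has_vector_derivative D x $ i) (at 0)"
        using grad_at_line[of F x 0 i "D x"] gr[of x] by simp
      hence lim: "((\<lambda>t. (F (x + t *\<^sub>R ?e) - F x) /\<^sub>R t) \<longlongrightarrow> D x $ i) (at 0)"
      proof -
        assume "((\<lambda>t. F (x + t *\<^sub>R ?e)) has_vector_derivative D x $ i) (at 0)"
        hence "(\<lambda>t. norm (F (x + t *\<^sub>R ?e) - F x - t *\<^sub>R D x $ i) / norm t) \<midarrow>0\<rightarrow> 0"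
          by (simp add: has_vector_derivative_def has_derivative_at)
        moreover have "norm (F (x + t *\<^sub>R ?e) - F x - t *\<^sub>R D x $ i) / norm t = norm ((F (x + t *\<^sub>R ?e) - F x) /\<^sub>R t - D x $ i)"
          if "t \<noteq> 0" for t
        proof -
          have "(F (x + t *\<^sub>R ?e) - F x) /\<^sub>R t - D x $ i = (F (x + t *\<^sub>R ?e) - F x - t *\<^sub>R D x $ i) /\<^sub>R t"
            using that by (simp add: scaleR_diff_right)
          thus ?thesis by (simp only: norm_scaleR) (simp add: divide_inverse mult.commute)
        qed
        ultimately have "(\<lambda>t. norm ((F (x + t *\<^sub>R ?e) - F x) /\<^sub>R t - D x $ i)) \<midarrow>0\<rightarrow> 0"
          by (subst (asm) LIM_equal) auto
        from tendsto_norm_zero_cancel[OF this] show ?thesis by (rule LIM_zero_cancel)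
      qed
      have "filterlim h (at 0) sequentially"
        using h0 h(1) by (auto simp: filterlim_at less_imp_neq[symmetric] intro!: always_eventually)
      from filterlim_compose[OF lim this] show "(\<lambda>n. d n x) \<longlonglongrightarrow> D x $ i" unfolding d_def .
    qed
    show "AE x in lborel. norm (d n x) \<le> indicator (cball 0 2) x *\<^sub>R M" for n
    proof (rule AE_I2)
      fix x
      show "norm (d n x) \<le> indicator (cball 0 2) x *\<^sub>R M"
      proof (cases "norm x \<le> 2")
        case True
        \<comment> \<open>The mean value inequality bounds each difference quotient by the maximum
          of the partial derivative.\<close>
        have "norm (F (x + h n *\<^sub>R ?e) - F (x + 0 *\<^sub>R ?e)) \<le> M * norm (h n - 0)"
        proof (rule differentiable_bound[where S=UNIV and f="\<lambda>t. F (x + t *\<^sub>R ?e)" and f'="\<lambda>t s. s *\<^sub>R D (x + t *\<^sub>R ?e) $ i"])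
          fix t :: real
          show "((\<lambda>t. F (x + t *\<^sub>R ?e)) has_derivative (\<lambda>s. s *\<^sub>R D (x + t *\<^sub>R ?e) $ i)) (at t)"
            using grad_at_line[OF gr] by (simp add: has_vector_derivative_def)
          show "onorm (\<lambda>s. s *\<^sub>R D (x + t *\<^sub>R ?e) $ i) \<le> M"
          proof (rule onorm_bound[OF M0])
            fix s :: real
            show "norm (s *\<^sub>R D (x + t *\<^sub>R ?e) $ i) \<le> M * norm s"
              using mult_left_mono[OF DM[of "x + t *\<^sub>R ?e"] abs_ge_zero[of s]] by (simp add: mult.commute)
          qed
        qed auto
        hence "norm (F (x + h n *\<^sub>R ?e) - F x) \<le> M * h n" using h(1)[of n] by simp
        hence "norm (F (x + h n *\<^sub>R ?e) - F x) / h n \<le> M" by (simp only: pos_divide_le_eq[OF h(1)])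
        hence "norm (d n x) \<le> M" using h(1)[of n] by (simp add: d_def divide_inverse mult.commute)
        thus ?thesis using True by simp
      next
        case False
        have "norm (x + h n *\<^sub>R ?e) \<ge> norm x - norm (h n *\<^sub>R ?e)" by (rule norm_diff_ineq)
        moreover have "norm (h n *\<^sub>R ?e) \<le> 1" using h[of n] by (simp add: norm_axis_1)
        ultimately have "norm (x + h n *\<^sub>R ?e) \<ge> 1" using False by linarith
        hence "d n x = 0" using F0[of x] F0[of "x + h n *\<^sub>R ?e"] False by (simp add: d_def)
        thus ?thesis using M0 by (simp add: indicator_def)
      qed
    qed
  qed
  have "integral\<^sup>L lborel (\<lambda>x. D x $ i) = 0"
    using lim unfolding zero LIMSEQ_const_iff by (rule sym)
  moreover have "integral\<^sup>L (lebesgue_on B1) (\<lambda>x. D x $ i) = integral\<^sup>L lborel (\<lambda>x. D x $ i)"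
  proof -
    have "(\<lambda>x. indicator B1 x *\<^sub>R D x $ i) = (\<lambda>x. D x $ i)"
      using D0 by (auto simp: indicator_def fun_eq_iff)
    thus ?thesis using borel_measurable_continuous_onI[OF Dc]
      by (simp add: integral_restrict_space integral_completion)
  qed
  ultimately show ?thesis by simp
qed

lemma test_function_mult:
  assumes w: "\<And>x. grad_at w x (g x)" "continuous_on UNIV g" and tf: "test_function \<phi> D"
  shows "test_function (\<lambda>x. w x * \<phi> x) (\<lambda>x. \<chi> i. w x * D x $ i + \<phi> x * g x $ i)"
proof -
  have gr: "grad_at \<phi> x (D x)" for x using tf by (simp add: test_function_def grad_at_def)
  have cont: "continuous_on UNIV w" "continuous_on UNIV \<phi>"
    using w(1) gr by (meson grad_at_continuous continuous_at_imp_continuous_on)+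
  have Dc: "continuous_on UNIV D" using tf by (simp add: test_function_def)
  have "continuous_on UNIV (\<lambda>x. \<chi> i. w x * D x $ i + \<phi> x * g x $ i)"
    by (intro continuous_on_vec_lambda continuous_intros cont Dc w(2))
  moreover have "\<exists>K. compact K \<and> K \<subseteq> B1 \<and> (\<forall>x. x \<notin> K \<longrightarrow> w x * \<phi> x = 0)"
    using tf unfolding test_function_def by (metis mult_zero_right)
  ultimately show ?thesis
    using grad_at_mult[OF w(1) gr] unfolding test_function_def grad_at_def by blast
qed

text \<open>Integration by parts: the partial derivative of the product of \<open>w\<close> with a
  test function has integral zero.\<close>

lemma has_weak_gradient_C1:
  assumes w: "\<And>x. grad_at w x (g x)" and g: "continuous_on UNIV g"
  shows "has_weak_gradient w g"
  unfolding has_weak_gradient_def L2_space_eq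
proof (intro conjI allI impI CollectI)
  have wc: "continuous_on A w" for A using w by (meson grad_at_continuous continuous_at_imp_continuous_on)
  have gc: "continuous_on A g" for A using g continuous_on_subset by blast
  show "square_integrable (lebesgue_on B1) w" "square_integrable (lebesgue_on B1) g"
    by (rule square_integrable_ball_continuous[OF wc], rule square_integrable_ball_continuous[OF gc])
  fix \<phi> D i assume tf: "test_function \<phi> D"
  have \<phi>c: "continuous_on A \<phi>" for A
    using tf unfolding test_function_def by (meson has_derivative_continuous continuous_at_imp_continuous_on)
  have Dc: "continuous_on A D" for A using tf unfolding test_function_def by (meson continuous_on_subset subset_UNIV)
  have "integral\<^sup>L (lebesgue_on B1) (\<lambda>x. w x * D x $ i + g x $ i * \<phi> x) = 0"
    using integral_partial_derivative_eq_0[OF test_function_mult[OF w g tf], of i] by (simp add: mult.commute)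
  moreover have "integral\<^sup>L (lebesgue_on B1) (\<lambda>x. w x * D x $ i + g x $ i * \<phi> x) =
     integral\<^sup>L (lebesgue_on B1) (\<lambda>x. w x * D x $ i) + integral\<^sup>L (lebesgue_on B1) (\<lambda>x. g x $ i * \<phi> x)"
    by (intro Bochner_Integration.integral_add integrable_ball_continuous continuous_intros wc Dc gc \<phi>c)
  ultimately show "integral\<^sup>L (lebesgue_on B1) (\<lambda>x. w x * D x $ i) = - integral\<^sup>L (lebesgue_on B1) (\<lambda>x. g x $ i * \<phi> x)"
    by (simp add: eq_neg_iff_add_eq_0)
qed

text \<open>Integration by parts in each coordinate, with the i-th component of the gradient in the
  role of \<open>w\<close>, followed by summation.\<close>

lemma weak_helmholtz_C2:
  assumes w: "continuous_on UNIV w" and g: "continuous_on UNIV g"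
    and H: "\<And>i x. grad_at (\<lambda>x. g x $ i) x (H i x)" "\<And>i. continuous_on UNIV (H i)"
    and pde: "\<And>x. (\<Sum>i\<in>UNIV. H i x $ i) = - of_real \<Lambda> * w x"
    and tf: "test_function \<phi> D"
  shows "integral\<^sup>L (lebesgue_on B1) (\<lambda>x. \<Sum>i\<in>UNIV. g x $ i * D x $ i) = of_real \<Lambda> * integral\<^sup>L (lebesgue_on B1) (\<lambda>x. w x * \<phi> x)"
proof -
  have sub: "continuous_on A f" if "continuous_on UNIV f" for A :: "pt set" and f :: "pt \<Rightarrow> 'b::topological_space"
    using that continuous_on_subset by blast
  have \<phi>c: "continuous_on A \<phi>" for A
    using tf unfolding test_function_def by (meson has_derivative_continuous continuous_at_imp_continuous_on)
  have Dc: "continuous_on A D" for A using tf unfolding test_function_def by (meson continuous_on_subset subset_UNIV)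
  have c1: "continuous_on A (\<lambda>x. g x $ i * D x $ i)" for A i by (intro continuous_intros Dc sub[OF g])
  have c2: "continuous_on A (\<lambda>x. H i x $ i * \<phi> x)" for A i by (intro continuous_intros \<phi>c sub[OF H(2)])
  have "integral\<^sup>L (lebesgue_on B1) (\<lambda>x. g x $ i * D x $ i) = - integral\<^sup>L (lebesgue_on B1) (\<lambda>x. H i x $ i * \<phi> x)" for i
  proof -
    have "integral\<^sup>L (lebesgue_on B1) (\<lambda>x. g x $ i * D x $ i + H i x $ i * \<phi> x) = 0"
      using integral_partial_derivative_eq_0[OF test_function_mult[OF H tf], of i i] by (simp add: mult.commute)
    moreover have "integral\<^sup>L (lebesgue_on B1) (\<lambda>x. g x $ i * D x $ i + H i x $ i * \<phi> x) =
       integral\<^sup>L (lebesgue_on B1) (\<lambda>x. g x $ i * D x $ i) + integral\<^sup>L (lebesgue_on B1) (\<lambda>x. H i x $ i * \<phi> x)"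
      by (intro Bochner_Integration.integral_add integrable_ball_continuous c1 c2)
    ultimately show ?thesis by (simp add: eq_neg_iff_add_eq_0)
  qed
  hence "integral\<^sup>L (lebesgue_on B1) (\<lambda>x. \<Sum>i\<in>UNIV. g x $ i * D x $ i) = (\<Sum>i\<in>UNIV. - integral\<^sup>L (lebesgue_on B1) (\<lambda>x. H i x $ i * \<phi> x))"
    by (subst Bochner_Integration.integral_sum) (auto intro!: integrable_ball_continuous c1)
  also have "\<dots> = - integral\<^sup>L (lebesgue_on B1) (\<lambda>x. \<Sum>i\<in>UNIV. H i x $ i * \<phi> x)"
    by (subst Bochner_Integration.integral_sum) (auto intro!: integrable_ball_continuous c2 simp: sum_negf)
  also have "(\<lambda>x. \<Sum>i\<in>UNIV. H i x $ i * \<phi> x) = (\<lambda>x. - (of_real \<Lambda> * (w x * \<phi> x)))"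
    by (simp add: sum_distrib_right[symmetric] pde mult.assoc)
  finally show ?thesis by simp
qed

section \<open>The differential equation of the Bessel power series\<close>

definition bessel_series1 :: "nat \<Rightarrow> real \<Rightarrow> real" where
  "bessel_series1 l z = (\<Sum>k. diffs (bessel_coeff l) k * z ^ k)"

definition bessel_series2 :: "nat \<Rightarrow> real \<Rightarrow> real" where
  "bessel_series2 l z = (\<Sum>k. diffs (diffs (bessel_coeff l)) k * z ^ k)"

lemma bessel_summable1: "summable (\<lambda>k. diffs (bessel_coeff l) k * z ^ k)"
  by (rule termdiff_converges_all) (rule summable_bessel)

lemma bessel_summable2: "summable (\<lambda>k. diffs (diffs (bessel_coeff l)) k * z ^ k)"
  by (rule termdiff_converges_all) (rule bessel_summable1)

lemma has_real_derivative_bessel_series: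
  "(bessel_series l has_real_derivative bessel_series1 l z) (at z)"
  "(bessel_series1 l has_real_derivative bessel_series2 l z) (at z)"
  unfolding bessel_series_def[abs_def] bessel_series1_def[abs_def] bessel_series2_def
  by (rule termdiffs_strong_converges_everywhere, rule summable_bessel,
      rule termdiffs_strong_converges_everywhere, rule bessel_summable1)

lemma continuous_on_bessel_series [continuous_intros]:
  assumes "continuous_on A f"
  shows "continuous_on A (\<lambda>x. bessel_series l (f x))" "continuous_on A (\<lambda>x. bessel_series1 l (f x))"
    "continuous_on A (\<lambda>x. bessel_series2 l (f x))"
proof -
  have 2: "isCont (bessel_series2 l) z" for z
    unfolding bessel_series2_def[abs_def]
    by (rule DERIV_isCont[OF termdiffs_strong_converges_everywhere[OF bessel_summable2]])
  have c: "continuous_on UNIV (bessel_series l)" "continuous_on UNIV (bessel_series1 l)" "continuous_on UNIV (bessel_series2 l)"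
    using DERIV_isCont[OF has_real_derivative_bessel_series(1)] DERIV_isCont[OF has_real_derivative_bessel_series(2)] 2
    by (intro continuous_at_imp_continuous_on ballI; blast)+
  show "continuous_on A (\<lambda>x. bessel_series l (f x))" "continuous_on A (\<lambda>x. bessel_series1 l (f x))"
    "continuous_on A (\<lambda>x. bessel_series2 l (f x))"
    using c by (blast intro: continuous_on_compose2[OF _ assms])+
qed

text \<open>The radial Helmholtz equation in the variable of the squared radius, after a solid
  harmonic of degree \<open>l\<close> has been split off. Comparing coefficients reduces it to
  \<open>bessel_coeff_Suc\<close>.\<close>

lemma bessel_ode:
  "4 * z * bessel_series2 l z + (6 + 4 * real l) * bessel_series1 l z = - bessel_series l z"
proof -
  let ?c = "bessel_coeff l"
  have s: "summable (\<lambda>k. real k * diffs ?c k * z ^ k)"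
    and e: "z * bessel_series2 l z = (\<Sum>k. real k * diffs ?c k * z ^ k)"
  proof -
    have f: "z * (diffs (diffs ?c) k * z ^ k) = real (Suc k) * diffs ?c (Suc k) * z ^ Suc k" for k
      by (simp add: diffs_def mult_ac)
    have "summable (\<lambda>k. real (Suc k) * diffs ?c (Suc k) * z ^ Suc k)"
      unfolding f[symmetric] by (intro summable_mult bessel_summable2)
    thus s: "summable (\<lambda>k. real k * diffs ?c k * z ^ k)"
      using summable_Suc_iff[of "\<lambda>k. real k * diffs ?c k * z ^ k"] by blast
    have "z * bessel_series2 l z = (\<Sum>k. z * (diffs (diffs ?c) k * z ^ k))"
      unfolding bessel_series2_def by (rule suminf_mult[OF bessel_summable2, symmetric])
    also have "\<dots> = (\<Sum>k. real (Suc k) * diffs ?c (Suc k) * z ^ Suc k)" by (simp only: f)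
    also have "\<dots> = (\<Sum>k. real k * diffs ?c k * z ^ k)"
      using suminf_split_head[OF s] by simp
    finally show "z * bessel_series2 l z = (\<Sum>k. real k * diffs ?c k * z ^ k)" .
  qed
  have "4 * z * bessel_series2 l z + (6 + 4 * real l) * bessel_series1 l z =
     (\<Sum>k. 4 * (real k * diffs ?c k * z ^ k) + (6 + 4 * real l) * (diffs ?c k * z ^ k))"
    using suminf_mult[OF s, of 4] suminf_mult[OF bessel_summable1, of "6 + 4 * real l" l z]
      suminf_add[OF summable_mult[OF s, of 4] summable_mult[OF bessel_summable1, of "6 + 4 * real l" l z]]
    by (simp add: e bessel_series1_def mult.assoc)
  also have "\<dots> = (\<Sum>k. - (?c k * z ^ k))"
  proof (intro suminf_cong)
    fix k
    have "4 * (real k * diffs ?c k * z ^ k) + (6 + 4 * real l) * (diffs ?c k * z ^ k) =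
       (2 * (real k + 1) * (2 * real l + 2 * real k + 3) * ?c (Suc k)) * z ^ k"
      by (simp add: diffs_def algebra_simps)
    also have "2 * (real k + 1) * (2 * real l + 2 * real k + 3) * ?c (Suc k) = - ?c k"
    proof -
      have "2 * (real k + 1) * (2 * real l + 2 * real k + 3) \<noteq> 0" by simp
      thus ?thesis unfolding bessel_coeff_Suc by simp
    qed
    finally show "4 * (real k * diffs ?c k * z ^ k) + (6 + 4 * real l) * (diffs ?c k * z ^ k) = - (?c k * z ^ k)"
      by simp
  qed
  also have "\<dots> = - bessel_series l z" by (simp add: bessel_series_def suminf_minus summable_bessel)
  finally show ?thesis .
qed

lemma grad_at_power:
  "grad_at f x g \<Longrightarrow> grad_at (\<lambda>x. f x ^ n) x (\<chi> i. of_nat n * f x ^ (n - 1) * g $ i)"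
proof (induction n)
  case 0
  show ?case unfolding grad_at_def by simp
next
  case (Suc n)
  from grad_at_mult[OF Suc.prems Suc.IH[OF Suc.prems]]
  have "grad_at (\<lambda>x. f x ^ Suc n) x (\<chi> i. f x * (of_nat n * f x ^ (n - 1) * g $ i) + f x ^ n * g $ i)" by simp
  moreover have "(\<chi> i. f x * (of_nat n * f x ^ (n - 1) * g $ i) + f x ^ n * g $ i) = (\<chi> i. of_nat (Suc n) * f x ^ (Suc n - 1) * g $ i)"
    by (cases n) (simp_all add: Finite_Cartesian_Product.vec_eq_iff algebra_simps)
  ultimately show ?case by simp
qed

text \<open>The gradient (1, \<i>, 0) of x1 + \<i> x2. The sum of its squared entries is zero, which
  makes every power of x1 + \<i> x2 harmonic.\<close>

definition planar_direction :: "complex^3" where "planar_direction = axis 1 1 + (\<chi> i. \<i> * axis 2 1 $ i)"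

lemma planar_direction_nth [simp]: "planar_direction $ 1 = 1" "planar_direction $ 2 = \<i>" "planar_direction $ 3 = 0"
  by (simp_all add: planar_direction_def axis_def)

lemma grad_at_cmult: "grad_at f x g \<Longrightarrow> grad_at (\<lambda>x. c * f x) x (\<chi> i. c * g $ i)"
  using grad_at_mult[OF grad_at_const[of c]] by fastforce

lemma grad_at_dir12: "grad_at (\<lambda>x. Complex (x $ 1) (x $ 2)) x planar_direction"
  unfolding Complex_eq planar_direction_def by (intro grad_at_add grad_at_cmult grad_at_coord)

text \<open>\<open>H i\<close> is the i-th row of the Hessian, so the sum of its diagonal entries is
  the Laplacian.\<close>

definition classical_helmholtz ::
  "real \<Rightarrow> (pt \<Rightarrow> complex) \<Rightarrow> (pt \<Rightarrow> complex^3) \<Rightarrow> (3 \<Rightarrow> pt \<Rightarrow> complex^3) \<Rightarrow> bool" where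
  "classical_helmholtz \<kappa> w g H \<longleftrightarrow>
    (\<forall>x. grad_at w x (g x)) \<and> continuous_on UNIV g \<and> (\<forall>i x. grad_at (\<lambda>x. g x $ i) x (H i x)) \<and>
    (\<forall>i. continuous_on UNIV (H i)) \<and> (\<forall>x. (\<Sum>i\<in>UNIV. H i x $ i) = - of_real (\<kappa>\<^sup>2) * w x)"

text \<open>The candidate eigenfunction is \<open>j\<^sub>l(\<kappa>|x|) Y\<^sub>l\<^sup>l(x/|x|)\<close> up to a constant; the highest order \<open>m = l\<close> makes the
  solid harmonic the power \<open>(x\<^sub>1 + \<i> x\<^sub>2)\<^sup>l\<close>.\<close>

lemma helmholtz_wave:
  fixes l :: nat and \<kappa> :: real
  defines "w \<equiv> \<lambda>x::pt. of_real (bessel_series l (\<kappa>\<^sup>2 * inner x x)) * Complex (x $ 1) (x $ 2) ^ l"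
  shows "\<exists>g H. classical_helmholtz \<kappa> w g H"
proof -
  define R where "R s = bessel_series l (\<kappa>\<^sup>2 * s)" for s
  define R1 where "R1 s = \<kappa>\<^sup>2 * bessel_series1 l (\<kappa>\<^sup>2 * s)" for s
  define R2 where "R2 s = \<kappa>\<^sup>2 * (\<kappa>\<^sup>2 * bessel_series2 l (\<kappa>\<^sup>2 * s))" for s
  have lin: "((\<lambda>s. \<kappa>\<^sup>2 * s) has_real_derivative \<kappa>\<^sup>2) (at s)" for s by (auto intro!: derivative_eq_intros)
  have dR: "(R has_real_derivative R1 s) (at s)" for s
    unfolding R_def[abs_def] R1_def
    by (rule DERIV_cong[OF DERIV_chain2[OF has_real_derivative_bessel_series(1) lin]]) simp
  have dR1: "(R1 has_real_derivative R2 s) (at s)" for s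
    unfolding R1_def[abs_def] R2_def
    by (rule DERIV_cong[OF DERIV_cmult[OF DERIV_chain2[OF has_real_derivative_bessel_series(2) lin]]]) simp
  have ode: "4 * s * R2 s + (6 + 4 * real l) * R1 s = - \<kappa>\<^sup>2 * R s" for s
  proof -
    have "4 * s * R2 s + (6 + 4 * real l) * R1 s = \<kappa>\<^sup>2 * (4 * (\<kappa>\<^sup>2 * s) * bessel_series2 l (\<kappa>\<^sup>2 * s) + (6 + 4 * real l) * bessel_series1 l (\<kappa>\<^sup>2 * s))"
      by (simp add: R1_def R2_def algebra_simps)
    thus ?thesis unfolding bessel_ode by (simp add: R_def)
  qed
  let ?s = "\<lambda>x::pt. inner x x"
  let ?z = "\<lambda>x::pt. Complex (x $ 1) (x $ 2)"
  define b where "b x = complex_of_real (R (?s x))" for x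
  define a where "a x = complex_of_real (R1 (?s x))" for x
  define p where "p x = ?z x ^ l" for x
  define q where "q x = of_nat l * ?z x ^ (l - 1)" for x
  define gb where "gb x = (\<chi> i. complex_of_real (R1 (?s x) * (2 * x $ i)))" for x
  define ga where "ga x = (\<chi> i. complex_of_real (R2 (?s x) * (2 * x $ i)))" for x
  define gp where "gp x = (\<chi> i. q x * planar_direction $ i)" for x
  define gq where "gq x = (\<chi> i. of_nat l * (of_nat (l - 1) * ?z x ^ (l - 1 - 1) * planar_direction $ i))" for x
  have db: "grad_at b x (gb x)" for x unfolding b_def[abs_def] gb_def by (rule grad_at_square[OF dR])
  have da: "grad_at a x (ga x)" for x unfolding a_def[abs_def] ga_def by (rule grad_at_square[OF dR1])
  have dp: "grad_at p x (gp x)" for x unfolding p_def[abs_def] gp_def q_def by (rule grad_at_power[OF grad_at_dir12])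
  have dq: "grad_at q x (gq x)" for x
    using grad_at_cmult[OF grad_at_power[OF grad_at_dir12, of "l - 1" x], of "of_nat l"] by (simp add: q_def[abs_def] gq_def)
  define g where "g x = (\<chi> i. b x * gp x $ i + p x * gb x $ i)" for x
  define xp where "xp i x = complex_of_real (x $ i) * p x" for i and x :: pt
  define gxp where "gxp i x = (\<chi> j. of_real (x $ i) * gp x $ j + p x * axis i 1 $ j)" for i and x :: pt
  define H where "H i x = (\<chi> j. planar_direction $ i * (\<chi> j. b x * gq x $ j + q x * gb x $ j) $ j) + (\<chi> j. 2 * (\<chi> j. a x * gxp i x $ j + xp i x * ga x $ j) $ j)" for i x
  have gi: "g x $ i = planar_direction $ i * (b x * q x) + 2 * (a x * xp i x)" for x i
    by (simp add: g_def gp_def gb_def xp_def a_def mult_ac)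
  have dxp: "grad_at (xp i) x (gxp i x)" for i x
    unfolding xp_def[abs_def] gxp_def by (rule grad_at_mult[OF grad_at_coord dp])
  have dH: "grad_at (\<lambda>x. g x $ i) x (H i x)" for i x
    unfolding gi H_def by (intro grad_at_add grad_at_cmult grad_at_mult db dq da dxp)
  have wbp: "w = (\<lambda>x. b x * p x)" by (simp add: w_def b_def p_def R_def)
  have dw: "grad_at w x (g x)" for x unfolding wbp g_def by (rule grad_at_mult[OF db dp])
  have z: "continuous_on UNIV ?z" unfolding Complex_eq by (intro continuous_intros)
  have R: "continuous_on UNIV (\<lambda>x::pt. R1 (?s x))" "continuous_on UNIV (\<lambda>x::pt. R2 (?s x))" "continuous_on UNIV (\<lambda>x::pt. R (?s x))"
    unfolding R1_def R2_def R_def by (intro continuous_intros)+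
  have c: "continuous_on UNIV b" "continuous_on UNIV a" "continuous_on UNIV p" "continuous_on UNIV q" "continuous_on UNIV gb" "continuous_on UNIV ga" "continuous_on UNIV gq"
    unfolding b_def[abs_def] a_def[abs_def] p_def[abs_def] q_def[abs_def] gb_def[abs_def] ga_def[abs_def] gq_def[abs_def]
    by (intro continuous_on_vec_lambda continuous_intros z R)+
  have cgp: "continuous_on UNIV gp" unfolding gp_def[abs_def] by (intro continuous_on_vec_lambda continuous_intros c)
  have cxp: "continuous_on UNIV (xp i)" "continuous_on UNIV (gxp i)" for i
    unfolding xp_def[abs_def] gxp_def[abs_def] by (intro continuous_on_vec_lambda continuous_intros c cgp)+
  have cg: "continuous_on UNIV g" unfolding g_def[abs_def] by (intro continuous_on_vec_lambda continuous_intros c cgp)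
  have cH: "continuous_on UNIV (H i)" for i unfolding H_def[abs_def]
    by (intro continuous_on_vec_lambda continuous_intros c cxp)
  have pde: "(\<Sum>i\<in>UNIV. H i x $ i) = - of_real (\<kappa>\<^sup>2) * w x" for x
  proof -
    \<comment> \<open>Euler's relation for the homogeneous polynomial \<open>p\<close>; degree 0 is
      separate because of the truncated exponent \<open>l - 1\<close>.\<close>
    have qz: "q x * ?z x = of_nat l * p x" by (cases l) (simp_all add: q_def p_def)
    have zx: "?z x = of_real (x $ 1) + \<i> * of_real (x $ 2)" by (simp add: Complex_eq)
    have sx: "complex_of_real (?s x) = of_real (x$1) * of_real (x$1) + of_real (x$2) * of_real (x$2) + of_real (x$3) * of_real (x$3)"
      by (simp add: inner_vec_def sum_3)
    \<comment> \<open>The contributions of \<open>gq\<close> cancel by the isotropy of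
      \<open>planar_direction\<close>; what remains has the coefficients of the ordinary
      differential equation.\<close>
    have "(\<Sum>i\<in>UNIV. H i x $ i) = 4 * a x * (q x * ?z x) + 6 * a x * p x + 4 * of_real (R2 (?s x)) * of_real (?s x) * p x"
      unfolding zx sx H_def sum_3
      by (simp add: gxp_def xp_def gp_def gb_def ga_def gq_def a_def[symmetric] axis_def algebra_simps)
    also have "\<dots> = of_real (4 * ?s x * R2 (?s x) + (6 + 4 * real l) * R1 (?s x)) * p x"
      unfolding qz a_def by (simp add: algebra_simps)
    also have "\<dots> = - of_real (\<kappa>\<^sup>2) * w x" unfolding ode wbp b_def by simp
    finally show ?thesis .
  qed
  have "classical_helmholtz \<kappa> w g H"
    unfolding classical_helmholtz_def by (intro conjI allI dw cg dH cH pde)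
  thus ?thesis by blast
qed

section \<open>Approximation by test functions and the eigenfunction\<close>

lemma l2norm_ball_tendsto_0:
  fixes f :: "nat \<Rightarrow> pt \<Rightarrow> 'b::{banach,second_countable_topology}"
  assumes c: "\<And>n. continuous_on (cball 0 1) (f n)" and K: "\<And>n x. norm x < 1 \<Longrightarrow> norm (f n x) \<le> K"
    and z: "\<And>x. norm x < 1 \<Longrightarrow> eventually (\<lambda>n. f n x = 0) sequentially"
  shows "(\<lambda>n. l2norm (lebesgue_on B1) (f n)) \<longlonglongrightarrow> 0"
proof -
  have "(\<lambda>n. integral\<^sup>L (lebesgue_on B1) (\<lambda>x. (norm (f n x))\<^sup>2)) \<longlonglongrightarrow> integral\<^sup>L (lebesgue_on B1) (\<lambda>x. 0::real)"
  proof (rule integral_dominated_convergence[where w="\<lambda>_. K\<^sup>2"])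
    show "(\<lambda>x. (norm (f n x))\<^sup>2) \<in> borel_measurable (lebesgue_on B1)" for n
      using square_integrable_measurable[OF square_integrable_ball_continuous[OF c]] by measurable
    show "integrable (lebesgue_on B1) (\<lambda>_. K\<^sup>2)"
      using finite_measure.integrable_const[OF finite_measure_ball] .
    show "AE x in lebesgue_on B1. (\<lambda>n. (norm (f n x))\<^sup>2) \<longlonglongrightarrow> 0"
    proof (rule AE_I2)
      fix x :: pt assume "x \<in> space (lebesgue_on B1)"
      hence "eventually (\<lambda>n. f n x = 0) sequentially" by (intro z) (simp add: space_restrict_space)
      hence "eventually (\<lambda>n. (norm (f n x))\<^sup>2 = 0) sequentially" by (rule eventually_mono) simp
      thus "(\<lambda>n. (norm (f n x))\<^sup>2) \<longlonglongrightarrow> 0" by (rule tendsto_eventually)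
    qed
    show "AE x in lebesgue_on B1. norm ((norm (f n x))\<^sup>2) \<le> K\<^sup>2" for n
      by (rule AE_I2) (simp add: space_restrict_space K power_mono)
  qed simp
  from tendsto_real_sqrt[OF this] show ?thesis by (simp add: l2norm_def)
qed

lemma norm_complex_vec3_le:
  fixes v :: "complex^3"
  assumes "\<And>i. norm (v $ i) \<le> B"
  shows "norm v \<le> 3 * B"
proof -
  have "norm v \<le> (\<Sum>i\<in>UNIV. norm (v $ i))" unfolding norm_vec_def by (rule L2_set_le_sum) simp
  also have "\<dots> \<le> (\<Sum>i\<in>(UNIV::3 set). B)" by (intro sum_mono assms)
  finally show ?thesis by simp
qed

text \<open>Multiplying by a cutoff in the squared norm costs a derivative of order 1/a, but where
  it is nonzero the hypothesis makes \<open>w\<close> of order a. The gradient error is thus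
  uniformly bounded and eventually zero at each point, so it tends to zero in norm.\<close>

lemma test_function_approximation:
  assumes w: "\<And>x. grad_at w x (g x)" and g: "continuous_on UNIV g"
    and M: "\<And>x. norm x < 1 \<Longrightarrow> norm (w x) \<le> M * (1 - inner x x)" and e: "e > 0"
  shows "\<exists>\<phi> D. test_function \<phi> D \<and> L2_norm (\<lambda>x. w x - \<phi> x) < e \<and> L2_norm (\<lambda>x. g x - D x) < e"
proof -
  define a where "a n = inverse (real (Suc (Suc n)) + 1)" for n
  have a: "0 < a n" "a n < 1/2" for n by (auto simp: a_def field_simps)
  have a0: "a \<longlonglongrightarrow> 0"
  proof -
    have "(\<lambda>n. inverse (real (Suc (n + 2)))) \<longlonglongrightarrow> 0"
      using LIMSEQ_ignore_initial_segment[OF LIMSEQ_inverse_real_of_nat, of 2] by simp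
    thus ?thesis by (simp add: a_def[abs_def] add.commute)
  qed
  let ?s = "\<lambda>x::pt. inner x x"
  define \<phi> where "\<phi> n x = of_real (cutoff (a n) (?s x)) * w x" for n x
  define D where "D n x = (\<chi> i. of_real (cutoff (a n) (?s x)) * g x $ i + w x * (\<chi> i. of_real (cutoff' (a n) (?s x) * (2 * x $ i))) $ i)" for n x
  have sub: "continuous_on A f" if "continuous_on UNIV f" for A :: "pt set" and f :: "pt \<Rightarrow> 'b::topological_space"
    using that continuous_on_subset by blast
  have wc: "continuous_on A w" for A using w by (meson grad_at_continuous continuous_at_imp_continuous_on)
  have Dc: "continuous_on A (D n)" for A n
    unfolding D_def[abs_def] by (intro continuous_on_vec_lambda continuous_intros wc sub[OF g])
  have \<phi>c: "continuous_on A (\<phi> n)" for A n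
    unfolding \<phi>_def[abs_def] by (intro continuous_intros wc)
  have tf: "test_function (\<phi> n) (D n)" for n
  proof -
    have "test_function (\<phi> n) (\<lambda>x. if x \<in> UNIV then D n x else 0)"
    proof (rule test_functionI[of "cball 0 (sqrt (1 - a n))"])
      show "cball 0 (sqrt (1 - a n)) \<subseteq> B1"
      proof
        fix x :: pt assume "x \<in> cball 0 (sqrt (1 - a n))"
        hence "norm x \<le> sqrt (1 - a n)" by simp
        also have "\<dots> < 1" using a(1)[of n] by simp
        finally show "x \<in> B1" by simp
      qed
      show "\<phi> n x = 0" if "x \<notin> cball 0 (sqrt (1 - a n))" for x
      proof -
        have "sqrt (1 - a n) < norm x" using that by simp
        hence "(sqrt (1 - a n))\<^sup>2 \<le> (norm x)\<^sup>2" using a[of n] by (intro power_mono) auto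
        hence "1 - a n \<le> ?s x" using a[of n] by (simp add: power2_norm_eq_inner)
        thus ?thesis using cutoff_props(4)[OF a(1)] by (simp add: \<phi>_def)
      qed
      show "grad_at (\<phi> n) x (D n x)" for x
        unfolding \<phi>_def[abs_def] D_def
        by (rule grad_at_mult[OF grad_at_square[OF has_real_derivative_cutoff[OF a(1)]] w])
      show "continuous_on UNIV (D n)" by (rule Dc)
    qed auto
    thus ?thesis by simp
  qed
  have ev: "eventually (\<lambda>n. ?s x \<le> 1 - 2 * a n) sequentially" if "norm x < 1" for x
  proof -
    have "(norm x)\<^sup>2 < 1" using that by (simp add: power_less_one_iff abs_square_less_1)
    hence "0 < (1 - ?s x) / 2" by (simp add: power2_norm_eq_inner)
    from order_tendstoD(2)[OF a0 this] show ?thesis by (rule eventually_mono) simp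
  qed
  obtain K1 where K1: "\<And>x. x \<in> cball 0 1 \<Longrightarrow> norm (w x) \<le> K1" using compact_norm_bound[OF compact_cball wc] by blast
  obtain K2 where K2: "\<And>x. x \<in> cball 0 1 \<Longrightarrow> norm (g x) \<le> K2" using compact_norm_bound[OF compact_cball sub[OF g]] by blast
  have M0: "0 \<le> M" using M[of 0] by (simp add: order_trans[OF norm_ge_zero])
  have 1: "(\<lambda>n. l2norm (lebesgue_on B1) (\<lambda>x. w x - \<phi> n x)) \<longlonglongrightarrow> 0"
  proof (rule l2norm_ball_tendsto_0[where K=K1])
    show "continuous_on (cball 0 1) (\<lambda>x. w x - \<phi> n x)" for n by (intro continuous_intros wc \<phi>c)
    show "norm (w x - \<phi> n x) \<le> K1" if "norm x < 1" for n x
    proof -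
      have "w x - \<phi> n x = of_real (1 - cutoff (a n) (?s x)) * w x" by (simp add: \<phi>_def algebra_simps)
      hence "norm (w x - \<phi> n x) = \<bar>1 - cutoff (a n) (?s x)\<bar> * norm (w x)" by (simp only: norm_mult norm_of_real)
      also have "\<dots> \<le> 1 * norm (w x)" using cutoff_props(1,2)[OF a(1), of n "?s x"] by (intro mult_right_mono) auto
      finally show ?thesis using K1[of x] that by simp
    qed
    show "eventually (\<lambda>n. w x - \<phi> n x = 0) sequentially" if "norm x < 1" for x
      using ev[OF that] by (rule eventually_mono) (simp add: \<phi>_def cutoff_props(3)[OF a(1)])
  qed
  have 2: "(\<lambda>n. l2norm (lebesgue_on B1) (\<lambda>x. g x - D n x)) \<longlonglongrightarrow> 0"
  proof (rule l2norm_ball_tendsto_0[where K="3 * (K2 + 16 * M)"])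
    show "continuous_on (cball 0 1) (\<lambda>x. g x - D n x)" for n by (intro continuous_intros Dc sub[OF g])
    show "eventually (\<lambda>n. g x - D n x = 0) sequentially" if "norm x < 1" for x
      using ev[OF that]
      by (rule eventually_mono)
         (simp add: D_def cutoff_props(3)[OF a(1)] cutoff_props(6)[OF a(1)] Finite_Cartesian_Product.vec_eq_iff)
    fix n and x :: pt assume x: "norm x < 1"
    show "norm (g x - D n x) \<le> 3 * (K2 + 16 * M)"
    proof (rule norm_complex_vec3_le)
      fix i
      let ?c = "cutoff (a n) (?s x)" and ?c' = "cutoff' (a n) (?s x)"
      have "(g x - D n x) $ i = of_real (1 - ?c) * g x $ i - w x * of_real (?c' * (2 * x $ i))"
        by (simp add: D_def algebra_simps)
      hence "norm ((g x - D n x) $ i) \<le> norm (of_real (1 - ?c) * g x $ i) + norm (w x * of_real (?c' * (2 * x $ i)))"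
        by (simp only: norm_triangle_ineq4)
      also have "norm (of_real (1 - ?c) * g x $ i) \<le> 1 * K2"
        unfolding norm_mult norm_of_real
      proof (intro mult_mono)
        show "\<bar>1 - ?c\<bar> \<le> 1" using cutoff_props(1,2)[OF a(1), of n "?s x"] by auto
        have "norm (g x) \<le> K2" using K2[of x] x by simp
        thus "norm (g x $ i) \<le> K2" using Finite_Cartesian_Product.norm_nth_le order_trans by blast
      qed auto
      also have "norm (w x * of_real (?c' * (2 * x $ i))) \<le> 16 * M"
      proof (cases "?s x \<le> 1 - 2 * a n")
        case True
        thus ?thesis using cutoff_props(6)[OF a(1) True] M0 by simp
      next
        case False
        have "\<bar>x $ i\<bar> \<le> 1" using Finite_Cartesian_Product.norm_nth_le[of x i] x by simp
        hence xi: "\<bar>2 * x $ i\<bar> \<le> 2" by simp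
        have "norm (w x) \<le> M * (2 * a n)" using M[OF x] False M0 by (intro order_trans[OF M[OF x]] mult_left_mono) auto
        \<comment> \<open>The factors are 2 a M for \<open>w\<close> in the layer, 4 / a for the
          derivative of the cutoff and 2 for the gradient of the squared norm; \<open>a\<close>
          cancels.\<close>
        hence "norm (w x) * (\<bar>?c'\<bar> * \<bar>2 * x $ i\<bar>) \<le> M * (2 * a n) * (4 / a n * 2)"
          using cutoff_props(8)[OF a(1)] xi M0 a(1)[of n] by (intro mult_mono) auto
        also have "\<dots> = 16 * M" using a(1)[of n] by simp
        finally show ?thesis unfolding norm_mult norm_of_real abs_mult[of ?c'] .
      qed
      finally show "norm ((g x - D n x) $ i) \<le> K2 + 16 * M" by simp
    qed
  qed
  have "eventually (\<lambda>n. l2norm (lebesgue_on B1) (\<lambda>x. w x - \<phi> n x) < e \<and> l2norm (lebesgue_on B1) (\<lambda>x. g x - D n x) < e) sequentially"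
    using order_tendstoD(2)[OF 1 e] order_tendstoD(2)[OF 2 e] by (rule eventually_conj)
  then obtain n where "l2norm (lebesgue_on B1) (\<lambda>x. w x - \<phi> n x) < e" "l2norm (lebesgue_on B1) (\<lambda>x. g x - D n x) < e"
    unfolding eventually_sequentially by blast
  thus ?thesis using tf[of n] unfolding L2_norm_eq by blast
qed

lemma l2norm_ball_eq_0:
  fixes w :: "pt \<Rightarrow> complex"
  assumes w: "continuous_on UNIV w" and z: "l2norm (lebesgue_on B1) w = 0" and x: "norm x < 1"
  shows "w x = 0"
proof -
  have c: "continuous_on (cball 0 1) w" using w continuous_on_subset by blast
  have i: "integrable (lebesgue_on B1) (\<lambda>x. (norm (w x))\<^sup>2)"
    using square_integrable_ball_continuous[OF c] by (simp add: square_integrable_def)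
  have "integral\<^sup>L (lebesgue_on B1) (\<lambda>x. (norm (w x))\<^sup>2) = 0" using z l2norm_power2[of "lebesgue_on B1" w] by simp
  moreover have "AE x in lebesgue_on B1. 0 \<le> (norm (w x))\<^sup>2" by (rule AE_I2) simp
  ultimately have "AE x in lebesgue_on B1. (norm (w x))\<^sup>2 = 0"
    using integral_nonneg_eq_0_iff_AE[OF i] by blast
  hence "AE x in lebesgue. x \<in> B1 \<longrightarrow> (norm (w x))\<^sup>2 = 0" by (subst (asm) AE_restrict_space_iff) simp_all
  hence ae: "AE x in lebesgue. x \<in> B1 \<longrightarrow> x \<in> {x. w x = 0}" by (rule eventually_mono) simp
  have "closed {x. w x = 0}" by (rule closed_Collect_eq[OF w continuous_on_const])
  from mem_closed_if_AE_lebesgue_open[OF open_ball this ae, of x] x show ?thesis by simp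
qed

text \<open>The Helmholtz wave built from degree \<open>l\<close> has boundary values zero exactly
  because the power series vanishes at \<kappa>^2; membership in the closure of the test functions
  then follows from linear decay at the boundary.\<close>

lemma dirichlet_eigenvalue_if_bessel_zero:
  assumes k: "\<kappa> > 0" and j: "spherical_bessel l \<kappa> = 0"
  shows "dirichlet_eigenvalue (\<kappa>\<^sup>2)"
proof -
  define w where "w = (\<lambda>x::pt. complex_of_real (bessel_series l (\<kappa>\<^sup>2 * inner x x)) * Complex (x $ 1) (x $ 2) ^ l)"
  have "\<exists>g H. classical_helmholtz \<kappa> w g H" unfolding w_def by (rule helmholtz_wave)
  then obtain g H where gH: "classical_helmholtz \<kappa> w g H" by blast
  have gw: "grad_at w x (g x)" for x using gH unfolding classical_helmholtz_def by blast
  have gc: "continuous_on UNIV g" using gH unfolding classical_helmholtz_def by blast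
  have H: "grad_at (\<lambda>x. g x $ i) x (H i x)" "continuous_on UNIV (H i)" for i x
    using gH unfolding classical_helmholtz_def by (blast+)
  have pde: "(\<Sum>i\<in>UNIV. H i x $ i) = - of_real (\<kappa>\<^sup>2) * w x" for x
    using gH unfolding classical_helmholtz_def by blast
  have wc: "continuous_on UNIV w" using gw by (meson grad_at_continuous continuous_at_imp_continuous_on)
  have R1: "bessel_series l (\<kappa>\<^sup>2) = 0" using j k by (simp add: spherical_bessel_eq)
  obtain B where B: "\<And>s. s \<in> {0..1} \<Longrightarrow> norm (\<kappa>\<^sup>2 * bessel_series1 l (\<kappa>\<^sup>2 * s)) \<le> B"
  proof -
    have "continuous_on {0..1} (\<lambda>s. \<kappa>\<^sup>2 * bessel_series1 l (\<kappa>\<^sup>2 * s))" by (intro continuous_intros)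
    thus ?thesis using compact_norm_bound[OF compact_Icc] that by blast
  qed
  \<comment> \<open>The mean value inequality from the zero at s = 1, where s stands for the squared
    norm of the point.\<close>
  have Rb: "\<bar>bessel_series l (\<kappa>\<^sup>2 * s)\<bar> \<le> B * (1 - s)" if s: "0 \<le> s" "s \<le> 1" for s
  proof -
    have "norm (bessel_series l (\<kappa>\<^sup>2 * s) - bessel_series l (\<kappa>\<^sup>2 * 1)) \<le> B * norm (s - 1)"
    proof (rule field_differentiable_bound[where S="{0..1}" and f="\<lambda>s. bessel_series l (\<kappa>\<^sup>2 * s)" and f'="\<lambda>s. \<kappa>\<^sup>2 * bessel_series1 l (\<kappa>\<^sup>2 * s)"])
      show "((\<lambda>s. bessel_series l (\<kappa>\<^sup>2 * s)) has_field_derivative \<kappa>\<^sup>2 * bessel_series1 l (\<kappa>\<^sup>2 * z)) (at z within {0..1})" for z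
      proof -
        have "((\<lambda>s. \<kappa>\<^sup>2 * s) has_real_derivative \<kappa>\<^sup>2) (at z)" by (auto intro!: derivative_eq_intros)
        from DERIV_chain2[OF has_real_derivative_bessel_series(1) this] show ?thesis
          unfolding mult.commute[of "\<kappa>\<^sup>2" "bessel_series1 _ _"] by (rule has_field_derivative_at_within)
      qed
      show "norm (\<kappa>\<^sup>2 * bessel_series1 l (\<kappa>\<^sup>2 * z)) \<le> B" if "z \<in> {0..1}" for z
        using B[OF that] .
    qed (use s in simp_all)
    moreover have "norm (s - 1) = 1 - s" using s by simp
    ultimately show ?thesis using R1 by simp
  qed
  have bound: "norm (w x) \<le> B * (1 - inner x x)" if x: "norm x < 1" for x
  proof -
    have "(norm x)\<^sup>2 \<le> 1" using x by (simp add: abs_square_le_1)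
    hence s: "0 \<le> inner x x" "inner x x \<le> 1" by (auto simp: power2_norm_eq_inner)
    have "cmod (Complex (x $ 1) (x $ 2)) \<le> norm x" unfolding cmod_def norm_pt by (intro real_sqrt_le_mono) simp
    hence "cmod (Complex (x $ 1) (x $ 2)) ^ l \<le> 1" using x by (intro power_le_one) auto
    hence "norm (w x) \<le> \<bar>bessel_series l (\<kappa>\<^sup>2 * inner x x)\<bar> * 1"
      unfolding w_def norm_mult norm_of_real norm_power by (intro mult_left_mono) auto
    thus ?thesis using Rb[OF s] by simp
  qed
  have nz: "L2_norm w \<noteq> 0"
  proof
    assume "L2_norm w = 0"
    hence w0: "w x = 0" if "norm x < 1" for x using l2norm_ball_eq_0[OF wc _ that] by (simp add: L2_norm_eq)
    \<comment> \<open>Along the first axis the solid harmonic is t^l and nonzero for t > 0, so the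
      series would have to vanish there and, by continuity, at 0, where its value is the positive
      first coefficient.\<close>
    have zero: "bessel_series l (\<kappa>\<^sup>2 * t\<^sup>2) = 0" if t: "t \<in> {0<..<1}" for t
    proof -
      have "norm (t *\<^sub>R axis 1 1 :: pt) < 1" using t by (simp add: norm_axis_1)
      hence w1: "w (t *\<^sub>R axis 1 1) = 0" by (rule w0)
      have i: "inner (t *\<^sub>R axis 1 1 :: pt) (t *\<^sub>R axis 1 1) = t\<^sup>2"
        by (simp add: inner_axis_axis power2_eq_square)
      have n: "(t *\<^sub>R axis 1 1 :: pt) $ 1 = t" "(t *\<^sub>R axis 1 1 :: pt) $ 2 = 0" by (simp_all add: axis_def)
      have "complex_of_real (bessel_series l (\<kappa>\<^sup>2 * t\<^sup>2)) * Complex t 0 ^ l = 0"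
        using w1 unfolding w_def i n .
      moreover have "Complex t 0 \<noteq> 0" using t by (simp add: complex_eq_iff)
      ultimately show ?thesis by simp
    qed
    have cont: "continuous_on (closure {0<..<1}) (\<lambda>t. bessel_series l (\<kappa>\<^sup>2 * t\<^sup>2))" by (intro continuous_intros)
    have "(0::real) \<in> closure {0<..<1}" by simp
    from continuous_constant_on_closure[OF cont zero this] have "bessel_series l (\<kappa>\<^sup>2 * 0\<^sup>2) = 0" by simp
    thus False using abs_bessel_coeff_0[of l] by (simp add: bessel_series_def)
  qed
  show ?thesis
    unfolding dirichlet_eigenvalue_def
  proof (rule exI[of _ w], rule exI[of _ g], intro conjI allI impI)
    show "has_weak_gradient w g" by (rule has_weak_gradient_C1[OF gw gc])
    show "L2_norm w \<noteq> 0" by (rule nz)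
    show "\<exists>\<phi> D. test_function \<phi> D \<and> L2_norm (\<lambda>x. w x - \<phi> x) < e \<and> L2_norm (\<lambda>x. g x - D x) < e" if "e > 0" for e
      by (rule test_function_approximation[OF gw gc _ that]) (rule bound)
    show "integral\<^sup>L (lebesgue_on B1) (\<lambda>x. \<Sum>i\<in>UNIV. g x $ i * D x $ i) = of_real (\<kappa>\<^sup>2) * integral\<^sup>L (lebesgue_on B1) (\<lambda>x. w x * \<phi> x)"
      if "test_function \<phi> D" for \<phi> D
      by (rule weak_helmholtz_C2[OF wc gc H pde that])
  qed
qed

section \<open>Truncated singular value decomposition\<close>

lemma vec_l2_norm_eq: "vec_l2_norm v = L2_set (\<lambda>i. cmod (vec_index v i)) {..<dim_vec v}"
  by (simp add: vec_l2_norm_def L2_set_def)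

lemma vec_l2_norm_power2: "of_real ((vec_l2_norm v)\<^sup>2) = v \<bullet>c v"
proof -
  have "(vec_l2_norm v)\<^sup>2 = (\<Sum>p<dim_vec v. (cmod (vec_index v p))\<^sup>2)"
    by (simp add: vec_l2_norm_def sum_nonneg)
  thus ?thesis
    by (simp add: scalar_prod_def conjugate_vec_def complex_norm_square lessThan_atLeast0 del: of_real_power)
qed

section \<open>Adjoints, unitary matrices and their effect on the Euclidean norm\<close>

lemma mat_adjoint_carrier: "A \<in> carrier_mat n m \<Longrightarrow> mat_adjoint A \<in> carrier_mat m n"
  unfolding mat_adjoint_def by (auto simp: mat_of_rows_def)

lemma mat_adjoint_index:
  assumes "A \<in> carrier_mat n m" "i < m" "j < n"
  shows "mat_adjoint A $$ (i, j) = cnj (A $$ (j, i))"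
  using assms unfolding mat_adjoint_def by (simp add: mat_of_rows_index conjugate_vec_def)

lemma cscalar_prod_mult_mat_vec:
  assumes A: "A \<in> carrier_mat n m" and w: "w \<in> carrier_vec m" and u: "(u :: complex Matrix.vec) \<in> carrier_vec n"
  shows "(A *\<^sub>v w) \<bullet>c u = w \<bullet>c (mat_adjoint A *\<^sub>v u)"
proof -
  note Ac = mat_adjoint_carrier[OF A]
  have "(A *\<^sub>v w) \<bullet>c u = (\<Sum>i<n. (\<Sum>j<m. A $$ (i, j) * vec_index w j) * cnj (vec_index u i))"
    using A w u by (simp add: scalar_prod_def mult_mat_vec_def lessThan_atLeast0)
  also have "\<dots> = (\<Sum>j<m. \<Sum>i<n. A $$ (i, j) * vec_index w j * cnj (vec_index u i))"
    unfolding sum_distrib_right by (rule sum.swap)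
  also have "\<dots> = (\<Sum>j<m. vec_index w j * cnj (\<Sum>i<n. mat_adjoint A $$ (j, i) * vec_index u i))"
    by (intro sum.cong refl) (simp add: mat_adjoint_index[OF A] sum_distrib_left mult_ac)
  also have "\<dots> = w \<bullet>c (mat_adjoint A *\<^sub>v u)"
    using Ac w u by (simp add: scalar_prod_def mult_mat_vec_def lessThan_atLeast0)
  finally show ?thesis .
qed

lemma unitary_matD:
  assumes "unitary_mat n U"
  shows "U \<in> carrier_mat n n" "mat_adjoint U \<in> carrier_mat n n" "mat_adjoint U * U = 1\<^sub>m n" "U * mat_adjoint U = 1\<^sub>m n"
  using assms mat_adjoint_carrier by (auto simp: unitary_mat_def)

lemma unitary_mat_mult_adjoint:
  assumes "unitary_mat n U" "v \<in> carrier_vec n"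
  shows "U *\<^sub>v (mat_adjoint U *\<^sub>v v) = v" "mat_adjoint U *\<^sub>v (U *\<^sub>v v) = v"
  using assoc_mult_mat_vec[of U n n "mat_adjoint U" n v] assoc_mult_mat_vec[of "mat_adjoint U" n n U n v]
    unitary_matD[OF assms(1)] assms(2) by simp_all

lemma vec_l2_norm_unitary:
  assumes U: "unitary_mat n U" and v: "v \<in> carrier_vec n"
  shows "vec_l2_norm (U *\<^sub>v v) = vec_l2_norm v"
proof -
  note Ud = unitary_matD[OF U]
  have "(U *\<^sub>v v) \<bullet>c (U *\<^sub>v v) = v \<bullet>c v"
    using cscalar_prod_mult_mat_vec[OF Ud(1) v, of "U *\<^sub>v v"] unitary_mat_mult_adjoint(2)[OF U v] Ud(1) v by simp
  hence "complex_of_real ((vec_l2_norm (U *\<^sub>v v))\<^sup>2) = of_real ((vec_l2_norm v)\<^sup>2)"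
    by (simp only: vec_l2_norm_power2)
  hence "(vec_l2_norm (U *\<^sub>v v))\<^sup>2 = (vec_l2_norm v)\<^sup>2" by (simp only: of_real_eq_iff)
  thus ?thesis by (simp add: vec_l2_norm_def sum_nonneg power2_eq_iff_nonneg)
qed

lemma vec_l2_norm_unitary_adjoint:
  assumes U: "unitary_mat n U" and v: "v \<in> carrier_vec n"
  shows "vec_l2_norm (mat_adjoint U *\<^sub>v v) = vec_l2_norm v"
  using vec_l2_norm_unitary[OF U, of "mat_adjoint U *\<^sub>v v"] unitary_mat_mult_adjoint(1)[OF U v]
    unitary_matD(2)[OF U] v by simp

lemma rect_diag_mult_vec:
  assumes "v \<in> carrier_vec n"
  shows "rect_diag m n d *\<^sub>v v = Matrix.vec m (\<lambda>i. if i < n then of_real (d i) * vec_index v i else 0)"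
proof (rule eq_vecI)
  fix i assume "i < dim_vec (Matrix.vec m (\<lambda>i. if i < n then of_real (d i) * vec_index v i else 0))"
  hence i: "i < m" by simp
  have "vec_index (rect_diag m n d *\<^sub>v v) i = (\<Sum>j<n. (if i = j then of_real (d i) else 0) * vec_index v j)"
    using i assms by (simp add: rect_diag_def mult_mat_vec_def scalar_prod_def lessThan_atLeast0)
  also have "\<dots> = (\<Sum>j<n. if j = i then of_real (d i) * vec_index v i else 0)"
    by (intro sum.cong) auto
  also have "\<dots> = (if i < n then of_real (d i) * vec_index v i else 0)"
    by (simp add: sum.delta')
  finally show "vec_index (rect_diag m n d *\<^sub>v v) i = vec_index (Matrix.vec m (\<lambda>i. if i < n then of_real (d i) * vec_index v i else 0)) i"
    using i by simp
qed (simp add: rect_diag_def)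

lemma rect_diag_carrier: "rect_diag m n d \<in> carrier_mat m n"
  by (simp add: rect_diag_def)

lemma sigma_max_nonneg: "0 \<le> sigma_max A d"
  unfolding sigma_max_def by (intro Max_ge) auto

lemma is_svd_mult_vec:
  assumes svd: "is_svd A U d V" and A: "A \<in> carrier_mat S n" and v: "v \<in> carrier_vec n"
  shows "A *\<^sub>v v = U *\<^sub>v (rect_diag S n d *\<^sub>v (mat_adjoint V *\<^sub>v v))"
proof -
  have U: "unitary_mat S U" and V: "unitary_mat n V" and eq: "A = U * rect_diag S n d * mat_adjoint V"
    using svd A by (auto simp: is_svd_def)
  note Ud = unitary_matD[OF U] and Vd = unitary_matD[OF V] and D = rect_diag_carrier[of S n d]
  have "A *\<^sub>v v = (U * rect_diag S n d) *\<^sub>v (mat_adjoint V *\<^sub>v v)"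
    unfolding eq using assoc_mult_mat_vec[of "U * rect_diag S n d" S n "mat_adjoint V" n v] Ud Vd D v by simp
  also have "\<dots> = U *\<^sub>v (rect_diag S n d *\<^sub>v (mat_adjoint V *\<^sub>v v))"
    using assoc_mult_mat_vec[of U S S "rect_diag S n d" n "mat_adjoint V *\<^sub>v v"] Ud Vd D v by simp
  finally show ?thesis .
qed

lemma regularized_solution_carrier:
  assumes svd: "is_svd A U d V" and A: "A \<in> carrier_mat S n" and b: "b \<in> carrier_vec S"
  shows "regularized_solution A U d V \<epsilon> b \<in> carrier_vec n"
proof -
  have "unitary_mat S U" "unitary_mat n V" using svd A by (auto simp: is_svd_def)
  from unitary_matD(2)[OF this(1)] unitary_matD(1)[OF this(2)] show ?thesis
    using A b unfolding regularized_solution_def Let_def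
    by (intro mult_mat_vec_carrier[of _ n S] mult_carrier_mat[of _ n S _ S] mult_carrier_mat[of _ n n _ S])
       (auto simp: rect_diag_def)
qed

text \<open>In the singular bases both residuals are diagonal. An index kept by the truncation contributes
  nothing to the regularized residual, and a truncated one contributes
  \<open>\<bar>\<beta>\<^sub>i\<bar> \<le> \<bar>\<beta>\<^sub>i - d\<^sub>i \<nu>\<^sub>i\<bar> + d\<^sub>i \<bar>\<nu>\<^sub>i\<bar>\<close> with \<open>d\<^sub>i \<le> \<epsilon> \<sigma>\<^bsub>max\<^esub>\<close>.\<close>

lemma regularized_residual_le:
  assumes svd: "is_svd A U d V" and A: "A \<in> carrier_mat S n"
    and b: "b \<in> carrier_vec S" and mu: "\<mu> \<in> carrier_vec n" and e: "\<epsilon> > 0"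
  shows "vec_l2_norm (b - A *\<^sub>v regularized_solution A U d V \<epsilon> b)
    \<le> vec_l2_norm (b - A *\<^sub>v \<mu>) + \<epsilon> * sigma_max A d * vec_l2_norm \<mu>"
proof -
  have U: "unitary_mat S U" and V: "unitary_mat n V" and d0: "\<And>i. i < min S n \<Longrightarrow> d i \<ge> 0"
    using svd A by (auto simp: is_svd_def)
  note Ud = unitary_matD[OF U] and Vd = unitary_matD[OF V]
  define \<sigma> where "\<sigma> = sigma_max A d"
  define de where "de = (\<lambda>i. if d i < \<epsilon> * \<sigma> then 0 else d i)"
  define \<xi> where "\<xi> = regularized_solution A U d V \<epsilon> b"
  define \<beta> where "\<beta> = mat_adjoint U *\<^sub>v b"
  define \<nu> where "\<nu> = mat_adjoint V *\<^sub>v \<mu>"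
  define E where "E = rect_diag n S (\<lambda>i. inverse (de i))"
  have bc: "\<beta> \<in> carrier_vec S" and nc: "\<nu> \<in> carrier_vec n" and Ec: "E \<in> carrier_mat n S"
    using Ud Vd b mu by (auto simp: \<beta>_def \<nu>_def E_def rect_diag_def)
  have "\<xi> = V *\<^sub>v (E *\<^sub>v \<beta>)"
  proof -
    have "\<xi> = (V * E * mat_adjoint U) *\<^sub>v b"
      using A by (simp add: \<xi>_def regularized_solution_def Let_def E_def de_def \<sigma>_def)
    also have "\<dots> = (V * E) *\<^sub>v \<beta>"
      using assoc_mult_mat_vec[of "V * E" n S "mat_adjoint U" S b] Ud Vd Ec b by (simp add: \<beta>_def)
    also have "\<dots> = V *\<^sub>v (E *\<^sub>v \<beta>)"
      using assoc_mult_mat_vec[of V n n E S \<beta>] Vd Ec bc by simp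
    finally show ?thesis .
  qed
  hence xV: "mat_adjoint V *\<^sub>v \<xi> = E *\<^sub>v \<beta>" and xc: "\<xi> \<in> carrier_vec n"
    using unitary_mat_mult_adjoint(2)[OF V] Ec bc Vd by auto
  \<comment> \<open>Multiplication by the adjoint of \<open>U\<close> preserves the norm and makes
    the residual of any coefficient vector diagonal; rows beyond the \<open>n\<close> columns
    receive nothing from the matrix.\<close>
  have res: "vec_l2_norm (b - A *\<^sub>v y) = L2_set (\<lambda>i. cmod (vec_index \<beta> i - (if i < n then of_real (d i) * vec_index (mat_adjoint V *\<^sub>v y) i else 0))) {..<S}"
    if y: "y \<in> carrier_vec n" for y
  proof -
    let ?z = "rect_diag S n d *\<^sub>v (mat_adjoint V *\<^sub>v y)"
    have yc: "mat_adjoint V *\<^sub>v y \<in> carrier_vec n" using Vd y by auto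
    have z: "?z \<in> carrier_vec S" using rect_diag_carrier[of S n d] yc by auto
    have "b - A *\<^sub>v y = U *\<^sub>v \<beta> - U *\<^sub>v ?z"
      using is_svd_mult_vec[OF svd A y] unitary_mat_mult_adjoint(1)[OF U b] by (simp add: \<beta>_def)
    also have "\<dots> = U *\<^sub>v (\<beta> - ?z)" using mult_minus_distrib_mat_vec[OF Ud(1) bc z] by simp
    finally have "vec_l2_norm (b - A *\<^sub>v y) = vec_l2_norm (\<beta> - ?z)"
      using vec_l2_norm_unitary[OF U, of "\<beta> - ?z"] bc z by simp
    also have "\<dots> = L2_set (\<lambda>i. cmod (vec_index (\<beta> - ?z) i)) {..<S}"
      unfolding vec_l2_norm_eq using carrier_vecD[OF minus_carrier_vec[OF bc z]] by (simp only:)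
    also have "\<dots> = L2_set (\<lambda>i. cmod (vec_index \<beta> i - (if i < n then of_real (d i) * vec_index (mat_adjoint V *\<^sub>v y) i else 0))) {..<S}"
      using z bc by (intro L2_set_cong) (auto simp: rect_diag_mult_vec[OF yc])
    finally show ?thesis .
  qed
  \<comment> \<open>Extension by zero, since the sum runs over \<open>S\<close> rows while the
    coefficient vector has \<open>n\<close> entries.\<close>
  define \<nu>' where "\<nu>' i = (if i < n then cmod (vec_index \<nu> i) else 0)" for i
  have es: "0 \<le> \<epsilon> * \<sigma>" using e sigma_max_nonneg[of A d] by (simp add: \<sigma>_def)
  have "vec_l2_norm (b - A *\<^sub>v \<xi>) \<le> L2_set (\<lambda>i. cmod (vec_index \<beta> i - (if i < n then of_real (d i) * vec_index \<nu> i else 0)) + \<epsilon> * \<sigma> * \<nu>' i) {..<S}"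
    unfolding res[OF xc] xV
  proof (rule L2_set_mono)
    fix i assume i: "i \<in> {..<S}"
    let ?bi = "vec_index \<beta> i"
    show "cmod (?bi - (if i < n then of_real (d i) * vec_index (E *\<^sub>v \<beta>) i else 0))
      \<le> cmod (?bi - (if i < n then of_real (d i) * vec_index \<nu> i else 0)) + \<epsilon> * \<sigma> * \<nu>' i"
    proof (cases "i < n")
      case False
      thus ?thesis by (simp add: \<nu>'_def)
    next
      case True
      have Ei: "vec_index (E *\<^sub>v \<beta>) i = of_real (inverse (de i)) * ?bi"
        using True i by (simp add: E_def rect_diag_mult_vec[OF bc])
      show ?thesis
      proof (cases "de i = 0")
        case False
        hence "of_real (d i) * vec_index (E *\<^sub>v \<beta>) i = ?bi"
          unfolding Ei by (auto simp: de_def split: if_splits)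
        thus ?thesis using True es by (simp add: \<nu>'_def)
      next
        case z: True
        \<comment> \<open>Either the value was truncated or it is zero itself; both give d i \<le>
          \<epsilon> \<sigma>, and \<open>inverse 0 = 0\<close> removes the entry from the
          solution.\<close>
        have d: "0 \<le> d i" "d i \<le> \<epsilon> * \<sigma>" using z d0[of i] True i es by (auto simp: de_def split: if_splits)
        have "cmod ?bi \<le> cmod (?bi - of_real (d i) * vec_index \<nu> i) + cmod (of_real (d i) * vec_index \<nu> i)"
          by (metis norm_triangle_ineq diff_add_cancel)
        also have "cmod (of_real (d i) * vec_index \<nu> i) \<le> \<epsilon> * \<sigma> * \<nu>' i"
          using d True by (simp add: norm_mult \<nu>'_def mult_right_mono)
        finally show ?thesis using True z Ei by simp
      qed
    qed
  qed simp
  also have "\<dots> \<le> L2_set (\<lambda>i. cmod (vec_index \<beta> i - (if i < n then of_real (d i) * vec_index \<nu> i else 0))) {..<S}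
      + L2_set (\<lambda>i. \<epsilon> * \<sigma> * \<nu>' i) {..<S}"
    by (rule L2_set_triangle_ineq)
  also have "L2_set (\<lambda>i. \<epsilon> * \<sigma> * \<nu>' i) {..<S} = \<epsilon> * \<sigma> * L2_set \<nu>' {..<S}"
    by (rule L2_set_right_distrib[symmetric, OF es])
  also have "L2_set \<nu>' {..<S} \<le> vec_l2_norm \<nu>"
  proof -
    have "(\<Sum>i<S. (\<nu>' i)\<^sup>2) = (\<Sum>i\<in>{..<S} \<inter> {..<n}. (cmod (vec_index \<nu> i))\<^sup>2)"
      by (intro sum.mono_neutral_cong_right) (auto simp: \<nu>'_def)
    also have "\<dots> \<le> (\<Sum>i<n. (cmod (vec_index \<nu> i))\<^sup>2)" by (intro sum_mono2) auto
    finally show ?thesis using nc by (simp add: L2_set_def vec_l2_norm_def)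
  qed
  also have "vec_l2_norm \<nu> = vec_l2_norm \<mu>"
    unfolding \<nu>_def by (rule vec_l2_norm_unitary_adjoint[OF V mu])
  finally show ?thesis using es unfolding res[OF mu] \<nu>_def[symmetric] by (simp add: \<xi>_def \<sigma>_def mult_left_mono)
qed

text \<open>The right singular vector, the image of a unit vector under \<open>V\<close>, is the
  witness. It turns an operator bound for the matrix into a bound on the singular values.\<close>

lemma singular_value_attained:
  assumes svd: "is_svd A U d V" and A: "A \<in> carrier_mat S n" and i: "i < min S n"
  obtains y where "y \<in> carrier_vec n" "vec_l2_norm y = 1" "vec_l2_norm (A *\<^sub>v y) = d i"
proof -
  have U: "unitary_mat S U" and V: "unitary_mat n V" and d0: "d i \<ge> 0"
    using svd A i by (auto simp: is_svd_def)
  note Ud = unitary_matD[OF U] and Vd = unitary_matD[OF V]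
  have nu: "vec_l2_norm (unit_vec n i :: complex Matrix.vec) = 1"
  proof -
    have "(\<Sum>p<n. (cmod (vec_index (unit_vec n i :: complex Matrix.vec) p))\<^sup>2) = (\<Sum>p<n. if p = i then 1 else 0)"
      by (intro sum.cong) (auto simp: unit_vec_def)
    thus ?thesis using i by (simp add: vec_l2_norm_def)
  qed
  let ?y = "V *\<^sub>v unit_vec n i"
  have yc: "?y \<in> carrier_vec n" using Vd by auto
  have "A *\<^sub>v ?y = U *\<^sub>v (rect_diag S n d *\<^sub>v unit_vec n i)"
    using is_svd_mult_vec[OF svd A yc] unitary_mat_mult_adjoint(2)[OF V, of "unit_vec n i"] by simp
  hence "vec_l2_norm (A *\<^sub>v ?y) = vec_l2_norm (rect_diag S n d *\<^sub>v unit_vec n i)"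
    using vec_l2_norm_unitary[OF U, of "rect_diag S n d *\<^sub>v unit_vec n i"] rect_diag_carrier[of S n d] by auto
  also have "\<dots> = sqrt (\<Sum>p<S. if p = i then (d i)\<^sup>2 else 0)"
    unfolding vec_l2_norm_def rect_diag_mult_vec[OF unit_vec_carrier]
    by (intro arg_cong[where f=sqrt] sum.cong) (use i in \<open>auto simp: unit_vec_def norm_mult\<close>)
  also have "\<dots> = d i" using i d0 by simp
  finally have "vec_l2_norm (A *\<^sub>v ?y) = d i" .
  thus ?thesis using that[OF yc] vec_l2_norm_unitary[OF V, of "unit_vec n i"] nu by simp
qed

section \<open>Error of the regularized solution\<close>

lemma continuous_on_complex_vec: "continuous_on UNIV (\<lambda>v::complex^3. \<chi> i. c * v $ i)"
  by (intro continuous_on_vec_lambda continuous_intros)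

lemma norm_cmult_complex_vec: "norm (\<chi> i. c * v $ i) = norm c * norm (v :: complex^3)"
  by (simp add: norm_vec_def norm_mult L2_set_right_distrib)

lemma has_weak_gradient_zero: "has_weak_gradient (\<lambda>_. 0) (\<lambda>_. 0)"
  by (simp add: has_weak_gradient_def L2_space_eq square_integrable_def)

lemma has_weak_gradient_add_cmult:
  assumes "has_weak_gradient u g" "has_weak_gradient v h"
  shows "has_weak_gradient (\<lambda>x. u x + c * v x) (\<lambda>x. g x + (\<chi> i. c * h x $ i))"
proof -
  let ?M = "lebesgue_on B1"
  have u: "square_integrable ?M u" and g: "square_integrable ?M g" and v: "square_integrable ?M v" and h: "square_integrable ?M h"
    using assms by (simp_all add: has_weak_gradient_def L2_space_eq)
  have ch: "square_integrable ?M (\<lambda>x. \<chi> i. c * h x $ i)"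
  proof -
    have "(\<lambda>x. \<chi> i. c * h x $ i) \<in> borel_measurable ?M"
      by (rule measurable_compose[OF square_integrable_measurable[OF h] borel_measurable_continuous_onI[OF continuous_on_complex_vec]])
    thus ?thesis using h by (simp add: square_integrable_def norm_cmult_complex_vec power_mult_distrib)
  qed
  have "integral\<^sup>L ?M (\<lambda>x. (u x + c * v x) * D x $ i) = - integral\<^sup>L ?M (\<lambda>x. (g x + (\<chi> i. c * h x $ i)) $ i * \<phi> x)"
    if tf: "test_function \<phi> D" for \<phi> D i
  proof -
    have "continuous_on UNIV D" using tf by (simp add: test_function_def)
    hence "continuous_on (cball 0 1) D" using continuous_on_subset by blast
    hence D: "square_integrable ?M (\<lambda>x. D x $ i)" by (intro square_integrable_ball_continuous continuous_on_component)
    have "continuous_on (cball 0 1) \<phi>"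
      using tf unfolding test_function_def by (meson has_derivative_continuous continuous_at_imp_continuous_on)
    hence p: "square_integrable ?M \<phi>" by (rule square_integrable_ball_continuous)
    note iu = integrable_mult_square_integrable[OF u D] and iv = integrable_mult_square_integrable[OF v D]
      and ig = integrable_mult_square_integrable[OF square_integrable_component(1)[OF g, of i] p]
      and ih = integrable_mult_square_integrable[OF square_integrable_component(1)[OF h, of i] p]
    have "integral\<^sup>L ?M (\<lambda>x. (u x + c * v x) * D x $ i) = integral\<^sup>L ?M (\<lambda>x. u x * D x $ i) + c * integral\<^sup>L ?M (\<lambda>x. v x * D x $ i)"
      using iu iv by (simp add: distrib_right mult.assoc)
    also have "\<dots> = - integral\<^sup>L ?M (\<lambda>x. g x $ i * \<phi> x) + c * - integral\<^sup>L ?M (\<lambda>x. h x $ i * \<phi> x)"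
      using assms tf unfolding has_weak_gradient_def by simp
    also have "\<dots> = - integral\<^sup>L ?M (\<lambda>x. (g x + (\<chi> i. c * h x $ i)) $ i * \<phi> x)"
      using ig ih by (simp add: distrib_right mult.assoc)
    finally show ?thesis .
  qed
  thus ?thesis
    unfolding has_weak_gradient_def L2_space_eq
    using square_integrable_add[OF u square_integrable_cmult[OF v]] square_integrable_add[OF g ch] by simp
qed

text \<open>\<open>weak_gradient\<close> is selected by choice and linear only up to null sets,
  which makes linear combinations under \<open>B_norm\<close> awkward. Existence of a weak gradient
  and approximability in the plain norm of the ball pass to linear combinations directly and feed
  both main inequalities.\<close>

definition continuous_wave :: "real \<Rightarrow> (pt \<Rightarrow> complex) \<Rightarrow> bool" where
  "continuous_wave \<kappa> v \<longleftrightarrow> v \<in> H1_space \<and> wave_approximable \<kappa> v \<and> continuous_on (cball 0 1) v"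

lemma L2_norm_le_B_norm: "L2_norm v \<le> B_norm \<kappa> v"
proof -
  have "L2_norm v = sqrt ((L2_norm v)\<^sup>2)" by (simp add: L2_norm_eq)
  also have "\<dots> \<le> B_norm \<kappa> v" unfolding B_norm_def by (intro real_sqrt_le_mono) simp
  finally show ?thesis .
qed

lemma L2_norm_weak_gradient_le:
  assumes "\<kappa> > 0"
  shows "L2_norm (weak_gradient v) \<le> \<kappa> * B_norm \<kappa> v"
proof -
  have "L2_norm (weak_gradient v) / \<kappa> = sqrt ((L2_norm (weak_gradient v))\<^sup>2 / \<kappa>\<^sup>2)"
    using assms by (simp add: L2_norm_eq real_sqrt_divide)
  also have "\<dots> \<le> B_norm \<kappa> v" unfolding B_norm_def by (intro real_sqrt_le_mono) simp
  finally show ?thesis using assms by (simp add: field_simps)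
qed

lemma continuous_wave_B_space:
  assumes "v \<in> B_space \<kappa>" "continuous_on (cball 0 1) v"
  shows "continuous_wave \<kappa> v"
  using assms unfolding continuous_wave_def B_space_def wave_approximable_def L2_norm_eq[symmetric]
  by (blast intro: order_le_less_trans[OF L2_norm_le_B_norm])

lemma continuous_wave_zero: "continuous_wave \<kappa> (\<lambda>_. 0)"
proof -
  have span: "(\<lambda>_. 0) \<in> spherical_wave_span \<kappa>"
    unfolding spherical_wave_span_def by (intro CollectI exI[of _ 0] exI[of _ "\<lambda>_ _. 0"]) simp
  have "wave_approximable \<kappa> (\<lambda>_. 0)"
    unfolding wave_approximable_def
  proof (intro allI impI bexI[OF _ span])
    show "l2norm (lebesgue_on B1) (\<lambda>x::pt. 0 - 0 :: complex) < e" if "e > 0" for e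
      using that by (simp add: l2norm_def)
  qed
  moreover have "(\<lambda>_. 0) \<in> H1_space" unfolding H1_space_def using has_weak_gradient_zero by (intro CollectI exI)
  ultimately show ?thesis by (simp add: continuous_wave_def)
qed

lemma continuous_wave_add_cmult:
  assumes "continuous_wave \<kappa> u" "continuous_wave \<kappa> v"
  shows "continuous_wave \<kappa> (\<lambda>x. u x + c * v x)"
  unfolding continuous_wave_def
proof (intro conjI)
  show "(\<lambda>x. u x + c * v x) \<in> H1_space"
  proof -
    obtain g where g: "has_weak_gradient u g" using assms(1) by (auto simp: continuous_wave_def H1_space_def)
    obtain h where h: "has_weak_gradient v h" using assms(2) by (auto simp: continuous_wave_def H1_space_def)
    show ?thesis unfolding H1_space_def by (rule CollectI, rule exI, rule has_weak_gradient_add_cmult[OF g h])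
  qed
  have uc: "continuous_on (cball 0 1) u" and vc: "continuous_on (cball 0 1) v" using assms by (simp_all add: continuous_wave_def)
  show "continuous_on (cball 0 1) (\<lambda>x. u x + c * v x)" by (intro continuous_intros uc vc)
  show "wave_approximable \<kappa> (\<lambda>x. u x + c * v x)"
    unfolding wave_approximable_def
  proof (intro allI impI)
    fix e :: real assume e: "e > 0"
    let ?N = "l2norm (lebesgue_on B1)"
    define q where "q = e / (norm c + 1)"
    have q: "q > 0" unfolding q_def using e by (intro divide_pos_pos add_nonneg_pos) auto
    have qe: "norm c * q + q = e"
    proof -
      have "norm c + 1 \<noteq> 0" using norm_ge_zero[of c] by linarith
      hence "(norm c + 1) * q = e" by (simp add: q_def)
      thus ?thesis by (simp add: distrib_right)
    qed
    obtain s where s: "s \<in> spherical_wave_span \<kappa>" "?N (\<lambda>x. u x - s x) < q"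
      using assms(1) q unfolding continuous_wave_def wave_approximable_def by blast
    obtain t where t: "t \<in> spherical_wave_span \<kappa>" "?N (\<lambda>x. v x - t x) < q"
      using assms(2) q unfolding continuous_wave_def wave_approximable_def by blast
    have s1: "square_integrable (lebesgue_on B1) (\<lambda>x. u x - s x)"
      by (intro square_integrable_diff square_integrable_ball_continuous uc wave_span_square_integrable(1)[OF s(1)])
    have t1: "square_integrable (lebesgue_on B1) (\<lambda>x. c * (v x - t x))"
      by (intro square_integrable_cmult square_integrable_diff square_integrable_ball_continuous vc wave_span_square_integrable(1)[OF t(1)])
    have "?N (\<lambda>x. (u x - s x) + c * (v x - t x)) \<le> ?N (\<lambda>x. u x - s x) + norm c * ?N (\<lambda>x. v x - t x)"
      using l2norm_triangle[OF s1 t1] by (simp only: l2norm_cmult)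
    also have "\<dots> < q + norm c * q"
      using s(2) t(2) by (intro add_less_le_mono mult_left_mono) auto
    also have "\<dots> = e" using qe by simp
    also have "(\<lambda>x. (u x - s x) + c * (v x - t x)) = (\<lambda>x. (u x + c * v x) - (s x + c * t x))"
      by (simp add: algebra_simps)
    finally have "?N (\<lambda>x. (u x + c * v x) - (s x + c * t x)) < e" .
    moreover have "(\<lambda>x. s x + c * t x) \<in> spherical_wave_span \<kappa>"
      by (intro spherical_wave_span_add spherical_wave_span_cmult s t)
    ultimately show "\<exists>s\<in>spherical_wave_span \<kappa>. ?N (\<lambda>x. (u x + c * v x) - s x) < e" by (intro bexI)
  qed
qed

lemma continuous_wave_synthesis:
  assumes "\<And>\<phi>. \<phi> \<in> set \<phi>s \<Longrightarrow> continuous_wave \<kappa> \<phi>"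
  shows "continuous_wave \<kappa> (synthesis \<phi>s \<mu>)"
proof -
  have "continuous_wave \<kappa> (\<lambda>x. \<Sum>p<n. vec_index \<mu> p * (\<phi>s ! p) x)" if "n \<le> length \<phi>s" for n
    using that
  proof (induction n)
    case 0
    show ?case using continuous_wave_zero by simp
  next
    case (Suc n)
    have "continuous_wave \<kappa> (\<lambda>x. (\<Sum>p<n. vec_index \<mu> p * (\<phi>s ! p) x) + vec_index \<mu> n * (\<phi>s ! n) x)"
      using Suc by (intro continuous_wave_add_cmult) (auto intro: assms)
    thus ?case by simp
  qed
  thus ?thesis unfolding synthesis_def[abs_def] by simp
qed

text \<open>The weight in \<open>B_norm\<close> bounds the gradient by \<kappa> times the norm,
  which accounts for the factor \<open>1 + \<kappa>\<close>; the final 1 makes the constant plainly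
  positive.\<close>

lemma continuous_wave_trace:
  assumes "\<kappa> > 0" "continuous_wave \<kappa> v"
  shows "l2norm sphere_measure v \<le> (6 * sqrt (measure radius_measure (space radius_measure)) * (1 + \<kappa>) + 1) * B_norm \<kappa> v"
proof -
  have "has_weak_gradient v (weak_gradient v)"
  proof -
    have "\<exists>g. has_weak_gradient v g" using assms(2) by (simp add: continuous_wave_def H1_space_def)
    thus ?thesis unfolding weak_gradient_def by (rule someI_ex)
  qed
  hence "l2norm sphere_measure v \<le> 6 * sqrt (measure radius_measure (space radius_measure)) * (L2_norm v + L2_norm (weak_gradient v))"
    unfolding L2_norm_eq by (rule trace_inequality) (use assms(2) in \<open>simp add: continuous_wave_def\<close>)
  also have "\<dots> \<le> 6 * sqrt (measure radius_measure (space radius_measure)) * (B_norm \<kappa> v + \<kappa> * B_norm \<kappa> v)"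
    by (intro mult_left_mono add_mono L2_norm_le_B_norm L2_norm_weak_gradient_le assms) simp
  also have "\<dots> \<le> (6 * sqrt (measure radius_measure (space radius_measure)) * (1 + \<kappa>) + 1) * B_norm \<kappa> v"
  proof -
    have "0 \<le> B_norm \<kappa> v" by (simp add: B_norm_def)
    thus ?thesis by (simp add: algebra_simps)
  qed
  finally show ?thesis .
qed

section \<open>Sample vectors, the sampling matrix and the error estimate\<close>

lemma sampling_matrix_carrier: "sampling_matrix x w S \<phi>s \<in> carrier_mat S (length \<phi>s)"
  by (simp add: sampling_matrix_def)

lemma sampling_mult_vec:
  assumes "\<mu> \<in> carrier_vec (length \<phi>s)" "s < S"
  shows "vec_index (sampling_matrix x w S \<phi>s *\<^sub>v \<mu>) s = of_real (sqrt (w S s)) * synthesis \<phi>s \<mu> (x S s)"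
  using assms
  by (simp add: sampling_matrix_def mult_mat_vec_def scalar_prod_def synthesis_def sum_distrib_left mult_ac lessThan_atLeast0)

lemma vec_l2_norm_samples:
  assumes "\<And>s. s < S \<Longrightarrow> w S s > 0" "dim_vec v = S" "\<And>s. s < S \<Longrightarrow> vec_index v s = of_real (sqrt (w S s)) * f (x S s)"
  shows "vec_l2_norm v = sample_norm x w S f"
proof -
  have "(\<Sum>s<S. (norm (vec_index v s))\<^sup>2) = (\<Sum>s<S. w S s * (norm (f (x S s)))\<^sup>2)"
    using assms by (intro sum.cong refl) (simp add: norm_mult power_mult_distrib less_imp_le)
  thus ?thesis using assms(2) by (simp add: vec_l2_norm_def sample_norm_def)
qed

lemma sampling_residual_norm:
  assumes w: "\<And>s. s < S \<Longrightarrow> w S s > 0" and \<mu>: "\<mu> \<in> carrier_vec (length \<phi>s)"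
  shows "vec_l2_norm (sampling_rhs x w S u - sampling_matrix x w S \<phi>s *\<^sub>v \<mu>) = sample_norm x w S (\<lambda>y. u y - synthesis \<phi>s \<mu> y)"
proof (rule vec_l2_norm_samples)
  show "w S s > 0" if "s < S" for s using w[OF that] .
  show "dim_vec (sampling_rhs x w S u - sampling_matrix x w S \<phi>s *\<^sub>v \<mu>) = S"
    using sampling_matrix_carrier[of x w S \<phi>s] by simp
  fix s assume s: "s < S"
  have "dim_vec (sampling_matrix x w S \<phi>s *\<^sub>v \<mu>) = S" using sampling_matrix_carrier[of x w S \<phi>s] by simp
  thus "vec_index (sampling_rhs x w S u - sampling_matrix x w S \<phi>s *\<^sub>v \<mu>) s = of_real (sqrt (w S s)) * (u (x S s) - synthesis \<phi>s \<mu> (x S s))"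
    using s sampling_mult_vec[OF \<mu> s] by (simp add: sampling_rhs_def right_diff_distrib)
qed

text \<open>A bound without \<open>S\<close>: a unit coefficient vector has entries of modulus at
  most 1, and its image is the discrete norm of a combination of the given functions. An \<epsilon>0
  valid for all large \<open>S\<close> rests on this.\<close>

lemma sigma_max_sampling_le:
  assumes w: "\<And>s. s < S \<Longrightarrow> w S s > 0"
    and svd: "is_svd (sampling_matrix x w S \<phi>s) U d V"
    and c: "\<And>\<phi>. \<phi> \<in> set \<phi>s \<Longrightarrow> continuous_on (sphere 0 1) \<phi>"
    and le: "\<And>y. sample_norm x w S (synthesis \<phi>s y) \<le> 2 * l2norm sphere_measure (synthesis \<phi>s y)"
  shows "sigma_max (sampling_matrix x w S \<phi>s) d \<le> 2 * (\<Sum>p<length \<phi>s. l2norm sphere_measure (\<phi>s ! p))"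
proof -
  let ?A = "sampling_matrix x w S \<phi>s" and ?B = "2 * (\<Sum>p<length \<phi>s. l2norm sphere_measure (\<phi>s ! p))"
  note A = sampling_matrix_carrier[of x w S \<phi>s]
  have "d i \<le> ?B" if i: "i < min S (length \<phi>s)" for i
  proof -
    obtain y where y: "y \<in> carrier_vec (length \<phi>s)" "vec_l2_norm y = 1" "vec_l2_norm (?A *\<^sub>v y) = d i"
      using singular_value_attained[OF svd A i] by metis
    have yp: "norm (vec_index y p) \<le> 1" if "p < length \<phi>s" for p
    proof -
      have "norm (vec_index y p) \<le> L2_set (\<lambda>i. norm (vec_index y i)) {..<length \<phi>s}"
        using that by (intro member_le_L2_set) auto
      thus ?thesis using y(1,2) by (simp add: vec_l2_norm_eq)
    qed
    have si: "square_integrable sphere_measure (\<lambda>x. vec_index y p * (\<phi>s ! p) x)" if "p < length \<phi>s" for p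
      using that c by (intro square_integrable_cmult square_integrable_surf) simp
    have "d i = sample_norm x w S (synthesis \<phi>s y)"
    proof -
      have "vec_l2_norm (?A *\<^sub>v y) = sample_norm x w S (synthesis \<phi>s y)"
      proof (rule vec_l2_norm_samples)
        show "w S s > 0" if "s < S" for s using w[OF that] .
        show "dim_vec (?A *\<^sub>v y) = S" using A by simp
        show "vec_index (?A *\<^sub>v y) s = of_real (sqrt (w S s)) * synthesis \<phi>s y (x S s)" if "s < S" for s
          by (rule sampling_mult_vec[OF y(1) that])
      qed
      thus ?thesis by (simp only: y(3))
    qed
    also have "\<dots> \<le> 2 * l2norm sphere_measure (synthesis \<phi>s y)" by (rule le)
    also have "l2norm sphere_measure (synthesis \<phi>s y) \<le> (\<Sum>p<length \<phi>s. l2norm sphere_measure (\<phi>s ! p))"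
    proof -
      have "l2norm sphere_measure (\<lambda>x. \<Sum>p<n. vec_index y p * (\<phi>s ! p) x) \<le> (\<Sum>p<n. l2norm sphere_measure (\<phi>s ! p))" if "n \<le> length \<phi>s" for n
        using that
      proof (induction n)
        case 0
        show ?case by (simp add: l2norm_def)
      next
        case (Suc n)
        have "square_integrable sphere_measure (\<lambda>x. \<Sum>p<n. vec_index y p * (\<phi>s ! p) x)"
          using Suc.prems by (intro square_integrable_sum si) simp
        from l2norm_triangle[OF this si[of n]] Suc.prems
        have "l2norm sphere_measure (\<lambda>x. \<Sum>p<Suc n. vec_index y p * (\<phi>s ! p) x) \<le>
          l2norm sphere_measure (\<lambda>x. \<Sum>p<n. vec_index y p * (\<phi>s ! p) x) + norm (vec_index y n) * l2norm sphere_measure (\<phi>s ! n)"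
          by (simp add: l2norm_cmult)
        also have "norm (vec_index y n) * l2norm sphere_measure (\<phi>s ! n) \<le> 1 * l2norm sphere_measure (\<phi>s ! n)"
          using yp[of n] Suc.prems by (intro mult_right_mono) auto
        finally show ?case using Suc by simp
      qed
      thus ?thesis unfolding synthesis_def[abs_def] by simp
    qed
    finally show ?thesis by simp
  qed
  moreover have "0 \<le> ?B" by (simp add: sum_nonneg)
  ultimately show ?thesis unfolding sigma_max_def using A by (auto intro!: Max.boundedI)
qed

text \<open>The two scalars let a single \<open>S0\<close> serve both for residuals (1 and -1) and
  for combinations of the set alone (0 and 1), the latter being needed for the largest singular
  value.\<close>

lemma uniform_sampling_synthesis:
  assumes quad: "convergent_quadrature x w" and u: "continuous_on (sphere 0 1) u"
    and c: "\<And>\<phi>. \<phi> \<in> set \<phi>s \<Longrightarrow> continuous_on (sphere 0 1) \<phi>"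
  shows "\<exists>S0. \<forall>S\<ge>S0. \<forall>a b \<mu>.
    l2norm sphere_measure (\<lambda>y. a * u y + b * synthesis \<phi>s \<mu> y) \<le> 2 * sample_norm x w S (\<lambda>y. a * u y + b * synthesis \<phi>s \<mu> y) \<and>
    sample_norm x w S (\<lambda>y. a * u y + b * synthesis \<phi>s \<mu> y) \<le> 2 * l2norm sphere_measure (\<lambda>y. a * u y + b * synthesis \<phi>s \<mu> y)"
proof -
  define n where "n = Suc (length \<phi>s)"
  define f where "f i = (if i = 0 then u else \<phi>s ! (i - 1))" for i
  have "continuous_on (sphere 0 1) (f i)" if "i < n" for i
  proof (cases i)
    case (Suc j)
    thus ?thesis using that c[of "\<phi>s ! j"] by (simp add: f_def n_def)
  qed (simp add: f_def u)
  hence "\<forall>i<n. continuous_on (sphere 0 1) (f i)" by blast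
  from uniform_sampling[OF quad this] obtain S0 where
    S0: "\<forall>S\<ge>S0. \<forall>v. (\<exists>c. \<forall>\<omega>\<in>sphere 0 1. v \<omega> = (\<Sum>i<n. c i * f i \<omega>)) \<longrightarrow>
      l2norm sphere_measure v \<le> 2 * sample_norm x w S v \<and> sample_norm x w S v \<le> 2 * l2norm sphere_measure v" ..
  have span: "\<exists>c. \<forall>\<omega>\<in>sphere 0 1. a * u \<omega> + b * synthesis \<phi>s \<mu> \<omega> = (\<Sum>i<n. c i * f i \<omega>)" for a b \<mu>
  proof (intro exI ballI)
    fix \<omega> :: pt
    show "a * u \<omega> + b * synthesis \<phi>s \<mu> \<omega> = (\<Sum>i<n. (if i = 0 then a else b * vec_index \<mu> (i - 1)) * f i \<omega>)"
      by (simp add: n_def f_def sum.lessThan_Suc_shift synthesis_def sum_distrib_left mult.assoc del: sum.lessThan_Suc)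
  qed
  show ?thesis using S0 span by (intro exI[of _ S0] allI impI) (rule S0[rule_format])
qed

text \<open>\<open>D\<close> leads from ball to sphere and a factor 2 to the samples; there the
  regularized solution is compared with \<mu>, and a second factor 2 leads the residual of \<mu>
  back to the sphere. Hence 4 D and 2 D.\<close>

lemma regularized_error_le:
  assumes D: "D \<ge> 0" "\<And>v. continuous_wave \<kappa> v \<Longrightarrow> L2_norm v \<le> D * l2norm sphere_measure v"
    and u: "continuous_wave \<kappa> u" and \<phi>s: "\<And>\<phi>. \<phi> \<in> set \<phi>s \<Longrightarrow> continuous_wave \<kappa> \<phi>"
    and w: "\<And>s. s < S \<Longrightarrow> w S s > 0"
    and samp: "\<And>\<mu>. l2norm sphere_measure (\<lambda>y. u y - synthesis \<phi>s \<mu> y) \<le> 2 * sample_norm x w S (\<lambda>y. u y - synthesis \<phi>s \<mu> y)"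
      "\<And>\<mu>. sample_norm x w S (\<lambda>y. u y - synthesis \<phi>s \<mu> y) \<le> 2 * l2norm sphere_measure (\<lambda>y. u y - synthesis \<phi>s \<mu> y)"
    and svd: "is_svd (sampling_matrix x w S \<phi>s) U d V"
    and \<mu>: "\<mu> \<in> carrier_vec (length \<phi>s)" and e: "\<epsilon> > 0"
  shows "L2_norm (\<lambda>y. u y - synthesis \<phi>s (regularized_solution (sampling_matrix x w S \<phi>s) U d V \<epsilon> (sampling_rhs x w S u)) y)
    \<le> 4 * D * l2norm sphere_measure (\<lambda>y. u y - synthesis \<phi>s \<mu> y) + 2 * D * \<epsilon> * sigma_max (sampling_matrix x w S \<phi>s) d * vec_l2_norm \<mu>"
proof -
  let ?A = "sampling_matrix x w S \<phi>s" and ?b = "sampling_rhs x w S u"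
  define \<xi> where "\<xi> = regularized_solution ?A U d V \<epsilon> ?b"
  note A = sampling_matrix_carrier[of x w S \<phi>s]
  have b: "?b \<in> carrier_vec S" by (simp add: sampling_rhs_def)
  have \<xi>: "\<xi> \<in> carrier_vec (length \<phi>s)" unfolding \<xi>_def by (rule regularized_solution_carrier[OF svd A b])
  have "continuous_wave \<kappa> (\<lambda>y. u y + (-1) * synthesis \<phi>s \<xi> y)" by (intro continuous_wave_add_cmult u continuous_wave_synthesis \<phi>s)
  hence "continuous_wave \<kappa> (\<lambda>y. u y - synthesis \<phi>s \<xi> y)" by simp
  hence "L2_norm (\<lambda>y. u y - synthesis \<phi>s \<xi> y) \<le> D * l2norm sphere_measure (\<lambda>y. u y - synthesis \<phi>s \<xi> y)" by (rule D(2))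
  also have "\<dots> \<le> D * (2 * sample_norm x w S (\<lambda>y. u y - synthesis \<phi>s \<xi> y))"
    by (intro mult_left_mono samp D)
  also have "sample_norm x w S (\<lambda>y. u y - synthesis \<phi>s \<xi> y) = vec_l2_norm (?b - ?A *\<^sub>v \<xi>)"
    by (rule sampling_residual_norm[symmetric, OF _ \<xi>]) (rule w)
  also have "D * (2 * vec_l2_norm (?b - ?A *\<^sub>v \<xi>)) \<le> D * (2 * (vec_l2_norm (?b - ?A *\<^sub>v \<mu>) + \<epsilon> * sigma_max ?A d * vec_l2_norm \<mu>))"
    unfolding \<xi>_def by (intro mult_left_mono regularized_residual_le[OF svd A b \<mu> e] D) simp
  also have "vec_l2_norm (?b - ?A *\<^sub>v \<mu>) = sample_norm x w S (\<lambda>y. u y - synthesis \<phi>s \<mu> y)"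
    by (rule sampling_residual_norm[OF _ \<mu>]) (rule w)
  also have "D * (2 * (sample_norm x w S (\<lambda>y. u y - synthesis \<phi>s \<mu> y) + \<epsilon> * sigma_max ?A d * vec_l2_norm \<mu>))
      \<le> D * (2 * (2 * l2norm sphere_measure (\<lambda>y. u y - synthesis \<phi>s \<mu> y) + \<epsilon> * sigma_max ?A d * vec_l2_norm \<mu>))"
    by (intro mult_left_mono add_right_mono samp D) simp
  finally show ?thesis unfolding \<xi>_def by (simp add: algebra_simps)
qed

text \<open>The tolerance is chosen so that 4 D T times it equals \<delta> / 2. The set index is
  that of the stable approximation of \<open>u\<close>, and \<open>S0\<close> is at least 1 to
  guarantee a positive largest weight.\<close>

lemma stable_regularized_error_le:
  assumes k: "\<kappa> > 0" and quad: "convergent_quadrature x w" and D: "D > 0" "\<And>v. continuous_wave \<kappa> v \<Longrightarrow> L2_norm v \<le> D * l2norm sphere_measure v"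
    and T: "T > 0" "\<And>v. continuous_wave \<kappa> v \<Longrightarrow> l2norm sphere_measure v \<le> T * B_norm \<kappa> v"
    and \<Phi>: "approximation_sets \<kappa> \<Phi>" "\<And>k \<phi>. \<phi> \<in> set (\<Phi> k) \<Longrightarrow> continuous_on (cball 0 1) \<phi>"
    and stb: "stability_constants \<kappa> \<Phi> (\<delta> / (8 * D * T)) lam Cstb"
    and u: "u \<in> B_space \<kappa>" "continuous_on (cball 0 1) u"
  shows "\<exists>k S0 M. length (\<Phi> k) \<le> S0 \<and> 1 \<le> S0 \<and> 0 \<le> M \<and>
    (\<forall>S\<ge>S0. \<forall>U d V. is_svd (sampling_matrix x w S (\<Phi> k)) U d V \<longrightarrow>
      sigma_max (sampling_matrix x w S (\<Phi> k)) d \<le> M \<and>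
      (\<forall>\<epsilon>>0. L2_norm (\<lambda>y. u y - synthesis (\<Phi> k)
          (regularized_solution (sampling_matrix x w S (\<Phi> k)) U d V \<epsilon> (sampling_rhs x w S u)) y)
        \<le> \<delta> / 2 * B_norm \<kappa> u +
          2 * D * \<epsilon> * sigma_max (sampling_matrix x w S (\<Phi> k)) d * (Cstb * real (length (\<Phi> k)) powr lam * B_norm \<kappa> u)))"
proof -
  obtain k \<mu> where \<mu>: "\<mu> \<in> carrier_vec (length (\<Phi> k))"
      "B_norm \<kappa> (\<lambda>y. u y - synthesis (\<Phi> k) \<mu> y) \<le> \<delta> / (8 * D * T) * B_norm \<kappa> u"
      "vec_l2_norm \<mu> \<le> Cstb * real (length (\<Phi> k)) powr lam * B_norm \<kappa> u"
    using stb u(1) unfolding stability_constants_def by blast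
  have gu: "continuous_wave \<kappa> u" by (rule continuous_wave_B_space[OF u])
  have g: "continuous_wave \<kappa> \<phi>" if "\<phi> \<in> set (\<Phi> k)" for \<phi>
    using \<Phi>(1) that unfolding approximation_sets_def by (intro continuous_wave_B_space \<Phi>(2)[OF that]) blast
  have sphere_point: "continuous_on (sphere 0 1) v" if "continuous_wave \<kappa> v" for v
    using that unfolding continuous_wave_def by (meson continuous_on_subset sphere_cball)
  have w: "w S s > 0" if "s < S" for S s using quad that unfolding convergent_quadrature_def by blast
  obtain S1 where S1: "\<forall>S\<ge>S1. \<forall>a b \<mu>.
      l2norm sphere_measure (\<lambda>y. a * u y + b * synthesis (\<Phi> k) \<mu> y) \<le> 2 * sample_norm x w S (\<lambda>y. a * u y + b * synthesis (\<Phi> k) \<mu> y) \<and>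
      sample_norm x w S (\<lambda>y. a * u y + b * synthesis (\<Phi> k) \<mu> y) \<le> 2 * l2norm sphere_measure (\<lambda>y. a * u y + b * synthesis (\<Phi> k) \<mu> y)"
    using uniform_sampling_synthesis[OF quad sphere_point[OF gu] sphere_point[OF g]] ..
  define M where "M = 2 * (\<Sum>p<length (\<Phi> k). l2norm sphere_measure (\<Phi> k ! p))"
  have "L2_norm (\<lambda>y. u y - synthesis (\<Phi> k) (regularized_solution (sampling_matrix x w S (\<Phi> k)) U d V \<epsilon> (sampling_rhs x w S u)) y)
      \<le> \<delta> / 2 * B_norm \<kappa> u +
        2 * D * \<epsilon> * sigma_max (sampling_matrix x w S (\<Phi> k)) d * (Cstb * real (length (\<Phi> k)) powr lam * B_norm \<kappa> u)"
    if S: "S \<ge> S1" and svd: "is_svd (sampling_matrix x w S (\<Phi> k)) U d V" and e: "\<epsilon> > 0" for S U d V \<epsilon>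
  proof -
    let ?\<sigma> = "sigma_max (sampling_matrix x w S (\<Phi> k)) d"
    have "continuous_wave \<kappa> (\<lambda>y. u y + (-1) * synthesis (\<Phi> k) \<mu> y)" by (intro continuous_wave_add_cmult gu continuous_wave_synthesis g)
    hence "continuous_wave \<kappa> (\<lambda>y. u y - synthesis (\<Phi> k) \<mu> y)" by simp
    hence "l2norm sphere_measure (\<lambda>y. u y - synthesis (\<Phi> k) \<mu> y) \<le> T * B_norm \<kappa> (\<lambda>y. u y - synthesis (\<Phi> k) \<mu> y)" by (rule T(2))
    also have "\<dots> \<le> T * (\<delta> / (8 * D * T) * B_norm \<kappa> u)" using T(1) \<mu>(2) by (intro mult_left_mono) auto
    finally have "4 * D * l2norm sphere_measure (\<lambda>y. u y - synthesis (\<Phi> k) \<mu> y) \<le> 4 * D * (T * (\<delta> / (8 * D * T) * B_norm \<kappa> u))"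
      using D(1) by (intro mult_left_mono) auto
    also have "\<dots> = \<delta> / 2 * B_norm \<kappa> u" using D(1) T(1) by simp
    finally have 1: "4 * D * l2norm sphere_measure (\<lambda>y. u y - synthesis (\<Phi> k) \<mu> y) \<le> \<delta> / 2 * B_norm \<kappa> u" .
    have 2: "2 * D * \<epsilon> * ?\<sigma> * vec_l2_norm \<mu> \<le> 2 * D * \<epsilon> * ?\<sigma> * (Cstb * real (length (\<Phi> k)) powr lam * B_norm \<kappa> u)"
      using D(1) e by (intro mult_left_mono \<mu>(3) mult_nonneg_nonneg sigma_max_nonneg) auto
    have "L2_norm (\<lambda>y. u y - synthesis (\<Phi> k) (regularized_solution (sampling_matrix x w S (\<Phi> k)) U d V \<epsilon> (sampling_rhs x w S u)) y)
      \<le> 4 * D * l2norm sphere_measure (\<lambda>y. u y - synthesis (\<Phi> k) \<mu> y) + 2 * D * \<epsilon> * ?\<sigma> * vec_l2_norm \<mu>"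
    proof (rule regularized_error_le[OF less_imp_le[OF D(1)] D(2) gu g w _ _ svd \<mu>(1) e])
      fix \<nu>
      show "l2norm sphere_measure (\<lambda>y. u y - synthesis (\<Phi> k) \<nu> y) \<le> 2 * sample_norm x w S (\<lambda>y. u y - synthesis (\<Phi> k) \<nu> y)"
        "sample_norm x w S (\<lambda>y. u y - synthesis (\<Phi> k) \<nu> y) \<le> 2 * l2norm sphere_measure (\<lambda>y. u y - synthesis (\<Phi> k) \<nu> y)"
        using S1[rule_format, OF S, of 1 "-1" \<nu>] by simp_all
    qed
    with 1 2 show ?thesis by linarith
  qed
  moreover have "sigma_max (sampling_matrix x w S (\<Phi> k)) d \<le> M"
    if S: "S \<ge> S1" and svd: "is_svd (sampling_matrix x w S (\<Phi> k)) U d V" for S U d V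
    unfolding M_def
  proof (rule sigma_max_sampling_le[OF w svd])
    show "continuous_on (sphere 0 1) \<phi>" if "\<phi> \<in> set (\<Phi> k)" for \<phi> by (rule sphere_point[OF g[OF that]])
    show "sample_norm x w S (synthesis (\<Phi> k) y) \<le> 2 * l2norm sphere_measure (synthesis (\<Phi> k) y)" for y
      using S1[rule_format, OF S, of 0 1 y] by simp
  qed
  moreover have "0 \<le> M" unfolding M_def by (simp add: sum_nonneg)
  ultimately show ?thesis
    by (intro exI[of _ k] exI[of _ "Max {S1, length (\<Phi> k), 1}"] exI[of _ M] conjI allI impI) auto
qed

lemma weight_max_pos:
  assumes "convergent_quadrature x w" "S \<ge> 1"
  shows "weight_max w S > 0"
proof -
  have "w S 0 > 0" using assms unfolding convergent_quadrature_def by simp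
  also have "w S 0 \<le> \<bar>w S 0\<bar>" by simp
  also have "\<dots> \<le> weight_max w S" using assms(2) unfolding weight_max_def by (intro Max_ge) auto
  finally show ?thesis .
qed

text \<open>One \<open>k\<close> and one \<open>S0\<close> serve both conclusions: the first offers
  a threshold common to all \<open>S\<close>, the second the explicit one, which varies with
  \<open>S\<close> through the singular value and the weights. The tolerance \<eta> is fixed before
  the approximation sets and \<open>u\<close>.\<close>

theorem corollary2p5:
  fixes \<kappa> :: real
    and x :: "nat \<Rightarrow> nat \<Rightarrow> real^3"
    and w :: "nat \<Rightarrow> nat \<Rightarrow> real"
  assumes "\<kappa> > 0"
    and "convergent_quadrature x w"
    and "\<not> dirichlet_eigenvalue (\<kappa>\<^sup>2)"
  shows "\<exists>Cerr :: nat \<Rightarrow> real.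
    (\<forall>S. Cerr S > 0) \<and> Bseq (\<lambda>S. Cerr S * sqrt (weight_max w S)) \<and>
    (\<forall>\<delta>>0. \<exists>\<eta>>0. \<forall>\<Phi> lam Cstb.
       stable_approximation \<kappa> \<Phi> \<and>
       (\<forall>k. \<forall>\<phi>\<in>set (\<Phi> k). continuous_on (cball 0 1) \<phi>) \<and>
       stability_constants \<kappa> \<Phi> \<eta> lam Cstb \<longrightarrow>
       (\<forall>u\<in>B_space \<kappa>. continuous_on (cball 0 1) u \<longrightarrow>
          (\<exists>k. \<exists>S0\<ge>length (\<Phi> k).
             (\<exists>\<epsilon>0. 0 < \<epsilon>0 \<and> \<epsilon>0 \<le> 1 \<and>
                (\<forall>S\<ge>S0. \<forall>U d V. is_svd (sampling_matrix x w S (\<Phi> k)) U d V \<longrightarrow>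
                   (\<forall>\<epsilon>. 0 < \<epsilon> \<and> \<epsilon> \<le> \<epsilon>0 \<longrightarrow>
                      L2_norm (\<lambda>y. u y - synthesis (\<Phi> k)
                        (regularized_solution (sampling_matrix x w S (\<Phi> k)) U d V \<epsilon>
                           (sampling_rhs x w S u)) y) \<le> \<delta> * B_norm \<kappa> u))) \<and>
             (\<forall>S\<ge>S0. \<forall>U d V. is_svd (sampling_matrix x w S (\<Phi> k)) U d V \<longrightarrow>
                (\<forall>\<epsilon>. 0 < \<epsilon> \<and>
                     \<epsilon> \<le> epsilon_bound \<delta> (Cerr S) Cstb
                           (sigma_max (sampling_matrix x w S (\<Phi> k)) d)
                           (length (\<Phi> k)) lam (weight_max w S) \<longrightarrow>
                   L2_norm (\<lambda>y. u y - synthesis (\<Phi> k)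
                     (regularized_solution (sampling_matrix x w S (\<Phi> k)) U d V \<epsilon>
                        (sampling_rhs x w S u)) y) \<le> \<delta> * B_norm \<kappa> u)))))"
proof -
  have "spherical_bessel l \<kappa> \<noteq> 0" for l
    using dirichlet_eigenvalue_if_bessel_zero[OF assms(1)] assms(3) by blast
  then obtain D where D: "D > 0" "\<forall>v. continuous_on (cball 0 1) v \<longrightarrow> wave_approximable \<kappa> v \<longrightarrow>
      l2norm (lebesgue_on B1) v \<le> D * l2norm sphere_measure v"
    using ball_le_sphere[OF assms(1)] by blast
  have ball: "L2_norm v \<le> D * l2norm sphere_measure v" if "continuous_wave \<kappa> v" for v
    using D(2) that by (simp add: continuous_wave_def L2_norm_eq)
  define T where "T = 6 * sqrt (measure radius_measure (space radius_measure)) * (1 + \<kappa>) + 1"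
  have T0: "T > 0" unfolding T_def using assms(1) by (intro add_nonneg_pos mult_nonneg_nonneg) auto
  have T: "l2norm sphere_measure v \<le> T * B_norm \<kappa> v" if "continuous_wave \<kappa> v" for v
    unfolding T_def by (rule continuous_wave_trace[OF assms(1) that])
  \<comment> \<open>Chosen so that the product with the square root of the largest weight is 2 D
    whenever a node exists; without nodes the largest weight is 0 and any positive value will
    do.\<close>
  define Cerr where "Cerr S = (if weight_max w S > 0 then 2 * D / sqrt (weight_max w S) else 1)" for S
  have Cerr0: "Cerr S > 0" for S using D(1) by (simp add: Cerr_def)
  have Cerr: "Cerr S * sqrt (weight_max w S) = 2 * D" if "S \<ge> 1" for S
    using weight_max_pos[OF assms(2) that] by (simp add: Cerr_def)
  have "norm (Cerr S * sqrt (weight_max w S)) \<le> 2 * D" for S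
  proof (cases "S \<ge> 1")
    case True
    thus ?thesis using Cerr[OF True] D(1) by simp
  next
    case False
    hence "weight_max w S = 0" by (simp add: weight_max_def not_less_eq_eq)
    thus ?thesis using D(1) by simp
  qed
  hence bs: "Bseq (\<lambda>S. Cerr S * sqrt (weight_max w S))" by (rule BseqI')
  show ?thesis
  proof (rule exI[of _ Cerr], intro conjI allI impI bs Cerr0)
    fix \<delta> :: real assume \<delta>: "\<delta> > 0"
    define \<eta> where "\<eta> = \<delta> / (8 * D * T)"
    have \<eta>: "\<eta> > 0" unfolding \<eta>_def using \<delta> D(1) T0 by simp
    show "\<exists>\<eta>>0. \<forall>\<Phi> lam Cstb.
       stable_approximation \<kappa> \<Phi> \<and>
       (\<forall>k. \<forall>\<phi>\<in>set (\<Phi> k). continuous_on (cball 0 1) \<phi>) \<and>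
       stability_constants \<kappa> \<Phi> \<eta> lam Cstb \<longrightarrow>
       (\<forall>u\<in>B_space \<kappa>. continuous_on (cball 0 1) u \<longrightarrow>
          (\<exists>k. \<exists>S0\<ge>length (\<Phi> k).
             (\<exists>\<epsilon>0. 0 < \<epsilon>0 \<and> \<epsilon>0 \<le> 1 \<and>
                (\<forall>S\<ge>S0. \<forall>U d V. is_svd (sampling_matrix x w S (\<Phi> k)) U d V \<longrightarrow>
                   (\<forall>\<epsilon>. 0 < \<epsilon> \<and> \<epsilon> \<le> \<epsilon>0 \<longrightarrow>
                      L2_norm (\<lambda>y. u y - synthesis (\<Phi> k)
                        (regularized_solution (sampling_matrix x w S (\<Phi> k)) U d V \<epsilon>
                           (sampling_rhs x w S u)) y) \<le> \<delta> * B_norm \<kappa> u))) \<and>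
             (\<forall>S\<ge>S0. \<forall>U d V. is_svd (sampling_matrix x w S (\<Phi> k)) U d V \<longrightarrow>
                (\<forall>\<epsilon>. 0 < \<epsilon> \<and>
                     \<epsilon> \<le> epsilon_bound \<delta> (Cerr S) Cstb
                           (sigma_max (sampling_matrix x w S (\<Phi> k)) d)
                           (length (\<Phi> k)) lam (weight_max w S) \<longrightarrow>
                   L2_norm (\<lambda>y. u y - synthesis (\<Phi> k)
                     (regularized_solution (sampling_matrix x w S (\<Phi> k)) U d V \<epsilon>
                        (sampling_rhs x w S u)) y) \<le> \<delta> * B_norm \<kappa> u))))"
    proof (rule exI[of _ \<eta>], intro conjI allI impI ballI \<eta>)
      fix \<Phi> lam Cstb u
      assume \<Phi>: "stable_approximation \<kappa> \<Phi> \<and> (\<forall>k. \<forall>\<phi>\<in>set (\<Phi> k). continuous_on (cball 0 1) \<phi>) \<and>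
          stability_constants \<kappa> \<Phi> \<eta> lam Cstb"
        and u: "u \<in> B_space \<kappa>" "continuous_on (cball 0 1) u"
      have \<Phi>1: "approximation_sets \<kappa> \<Phi>" using \<Phi> by (simp add: stable_approximation_def)
      have \<Phi>2: "continuous_on (cball 0 1) \<phi>" if "\<phi> \<in> set (\<Phi> k)" for k \<phi> using \<Phi> that by blast
      have \<Phi>3: "stability_constants \<kappa> \<Phi> (\<delta> / (8 * D * T)) lam Cstb" using \<Phi> by (simp add: \<eta>_def)
      have Cs0: "Cstb \<ge> 0" using \<Phi> by (simp add: stability_constants_def)
      have B0: "B_norm \<kappa> u \<ge> 0" by (simp add: B_norm_def)
      define err where "err = (\<lambda>k S U d V \<epsilon>. L2_norm (\<lambda>y. u y - synthesis (\<Phi> k)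
          (regularized_solution (sampling_matrix x w S (\<Phi> k)) U d V \<epsilon> (sampling_rhs x w S u)) y))"
      have "\<exists>k S0 M. length (\<Phi> k) \<le> S0 \<and> 1 \<le> S0 \<and> 0 \<le> M \<and>
        (\<forall>S\<ge>S0. \<forall>U d V. is_svd (sampling_matrix x w S (\<Phi> k)) U d V \<longrightarrow>
          sigma_max (sampling_matrix x w S (\<Phi> k)) d \<le> M \<and>
          (\<forall>\<epsilon>>0. err k S U d V \<epsilon> \<le> \<delta> / 2 * B_norm \<kappa> u +
            2 * D * \<epsilon> * sigma_max (sampling_matrix x w S (\<Phi> k)) d * (Cstb * real (length (\<Phi> k)) powr lam * B_norm \<kappa> u)))"
        unfolding err_def
        by (rule stable_regularized_error_le[OF assms(1,2) D(1) _ T0 _ \<Phi>1 _ \<Phi>3 u]) (rule ball T \<Phi>2, assumption)+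
      then obtain k S0 M where S0: "length (\<Phi> k) \<le> S0" "1 \<le> S0" and M: "0 \<le> M" and all:
        "\<forall>S\<ge>S0. \<forall>U d V. is_svd (sampling_matrix x w S (\<Phi> k)) U d V \<longrightarrow>
          sigma_max (sampling_matrix x w S (\<Phi> k)) d \<le> M \<and>
          (\<forall>\<epsilon>>0. err k S U d V \<epsilon> \<le> \<delta> / 2 * B_norm \<kappa> u +
            2 * D * \<epsilon> * sigma_max (sampling_matrix x w S (\<Phi> k)) d * (Cstb * real (length (\<Phi> k)) powr lam * B_norm \<kappa> u))"
        by (elim exE conjE)
      define c where "c = Cstb * real (length (\<Phi> k)) powr lam"
      have c0: "c \<ge> 0" unfolding c_def using Cs0 by simp
      \<comment> \<open>The regularization term is \<epsilon> 4 D c \<sigma> / 2 times the norm of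
        \<open>u\<close>, so this condition bounds it by the second half of \<delta>.\<close>
      have small: "err k S U d V \<epsilon> \<le> \<delta> * B_norm \<kappa> u"
        if S: "S \<ge> S0" and svd: "is_svd (sampling_matrix x w S (\<Phi> k)) U d V" and e: "\<epsilon> > 0"
          and le: "\<epsilon> * (4 * D * c * sigma_max (sampling_matrix x w S (\<Phi> k)) d) \<le> \<delta>" for S U d V \<epsilon>
      proof -
        let ?\<sigma> = "sigma_max (sampling_matrix x w S (\<Phi> k)) d"
        have "err k S U d V \<epsilon> \<le> \<delta> / 2 * B_norm \<kappa> u + 2 * D * \<epsilon> * ?\<sigma> * (c * B_norm \<kappa> u)"
          using all[rule_format, OF S svd] e unfolding c_def by blast
        also have "\<dots> = (\<delta> + \<epsilon> * (4 * D * c * ?\<sigma>)) / 2 * B_norm \<kappa> u" by (simp add: field_simps)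
        also have "\<dots> \<le> \<delta> * B_norm \<kappa> u" using le B0 by (intro mult_right_mono) auto
        finally show ?thesis .
      qed
      \<comment> \<open>\<open>M\<close> stands in for the singular value at every \<open>S\<close>;
        the added 1 keeps the denominator positive.\<close>
      define \<epsilon>0 where "\<epsilon>0 = min 1 (\<delta> / (4 * D * c * M + 1))"
      have X: "4 * D * c * M \<ge> 0" using D(1) c0 M by simp
      have "0 < \<delta> / (4 * D * c * M + 1)" using \<delta> X by (intro divide_pos_pos) linarith+
      hence \<epsilon>0: "0 < \<epsilon>0" "\<epsilon>0 \<le> 1" by (simp_all add: \<epsilon>0_def)
      have first: "err k S U d V \<epsilon> \<le> \<delta> * B_norm \<kappa> u"
        if S: "S \<ge> S0" and svd: "is_svd (sampling_matrix x w S (\<Phi> k)) U d V" and e: "0 < \<epsilon> \<and> \<epsilon> \<le> \<epsilon>0" for S U d V \<epsilon>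
      proof (rule small[OF S svd])
        have "\<epsilon> * (4 * D * c * sigma_max (sampling_matrix x w S (\<Phi> k)) d) \<le> \<delta> / (4 * D * c * M + 1) * (4 * D * c * M)"
          using all[rule_format, OF S svd] e \<delta> X D(1) c0
          by (intro mult_mono mult_nonneg_nonneg sigma_max_nonneg) (auto simp: \<epsilon>0_def)
        also have "\<dots> \<le> \<delta>" using \<delta> X by (simp add: field_simps)
        finally show "\<epsilon> * (4 * D * c * sigma_max (sampling_matrix x w S (\<Phi> k)) d) \<le> \<delta>" .
      qed (use e in simp)
      have second: "err k S U d V \<epsilon> \<le> \<delta> * B_norm \<kappa> u"
        if S: "S \<ge> S0" and svd: "is_svd (sampling_matrix x w S (\<Phi> k)) U d V"
          and e: "0 < \<epsilon> \<and> \<epsilon> \<le> epsilon_bound \<delta> (Cerr S) Cstb (sigma_max (sampling_matrix x w S (\<Phi> k)) d)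
            (length (\<Phi> k)) lam (weight_max w S)" for S U d V \<epsilon>
      proof (rule small[OF S svd])
        let ?\<sigma> = "sigma_max (sampling_matrix x w S (\<Phi> k)) d"
        have "2 * Cerr S * Cstb * ?\<sigma> * real (length (\<Phi> k)) powr lam * sqrt (weight_max w S)
            = 2 * (Cerr S * sqrt (weight_max w S)) * c * ?\<sigma>" by (simp add: c_def)
        also have "\<dots> = 4 * D * c * ?\<sigma>" using Cerr[of S] S S0(2) by simp
        finally have q: "2 * Cerr S * Cstb * ?\<sigma> * real (length (\<Phi> k)) powr lam * sqrt (weight_max w S) = 4 * D * c * ?\<sigma>" .
        have q0: "4 * D * c * ?\<sigma> \<ge> 0" using D(1) c0 by (intro mult_nonneg_nonneg sigma_max_nonneg) auto
        show "\<epsilon> * (4 * D * c * ?\<sigma>) \<le> \<delta>"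
        \<comment> \<open>With a vanishing denominator \<open>epsilon_bound\<close> is 1 and the
          requirement on \<epsilon> is trivial.\<close>
        proof (cases "4 * D * c * ?\<sigma> = 0")
          case True
          show ?thesis unfolding True using \<delta> by simp
        next
          case False
          hence "4 * D * c * ?\<sigma> > 0" using q0 by linarith
          moreover have "\<epsilon> \<le> \<delta> / (4 * D * c * ?\<sigma>)" using e False unfolding epsilon_bound_def Let_def q by simp
          ultimately show ?thesis by (simp only: pos_le_divide_eq)
        qed
      qed (use e in simp)
      show "\<exists>k. \<exists>S0\<ge>length (\<Phi> k).
             (\<exists>\<epsilon>0. 0 < \<epsilon>0 \<and> \<epsilon>0 \<le> 1 \<and>
                (\<forall>S\<ge>S0. \<forall>U d V. is_svd (sampling_matrix x w S (\<Phi> k)) U d V \<longrightarrow>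
                   (\<forall>\<epsilon>. 0 < \<epsilon> \<and> \<epsilon> \<le> \<epsilon>0 \<longrightarrow>
                      L2_norm (\<lambda>y. u y - synthesis (\<Phi> k)
                        (regularized_solution (sampling_matrix x w S (\<Phi> k)) U d V \<epsilon>
                           (sampling_rhs x w S u)) y) \<le> \<delta> * B_norm \<kappa> u))) \<and>
             (\<forall>S\<ge>S0. \<forall>U d V. is_svd (sampling_matrix x w S (\<Phi> k)) U d V \<longrightarrow>
                (\<forall>\<epsilon>. 0 < \<epsilon> \<and>
                     \<epsilon> \<le> epsilon_bound \<delta> (Cerr S) Cstb
                           (sigma_max (sampling_matrix x w S (\<Phi> k)) d)
                           (length (\<Phi> k)) lam (weight_max w S) \<longrightarrow>
                   L2_norm (\<lambda>y. u y - synthesis (\<Phi> k)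
                     (regularized_solution (sampling_matrix x w S (\<Phi> k)) U d V \<epsilon>
                        (sampling_rhs x w S u)) y) \<le> \<delta> * B_norm \<kappa> u))"
        by (rule exI[of _ k], rule exI[of _ S0], intro conjI S0(1) exI[of _ \<epsilon>0] \<epsilon>0 allI impI)
           (rule first[unfolded err_def] second[unfolded err_def]; assumption)+
    qed
  qed
qed

end
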